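(* Let $M$ be a $4$-dimensional compact oriented spin manifold with boundary $\partial M$, with metric $g^M$ which near $\partial M$ has the form $g^M=\frac{1}{h(x_n)}g^{\partial M}+dx_n^2$ ($n=4$), where $h$ is smooth and positive with $h(0)=1$. Let $D$ be the Dirac operator on the extension $\widehat M$ of $M$ by a small open collar. Assume that $\partial M$ (with $g^{\partial M}$) is flat. Then $$\int_{\partial M}\mathrm{res}_{1,1}(D^{-1},D^{-1})=\frac{\pi}{8}\,\Omega_3\,I_{\mathrm{Gr},b},\qquad \int_{\partial M}\mathrm{res}_{2,1}(D^{-1},D^{-1})=-\frac{3\pi}{8}\,\Omega_3\,I_{\mathrm{Gr},b},$$ where $\Omega_3=\frac{2\pi^{3/2}}{\Gamma(3/2)}=4\pi$ and $I_{\mathrm{Gr},b}$ is the boundary term of the gravitational (Einstein–Hilbert) action.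
   Context: Setting: a collar $U\cong\partial M\times[0,1)$ of $\partial M$ in $M$ is fixed, $x_n\in[0,1)$ is the normal coordinate ($x_n=0$ on $\partial M$), $g^{\partial M}$ is a metric on $\partial M$, and $h$ is the restriction to $[0,1)$ of a smooth function $\widetilde h>0$ on $(-\varepsilon,1)$, $\varepsilon>0$ small. $\widehat M=M\cup_{\partial M}\partial M\times(-\varepsilon,0]$ carries the metric $\widehat g$ with $\widehat g|_M=g^M$ and $\widehat g=\frac{1}{\widetilde h(x_n)}g^{\partial M}+dx_n^2$ on the collar; the spin structure is extended. $D$ is the Dirac operator of $\widehat g$ on the rank-$4$ spinor bundle $S(T\widehat M)$, with $c(v)c(w)+c(w)c(v)=-2\langle v,w\rangle$. $D^{-1}$ is a pseudodifferential inverse (parametrix), with full symbol $\sum_{j\ge1}\sigma_{-j}(D^{-1})$. Gravitational action: $I_{\mathrm{Gr}}=\frac{1}{16\pi}\int_Ms\,\mathrm{dvol}_M+2\int_{\partial M}K\,\mathrm{dvol}_{\partial M}=:I_{\mathrm{Gr},i}+I_{\mathrm{Gr},b}$, so $I_{\mathrm{Gr},b}=2\int_{\partial M}K\,\mathrm{dvol}_{\partial M}$, where $K=\sum_{1\le i,j\le n-1}K_{i,j}g_{\partial M}^{i,j}$, $K_{i,j}=-\Gamma^n_{i,j}$, and $\Gamma^k_{i,j}$ are the Christoffel symbols of the Levi-Civita connection of $g^M$ in coordinates $(x_1,\dots,x_{n-1},x_n)$ with $x_1,\dots,x_{n-1}$ coordinates on $\partial M$. Definition of $\mathrm{res}_{1,1},\mathrm{res}_{2,1}$: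 for pseudodifferential operators $P,P'$ on $\widehat M$ with the transmission property, locally on $\partial M$ (at $x_n=0$), $$\mathrm{res}_{1,1}(P,P')=-\frac12\int_{|\xi'|=1}\int_{-\infty}^{+\infty}\mathrm{trace}\big[\partial_{x_n}\pi^+_{\xi_n}\sigma_{-1}(P)\cdot\partial^2_{\xi_n}\sigma_{-1}(P')\big]d\xi_n\,\sigma(\xi')dx',$$ $$\mathrm{res}_{2,1}(P,P')=-i\int_{|\xi'|=1}\int_{-\infty}^{+\infty}\mathrm{trace}\big[\pi^+_{\xi_n}\sigma_{-2}(P)\cdot\partial_{\xi_n}\sigma_{-1}(P')\big]d\xi_n\,\sigma(\xi')dx'.$$ Here $\xi=\xi'+\xi_ndx_n$, $\sigma(\xi')$ is the canonical volume form of the unit sphere $|\xi'|=1$ in $T^*\partial M$, and for a rational function $f$ of $\xi_n$ vanishing at infinity, without real poles, $\pi^+_{\xi_n}f$ is the part of its partial fraction decomposition with poles in the upper half-plane. Since $\partial M$ is flat, these are computed in local coordinates $x'=(x_1,x_2,x_3)$ of $\partial M$ with $g^{\partial M}_{ij}=\delta_{ij}$ (oriented), together with $x_n$, and in the trivialization of the spinor bundle by a spin frame lifting the orthonormal frame $\widetilde e_i=\sqrt{h(x_n)}\,\partial_{x_i}$ ($i<n$), $\widetilde e_n=\partial_{x_n}$, so that the matrices $c(\widetilde e_i)$ are constant; they thus define global forms on $\partial M$. *)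

theory Defs
  imports "HOL-Analysis.Analysis" "HOL-Computational_Algebra.Polynomial"
begin

section \<open>Smooth maps and oriented smooth manifolds\<close>

definition dird :: "'a::real_normed_vector \<Rightarrow> ('a \<Rightarrow> 'b::real_normed_vector) \<Rightarrow> 'a \<Rightarrow> 'b" where
  "dird v f x = frechet_derivative f (at x) v"

definition dirds :: "'a::real_normed_vector list \<Rightarrow> ('a \<Rightarrow> 'b::real_normed_vector) \<Rightarrow> 'a \<Rightarrow> 'b" where
  "dirds vs f = foldr dird vs f"

text \<open>Smoothness on an open set: all iterated directional derivatives exist and are again
  (Frechet) differentiable. It is only used for open sets.\<close>

definition smooth_on :: "'a::real_normed_vector set \<Rightarrow> ('a \<Rightarrow> 'b::real_normed_vector) \<Rightarrow> bool" where
  "smooth_on S f \<longleftrightarrow> (\<forall>vs. \<forall>x\<in>S. dirds vs f differentiable (at x))"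

text \<open>A chart is a domain together with a coordinate map, which is arbitrary off the domain.\<close>

type_synonym ('a, 'n) chart = "'a set \<times> ('a \<Rightarrow> real^'n)"

abbreviation cdom :: "('a, 'n::finite) chart \<Rightarrow> 'a set" where
  "cdom c \<equiv> fst c"

abbreviation coord :: "('a, 'n::finite) chart \<Rightarrow> 'a \<Rightarrow> real^'n" where
  "coord c \<equiv> snd c"

definition crange :: "('a, 'n::finite) chart \<Rightarrow> (real^'n) set" where
  "crange c = coord c ` cdom c"

definition param :: "('a, 'n::finite) chart \<Rightarrow> real^'n \<Rightarrow> 'a" where
  "param c = inv_into (cdom c) (coord c)"

definition is_chart :: "'a::topological_space set \<Rightarrow> ('a, 'n::finite) chart \<Rightarrow> bool" where
  "is_chart X c \<longleftrightarrow> openin (top_of_set X) (cdom c) \<and> open (crange c) \<and>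
     homeomorphism (cdom c) (crange c) (coord c) (param c)"

definition overlap :: "('a, 'n::finite) chart \<Rightarrow> ('a, 'n) chart \<Rightarrow> (real^'n) set" where
  "overlap c c' = coord c ` (cdom c \<inter> cdom c')"

definition transition :: "('a, 'n::finite) chart \<Rightarrow> ('a, 'n) chart \<Rightarrow> real^'n \<Rightarrow> real^'n" where
  "transition c c' x = coord c' (param c x)"

definition jac :: "('a, 'n::finite) chart \<Rightarrow> ('a, 'n) chart \<Rightarrow> 'a \<Rightarrow> real^'n^'n" where
  "jac c c' p = jacobian (transition c c') (at (coord c p))"

definition oriented_compatible :: "('a, 'n::finite) chart \<Rightarrow> ('a, 'n) chart \<Rightarrow> bool" where
  "oriented_compatible c c' \<longleftrightarrow> smooth_on (overlap c c') (transition c c') \<and>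
     (\<forall>p\<in>cdom c \<inter> cdom c'. det (jac c c' p) > 0)"

text \<open>The carrier is a subset X of a (Hausdorff, second countable) space with the subspace
  topology; the structure is given by its maximal oriented atlas.\<close>

definition oriented_manifold :: "'a::topological_space set \<Rightarrow> ('a, 'n::finite) chart set \<Rightarrow> bool" where
  "oriented_manifold X A \<longleftrightarrow>
     (\<forall>c\<in>A. is_chart X c) \<and> (\<Union>c\<in>A. cdom c) = X \<and>
     (\<forall>c\<in>A. \<forall>c'\<in>A. oriented_compatible c c') \<and>
     (\<forall>c. is_chart X c \<and> (\<forall>c'\<in>A. oriented_compatible c c' \<and> oriented_compatible c' c) \<longrightarrow> c \<in> A)"

section \<open>Riemannian metrics\<close>

text \<open>\<open>g c p\<close> is the Gram matrix at p of the coordinate vector fields of the chart c.\<close>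

type_synonym ('a, 'n) metric = "('a, 'n) chart \<Rightarrow> 'a \<Rightarrow> real^'n^'n"

definition riemannian_metric :: "('a, 'n::finite) chart set \<Rightarrow> ('a, 'n) metric \<Rightarrow> bool" where
  "riemannian_metric A g \<longleftrightarrow>
     (\<forall>c\<in>A. smooth_on (crange c) (\<lambda>x. g c (param c x)) \<and>
        (\<forall>p\<in>cdom c. transpose (g c p) = g c p \<and> (\<forall>v. v \<noteq> 0 \<longrightarrow> v \<bullet> (g c p *v v) > 0))) \<and>
     (\<forall>c\<in>A. \<forall>c'\<in>A. \<forall>p\<in>cdom c \<inter> cdom c'.
        g c p = transpose (jac c c' p) ** g c' p ** jac c c' p)"

definition flat_chart :: "('a, 'n::finite) metric \<Rightarrow> ('a, 'n) chart \<Rightarrow> bool" where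
  "flat_chart g c \<longleftrightarrow> (\<forall>p\<in>cdom c. g c p = mat 1)"

text \<open>Flat means locally isometric to Euclidean space.\<close>

definition flat_metric :: "'a set \<Rightarrow> ('a, 'n::finite) chart set \<Rightarrow> ('a, 'n) metric \<Rightarrow> bool" where
  "flat_metric X A g \<longleftrightarrow> (\<forall>p\<in>X. \<exists>c\<in>A. p \<in> cdom c \<and> flat_chart g c)"

definition riemannian_volume ::
  "'a::topological_space set \<Rightarrow> ('a, 'n::finite) chart set \<Rightarrow> ('a, 'n) metric \<Rightarrow> 'a measure" where
  "riemannian_volume X A g = (THE \<nu>. space \<nu> = X \<and> sets \<nu> = sets (restrict_space borel X) \<and>
     (\<forall>c\<in>A. \<forall>S\<in>sets \<nu>. S \<subseteq> cdom c \<longrightarrow>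
        emeasure \<nu> S = (\<integral>\<^sup>+x. indicator (coord c ` S) x * ennreal (sqrt (det (g c (param c x)))) \<partial>lborel)))"

text \<open>Christoffel symbol with upper index k and lower indices i, j of the coordinate metric G.\<close>

definition christoffel ::
  "(real^'n \<Rightarrow> real^'n^'n) \<Rightarrow> real^'n \<Rightarrow> 'n::finite \<Rightarrow> 'n \<Rightarrow> 'n \<Rightarrow> real" where
  "christoffel G x k i j = (1/2) * (\<Sum>l\<in>UNIV. matrix_inv (G x) $ k $ l *
     (dird (axis i 1) (\<lambda>z. G z $ j $ l) x + dird (axis j 1) (\<lambda>z. G z $ i $ l) x
      - dird (axis l 1) (\<lambda>z. G z $ i $ j) x))"

section \<open>Clifford algebra and spin structures in dimension four\<close>

definition clifford :: "(4 \<Rightarrow> complex^4^4) \<Rightarrow> real^4 \<Rightarrow> complex^4^4" where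
  "clifford \<gamma> v = (\<Sum>i\<in>UNIV. v $ i *\<^sub>R \<gamma> i)"

definition clifford_relations :: "(4 \<Rightarrow> complex^4^4) \<Rightarrow> bool" where
  "clifford_relations \<gamma> \<longleftrightarrow> (\<forall>v w. clifford \<gamma> v ** clifford \<gamma> w + clifford \<gamma> w ** clifford \<gamma> v
     = mat (complex_of_real (-2 * (v \<bullet> w))))"

text \<open>Spin(4): products of an even number of unit vectors. It is realized inside the
  complex 4x4 matrices, on which the complexified Clifford algebra acts faithfully.\<close>

inductive_set spin_group :: "(4 \<Rightarrow> complex^4^4) \<Rightarrow> (complex^4^4) set" for \<gamma> where
  one: "mat 1 \<in> spin_group \<gamma>"
| step: "S \<in> spin_group \<gamma> \<Longrightarrow> norm v = 1 \<Longrightarrow> norm w = 1 \<Longrightarrow>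
    S ** clifford \<gamma> v ** clifford \<gamma> w \<in> spin_group \<gamma>"

definition spin_covers :: "(4 \<Rightarrow> complex^4^4) \<Rightarrow> complex^4^4 \<Rightarrow> real^4^4 \<Rightarrow> bool" where
  "spin_covers \<gamma> S \<Lambda> \<longleftrightarrow> (\<forall>v. S ** clifford \<gamma> v ** matrix_inv S = clifford \<gamma> (\<Lambda> *v v))"

text \<open>A Riemannian 4-manifold on the type 'm with a principal Spin(4)-bundle whose total space
  is the type 'p. The columns of \<open>bframe c u\<close> are the components, in the chart c, of the
  orthonormal frame that lies under \<open>u\<close>.\<close>

record ('m, 'p) spin_manifold =
  atlas :: "('m, 4) chart set"
  metr :: "('m, 4) metric"
  gam :: "4 \<Rightarrow> complex^4^4"
  bproj :: "'p \<Rightarrow> 'm"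
  bact :: "'p \<Rightarrow> complex^4^4 \<Rightarrow> 'p"
  bframe :: "('m, 4) chart \<Rightarrow> 'p \<Rightarrow> real^4^4"

text \<open>Local sections of the spin bundle over a chart domain. The bundle covers the frame bundle,
  so a continuous section is smooth iff the frame under it is.\<close>

definition spin_frame ::
  "('m::topological_space, 'p::topological_space, 'z) spin_manifold_scheme \<Rightarrow>
   ('m, 4) chart \<Rightarrow> ('m \<Rightarrow> 'p) \<Rightarrow> bool" where
  "spin_frame X c s \<longleftrightarrow> c \<in> atlas X \<and> continuous_on (cdom c) s \<and>
     (\<forall>p\<in>cdom c. bproj X (s p) = p) \<and>
     smooth_on (crange c) (\<lambda>x. bframe X c (s (param c x)))"

text \<open>The spin structure is a Spin(4)-equivariant covering of the bundle of oriented orthonormal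
  frames, written over each chart domain; the last clause says that the Spin(4)-bundle is smooth.\<close>

definition spin_structure ::
  "('m::topological_space, 'p::topological_space, 'z) spin_manifold_scheme \<Rightarrow> bool" where
  "spin_structure X \<longleftrightarrow>
     clifford_relations (gam X) \<and>
     (\<forall>u. \<forall>S\<in>spin_group (gam X). bproj X (bact X u S) = bproj X u) \<and>
     (\<forall>u. bact X u (mat 1) = u) \<and>
     (\<forall>u. \<forall>S\<in>spin_group (gam X). \<forall>T\<in>spin_group (gam X).
        bact X (bact X u S) T = bact X u (S ** T)) \<and>
     (\<forall>u v. bproj X u = bproj X v \<longrightarrow> (\<exists>!S. S \<in> spin_group (gam X) \<and> v = bact X u S)) \<and>
     continuous_on (UNIV \<times> spin_group (gam X)) (\<lambda>(u, S). bact X u S) \<and>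
     (\<forall>c\<in>atlas X. \<forall>c'\<in>atlas X. \<forall>u. bproj X u \<in> cdom c \<inter> cdom c' \<longrightarrow>
        bframe X c' u = jac c c' (bproj X u) ** bframe X c u) \<and>
     (\<forall>c\<in>atlas X. \<forall>u. \<forall>S\<in>spin_group (gam X). \<forall>\<Lambda>.
        bproj X u \<in> cdom c \<longrightarrow> spin_covers (gam X) S \<Lambda> \<longrightarrow>
        bframe X c (bact X u S) = bframe X c u ** \<Lambda>) \<and>
     (\<forall>c\<in>atlas X. covering_space (bproj X -` cdom c) (\<lambda>u. (bproj X u, bframe X c u))
        {(p, F). p \<in> cdom c \<and> transpose F ** metr X c p ** F = mat 1 \<and> det F > 0}) \<and>
     (\<forall>c s c' s' S. spin_frame X c s \<longrightarrow> spin_frame X c' s' \<longrightarrow>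
        (\<forall>p\<in>cdom c \<inter> cdom c'. S p \<in> spin_group (gam X) \<and> s' p = bact X (s p) (S p)) \<longrightarrow>
        smooth_on (overlap c c') (\<lambda>x. S (param c x)))"

section \<open>Spinors and the Dirac operator\<close>

text \<open>Sections of the associated spinor bundle are the equivariant functions on the spin bundle.\<close>

definition smooth_spinor ::
  "('m::topological_space, 'p::topological_space, 'z) spin_manifold_scheme \<Rightarrow> ('p \<Rightarrow> complex^4) \<Rightarrow> bool" where
  "smooth_spinor X \<Psi> \<longleftrightarrow>
     (\<forall>u. \<forall>S\<in>spin_group (gam X). \<Psi> (bact X u S) = matrix_inv S *v \<Psi> u) \<and>
     (\<forall>c s. spin_frame X c s \<longrightarrow> smooth_on (crange c) (\<lambda>x. \<Psi> (s (param c x))))"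

definition spinor_support ::
  "('m::topological_space, 'p, 'z) spin_manifold_scheme \<Rightarrow> ('p \<Rightarrow> complex^4) \<Rightarrow> 'm set" where
  "spinor_support X \<Psi> = closure (bproj X ` {u. \<Psi> u \<noteq> 0})"

definition test_spinor ::
  "('m::topological_space, 'p::topological_space, 'z) spin_manifold_scheme \<Rightarrow> ('p \<Rightarrow> complex^4) \<Rightarrow> bool" where
  "test_spinor X \<Psi> \<longleftrightarrow> smooth_spinor X \<Psi> \<and> compact (spinor_support X \<Psi>)"

definition local_rep ::
  "('m, 4) chart \<Rightarrow> ('m \<Rightarrow> 'p) \<Rightarrow> ('p \<Rightarrow> complex^4) \<Rightarrow> real^4 \<Rightarrow> complex^4" where
  "local_rep c s \<Psi> x = (if x \<in> crange c then \<Psi> (s (param c x)) else 0)"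

text \<open>For the orthonormal frame e whose components are the columns of E, this is
  the inner product of the covariant derivative of e_s along e_i with e_t.\<close>

definition frame_connection ::
  "(real^4 \<Rightarrow> real^4^4) \<Rightarrow> (real^4 \<Rightarrow> real^4^4) \<Rightarrow> real^4 \<Rightarrow> 4 \<Rightarrow> 4 \<Rightarrow> 4 \<Rightarrow> real" where
  "frame_connection G E x i s t = (\<Sum>k\<in>UNIV. \<Sum>l\<in>UNIV. G x $ k $ l * E x $ l $ t *
     (\<Sum>a\<in>UNIV. E x $ a $ i *
        (dird (axis a 1) (\<lambda>z. E z $ k $ s) x + (\<Sum>b\<in>UNIV. christoffel G x k a b * E x $ b $ s))))"

text \<open>With the sign convention \<open>c(v)c(v) = - |v|^2\<close> the spin connection along e_i is e_i plus a quarter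
  of the sum over s, t of \<open>frame_connection G E x i s t\<close> times \<open>\<gamma> s ** \<gamma> t\<close>; this is the sign for
  which it is compatible with Clifford multiplication.\<close>

definition local_dirac ::
  "(4 \<Rightarrow> complex^4^4) \<Rightarrow> (real^4 \<Rightarrow> real^4^4) \<Rightarrow> (real^4 \<Rightarrow> real^4^4) \<Rightarrow>
   (real^4 \<Rightarrow> complex^4) \<Rightarrow> real^4 \<Rightarrow> complex^4" where
  "local_dirac \<gamma> G E \<psi> x = (\<Sum>i\<in>UNIV. \<gamma> i *v
     (dird (column i (E x)) \<psi> x +
      (1/4) *\<^sub>R (\<Sum>s\<in>UNIV. \<Sum>t\<in>UNIV. frame_connection G E x i s t *\<^sub>R ((\<gamma> s ** \<gamma> t) *v \<psi> x))))"

type_synonym 'p spinor_op = "('p \<Rightarrow> complex^4) \<Rightarrow> ('p \<Rightarrow> complex^4)"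

definition dirac_operator ::
  "('m::topological_space, 'p::topological_space, 'z) spin_manifold_scheme \<Rightarrow> 'p spinor_op \<Rightarrow> bool" where
  "dirac_operator X D \<longleftrightarrow> (\<forall>\<Psi> c s. smooth_spinor X \<Psi> \<longrightarrow> spin_frame X c s \<longrightarrow>
     (\<forall>x\<in>crange c. D \<Psi> (s (param c x)) =
        local_dirac (gam X) (\<lambda>z. metr X c (param c z)) (\<lambda>z. bframe X c (s (param c z)))
          (local_rep c s \<Psi>) x))"

section \<open>Classical pseudodifferential operators\<close>

text \<open>Also used for matrix-valued integral kernels k (x, y).\<close>

type_synonym symbol = "(real^4) \<times> (real^4) \<Rightarrow> complex^4^4"

definition fourier :: "(real^4 \<Rightarrow> complex^4) \<Rightarrow> real^4 \<Rightarrow> complex^4" where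
  "fourier v \<xi> = (LINT y|lborel. cis (- (y \<bullet> \<xi>)) *s v y)"

definition quantize :: "symbol \<Rightarrow> (real^4 \<Rightarrow> complex^4) \<Rightarrow> real^4 \<Rightarrow> complex^4" where
  "quantize q v x =
     (1 / (2 * pi) ^ 4) *\<^sub>R (LINT \<xi>|lborel. cis (x \<bullet> \<xi>) *s (q (x, \<xi>) *v fourier v \<xi>))"

text \<open>Symbol estimates of order m, locally uniform over V, for covectors of length at least R.\<close>

definition symbol_bound :: "int \<Rightarrow> (real^4) set \<Rightarrow> real \<Rightarrow> symbol \<Rightarrow> bool" where
  "symbol_bound m V R q \<longleftrightarrow> (\<forall>K is js. compact K \<and> K \<subseteq> V \<longrightarrow>
     (\<exists>C. \<forall>x\<in>K. \<forall>\<xi>. norm \<xi> \<ge> R \<longrightarrow>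
        norm (dirds (map (\<lambda>i. (axis i 1, 0)) is @ map (\<lambda>j. (0, axis j 1)) js) q (x, \<xi>))
          \<le> C * (1 + norm \<xi>) powi (m - int (length js))))"

definition symbol_class :: "int \<Rightarrow> (real^4) set \<Rightarrow> symbol \<Rightarrow> bool" where
  "symbol_class m V q \<longleftrightarrow> smooth_on (V \<times> UNIV) q \<and> symbol_bound m V 0 q"

text \<open>\<open>\<sigma> d\<close> is the homogeneous part of degree d, and the expansion is asymptotic.\<close>

definition classical_expansion :: "int \<Rightarrow> (real^4) set \<Rightarrow> symbol \<Rightarrow> (int \<Rightarrow> symbol) \<Rightarrow> bool" where
  "classical_expansion m V q \<sigma> \<longleftrightarrow>
     (\<forall>d. smooth_on (V \<times> (- {0})) (\<sigma> d)) \<and>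
     (\<forall>d. \<forall>x\<in>V. \<forall>\<xi>. \<xi> \<noteq> 0 \<longrightarrow> (d > m \<longrightarrow> \<sigma> d (x, \<xi>) = 0) \<and>
        (\<forall>t>0. \<sigma> d (x, t *\<^sub>R \<xi>) = (t powi d) *\<^sub>R \<sigma> d (x, \<xi>))) \<and>
     (\<forall>N. symbol_bound (m - int N) V 1 (\<lambda>z. q z - (\<Sum>j<N. \<sigma> (m - int j) z)))"

definition smooth_kernel :: "(real^4) set \<Rightarrow> symbol \<Rightarrow> bool" where
  "smooth_kernel V k \<longleftrightarrow> smooth_on (V \<times> V) k"

definition full_symbol_of_order ::
  "('m::topological_space, 'p::topological_space, 'z) spin_manifold_scheme \<Rightarrow> int \<Rightarrow> 'p spinor_op \<Rightarrow>
   ('m, 4) chart \<Rightarrow> ('m \<Rightarrow> 'p) \<Rightarrow> (int \<Rightarrow> symbol) \<Rightarrow> bool" where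
  "full_symbol_of_order X m T c s \<sigma> \<longleftrightarrow> (\<exists>q k.
     symbol_class m (crange c) q \<and> classical_expansion m (crange c) q \<sigma> \<and>
     smooth_kernel (crange c) k \<and>
     (\<forall>\<Psi>. test_spinor X \<Psi> \<and> spinor_support X \<Psi> \<subseteq> cdom c \<longrightarrow>
        (\<forall>x\<in>crange c. T \<Psi> (s (param c x)) =
           quantize q (local_rep c s \<Psi>) x + (LINT y|lborel. k (x, y) *v local_rep c s \<Psi> y))))"

definition full_symbol ::
  "('m::topological_space, 'p::topological_space, 'z) spin_manifold_scheme \<Rightarrow> 'p spinor_op \<Rightarrow>
   ('m, 4) chart \<Rightarrow> ('m \<Rightarrow> 'p) \<Rightarrow> (int \<Rightarrow> symbol) \<Rightarrow> bool" where
  "full_symbol X T c s \<sigma> \<longleftrightarrow> (\<exists>m. full_symbol_of_order X m T c s \<sigma>)"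

text \<open>Chart domains may be disconnected, so the condition on all charts also makes the Schwartz
  kernel of T smooth off the diagonal.\<close>

definition pseudodifferential ::
  "('m::topological_space, 'p::topological_space, 'z) spin_manifold_scheme \<Rightarrow> int \<Rightarrow> 'p spinor_op \<Rightarrow> bool" where
  "pseudodifferential X m T \<longleftrightarrow>
     (\<forall>\<Psi>. test_spinor X \<Psi> \<longrightarrow> smooth_spinor X (T \<Psi>)) \<and>
     (\<forall>\<Psi> \<Phi> a b. test_spinor X \<Psi> \<longrightarrow> test_spinor X \<Phi> \<longrightarrow>
        T (\<lambda>u. a *s \<Psi> u + b *s \<Phi> u) = (\<lambda>u. a *s T \<Psi> u + b *s T \<Phi> u)) \<and>
     (\<forall>c s. spin_frame X c s \<longrightarrow> (\<exists>\<sigma>. full_symbol_of_order X m T c s \<sigma>))"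

definition smoothing_operator ::
  "('m::topological_space, 'p::topological_space, 'z) spin_manifold_scheme \<Rightarrow> 'p spinor_op \<Rightarrow> bool" where
  "smoothing_operator X T \<longleftrightarrow> (\<forall>c s. spin_frame X c s \<longrightarrow> (\<exists>k. smooth_kernel (crange c) k \<and>
     (\<forall>\<Psi>. test_spinor X \<Psi> \<and> spinor_support X \<Psi> \<subseteq> cdom c \<longrightarrow>
        (\<forall>x\<in>crange c. T \<Psi> (s (param c x)) = (LINT y|lborel. k (x, y) *v local_rep c s \<Psi> y)))))"

definition parametrix ::
  "('m::topological_space, 'p::topological_space, 'z) spin_manifold_scheme \<Rightarrow> 'p spinor_op \<Rightarrow> 'p spinor_op \<Rightarrow> bool" where
  "parametrix X D Q \<longleftrightarrow> pseudodifferential X (-1) Q \<and>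
     smoothing_operator X (\<lambda>\<Psi> u. D (Q \<Psi>) u - \<Psi> u) \<and>
     smoothing_operator X (\<lambda>\<Psi> u. Q (D \<Psi>) u - \<Psi> u)"

section \<open>Manifolds with boundary and their collar extension\<close>

text \<open>The spin manifold is the extension; the given compact manifold with boundary is
  its regular domain \<open>body\<close>. The warping function \<open>warp\<close> is defined on the extended
  interval \<open>{- ceps<..<1}\<close>.\<close>

record ('m, 'p) collar_manifold = "('m, 'p) spin_manifold" +
  body :: "'m set"
  bdry :: "'m set"
  batlas :: "('m, 3) chart set"
  bmetr :: "('m, 3) metric"
  ceps :: real
  warp :: "real \<Rightarrow> real"
  collar :: "'m \<times> real \<Rightarrow> 'm"

definition down :: "4 \<Rightarrow> 3" where
  "down j = (if j = 1 then 1 else if j = 2 then 2 else 3)"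

definition up :: "3 \<Rightarrow> 4" where
  "up i = (if i = 1 then 1 else if i = 2 then 2 else 3)"

definition join :: "real^3 \<Rightarrow> real \<Rightarrow> real^4" where
  "join x t = (\<chi> j. if j = 4 then t else x $ down j)"

definition block :: "real^3^3 \<Rightarrow> real \<Rightarrow> real^4^4" where
  "block N a = (\<chi> i j. if i = 4 \<and> j = 4 then a else if i = 4 \<or> j = 4 then 0 else N $ down i $ down j)"

definition collar_dom :: "('m, 'p, 'z) collar_manifold_scheme \<Rightarrow> 'm set \<Rightarrow> ('m \<times> real) set" where
  "collar_dom X V = V \<times> {- ceps X<..<1}"

definition collar_chart ::
  "('m, 'p, 'z) collar_manifold_scheme \<Rightarrow> ('m, 3) chart \<Rightarrow> ('m, 4) chart" where
  "collar_chart X b = (collar X ` collar_dom X (cdom b),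
     \<lambda>p. case inv_into (collar_dom X (bdry X)) (collar X) p of (y, t) \<Rightarrow> join (coord b y) t)"

definition normal_coord :: "('m, 'p, 'z) collar_manifold_scheme \<Rightarrow> 'm \<Rightarrow> real" where
  "normal_coord X p = snd (inv_into (collar_dom X (bdry X)) (collar X) p)"

text \<open>The collar charts belong to the maximal oriented atlas: this says both that the collar is
  a diffeomorphism onto its image and that coordinates on the boundary are oriented when,
  followed by the normal coordinate, they are oriented.\<close>

definition spin_manifold_with_collar ::
  "('m::{t2_space, second_countable_topology}, 'p::topological_space, 'z) collar_manifold_scheme \<Rightarrow> bool" where
  "spin_manifold_with_collar X \<longleftrightarrow>
     oriented_manifold UNIV (atlas X) \<and> riemannian_metric (atlas X) (metr X) \<and> spin_structure X \<and>
     compact (body X) \<and> frontier (body X) = bdry X \<and>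
     oriented_manifold (bdry X) (batlas X) \<and> riemannian_metric (batlas X) (bmetr X) \<and>
     ceps X > 0 \<and> smooth_on {- ceps X<..<1} (warp X) \<and> (\<forall>t\<in>{- ceps X<..<1}. warp X t > 0) \<and>
     open (collar X ` collar_dom X (bdry X)) \<and>
     (\<exists>r. homeomorphism (collar_dom X (bdry X)) (collar X ` collar_dom X (bdry X)) (collar X) r) \<and>
     (\<forall>y\<in>bdry X. collar X (y, 0) = y) \<and>
     body X \<inter> collar X ` collar_dom X (bdry X) = collar X ` (bdry X \<times> {0..<1}) \<and>
     body X \<union> collar X ` (bdry X \<times> {- ceps X<..0}) = UNIV \<and>
     (\<forall>b\<in>batlas X. collar_chart X b \<in> atlas X) \<and>
     (\<forall>b\<in>batlas X. \<forall>y\<in>cdom b. \<forall>t\<in>{- ceps X<..<1}.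
        metr X (collar_chart X b) (collar X (y, t)) = block ((1 / warp X t) *\<^sub>R bmetr X b y) 1)"

definition boundary_volume :: "('m::topological_space, 'p, 'z) collar_manifold_scheme \<Rightarrow> 'm measure" where
  "boundary_volume X = riemannian_volume (bdry X) (batlas X) (bmetr X)"

definition extrinsic_curvature :: "('m, 'p, 'z) collar_manifold_scheme \<Rightarrow> ('m, 3) chart \<Rightarrow> 'm \<Rightarrow> 3 \<Rightarrow> 3 \<Rightarrow> real" where
  "extrinsic_curvature X b y i j =
     - christoffel (\<lambda>z. metr X (collar_chart X b) (param (collar_chart X b) z))
         (join (coord b y) 0) 4 (up i) (up j)"

definition extrinsic_trace :: "('m, 'p, 'z) collar_manifold_scheme \<Rightarrow> 'm \<Rightarrow> real" where
  "extrinsic_trace X y = (THE K. \<exists>b\<in>batlas X. y \<in> cdom b \<and>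
     K = (\<Sum>i\<in>UNIV. \<Sum>j\<in>UNIV. extrinsic_curvature X b y i j * matrix_inv (bmetr X b y) $ i $ j))"

definition I_Gr_b :: "('m::topological_space, 'p, 'z) collar_manifold_scheme \<Rightarrow> real" where
  "I_Gr_b X = 2 * (LINT y|boundary_volume X. extrinsic_trace X y)"

section \<open>The boundary residue densities\<close>

text \<open>The part, with poles in the upper half-plane, of the partial fraction decomposition of a
  rational function without real poles that vanishes at infinity.\<close>

definition pi_plus :: "(real \<Rightarrow> complex) \<Rightarrow> real \<Rightarrow> complex" where
  "pi_plus f = (THE g. \<exists>p1 q1 p2 q2 :: complex poly.
     q1 \<noteq> 0 \<and> q2 \<noteq> 0 \<and> (p1 = 0 \<or> degree p1 < degree q1) \<and> (p2 = 0 \<or> degree p2 < degree q2) \<and>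
     (\<forall>z. poly q1 z = 0 \<longrightarrow> Im z > 0) \<and> (\<forall>z. poly q2 z = 0 \<longrightarrow> Im z < 0) \<and>
     (\<forall>t. g t = poly p1 (of_real t) / poly q1 (of_real t)) \<and>
     (\<forall>t. f t = g t + poly p2 (of_real t) / poly q2 (of_real t)))"

definition pi_plus_mat :: "(real \<Rightarrow> complex^4^4) \<Rightarrow> real \<Rightarrow> complex^4^4" where
  "pi_plus_mat F t = (\<chi> i j. pi_plus (\<lambda>\<tau>. F \<tau> $ i $ j) t)"

definition sphere_integral :: "(real^3 \<Rightarrow> complex) \<Rightarrow> complex" where
  "sphere_integral f = (LINT \<theta>:{0..pi}|lborel. LINT \<phi>:{0..2*pi}|lborel.
     sin \<theta> *\<^sub>R f (vector [sin \<theta> * cos \<phi>, sin \<theta> * sin \<phi>, cos \<theta>]))"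

text \<open>Coefficients of the residue forms with respect to dx', at the boundary point
  with coordinates x.\<close>

definition local_res11 :: "(int \<Rightarrow> symbol) \<Rightarrow> (int \<Rightarrow> symbol) \<Rightarrow> real^3 \<Rightarrow> complex" where
  "local_res11 \<sigma> \<sigma>' x = - (1/2) * sphere_integral (\<lambda>\<omega>. LINT t|lborel. trace (
     vector_derivative (\<lambda>r. pi_plus_mat (\<lambda>\<tau>. \<sigma> (-1) (join x r, join \<omega> \<tau>)) t) (at 0) **
     vector_derivative (\<lambda>\<tau>. vector_derivative (\<lambda>\<rho>. \<sigma>' (-1) (join x 0, join \<omega> \<rho>)) (at \<tau>)) (at t)))"

definition local_res21 :: "(int \<Rightarrow> symbol) \<Rightarrow> (int \<Rightarrow> symbol) \<Rightarrow> real^3 \<Rightarrow> complex" where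
  "local_res21 \<sigma> \<sigma>' x = - \<i> * sphere_integral (\<lambda>\<omega>. LINT t|lborel. trace (
     pi_plus_mat (\<lambda>\<tau>. \<sigma> (-2) (join x 0, join \<omega> \<tau>)) t **
     vector_derivative (\<lambda>\<tau>. \<sigma>' (-1) (join x 0, join \<omega> \<tau>)) (at t)))"

text \<open>Near the boundary point y: c is a collar chart, possibly restricted to a smaller domain, over a
  flat oriented chart b of the boundary, and s lifts the orthonormal frame consisting of
  \<open>sqrt (warp X x\<^sub>n)\<close> times the first three coordinate fields and of the last one.\<close>

definition adapted ::
  "('m::topological_space, 'p::topological_space, 'z) collar_manifold_scheme \<Rightarrow>
   ('m, 3) chart \<Rightarrow> ('m, 4) chart \<Rightarrow> ('m \<Rightarrow> 'p) \<Rightarrow> 'm \<Rightarrow> bool" where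
  "adapted X b c s y \<longleftrightarrow> b \<in> batlas X \<and> flat_chart (bmetr X) b \<and>
     y \<in> cdom b \<and> y \<in> cdom c \<and> cdom c \<subseteq> cdom (collar_chart X b) \<and>
     (\<forall>p\<in>cdom c. coord c p = coord (collar_chart X b) p) \<and> spin_frame X c s \<and>
     (\<forall>p\<in>cdom c. bframe X c (s p) = block (mat (sqrt (warp X (normal_coord X p)))) 1)"

text \<open>In flat coordinates dx' is the Riemannian volume form of the boundary, so these are the
  coefficients of the global residue forms with respect to the boundary volume.\<close>

definition res11 ::
  "('m::topological_space, 'p::topological_space, 'z) collar_manifold_scheme \<Rightarrow>
   'p spinor_op \<Rightarrow> 'p spinor_op \<Rightarrow> 'm \<Rightarrow> complex" where
  "res11 X P P' y = (THE r. \<exists>b c s \<sigma> \<sigma>'. adapted X b c s y \<and> full_symbol X P c s \<sigma> \<and>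
     full_symbol X P' c s \<sigma>' \<and> r = local_res11 \<sigma> \<sigma>' (coord b y))"

definition res21 ::
  "('m::topological_space, 'p::topological_space, 'z) collar_manifold_scheme \<Rightarrow>
   'p spinor_op \<Rightarrow> 'p spinor_op \<Rightarrow> 'm \<Rightarrow> complex" where
  "res21 X P P' y = (THE r. \<exists>b c s \<sigma> \<sigma>'. adapted X b c s y \<and> full_symbol X P c s \<sigma> \<and>
     full_symbol X P' c s \<sigma>' \<and> r = local_res21 \<sigma> \<sigma>' (coord b y))"

definition Omega3 :: real where
  "Omega3 = 2 * pi powr (3/2) / Gamma (3/2)"

lemma Omega3_eq: "Omega3 = 4 * pi"
proof -
  have "Gamma (3/2 :: real) = Gamma (1/2 + 1)" by simp
  also have "\<dots> = 1/2 * sqrt pi"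
    by (subst Gamma_plus1) (auto simp: Gamma_one_half_real elim!: nonpos_Ints_cases)
  finally have G: "Gamma (3/2 :: real) = sqrt pi / 2" by simp
  have "pi powr (3/2) = pi powr (1 + 1/2)" by simp
  also have "\<dots> = pi * sqrt pi" by (subst powr_add) (simp add: powr_half_sqrt)
  finally show ?thesis by (simp add: Omega3_def G)
qed

end

theory Submission
  imports Defs "HOL-Probability.Probability" "HOL-Computational_Algebra.Fundamental_Theorem_Algebra"
begin

text \<open>The homogeneous terms of the full symbol of a parametrix of D are determined by D: testing the
  equation \<open>D D\<^sup>-\<^sup>1 = 1\<close>, valid up to smooth kernels, on wave packets of large frequency in the direction
  \<open>\<xi>\<close> shows that the composed symbol is 1 up to order \<open>-\<infinity>\<close>. In a frame adapted to the collar
  the terms of degree \<open>-1\<close> and \<open>-2\<close> are rational functions of the normal covariable at a boundary point,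
  and they depend on the metric only through \<open>h'(0)\<close>, by Clifford algebra. Partial fractions and the
  integrals of \<open>(1 + t\<^sup>2)\<^sup>-\<^sup>2\<close> and \<open>(1 + t\<^sup>2)\<^sup>-\<^sup>3\<close> over the line give the constant residue densities
  \<open>-(3/2) \<pi>\<^sup>2 h'(0)\<close> and \<open>(9/2) \<pi>\<^sup>2 h'(0)\<close>. The trace of the extrinsic curvature is the constant
  \<open>-(3/2) h'(0)\<close>, so both sides of each equation are the same multiple of the volume of the boundary. It
  remains to see that the boundary volume, specified by its values in charts, is an actual measure on
  the whole boundary, which is the change of variables formula.\<close>

section \<open>Calculus of iterated directional derivatives\<close>

text \<open>The parametrix is known only through its defining property, so its symbol has to be
  extracted, not constructed. Composing with D on the left keeps this elementary: differentiating
  \<open>quantize q v\<close> along w replaces q by i(w.\<xi>)q plus the derivative of q along w,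
  exactly, so no asymptotic product formula is involved. Each packet is evaluated at its own centre,
  where the phases cancel and dominated convergence gives the limit of large frequency. The
  densities are definite descriptions over all choices of frame and symbol. One value is computed
  for every choice; that some choice exists requires lifting the orthonormal frame through the spin
  covering near the point. The line integrals stay short because the upper half-plane parts that
  enter are multiples of C + iG, with C the Clifford matrix of the unit tangential covector and G
  that of the normal. The trace against A C + B G then sees only A + iB, and for the principal term
  i(C + tG)/(1 + t^2) this is -1/(t + i), with a single pole in the lower half-plane.\<close>

primrec ndiff :: "nat \<Rightarrow> 'a::real_normed_vector set \<Rightarrow> ('a \<Rightarrow> 'b::real_normed_vector) \<Rightarrow> bool" where
  "ndiff 0 S f = True"
| "ndiff (Suc n) S f = ((\<forall>x\<in>S. f differentiable (at x)) \<and> (\<forall>v. ndiff n S (dird v f)))"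

lemma dirds_Nil [simp]: "dirds [] f = f"
  by (simp add: dirds_def)

lemma dirds_snoc [simp]: "dirds (vs @ [v]) f = dirds vs (dird v f)"
  by (simp add: dirds_def)

lemma dirds_Cons: "dirds (v # vs) f = dird v (dirds vs f)"
  by (simp add: dirds_def)

text \<open>\<open>dirds\<close> applies the last direction of the list first, so splitting the list
  at its end peels off the innermost derivative. This is the coinductive unfolding of
  smoothness.\<close>

lemma smooth_on_iff:
  "smooth_on S f \<longleftrightarrow> (\<forall>x\<in>S. f differentiable (at x)) \<and> (\<forall>v. smooth_on S (dird v f))"
proof
  assume "smooth_on S f"
  then have *: "\<forall>vs. \<forall>x\<in>S. dirds vs f differentiable (at x)"
    by (simp add: smooth_on_def)
  show "(\<forall>x\<in>S. f differentiable (at x)) \<and> (\<forall>v. smooth_on S (dird v f))"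
    unfolding smooth_on_def using spec[OF *, of "[]"] spec[OF *, of "_ @ [_]"] by simp
next
  assume *: "(\<forall>x\<in>S. f differentiable (at x)) \<and> (\<forall>v. smooth_on S (dird v f))"
  show "smooth_on S f"
    unfolding smooth_on_def
  proof (intro allI)
    fix vs show "\<forall>x\<in>S. dirds vs f differentiable (at x)"
      using * by (cases vs rule: rev_cases) (auto simp: smooth_on_def)
  qed
qed

lemma ndiff_Suc_D: "ndiff (Suc n) S f \<Longrightarrow> ndiff n S f"
proof (induction n arbitrary: f)
  case (Suc n)
  then show ?case by (metis ndiff.simps(2))
qed simp

text \<open>Grading by the number of derivatives makes closure properties inductions on n. A fixed
  list of directions would not do: product and chain rule turn one derivative into sums of terms
  with their own directions, while \<open>ndiff\<close> quantifies over all directions at each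
  stage.\<close>

lemma smooth_on_ndiff: "smooth_on S f \<longleftrightarrow> (\<forall>n. ndiff n S f)"
proof
  show "smooth_on S f \<Longrightarrow> \<forall>n. ndiff n S f"
  proof (intro allI)
    fix n show "smooth_on S f \<Longrightarrow> ndiff n S f"
    proof (induction n arbitrary: f)
      case (Suc n) then show ?case using smooth_on_iff[of S f] by simp
    qed simp
  qed
next
  assume *: "\<forall>n. ndiff n S f"
  have "ndiff (Suc (length vs)) S f \<Longrightarrow> \<forall>x\<in>S. dirds vs f differentiable (at x)" for vs
    by (induction vs arbitrary: f rule: rev_induct) auto
  with * show "smooth_on S f"
    unfolding smooth_on_def by blast
qed

text \<open>The predicate \<open>has_derivative\<close> cannot distinguish two functions that agree
  near x, and \<open>frechet_derivative\<close> is a choice from it; so the equality holds whether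
  or not a derivative exists.\<close>

lemma dird_cong_open:
  assumes "open S" "x \<in> S" "\<And>y. y \<in> S \<Longrightarrow> f y = g y"
  shows "dird v f x = dird v g x"
proof -
  have "(f has_derivative D) (at x) \<longleftrightarrow> (g has_derivative D) (at x)" for D
    using has_derivative_transform_within_open[of f D x UNIV S g]
      has_derivative_transform_within_open[of g D x UNIV S f] assms by auto
  then show ?thesis
    by (simp add: dird_def frechet_derivative_def)
qed

lemma differentiable_cong_open:
  assumes "open S" "x \<in> S" "\<And>y. y \<in> S \<Longrightarrow> f y = g y" "f differentiable (at x)"
  shows "g differentiable (at x)"
  using has_derivative_transform_within_open[of f _ x UNIV S g] assms
  unfolding differentiable_def by auto

lemma ndiff_cong:
  assumes "open S" "\<And>y. y \<in> S \<Longrightarrow> f y = g y" "ndiff n S f"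
  shows "ndiff n S g"
  using assms(2,3)
proof (induction n arbitrary: f g)
  case (Suc n)
  have "ndiff n S (dird v g)" for v
    using Suc.IH[of "dird v f" "dird v g"] Suc.prems dird_cong_open[OF assms(1), of _ f g v] by auto
  then show ?case
    using Suc.prems differentiable_cong_open[OF assms(1), of _ f g] by auto
qed simp

lemma smooth_on_cong:
  assumes "open S" "\<And>y. y \<in> S \<Longrightarrow> f y = g y" "smooth_on S f"
  shows "smooth_on S g"
  using assms ndiff_cong[OF assms(1,2)] by (simp add: smooth_on_ndiff)

lemma smooth_on_subset: "smooth_on S f \<Longrightarrow> T \<subseteq> S \<Longrightarrow> smooth_on T f"
  by (auto simp: smooth_on_def)

lemma smooth_on_Un: "smooth_on S f \<Longrightarrow> smooth_on T f \<Longrightarrow> smooth_on (S \<union> T) f"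
  by (auto simp: smooth_on_def)

lemma dird_eq: "(f has_derivative D) (at x) \<Longrightarrow> dird v f x = D v"
  unfolding dird_def by (metis frechet_derivative_at)

lemma has_derivative_dird:
  "f differentiable (at x) \<Longrightarrow> (f has_derivative (\<lambda>v. dird v f x)) (at x)"
  unfolding dird_def by (simp add: frechet_derivative_works)

lemma smooth_onD_diff: "smooth_on S f \<Longrightarrow> x \<in> S \<Longrightarrow> f differentiable (at x)"
  using smooth_on_iff by blast

lemma smooth_on_dird: "smooth_on S f \<Longrightarrow> smooth_on S (dird v f)"
  using smooth_on_iff by blast

lemma smooth_on_imp_continuous_on: "smooth_on S f \<Longrightarrow> continuous_on S f"
  by (meson continuous_at_imp_continuous_on differentiable_imp_continuous_within smooth_onD_diff)

lemma dird_linear: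
  assumes "f differentiable (at x)"
  shows "linear (\<lambda>v. dird v f x)"
  using has_derivative_dird[OF assms] has_derivative_linear by blast

lemma dird_scaleR: "f differentiable (at x) \<Longrightarrow> dird (a *\<^sub>R v) f x = a *\<^sub>R dird v f x"
  using linear_scale[OF dird_linear] by blast

lemma dird_line:
  assumes "f differentiable (at (x + r *\<^sub>R v))"
  shows "((\<lambda>s. f (x + s *\<^sub>R v)) has_vector_derivative dird v f (x + r *\<^sub>R v)) (at r)"
proof -
  have "((\<lambda>s. x + s *\<^sub>R v) has_vector_derivative v) (at r)"
    by (auto intro!: derivative_eq_intros)
  note chain = vector_derivative_diff_chain_within[OF this, of f "\<lambda>w. dird w f (x + r *\<^sub>R v)"]
  from chain[OF has_derivative_at_withinI[OF has_derivative_dird[OF assms]]]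
  show ?thesis by (simp add: o_def)
qed

lemma dird_eq_line:
  assumes "f differentiable (at x)" "((\<lambda>s. f (x + s *\<^sub>R v)) has_vector_derivative d) (at 0)"
  shows "dird v f x = d"
  using dird_line[of f x 0 v] assms vector_derivative_unique_at by fastforce

text \<open>The induction never leaves \<open>F\<close>, because each derivative agrees on S with
  another member. Concrete smoothness proofs (\<open>sqrt\<close>, \<open>cis\<close>,
  \<open>flat_fun\<close>) then only need a family closed under derivatives.\<close>

lemma ndiff_family:
  assumes S: "open S" and f: "f \<in> F"
    and F: "\<And>f x. f \<in> F \<Longrightarrow> x \<in> S \<Longrightarrow> f differentiable (at x)"
    and D: "\<And>f v. f \<in> F \<Longrightarrow> \<exists>g\<in>F. \<forall>x\<in>S. dird v f x = g x"
  shows "ndiff n S f"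
  using f
proof (induction n arbitrary: f)
  case (Suc n)
  have "ndiff n S (dird v f)" for v
  proof -
    obtain g where "g \<in> F" "\<forall>x\<in>S. dird v f x = g x" using D[OF Suc.prems] by blast
    then show ?thesis using ndiff_cong[OF S, of g "dird v f"] Suc.IH by auto
  qed
  then show ?case using F Suc.prems by auto
qed simp

lemma smooth_on_family:
  assumes "open S" "f \<in> F"
    and "\<And>f x. f \<in> F \<Longrightarrow> x \<in> S \<Longrightarrow> f differentiable (at x)"
    and "\<And>f v. f \<in> F \<Longrightarrow> \<exists>g\<in>F. \<forall>x\<in>S. dird v f x = g x"
  shows "smooth_on S f"
  unfolding smooth_on_ndiff using ndiff_family[of S f F] assms by blast

lemma smooth_on_const [simp]: "smooth_on S (\<lambda>x. c)"
proof -
  have "smooth_on UNIV (\<lambda>x::'a. c)"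
    by (rule smooth_on_family[where F = "range (\<lambda>c x. c)"]) (auto simp: dird_eq[OF has_derivative_const])
  then show ?thesis by (rule smooth_on_subset) simp
qed

text \<open>Sums come along with products because the derivative of h(f, g) is a sum of two such
  terms. In each term one factor stays underived, whence the use of
  \<open>ndiff_Suc_D\<close>.\<close>

lemma ndiff_bilinear:
  fixes h :: "'b::real_normed_vector \<Rightarrow> 'c::real_normed_vector \<Rightarrow> 'd::real_normed_vector"
  assumes S: "open S" and h: "bounded_bilinear h"
  shows "ndiff n S f \<Longrightarrow> ndiff n S g \<Longrightarrow> ndiff n S (\<lambda>x. h (f x) (g x))"
    and "ndiff n S k \<Longrightarrow> ndiff n S l \<Longrightarrow> ndiff n S (\<lambda>x. k x + l x :: 'd)"
proof -
  have add: "ndiff n S k \<Longrightarrow> ndiff n S l \<Longrightarrow> ndiff n S (\<lambda>x. k x + l x)" for n and k l :: "'a \<Rightarrow> 'd"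
  proof (induction n arbitrary: k l)
    case (Suc n)
    have D: "((\<lambda>x. k x + l x) has_derivative (\<lambda>v. dird v k x + dird v l x)) (at x)" if "x \<in> S" for x
      using Suc.prems that by (intro has_derivative_add has_derivative_dird) auto
    have "ndiff n S (dird v (\<lambda>x. k x + l x))" for v
      by (rule ndiff_cong[OF S, of "\<lambda>x. dird v k x + dird v l x"])
        (use Suc in \<open>auto simp: dird_eq[OF D]\<close>)
    then show ?case using D by (auto simp: differentiable_def)
  qed simp
  have bil: "ndiff n S f \<Longrightarrow> ndiff n S g \<Longrightarrow> ndiff n S (\<lambda>x. h (f x) (g x))" for n and f g
  proof (induction n arbitrary: f g)
    case (Suc n)
    have D: "((\<lambda>x. h (f x) (g x)) has_derivative (\<lambda>v. h (f x) (dird v g x) + h (dird v f x) (g x))) (at x)"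
      if "x \<in> S" for x
      using Suc.prems that by (intro bounded_bilinear.FDERIV[OF h] has_derivative_dird) auto
    have "ndiff n S (dird v (\<lambda>x. h (f x) (g x)))" for v
    proof (rule ndiff_cong[OF S, of "\<lambda>x. h (f x) (dird v g x) + h (dird v f x) (g x)"])
      show "ndiff n S (\<lambda>x. h (f x) (dird v g x) + h (dird v f x) (g x))"
        using Suc.prems by (intro add Suc.IH Suc.prems[THEN ndiff_Suc_D]) auto
    qed (auto simp: dird_eq[OF D])
    then show ?case using D by (auto simp: differentiable_def)
  qed simp
  show "ndiff n S f \<Longrightarrow> ndiff n S g \<Longrightarrow> ndiff n S (\<lambda>x. h (f x) (g x))" by (rule bil)
  show "ndiff n S k \<Longrightarrow> ndiff n S l \<Longrightarrow> ndiff n S (\<lambda>x. k x + l x)" by (rule add)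
qed

lemma smooth_on_bilinear:
  assumes "open S" "bounded_bilinear h" "smooth_on S f" "smooth_on S g"
  shows "smooth_on S (\<lambda>x. h (f x) (g x))"
  using assms ndiff_bilinear(1)[OF assms(1,2)] unfolding smooth_on_ndiff by blast

lemma smooth_on_add:
  fixes f g :: "_ \<Rightarrow> 'd::real_normed_vector"
  assumes "open S" "smooth_on S f" "smooth_on S g"
  shows "smooth_on S (\<lambda>x. f x + g x)"
  using assms ndiff_bilinear(2)[OF assms(1) bounded_bilinear_scaleR] unfolding smooth_on_ndiff by blast

lemma smooth_on_sum:
  assumes "open S" "\<And>i. i \<in> I \<Longrightarrow> smooth_on S (f i)"
  shows "smooth_on S (\<lambda>x. \<Sum>i\<in>I. f i x)"
  using assms(2) by (induction I rule: infinite_finite_induct) (auto intro!: smooth_on_add assms(1))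

lemma smooth_on_bounded_linear:
  assumes "open S" "bounded_linear L" "smooth_on S f"
  shows "smooth_on S (\<lambda>x. L (f x))"
proof (rule smooth_on_family[where F = "{\<lambda>x. L (g x) |g. smooth_on S g}"])
  fix f x assume f: "f \<in> {\<lambda>x. L (g x) |g. smooth_on S g}"
  then obtain g where g: "f = (\<lambda>x. L (g x))" "smooth_on S g" by blast
  have D: "(f has_derivative (\<lambda>v. L (dird v g x))) (at x)" if "x \<in> S" for x
    unfolding g(1) using smooth_onD_diff[OF g(2) that]
    by (intro bounded_linear.has_derivative[OF assms(2)] has_derivative_dird)
  show "x \<in> S \<Longrightarrow> f differentiable (at x)" using D by (auto simp: differentiable_def)
  show "\<exists>g\<in>{\<lambda>x. L (g x) |g. smooth_on S g}. \<forall>x\<in>S. dird v f x = g x" for v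
    by (rule bexI[of _ "\<lambda>x. L (dird v g x)"]) (use smooth_on_dird[OF g(2), of v] dird_eq[OF D] in auto)
qed (use assms in auto)

lemma smooth_on_linear [simp]: "bounded_linear L \<Longrightarrow> smooth_on S L"
proof -
  assume L: "bounded_linear L"
  have D: "dird v L x = L v" for v x
    using dird_eq[OF bounded_linear_imp_has_derivative[OF L]] .
  have "(\<forall>x\<in>S. L differentiable at x)"
    using bounded_linear_imp_has_derivative[OF L] by (auto simp: differentiable_def)
  moreover have "dird v L = (\<lambda>x. L v)" for v using D by blast
  ultimately show ?thesis using smooth_on_iff[of S L] by auto
qed

lemma smooth_on_id [simp]: "smooth_on S (\<lambda>x. x)"
  by (rule smooth_on_linear) (rule bounded_linear_ident)

lemma smooth_on_minus: "open S \<Longrightarrow> smooth_on S f \<Longrightarrow> smooth_on S (\<lambda>x. - f x)"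
  by (rule smooth_on_bounded_linear[OF _ bounded_linear_minus[OF bounded_linear_ident]])

lemma smooth_on_diff: "open S \<Longrightarrow> smooth_on S f \<Longrightarrow> smooth_on S g \<Longrightarrow> smooth_on S (\<lambda>x. f x - g x)"
  using smooth_on_add[of S f "\<lambda>x. - g x"] smooth_on_minus[of S g] by simp

lemma smooth_on_scaleR:
  "open S \<Longrightarrow> smooth_on S f \<Longrightarrow> smooth_on S g \<Longrightarrow> smooth_on S (\<lambda>x. f x *\<^sub>R g x)"
  by (rule smooth_on_bilinear[OF _ bounded_bilinear_scaleR])

lemma smooth_on_mult:
  fixes f g :: "_ \<Rightarrow> 'd::real_normed_algebra"
  shows "open S \<Longrightarrow> smooth_on S f \<Longrightarrow> smooth_on S g \<Longrightarrow> smooth_on S (\<lambda>x. f x * g x)"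
  by (rule smooth_on_bilinear[OF _ bounded_bilinear_mult])

lemma smooth_on_prod:
  fixes f :: "_ \<Rightarrow> _ \<Rightarrow> 'd::real_normed_field"
  assumes "open S" "\<And>i. i \<in> I \<Longrightarrow> smooth_on S (f i)"
  shows "smooth_on S (\<lambda>x. \<Prod>i\<in>I. f i x)"
  using assms(2) by (induction I rule: infinite_finite_induct) (auto intro!: smooth_on_mult assms(1))

lemma frechet_euclidean:
  fixes f :: "'b::euclidean_space \<Rightarrow> 'c::real_normed_vector"
  assumes "f differentiable (at y)"
  shows "dird w f y = (\<Sum>b\<in>Basis. (w \<bullet> b) *\<^sub>R dird b f y)"
proof -
  have "dird w f y = dird (\<Sum>b\<in>Basis. (w \<bullet> b) *\<^sub>R b) f y" by (simp add: euclidean_representation)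
  also have "\<dots> = (\<Sum>b\<in>Basis. (w \<bullet> b) *\<^sub>R dird b f y)"
    using linear_sum[OF dird_linear[OF assms], of "\<lambda>b. (w \<bullet> b) *\<^sub>R b" Basis]
    by (simp add: dird_scaleR[OF assms])
  finally show ?thesis .
qed

text \<open>Only \<open>f\<close> varies in the induction: expanding the chain rule in the basis
  writes the derivative as a sum of smooth coefficients built from \<open>g\<close> times
  \<open>dird b f\<close> composed with \<open>g\<close>, and \<open>dird b f\<close> is again
  smooth on T.\<close>

lemma smooth_on_compose:
  fixes f :: "'b::euclidean_space \<Rightarrow> 'c::real_normed_vector" and g :: "'a::real_normed_vector \<Rightarrow> 'b"
  assumes S: "open S" and f: "smooth_on T f" and g: "smooth_on S g" and gT: "g ` S \<subseteq> T"
  shows "smooth_on S (\<lambda>x. f (g x))"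
proof -
  have "ndiff n S (\<lambda>x. f (g x))" if "smooth_on T f" for n f
    using that
  proof (induction n arbitrary: f)
    case (Suc n)
    have D: "((\<lambda>x. f (g x)) has_derivative (\<lambda>v. dird (dird v g x) f (g x))) (at x)" if "x \<in> S" for x
    proof -
      have "g x \<in> T" using that gT by blast
      then have "(f has_derivative (\<lambda>v. dird v f (g x))) (at (g x))"
        by (intro has_derivative_dird smooth_onD_diff[OF Suc.prems])
      from has_derivative_compose[OF has_derivative_dird[OF smooth_onD_diff[OF g that]] this]
      show ?thesis .
    qed
    have "ndiff n S (dird v (\<lambda>x. f (g x)))" for v
    proof (rule ndiff_cong[OF S, of "\<lambda>x. \<Sum>b\<in>Basis. (dird v g x \<bullet> b) *\<^sub>R dird b f (g x)"])
      have i: "ndiff n S (\<lambda>x. (dird v g x \<bullet> b) *\<^sub>R dird b f (g x))" for b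
      proof (rule ndiff_bilinear(1)[OF S bounded_bilinear_scaleR])
        show "ndiff n S (\<lambda>x. dird v g x \<bullet> b)"
          using smooth_on_bounded_linear[OF S bounded_linear_inner_left smooth_on_dird[OF g]]
          by (auto simp: smooth_on_ndiff)
        show "ndiff n S (\<lambda>x. dird b f (g x))"
          by (rule Suc.IH[OF smooth_on_dird[OF Suc.prems]])
      qed
      have "ndiff n S (\<lambda>x. \<Sum>b\<in>B. (dird v g x \<bullet> b) *\<^sub>R dird b f (g x))" for B
        using i by (induction B rule: infinite_finite_induct)
          (auto intro!: ndiff_bilinear(2)[OF S bounded_bilinear_scaleR]
             simp: spec[OF smooth_on_const[unfolded smooth_on_ndiff]])
      then show "ndiff n S (\<lambda>x. \<Sum>b\<in>Basis. (dird v g x \<bullet> b) *\<^sub>R dird b f (g x))" .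
    next
      fix x assume x: "x \<in> S"
      then have "f differentiable (at (g x))" using smooth_onD_diff[OF Suc.prems] gT by blast
      from frechet_euclidean[OF this, of "dird v g x"] dird_eq[OF D[OF x], of v]
      show "(\<Sum>b\<in>Basis. (dird v g x \<bullet> b) *\<^sub>R dird b f (g x)) = dird v (\<lambda>x. f (g x)) x" by simp
    qed
    then show ?case using D by (auto simp: differentiable_def)
  qed simp
  with f show ?thesis unfolding smooth_on_ndiff[of S] by blast
qed

lemma smooth_on_Pair:
  assumes S: "open S" and "smooth_on S f" "smooth_on S g"
  shows "smooth_on S (\<lambda>x. (f x, g x))"
proof -
  have "smooth_on S (\<lambda>x. (f x, 0) + (0, g x))"
    using assms
    by (intro smooth_on_add[OF S] smooth_on_bounded_linear[OF S, of "\<lambda>y. (y, 0)" f]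
        smooth_on_bounded_linear[OF S, of "\<lambda>y. (0, y)" g])
      (auto intro!: bounded_linear_intros)
  then show ?thesis by simp
qed

lemma smooth_on_nth:
  assumes "open S" "smooth_on S f"
  shows "smooth_on S (\<lambda>x. f x $ i)"
  using smooth_on_bounded_linear[OF assms(1) bounded_linear_vec_nth assms(2)] .

text \<open>The functions c sqrt(x) x^(-k) form a family closed under derivatives, each derivative
  raising k by one.\<close>

lemma smooth_on_sqrt: "smooth_on {0<..} sqrt"
proof (rule smooth_on_family[where F = "{\<lambda>x. c * sqrt x * inverse x ^ k |c k. True}"])
  fix f :: "real \<Rightarrow> real" assume "f \<in> {\<lambda>x. c * sqrt x * inverse x ^ k |c k. True}"
  then obtain c k where f: "f = (\<lambda>x. c * sqrt x * inverse x ^ k)" by blast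
  have R: "(f has_real_derivative (c * (1/2 - real k) * sqrt x * inverse x ^ (k + 1))) (at x)"
    if "x \<in> {0<..}" for x
  proof -
    have x: "x > 0" using that by simp
    have e: "inverse (sqrt x) = sqrt x * inverse x"
      using x by (simp add: field_simps)
    \<comment> \<open>At k = 0 the truncated exponent k - 1 is harmless, as the factor
      \<open>real k\<close> vanishes.\<close>
    have k: "real k * inverse x ^ (k - 1) * inverse x = real k * inverse x ^ k"
      by (cases k) simp_all
    have "((\<lambda>x. (c * sqrt x) * inverse x ^ k) has_real_derivative
        (c * (inverse (sqrt x) / 2)) * inverse x ^ k
        + (real k * (- (inverse x ^ Suc (Suc 0)) * inverse x ^ (k - Suc 0))) * (c * sqrt x)) (at x)"
      using x by (intro DERIV_mult DERIV_cmult DERIV_power DERIV_inverse DERIV_real_sqrt) simp_all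
    also have "(c * (inverse (sqrt x) / 2)) * inverse x ^ k
        + (real k * (- (inverse x ^ Suc (Suc 0)) * inverse x ^ (k - Suc 0))) * (c * sqrt x)
        = c * sqrt x * inverse x ^ (k + 1) / 2 - (real k * inverse x ^ (k - 1) * inverse x) * inverse x * c * sqrt x"
      unfolding e by (simp add: algebra_simps)
    also have "\<dots> = c * (1/2 - real k) * sqrt x * inverse x ^ (k + 1)"
      unfolding k by (simp add: algebra_simps)
    finally show ?thesis unfolding f .
  qed
  have D: "(f has_derivative (\<lambda>v. v * (c * (1/2 - real k) * sqrt x * inverse x ^ (k + 1)))) (at x)"
    if "x \<in> {0<..}" for x
    using R[OF that] by (simp only: has_field_derivative_def mult_commute_abs)
  show "x \<in> {0<..} \<Longrightarrow> f differentiable (at x)" for x using D by (auto simp only: differentiable_def)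
  show "\<exists>g\<in>{\<lambda>x. c * sqrt x * inverse x ^ k |c k. True}. \<forall>x\<in>{0<..}. dird v f x = g x" for v
  proof (rule bexI[of _ "\<lambda>x. (v * (c * (1/2 - real k))) * sqrt x * inverse x ^ (k + 1)"])
    show "\<forall>x\<in>{0<..}. dird v f x = (v * (c * (1/2 - real k))) * sqrt x * inverse x ^ (k + 1)"
      using dird_eq[OF D] by (simp only: mult.assoc) blast
  qed blast
next
  have "sqrt = (\<lambda>x. 1 * sqrt x * inverse x ^ 0)" by simp
  then show "sqrt \<in> {\<lambda>x. c * sqrt x * inverse x ^ k |c k. True}" by blast
qed simp

lemma smooth_on_cis:
  fixes c :: "'a::euclidean_space"
  shows "smooth_on S (\<lambda>y. cis (y \<bullet> c))"
proof -
  have "smooth_on UNIV (\<lambda>y. cis (y \<bullet> c))"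
  proof (rule smooth_on_family[where F = "{\<lambda>y. a * cis (y \<bullet> c) |a. True}"])
    fix f :: "'a \<Rightarrow> complex" assume "f \<in> {\<lambda>y. a * cis (y \<bullet> c) |a. True}"
    then obtain a where f: "f = (\<lambda>y. a * cis (y \<bullet> c))" by blast
    have D: "(f has_derivative (\<lambda>v. (a * (\<i> * of_real (v \<bullet> c))) * cis (x \<bullet> c))) (at x)" for x
    proof -
      have "((\<lambda>y. y \<bullet> c) has_derivative (\<lambda>v. v \<bullet> c)) (at x)"
        by (rule bounded_linear_imp_has_derivative[OF bounded_linear_inner_left])
      then have "((\<lambda>y. cis (y \<bullet> c)) has_derivative (\<lambda>v. (v \<bullet> c) *\<^sub>R (\<i> * cis (x \<bullet> c)))) (at x)"
        by (rule has_derivative_cis)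
      from has_derivative_mult_right[OF this, of a] show ?thesis unfolding f
        by (simp add: scaleR_conv_of_real algebra_simps)
    qed
    show "f differentiable (at x)" for x using D by (auto simp only: differentiable_def)
    show "\<exists>g\<in>{\<lambda>y. a * cis (y \<bullet> c) |a. True}. \<forall>x\<in>UNIV. dird v f x = g x" for v
      using dird_eq[OF D] by blast
  next
    have "(\<lambda>y. cis (y \<bullet> c)) = (\<lambda>y. 1 * cis (y \<bullet> c))" by simp
    then show "(\<lambda>y. cis (y \<bullet> c)) \<in> {\<lambda>y. a * cis (y \<bullet> c) |a. True}" by blast
  qed simp
  then show ?thesis by (rule smooth_on_subset) simp
qed

section \<open>Bump functions and oscillatory integrals\<close>

text \<open>The standard flat function exp(-1/x), with a polynomial in 1/x as prefactor so that the
  family is closed under differentiation.\<close>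

definition flat_fun :: "real poly \<Rightarrow> real \<Rightarrow> real" where
  "flat_fun p x = (if x > 0 then poly p (inverse x) * exp (- inverse x) else 0)"

lemma poly_exp_tendsto_0: "((\<lambda>u. poly p u * exp (- u)) \<longlongrightarrow> 0) (at_top :: real filter)"
proof -
  have "((\<lambda>u. \<Sum>i\<le>degree p. coeff p i * (u ^ i / exp u)) \<longlongrightarrow> 0) (at_top :: real filter)"
    by (intro tendsto_null_sum tendsto_mult_right_zero tendsto_power_div_exp_0)
  then show ?thesis
    by (simp add: poly_altdef sum_distrib_right sum_divide_distrib exp_minus divide_inverse mult.assoc)
qed

text \<open>With u = 1/x the derivative of p(u) exp(-u) is u^2 (p - p')(u) exp(-u), and
  \<open>[:0,0,1:]\<close> is the polynomial u^2. At 0 the right difference quotient is u p(u)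
  exp(-u), with \<open>pCons 0 p\<close> for u p(u), and tends to 0 as u grows.\<close>

lemma flat_fun_DERIV:
  "(flat_fun p has_real_derivative flat_fun ([:0,0,1:] * (p - pderiv p)) x) (at x)"
proof -
  consider "x > 0" | "x < 0" | "x = 0" by linarith
  then show ?thesis
  proof cases
    case 1
    have "((\<lambda>x. poly p (inverse x)) has_real_derivative
        poly (pderiv p) (inverse x) * - (inverse x ^ Suc (Suc 0))) (at x)"
      using 1 by (intro DERIV_chain2[OF poly_DERIV] DERIV_inverse) simp
    moreover have "((\<lambda>x. exp (- inverse x)) has_real_derivative
        exp (- inverse x) * - (- (inverse x ^ Suc (Suc 0)))) (at x)"
      using 1 by (intro DERIV_chain2[OF DERIV_exp] DERIV_minus DERIV_inverse) simp
    ultimately have "((\<lambda>x. poly p (inverse x) * exp (- inverse x)) has_real_derivative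
        flat_fun ([:0,0,1:] * (p - pderiv p)) x) (at x)"
      using 1 by (intro DERIV_cong[OF DERIV_mult]) (auto simp: flat_fun_def algebra_simps)
    then show ?thesis
      by (rule has_field_derivative_transform_within_open[of _ _ _ "{0<..}"])
        (use 1 in \<open>auto simp: flat_fun_def\<close>)
  next
    case 2
    have "((\<lambda>x. 0) has_real_derivative flat_fun ([:0,0,1:] * (p - pderiv p)) x) (at x)"
      using 2 by (simp add: flat_fun_def)
    then show ?thesis
      by (rule has_field_derivative_transform_within_open[of _ _ _ "{..<0}"])
        (use 2 in \<open>auto simp: flat_fun_def\<close>)
  next
    case 3
    have "((\<lambda>h. flat_fun p h / h) \<longlongrightarrow> 0) (at_right 0)"
    proof (rule Lim_transform_eventually)
      show "((\<lambda>h. poly (pCons 0 p) (inverse h) * exp (- inverse h)) \<longlongrightarrow> 0) (at_right (0::real))"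
        by (rule filterlim_compose[OF poly_exp_tendsto_0 filterlim_inverse_at_top_right])
      show "\<forall>\<^sub>F h in at_right (0::real). poly (pCons 0 p) (inverse h) * exp (- inverse h) = flat_fun p h / h"
        by (auto simp: eventually_at_filter flat_fun_def field_simps)
    qed
    moreover have "((\<lambda>h. flat_fun p h / h) \<longlongrightarrow> 0) (at_left 0)"
      by (rule Lim_transform_eventually[OF tendsto_const])
        (auto simp: eventually_at_filter flat_fun_def)
    ultimately have "((\<lambda>h. flat_fun p h / h) \<longlongrightarrow> 0) (at 0)"
      by (simp add: filterlim_split_at)
    then show ?thesis
      using 3 by (simp add: DERIV_def flat_fun_def)
  qed
qed

lemma smooth_on_flat_fun: "smooth_on UNIV (flat_fun p)"
proof (rule smooth_on_family[where F = "range flat_fun"])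
  fix f assume "f \<in> range flat_fun"
  then obtain p where p: "f = flat_fun p" by blast
  let ?p = "[:0,0,1:] * (p - pderiv p)"
  have D: "(f has_derivative (\<lambda>v. v * flat_fun ?p x)) (at x)" for x
    using flat_fun_DERIV[of p x] unfolding p by (simp only: has_field_derivative_def mult_commute_abs)
  show "f differentiable (at x)" for x using D by (auto simp only: differentiable_def)
  have "v * flat_fun ?p x = flat_fun (smult v ?p) x" for v x
    by (simp add: flat_fun_def)
  then show "\<exists>g\<in>range flat_fun. \<forall>x\<in>UNIV. dird v f x = g x" for v
    by (intro bexI[of _ "flat_fun (smult v ?p)"]) (auto simp: dird_eq[OF D])
qed auto

text \<open>Not normalised: apart from smoothness and support only the value at 0 enters, and only
  through being nonzero.\<close>

definition bump :: "real \<Rightarrow> real \<Rightarrow> real" where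
  "bump \<delta> y = flat_fun 1 (\<delta>\<^sup>2 - y\<^sup>2)"

lemma smooth_on_bump: "smooth_on UNIV (bump \<delta>)"
proof -
  have "smooth_on UNIV (\<lambda>y::real. \<delta>\<^sup>2 - y * y)"
    by (intro smooth_on_diff smooth_on_mult) auto
  from smooth_on_compose[OF _ smooth_on_flat_fun this, of 1] show ?thesis
    by (simp add: bump_def[abs_def] power2_eq_square)
qed

lemma bump_eq_0: "\<delta> > 0 \<Longrightarrow> \<bar>y\<bar> \<ge> \<delta> \<Longrightarrow> bump \<delta> y = 0"
  using abs_le_square_iff[of \<delta> y] by (simp add: bump_def flat_fun_def)

lemma bump_0: "\<delta> > 0 \<Longrightarrow> bump \<delta> 0 > 0"
  by (simp add: bump_def flat_fun_def)

section \<open>Differentiation under the integral sign and integration by parts\<close>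

lemma has_vector_derivative_at_lim:
  "(f has_vector_derivative d) (at (0::real)) \<longleftrightarrow> ((\<lambda>r. (1 / r) *\<^sub>R (f r - f 0)) \<longlongrightarrow> d) (at 0)"
proof -
  have b: "bounded_linear (\<lambda>h::real. h *\<^sub>R d)" by (rule bounded_linear_scaleR_left)
  have "norm ((f y - f 0) - (y - 0) *\<^sub>R d) / norm (y - 0) = norm ((1 / y) *\<^sub>R (f y - f 0) - d)"
    if "y \<noteq> 0" for y :: real
  proof -
    have "(1 / y) *\<^sub>R (f y - f 0) - d = (1 / y) *\<^sub>R ((f y - f 0) - y *\<^sub>R d)"
      using that by (simp add: scaleR_right_diff_distrib)
    then show ?thesis using that by simp
  qed
  then have "(f has_vector_derivative d) (at 0) \<longleftrightarrow> ((\<lambda>y. norm ((1 / y) *\<^sub>R (f y - f 0) - d)) \<longlongrightarrow> 0) (at 0)"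
    unfolding has_vector_derivative_def has_derivative_iff_norm using b
    by (auto intro!: tendsto_cong simp: eventually_at_filter)
  then show ?thesis by (simp add: tendsto_norm_zero_iff LIM_zero_iff)
qed

text \<open>The mean value inequality turns the bound G on the derivatives into a bound on all
  difference quotients, which is the domination needed. The limit is taken along sequences because
  dominated convergence is sequential.\<close>

lemma has_vector_derivative_integral:
  fixes F :: "real \<Rightarrow> 'a \<Rightarrow> 'b::{banach, second_countable_topology}"
  assumes \<delta>: "\<delta> > 0"
    and D: "\<And>r \<xi>. \<bar>r\<bar> < \<delta> \<Longrightarrow> \<xi> \<in> space M \<Longrightarrow> ((\<lambda>s. F s \<xi>) has_vector_derivative F' r \<xi>) (at r)"
    and I: "\<And>r. \<bar>r\<bar> < \<delta> \<Longrightarrow> integrable M (F r)"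
    and m: "F' 0 \<in> borel_measurable M"
    and B: "\<And>r \<xi>. \<bar>r\<bar> < \<delta> \<Longrightarrow> \<xi> \<in> space M \<Longrightarrow> norm (F' r \<xi>) \<le> G \<xi>"
    and G: "integrable M G"
  shows "((\<lambda>r. integral\<^sup>L M (F r)) has_vector_derivative integral\<^sup>L M (F' 0)) (at 0)"
proof -
  have lip: "norm (F r \<xi> - F 0 \<xi>) \<le> G \<xi> * \<bar>r\<bar>" if r: "\<bar>r\<bar> < \<delta>" and \<xi>: "\<xi> \<in> space M" for r \<xi>
  proof -
    have "norm (F r \<xi> - F 0 \<xi>) \<le> G \<xi> * norm (r - 0)"
    proof (rule differentiable_bound[of "{-\<delta><..<\<delta>}" "\<lambda>s. F s \<xi>" "\<lambda>s h. h *\<^sub>R F' s \<xi>"])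
      fix s assume s: "s \<in> {-\<delta><..<\<delta>}"
      then show "((\<lambda>s. F s \<xi>) has_derivative (\<lambda>h. h *\<^sub>R F' s \<xi>)) (at s within {-\<delta><..<\<delta>})"
        using D[of s \<xi>] \<xi> unfolding has_vector_derivative_def
        by (auto intro: has_derivative_at_withinI)
      show "onorm (\<lambda>h. h *\<^sub>R F' s \<xi>) \<le> G \<xi>"
      proof (rule onorm_bound)
        have "norm (F' s \<xi>) \<le> G \<xi>" using B[of s \<xi>] s \<xi> by auto
        then show "0 \<le> G \<xi>" using norm_ge_zero order_trans by blast
        show "norm (h *\<^sub>R F' s \<xi>) \<le> G \<xi> * norm h" for h
          using mult_right_mono[OF \<open>norm (F' s \<xi>) \<le> G \<xi>\<close>, of "\<bar>h\<bar>"] by (simp add: mult.commute)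
      qed
    qed (use r \<delta> in auto)
    then show ?thesis by simp
  qed
  have "((\<lambda>r. (1 / r) *\<^sub>R (integral\<^sup>L M (F r) - integral\<^sup>L M (F 0))) \<longlongrightarrow> integral\<^sup>L M (F' 0)) (at 0)"
  proof (subst tendsto_at_iff_sequentially, intro allI impI)
    fix X :: "nat \<Rightarrow> real" assume X0: "\<forall>i. X i \<in> UNIV - {0}" and X: "X \<longlonglongrightarrow> 0"
    \<comment> \<open>The sequence may start outside the interval where the bounds hold; its
      finitely many bad terms are replaced by an admissible nonzero value.\<close>
    define Y where "Y n = (if \<bar>X n\<bar> < \<delta> then X n else \<delta> / 2)" for n
    have Y: "Y n \<noteq> 0" "\<bar>Y n\<bar> < \<delta>" for n using X0 \<delta> by (auto simp: Y_def)
    have ev: "\<forall>\<^sub>F n in sequentially. Y n = X n"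
    proof -
      have "\<forall>\<^sub>F n in sequentially. dist (X n) 0 < \<delta>" using X \<delta> by (rule tendstoD)
      then show ?thesis by eventually_elim (simp add: Y_def)
    qed
    have Y0: "Y \<longlonglongrightarrow> 0" by (rule Lim_transform_eventually[OF X]) (use ev in eventually_elim, simp)
    have "(\<lambda>n. integral\<^sup>L M (\<lambda>\<xi>. (1 / Y n) *\<^sub>R (F (Y n) \<xi> - F 0 \<xi>))) \<longlonglongrightarrow> integral\<^sup>L M (F' 0)"
    proof (rule integral_dominated_convergence[of _ _ _ G])
      show "(\<lambda>\<xi>. (1 / Y n) *\<^sub>R (F (Y n) \<xi> - F 0 \<xi>)) \<in> borel_measurable M" for n
        using I[OF Y(2)[of n]] I[of 0] \<delta> by (intro borel_measurable_scaleR borel_measurable_diff) auto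
      show "AE \<xi> in M. (\<lambda>n. (1 / Y n) *\<^sub>R (F (Y n) \<xi> - F 0 \<xi>)) \<longlonglongrightarrow> F' 0 \<xi>"
      proof (rule AE_I2)
        fix \<xi> assume \<xi>: "\<xi> \<in> space M"
        have "((\<lambda>s. F s \<xi>) has_vector_derivative F' 0 \<xi>) (at 0)" using D[of 0 \<xi>] \<xi> \<delta> by simp
        then have "((\<lambda>s. (1 / s) *\<^sub>R (F s \<xi> - F 0 \<xi>)) \<longlongrightarrow> F' 0 \<xi>) (at 0)"
          by (simp add: has_vector_derivative_at_lim)
        then show "(\<lambda>n. (1 / Y n) *\<^sub>R (F (Y n) \<xi> - F 0 \<xi>)) \<longlonglongrightarrow> F' 0 \<xi>"
          using Y Y0 by (auto simp: tendsto_at_iff_sequentially o_def)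
      qed
      show "AE \<xi> in M. norm ((1 / Y n) *\<^sub>R (F (Y n) \<xi> - F 0 \<xi>)) \<le> G \<xi>" for n
      proof (rule AE_I2)
        fix \<xi> assume "\<xi> \<in> space M"
        have "norm ((1 / Y n) *\<^sub>R (F (Y n) \<xi> - F 0 \<xi>)) = norm (F (Y n) \<xi> - F 0 \<xi>) / \<bar>Y n\<bar>"
          by simp
        also have "\<dots> \<le> G \<xi>"
          using lip[OF Y(2)[of n] \<open>\<xi> \<in> space M\<close>] Y(1)[of n] by (simp add: pos_divide_le_eq)
        finally show "norm ((1 / Y n) *\<^sub>R (F (Y n) \<xi> - F 0 \<xi>)) \<le> G \<xi>" .
      qed
    qed (use m G in auto)
    moreover have "integral\<^sup>L M (\<lambda>\<xi>. (1 / Y n) *\<^sub>R (F (Y n) \<xi> - F 0 \<xi>))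
        = (1 / Y n) *\<^sub>R (integral\<^sup>L M (F (Y n)) - integral\<^sup>L M (F 0))" for n
      using I[OF Y(2)[of n]] I[of 0] \<delta> by simp
    ultimately have "(\<lambda>n. (1 / Y n) *\<^sub>R (integral\<^sup>L M (F (Y n)) - integral\<^sup>L M (F 0))) \<longlonglongrightarrow> integral\<^sup>L M (F' 0)"
      by (simp only:)
    then show "((\<lambda>r. (1 / r) *\<^sub>R (integral\<^sup>L M (F r) - integral\<^sup>L M (F 0))) \<circ> X) \<longlonglongrightarrow> integral\<^sup>L M (F' 0)"
      by (rule Lim_transform_eventually) (use ev in eventually_elim, simp add: o_def)
  qed
  then show ?thesis
    by (simp add: has_vector_derivative_at_lim)
qed

lemma integrable_compact_support:
  fixes f :: "'a::euclidean_space \<Rightarrow> 'b::{banach, second_countable_topology}"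
  assumes "compact K" "continuous_on UNIV f" "\<And>y. y \<notin> K \<Longrightarrow> f y = 0"
  shows "integrable lborel f"
proof -
  have "integrable lborel (\<lambda>x. indicator K x *\<^sub>R f x)"
    by (rule borel_integrable_compact) (use assms in \<open>auto intro: continuous_on_subset\<close>)
  moreover have "(\<lambda>x. indicator K x *\<^sub>R f x) = f"
    using assms(3) by (auto simp: indicator_def fun_eq_iff)
  ultimately show ?thesis by simp
qed

lemma integral_lborel_shift:
  fixes f :: "'a::euclidean_space \<Rightarrow> 'b::{banach, second_countable_topology}"
  assumes "f \<in> borel_measurable borel"
  shows "(\<integral>y. f (a + y) \<partial>lborel) = (\<integral>y. f y \<partial>lborel)"
proof -
  have "(\<integral>y. f y \<partial>lborel) = (\<integral>y. f y \<partial>distr lborel borel ((+) a))"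
    by (simp add: lborel_distr_plus)
  also have "\<dots> = (\<integral>y. f (a + y) \<partial>lborel)"
    by (rule integral_distr) (use assms in auto)
  finally show ?thesis by simp
qed

lemma integrable_lborel_shift:
  fixes f :: "'a::euclidean_space \<Rightarrow> 'b::{banach, second_countable_topology}"
  assumes "integrable lborel f"
  shows "integrable lborel (\<lambda>y. f (a + y))"
  using assms integrable_distr_eq[of "(+) a" lborel borel f] by (simp add: lborel_distr_plus)

lemma dird_outside:
  assumes "compact K" "\<And>y. y \<notin> K \<Longrightarrow> f y = 0" "y \<notin> K"
  shows "dird v f y = 0"
proof -
  have "dird v f y = dird v (\<lambda>x. 0) y"
    by (rule dird_cong_open[of "- K"]) (use assms in \<open>auto simp: open_Compl compact_imp_closed\<close>)
  then show ?thesis by (simp add: dird_eq[OF has_derivative_const])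
qed

text \<open>Translation invariance: the integral of F(y + r v) does not depend on r, and its
  derivative at r = 0 is the integral of \<open>dird v F\<close>.\<close>

lemma integral_dird_0:
  fixes F :: "'a::euclidean_space \<Rightarrow> 'b::euclidean_space"
  assumes K: "compact K" "\<And>y. y \<notin> K \<Longrightarrow> F y = 0" and F: "smooth_on UNIV F"
  shows "(\<integral>y. dird v F y \<partial>lborel) = 0"
proof -
  have cF: "continuous_on UNIV F" "continuous_on UNIV (dird v F)"
    using smooth_on_imp_continuous_on F smooth_on_dird by blast+
  then have mF: "F \<in> borel_measurable borel" "dird v F \<in> borel_measurable borel"
    by (auto intro: borel_measurable_continuous_onI)
  obtain R where R: "\<And>y. y \<in> K \<Longrightarrow> norm y \<le> R"
    using compact_imp_bounded[OF K(1)] unfolding bounded_iff by blast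
  have "bounded (dird v F ` K)"
    using cF K by (intro compact_imp_bounded compact_continuous_image) (auto intro: continuous_on_subset)
  then obtain B where B: "\<And>y. y \<in> K \<Longrightarrow> norm (dird v F y) \<le> B"
    unfolding bounded_iff by blast
  \<comment> \<open>This ball contains the supports of all translates with |r| < 1, so a constant on
    it dominates.\<close>
  let ?C = "cball 0 (R + norm v) :: 'a set"
  have "((\<lambda>r. \<integral>y. F (y + r *\<^sub>R v) \<partial>lborel) has_vector_derivative (\<integral>y. dird v F (y + 0 *\<^sub>R v) \<partial>lborel)) (at 0)"
  proof (rule has_vector_derivative_integral[of 1 _ _ _ "\<lambda>y. indicator ?C y *\<^sub>R \<bar>B\<bar>"])
    fix r :: real and y assume r: "\<bar>r\<bar> < 1"
    show "((\<lambda>s. F (y + s *\<^sub>R v)) has_vector_derivative dird v F (y + r *\<^sub>R v)) (at r)"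
      by (rule dird_line[OF smooth_onD_diff[OF F]]) simp
    show "norm (dird v F (y + r *\<^sub>R v)) \<le> indicator ?C y *\<^sub>R \<bar>B\<bar>"
    proof (cases "y + r *\<^sub>R v \<in> K")
      case True
      have "norm y \<le> norm (y + r *\<^sub>R v) + norm (r *\<^sub>R v)" by (metis add_diff_cancel norm_triangle_ineq4)
      also have "norm (r *\<^sub>R v) \<le> norm v" using r by (simp add: mult_left_le_one_le)
      finally have "y \<in> ?C" using R[OF True] by simp
      then show ?thesis using B[OF True] by simp
    qed (simp add: dird_outside[OF K])
  next
    fix r :: real
    have "integrable lborel F" by (rule integrable_compact_support[OF K(1) cF(1) K(2)])
    then show "integrable lborel (\<lambda>y. F (y + r *\<^sub>R v))"
      using integrable_lborel_shift[of F "r *\<^sub>R v"] by (simp add: add.commute)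
  next
    show "integrable lborel (\<lambda>y. indicator ?C y *\<^sub>R \<bar>B\<bar>)"
      by (rule borel_integrable_compact) auto
    show "(\<lambda>y. dird v F (y + 0 *\<^sub>R v)) \<in> borel_measurable lborel" using mF by simp
  qed simp
  moreover have "(\<integral>y. F (y + r *\<^sub>R v) \<partial>lborel) = (\<integral>y. F y \<partial>lborel)" for r
    using integral_lborel_shift[OF mF(1), of "r *\<^sub>R v"] by (simp add: add.commute)
  ultimately have "((\<lambda>r. \<integral>y. F y \<partial>lborel) has_vector_derivative (\<integral>y. dird v F y \<partial>lborel)) (at (0::real))"
    by simp
  then show ?thesis
    using vector_derivative_unique_at[OF has_vector_derivative_const] by metis
qed

text \<open>Integration by parts in the direction \<eta>: differentiating the exponential produces
  the factor i t |\<eta>|^2, so each power of t is paid for by one derivative of \<open>F\<close>,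
  which is again smooth and vanishes off K.\<close>

lemma oscillatory_decay:
  fixes F :: "'a::euclidean_space \<Rightarrow> complex"
  assumes K: "compact K" and \<eta>: "\<eta> \<noteq> 0"
  shows "(\<And>y. y \<notin> K \<Longrightarrow> F y = 0) \<Longrightarrow> smooth_on UNIV F \<Longrightarrow>
    \<exists>C. \<forall>t. \<bar>t\<bar> ^ N * norm (\<integral>y. F y * cis (y \<bullet> (t *\<^sub>R \<eta>)) \<partial>lborel) \<le> C"
proof (induction N arbitrary: F)
  case 0
  have i: "integrable lborel F"
    by (rule integrable_compact_support[OF K smooth_on_imp_continuous_on]) (use 0 in auto)
  have "norm (\<integral>y. F y * cis (y \<bullet> (t *\<^sub>R \<eta>)) \<partial>lborel) \<le> (\<integral>y. norm (F y) \<partial>lborel)" for t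
    using integral_norm_bound[of lborel "\<lambda>y. F y * cis (y \<bullet> (t *\<^sub>R \<eta>))"] by (simp add: norm_mult)
  then show ?case by auto
next
  case (Suc N)
  have sd: "smooth_on UNIV (dird \<eta> F)" using Suc.prems smooth_on_dird by blast
  have zd: "y \<notin> K \<Longrightarrow> dird \<eta> F y = 0" for y using dird_outside[OF K Suc.prems(1)] .
  obtain C where C: "\<And>t. \<bar>t\<bar> ^ N * norm (\<integral>y. dird \<eta> F y * cis (y \<bullet> (t *\<^sub>R \<eta>)) \<partial>lborel) \<le> C"
    using Suc.IH[OF zd sd] by blast
  have "\<bar>t\<bar> ^ Suc N * norm (\<integral>y. F y * cis (y \<bullet> (t *\<^sub>R \<eta>)) \<partial>lborel) \<le> C / (\<eta> \<bullet> \<eta>)" for t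
  proof -
    let ?e = "\<lambda>y. cis (y \<bullet> (t *\<^sub>R \<eta>))"
    have se: "smooth_on UNIV ?e" by (rule smooth_on_cis)
    have D: "dird \<eta> (\<lambda>y. F y * ?e y) y = dird \<eta> F y * ?e y + (\<i> * of_real (t * (\<eta> \<bullet> \<eta>))) * (F y * ?e y)" for y
    proof -
      have "((\<lambda>y. y \<bullet> (t *\<^sub>R \<eta>)) has_derivative (\<lambda>v. v \<bullet> (t *\<^sub>R \<eta>))) (at y)"
        by (rule bounded_linear_imp_has_derivative[OF bounded_linear_inner_left])
      then have "(?e has_derivative (\<lambda>v. (v \<bullet> (t *\<^sub>R \<eta>)) *\<^sub>R (\<i> * ?e y))) (at y)"
        by (rule has_derivative_cis)
      with has_derivative_dird[OF smooth_onD_diff[OF Suc.prems(2)]]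
      have "((\<lambda>y. F y * ?e y) has_derivative
          (\<lambda>v. F y * ((v \<bullet> (t *\<^sub>R \<eta>)) *\<^sub>R (\<i> * ?e y)) + dird v F y * ?e y)) (at y)"
        by (intro has_derivative_mult) auto
      from dird_eq[OF this, of \<eta>] show ?thesis
        by (simp add: scaleR_conv_of_real algebra_simps)
    qed
    have i1: "integrable lborel (\<lambda>y. dird \<eta> F y * ?e y)"
      by (rule integrable_compact_support[OF K])
        (intro smooth_on_imp_continuous_on smooth_on_mult sd se open_UNIV, simp add: zd)
    have i2: "integrable lborel (\<lambda>y. F y * ?e y)"
      by (rule integrable_compact_support[OF K])
        (intro smooth_on_imp_continuous_on smooth_on_mult Suc.prems se open_UNIV, simp add: Suc.prems)
    have "0 = (\<integral>y. dird \<eta> (\<lambda>y. F y * ?e y) y \<partial>lborel)"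
      by (rule integral_dird_0[OF K, symmetric]) (simp add: Suc.prems, intro smooth_on_mult se Suc.prems open_UNIV)
    also have "\<dots> = (\<integral>y. dird \<eta> F y * ?e y \<partial>lborel) + (\<i> * of_real (t * (\<eta> \<bullet> \<eta>))) * (\<integral>y. F y * ?e y \<partial>lborel)"
      unfolding D using i1 i2 by simp
    finally have "(\<i> * of_real (t * (\<eta> \<bullet> \<eta>))) * (\<integral>y. F y * ?e y \<partial>lborel) = - (\<integral>y. dird \<eta> F y * ?e y \<partial>lborel)"
      by (simp add: eq_neg_iff_add_eq_0 add.commute)
    from arg_cong[OF this, of norm]
    have "\<bar>t\<bar> * (\<eta> \<bullet> \<eta>) * norm (\<integral>y. F y * ?e y \<partial>lborel) = norm (\<integral>y. dird \<eta> F y * ?e y \<partial>lborel)"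
      by (simp add: norm_mult abs_mult)
    then have "\<bar>t\<bar> ^ N * (\<bar>t\<bar> * (\<eta> \<bullet> \<eta>) * norm (\<integral>y. F y * ?e y \<partial>lborel)) \<le> C"
      using C[of t] by (simp only:)
    then have "(\<eta> \<bullet> \<eta>) * (\<bar>t\<bar> ^ Suc N * norm (\<integral>y. F y * ?e y \<partial>lborel)) \<le> C"
      by (simp only: power_Suc mult_ac)
    then show ?thesis using \<eta> by (simp add: field_simps)
  qed
  then show ?case by blast
qed

section \<open>Fourier inversion\<close>

lemma
  fixes f :: "'a::euclidean_space \<Rightarrow> real \<Rightarrow> complex"
  assumes "\<And>b. b \<in> Basis \<Longrightarrow> integrable lborel (f b)"
  shows integrable_prod_Basis: "integrable lborel (\<lambda>x. \<Prod>b\<in>Basis. f b (x \<bullet> b))"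
    and integral_prod_Basis: "(\<integral>x. (\<Prod>b\<in>Basis. f b (x \<bullet> b)) \<partial>lborel) = (\<Prod>b\<in>Basis. \<integral>s. f b s \<partial>lborel)"
proof -
  interpret product_sigma_finite "\<lambda>b::'a. lborel :: real measure"
    by standard
  let ?T = "\<lambda>g. (\<Sum>b\<in>Basis. g b *\<^sub>R b) :: 'a"
  have T: "?T \<in> measurable (\<Pi>\<^sub>M b\<in>Basis. lborel) borel" by measurable
  have m: "(\<lambda>x. \<Prod>b\<in>Basis. f b (x \<bullet> b)) \<in> borel_measurable borel"
  proof (intro borel_measurable_prod)
    fix b :: 'a assume "b \<in> Basis"
    then have "f b \<in> borel_measurable borel" using borel_measurable_integrable[OF assms] by simp
    then show "(\<lambda>x. f b (x \<bullet> b)) \<in> borel_measurable borel" by measurable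
  qed
  have e: "(\<Prod>b\<in>Basis. f b (?T g \<bullet> b)) = (\<Prod>b\<in>Basis. f b (g b))" for g
    by (rule prod.cong) (auto simp: inner_sum_left inner_Basis if_distrib cong: if_cong)
  show "integrable lborel (\<lambda>x. \<Prod>b\<in>Basis. f b (x \<bullet> b))"
    unfolding lborel_eq[where 'a='a] integrable_distr_eq[OF T m] e
    by (rule product_integrable_prod) (use assms in auto)
  show "(\<integral>x. (\<Prod>b\<in>Basis. f b (x \<bullet> b)) \<partial>lborel) = (\<Prod>b\<in>Basis. \<integral>s. f b s \<partial>lborel)"
    unfolding lborel_eq[where 'a='a] integral_distr[OF T m] e
    by (rule product_integral_prod) (use assms in auto)
qed

lemma prod_Basis_vec: "(\<Prod>b\<in>(Basis :: (real^'n::finite) set). g b) = (\<Prod>i\<in>UNIV. g (axis i 1))"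
proof -
  have B: "(Basis :: (real^'n) set) = (\<lambda>i. axis i 1) ` UNIV" by (auto simp: Basis_vec_def)
  show ?thesis unfolding B by (subst prod.reindex) (auto simp: inj_on_def axis_eq_axis)
qed

lemma
  fixes f :: "'n::finite \<Rightarrow> real \<Rightarrow> complex"
  assumes "\<And>i. integrable lborel (f i)"
  shows integrable_prod_vec: "integrable lborel (\<lambda>x::real^'n. \<Prod>i\<in>UNIV. f i (x $ i))"
    and integral_prod_vec: "(\<integral>x. (\<Prod>i\<in>UNIV. f i (x $ i)) \<partial>(lborel :: (real^'n) measure)) = (\<Prod>i\<in>UNIV. \<integral>s. f i s \<partial>lborel)"
proof -
  let ?f = "\<lambda>b::real^'n. f (axis_index b)"
  have *: "(\<Prod>b\<in>Basis. ?f b (x \<bullet> b)) = (\<Prod>i\<in>UNIV. f i (x $ i))" for x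
    by (simp add: prod_Basis_vec axis_index_axis inner_axis)
  show "integrable lborel (\<lambda>x::real^'n. \<Prod>i\<in>UNIV. f i (x $ i))"
    using integrable_prod_Basis[of ?f] assms by (simp add: *)
  show "(\<integral>x. (\<Prod>i\<in>UNIV. f i (x $ i)) \<partial>(lborel :: (real^'n) measure)) = (\<Prod>i\<in>UNIV. \<integral>s. f i s \<partial>lborel)"
    using integral_prod_Basis[of ?f] assms by (simp add: * prod_Basis_vec axis_index_axis)
qed

definition fourier1 :: "(real \<Rightarrow> complex) \<Rightarrow> real \<Rightarrow> complex" where
  "fourier1 \<rho> \<xi> = (\<integral>y. \<rho> y * cis (- (y * \<xi>)) \<partial>lborel)"

text \<open>This is the characteristic function of the standard normal distribution, freed of the
  normalising constant of its density.\<close>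

lemma fourier_gaussian:
  "(\<integral>x. of_real (exp (- (x\<^sup>2 / 2))) * cis (t * x) \<partial>lborel) = of_real (sqrt (2 * pi) * exp (- (t\<^sup>2 / 2)))"
proof -
  have "of_real (exp (- (t\<^sup>2) / 2)) = char std_normal_distribution t"
    by (simp add: char_std_normal_distribution)
  also have "\<dots> = (\<integral>x. std_normal_density x *\<^sub>R iexp (t * x) \<partial>lborel)"
    unfolding char_def by (subst integral_density) (auto simp: normal_density_nonneg)
  also have "\<dots> = (\<integral>x. of_real (1 / sqrt (2 * pi)) * (of_real (exp (- (x\<^sup>2 / 2))) * cis (t * x)) \<partial>lborel)"
    by (rule Bochner_Integration.integral_cong)
      (auto simp: normal_density_def scaleR_conv_of_real cis_conv_exp algebra_simps)
  also have "\<dots> = of_real (1 / sqrt (2 * pi)) * (\<integral>x. of_real (exp (- (x\<^sup>2 / 2))) * cis (t * x) \<partial>lborel)"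
    by simp
  finally show ?thesis
    by (simp add: field_simps)
qed

lemma integrable_gaussian:
  assumes "e > (0::real)"
  shows "integrable lborel (\<lambda>x. exp (- ((e * x)\<^sup>2 / 2)))"
proof -
  have "integrable lborel (\<lambda>x. sqrt (2 * pi) * std_normal_density x)"
    by (intro integrable_mult_right integrable_normal_density) simp
  then have "integrable lborel (\<lambda>x::real. exp (- (x\<^sup>2 / 2)))"
    by (simp add: normal_density_def)
  from lborel_integrable_real_affine[OF this, of e 0] assms show ?thesis by simp
qed

lemma fourier1_measurable [measurable]:
  assumes [measurable]: "\<rho> \<in> borel_measurable borel"
  shows "fourier1 \<rho> \<in> borel_measurable borel"
  unfolding fourier1_def[abs_def] cis_conv_exp by measurable

text \<open>The double integral of \<rho>(y) exp(-i y \<xi>) is not absolutely convergent, so a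
  Gaussian of width 1/e is inserted before exchanging the order. Its transform concentrates at 0 as
  e tends to 0, and dominated convergence removes it on both sides.\<close>

lemma fourier1_inversion_at_0:
  assumes K: "compact K" "\<And>y. y \<notin> K \<Longrightarrow> \<rho> y = 0" and c: "continuous_on UNIV \<rho>"
    and i: "integrable lborel (fourier1 \<rho>)"
  shows "(\<integral>\<xi>. fourier1 \<rho> \<xi> \<partial>lborel) = 2 * of_real pi * \<rho> 0"
proof -
  have m[measurable]: "\<rho> \<in> borel_measurable borel"
    using c by (rule borel_measurable_continuous_onI)
  have i\<rho>: "integrable lborel \<rho>" by (rule integrable_compact_support[OF K(1) c K(2)])
  have cisb[measurable]: "cis \<in> borel_measurable borel"
    by (intro borel_measurable_continuous_onI continuous_intros)
  obtain B where B: "\<And>y. norm (\<rho> y) \<le> B"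
  proof -
    have "bounded (\<rho> ` K)"
      using c K by (intro compact_imp_bounded compact_continuous_image) (auto intro: continuous_on_subset)
    then obtain b where "\<And>y. y \<in> K \<Longrightarrow> norm (\<rho> y) \<le> b" unfolding bounded_iff by blast
    then have "norm (\<rho> y) \<le> \<bar>b\<bar>" for y using K(2)[of y] by (cases "y \<in> K") force+
    then show thesis using that by blast
  qed
  define e where "e n = 1 / real (Suc n)" for n
  have e: "e n > 0" for n by (simp add: e_def)
  have e0: "e \<longlonglongrightarrow> 0" unfolding e_def by (rule LIMSEQ_Suc[OF lim_1_over_n])
  let ?g = "\<lambda>x::real. exp (- (x\<^sup>2 / 2))"
  have step: "(\<integral>\<xi>. of_real (?g (e n * \<xi>)) * fourier1 \<rho> \<xi> \<partial>lborel)
      = of_real (sqrt (2 * pi)) * (\<integral>z. \<rho> (e n * z) * of_real (?g z) \<partial>lborel)" for n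
  proof -
    have ig: "integrable lborel (\<lambda>x. ?g (e n * x))" using integrable_gaussian[OF e] .
    have "(\<integral>\<xi>. of_real (?g (e n * \<xi>)) * fourier1 \<rho> \<xi> \<partial>lborel)
        = (\<integral>\<xi>. (\<integral>y. of_real (?g (e n * \<xi>)) * (\<rho> y * cis (- (y * \<xi>))) \<partial>lborel) \<partial>lborel)"
      unfolding fourier1_def by simp
    also have "\<dots> = (\<integral>y. (\<integral>\<xi>. of_real (?g (e n * \<xi>)) * (\<rho> y * cis (- (y * \<xi>))) \<partial>lborel) \<partial>lborel)"
    proof (rule lborel_pair.Fubini_integral[symmetric])
      show "integrable (lborel \<Otimes>\<^sub>M lborel)
          (\<lambda>(\<xi>, y). of_real (?g (e n * \<xi>)) * (\<rho> y * cis (- (y * \<xi>))))"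
      proof (rule lborel_pair.Fubini_integrable)
        show "(\<lambda>(\<xi>, y). of_real (?g (e n * \<xi>)) * (\<rho> y * cis (- (y * \<xi>)))) \<in> borel_measurable (lborel \<Otimes>\<^sub>M lborel)"
          by measurable
        show "integrable lborel (\<lambda>\<xi>. \<integral>y. norm (case (\<xi>, y) of (\<xi>, y) \<Rightarrow> of_real (?g (e n * \<xi>)) * (\<rho> y * cis (- (y * \<xi>)))) \<partial>lborel)"
          using ig by (simp add: norm_mult)
        show "AE \<xi> in lborel. integrable lborel (\<lambda>y. case (\<xi>, y) of (\<xi>, y) \<Rightarrow> of_real (?g (e n * \<xi>)) * (\<rho> y * cis (- (y * \<xi>))))"
        proof (intro AE_I2)
          fix \<xi> :: real
          show "integrable lborel (\<lambda>y. case (\<xi>, y) of (\<xi>, y) \<Rightarrow> of_real (?g (e n * \<xi>)) * (\<rho> y * cis (- (y * \<xi>))))"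
            by (rule Bochner_Integration.integrable_bound[OF integrable_mult_right[OF i\<rho>, of "of_real (?g (e n * \<xi>))"]])
              (auto simp: norm_mult)
        qed
      qed
    qed
    also have "\<dots> = (\<integral>y. \<rho> y * (of_real (1 / e n) * of_real (sqrt (2 * pi) * ?g (y / e n))) \<partial>lborel)"
    proof (rule Bochner_Integration.integral_cong[OF refl])
      fix y
      have "(\<integral>\<xi>. of_real (?g (e n * \<xi>)) * cis (- (y * \<xi>)) \<partial>lborel)
          = \<bar>1 / e n\<bar> *\<^sub>R (\<integral>x. of_real (?g (e n * (0 + 1 / e n * x))) * cis (- (y * (0 + 1 / e n * x))) \<partial>lborel)"
        using e[of n] by (subst lborel_integral_real_affine[of "1 / e n" _ 0]) auto
      also have "(\<integral>x. of_real (?g (e n * (0 + 1 / e n * x))) * cis (- (y * (0 + 1 / e n * x))) \<partial>lborel)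
          = (\<integral>x. of_real (?g x) * cis ((- y / e n) * x) \<partial>lborel)"
        using e[of n] by simp
      also have "\<dots> = of_real (sqrt (2 * pi) * ?g (y / e n))"
        unfolding fourier_gaussian by (simp add: power_divide)
      finally have "(\<integral>\<xi>. of_real (?g (e n * \<xi>)) * cis (- (y * \<xi>)) \<partial>lborel)
          = of_real (1 / e n) * of_real (sqrt (2 * pi) * ?g (y / e n))"
        using e[of n] by (simp add: scaleR_conv_of_real)
      moreover have "(\<integral>\<xi>. of_real (?g (e n * \<xi>)) * (\<rho> y * cis (- (y * \<xi>))) \<partial>lborel)
          = \<rho> y * (\<integral>\<xi>. of_real (?g (e n * \<xi>)) * cis (- (y * \<xi>)) \<partial>lborel)"
        by (subst integral_mult_right_zero[symmetric]) (simp add: mult_ac)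
      ultimately show "(\<integral>\<xi>. of_real (?g (e n * \<xi>)) * (\<rho> y * cis (- (y * \<xi>))) \<partial>lborel)
          = \<rho> y * (of_real (1 / e n) * of_real (sqrt (2 * pi) * ?g (y / e n)))" by simp
    qed
    \<comment> \<open>The substitution y = e z moves the concentration from the Gaussian into the
      argument of \<rho>, where continuity at 0 applies.\<close>
    also have "\<dots> = \<bar>e n\<bar> *\<^sub>R (\<integral>z. \<rho> (0 + e n * z) * (of_real (1 / e n) * of_real (sqrt (2 * pi) * ?g ((0 + e n * z) / e n))) \<partial>lborel)"
      using e[of n] by (intro lborel_integral_real_affine) simp
    also have "\<dots> = \<bar>e n\<bar> *\<^sub>R (\<integral>z. of_real (sqrt (2 * pi) / e n) * (\<rho> (e n * z) * of_real (?g z)) \<partial>lborel)"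
      using e[of n] by (simp add: mult_ac)
    also have "\<dots> = of_real (sqrt (2 * pi)) * (\<integral>z. \<rho> (e n * z) * of_real (?g z) \<partial>lborel)"
      using e[of n] by (simp add: scaleR_conv_of_real)
    finally show ?thesis .
  qed
  have "(\<lambda>n. \<integral>\<xi>. of_real (?g (e n * \<xi>)) * fourier1 \<rho> \<xi> \<partial>lborel) \<longlonglongrightarrow> (\<integral>\<xi>. fourier1 \<rho> \<xi> \<partial>lborel)"
  proof (rule integral_dominated_convergence[of _ _ _ "\<lambda>\<xi>. norm (fourier1 \<rho> \<xi>)"])
    show "AE \<xi> in lborel. (\<lambda>n. of_real (?g (e n * \<xi>)) * fourier1 \<rho> \<xi>) \<longlonglongrightarrow> fourier1 \<rho> \<xi>"
    proof (intro AE_I2)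
      fix \<xi>
      have "(\<lambda>n. of_real (?g (e n * \<xi>)) * fourier1 \<rho> \<xi>) \<longlonglongrightarrow> of_real (?g (0 * \<xi>)) * fourier1 \<rho> \<xi>"
        by (intro tendsto_intros e0) auto
      then show "(\<lambda>n. of_real (?g (e n * \<xi>)) * fourier1 \<rho> \<xi>) \<longlonglongrightarrow> fourier1 \<rho> \<xi>" by simp
    qed
    show "AE \<xi> in lborel. norm (of_real (?g (e n * \<xi>)) * fourier1 \<rho> \<xi>) \<le> norm (fourier1 \<rho> \<xi>)" for n
      by (intro AE_I2) (simp add: norm_mult mult_left_le_one_le)
  qed (use i in auto)
  moreover have "(\<lambda>n. of_real (sqrt (2 * pi)) * (\<integral>z. \<rho> (e n * z) * of_real (?g z) \<partial>lborel))
      \<longlonglongrightarrow> of_real (sqrt (2 * pi)) * (\<integral>z. \<rho> 0 * of_real (?g z) \<partial>lborel)"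
  proof (intro tendsto_mult tendsto_const integral_dominated_convergence[of _ _ _ "\<lambda>z. B * ?g z"])
    show "AE z in lborel. (\<lambda>n. \<rho> (e n * z) * of_real (?g z)) \<longlonglongrightarrow> \<rho> 0 * of_real (?g z)"
    proof (intro AE_I2 tendsto_mult tendsto_const)
      fix z
      have "(\<lambda>n. e n * z) \<longlonglongrightarrow> 0 * z" by (intro tendsto_intros e0)
      then show "(\<lambda>n. \<rho> (e n * z)) \<longlonglongrightarrow> \<rho> 0"
        using continuous_on_tendsto_compose[OF c, of "\<lambda>n. e n * z" 0 sequentially] by simp
    qed
    show "AE z in lborel. norm (\<rho> (e n * z) * of_real (?g z)) \<le> B * ?g z" for n
      using B by (intro AE_I2) (simp add: norm_mult)
    show "integrable lborel (\<lambda>z. B * ?g z)"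
      using integrable_gaussian[of 1] by simp
  qed auto
  ultimately have "(\<integral>\<xi>. fourier1 \<rho> \<xi> \<partial>lborel) = of_real (sqrt (2 * pi)) * (\<integral>z. \<rho> 0 * of_real (?g z) \<partial>lborel)"
    unfolding step by (rule LIMSEQ_unique)
  also have "(\<integral>z. \<rho> 0 * of_real (?g z) \<partial>lborel) = \<rho> 0 * of_real (sqrt (2 * pi))"
    using fourier_gaussian[of 0] by simp
  also have "of_real (sqrt (2 * pi)) * (\<rho> 0 * of_real (sqrt (2 * pi))) = of_real (sqrt (2 * pi) * sqrt (2 * pi)) * \<rho> 0"
    by (simp only: of_real_mult mult_ac)
  also have "sqrt (2 * pi) * sqrt (2 * pi) = 2 * pi" by simp
  finally show ?thesis by simp
qed

section \<open>Wave packets\<close>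

lemma bounded_bilinear_cvec: "bounded_bilinear (\<lambda>(c::complex) (v::complex^'n::finite). c *s v)"
  unfolding bilinear_conv_bounded_bilinear[symmetric] bilinear_def
  by (auto intro!: linearI simp: vec_eq_iff algebra_simps)

lemma bounded_bilinear_cmv: "bounded_bilinear (\<lambda>(A::complex^'n::finite^'m::finite) (v::complex^'n). A *v v)"
  unfolding bilinear_conv_bounded_bilinear[symmetric] bilinear_def
  by (auto intro!: linearI simp: vec_eq_iff matrix_vector_mult_def algebra_simps sum.distrib
      scaleR_sum_right)

lemma bounded_bilinear_cmm:
  "bounded_bilinear (\<lambda>(A::complex^'n::finite^'m::finite) (B::complex^'k::finite^'n). A ** B)"
  unfolding bilinear_conv_bounded_bilinear[symmetric] bilinear_def
  by (auto intro!: linearI simp: vec_eq_iff matrix_matrix_mult_def algebra_simps sum.distrib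
      scaleR_sum_right)

lemmas continuous_on_cvec [continuous_intros] = bounded_bilinear.continuous_on[OF bounded_bilinear_cvec]
lemmas continuous_on_cmv [continuous_intros] = bounded_bilinear.continuous_on[OF bounded_bilinear_cmv]
lemmas continuous_on_cmm [continuous_intros] = bounded_bilinear.continuous_on[OF bounded_bilinear_cmm]

lemma continuous_on_mat [continuous_intros]:
  fixes f :: "'a::topological_space \<Rightarrow> complex"
  shows "continuous_on S f \<Longrightarrow> continuous_on S (\<lambda>x. mat (f x) :: complex^'n::finite^'n)"
  unfolding mat_def
proof (intro continuous_on_vec_lambda)
  fix i j :: 'n
  assume "continuous_on S f"
  then show "continuous_on S (\<lambda>x. if i = j then f x else 0)" by (cases "i = j") auto
qed

lemma norm_cvec: "norm (c *s v) = cmod c * norm (v :: complex^'n::finite)"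
  by (simp add: norm_vec_def norm_mult L2_set_right_distrib)

text \<open>Natural exponents make the weight submultiplicative under addition of frequencies
  (\<open>growth_add\<close>), and it still dominates every symbol order, negative ones included
  (\<open>powi_le_growth\<close>).\<close>

definition growth :: "nat \<Rightarrow> 'a::real_normed_vector \<Rightarrow> real" where
  "growth N \<xi> = (1 + norm \<xi>) ^ N"

lemma growth_ge_1: "growth N \<xi> \<ge> 1"
  by (simp add: growth_def)

lemma growth_mono: "M \<le> N \<Longrightarrow> growth M \<xi> \<le> growth N \<xi>"
  by (simp add: growth_def power_increasing)

lemma growth_add: "growth N (\<zeta> + \<eta>) \<le> growth N \<zeta> * growth N \<eta>"
proof -
  have "1 + norm (\<zeta> + \<eta>) \<le> 1 + norm \<zeta> + norm \<eta>" using norm_triangle_ineq[of \<zeta> \<eta>] by simp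
  also have "\<dots> \<le> (1 + norm \<zeta>) * (1 + norm \<eta>)" by (simp add: algebra_simps)
  finally show ?thesis unfolding growth_def power_mult_distrib[symmetric] by (intro power_mono) auto
qed

lemma continuous_on_growth [continuous_intros]: "continuous_on S f \<Longrightarrow> continuous_on S (\<lambda>x. growth N (f x))"
  unfolding growth_def by (intro continuous_intros)

definition bumpc :: "real \<Rightarrow> real \<Rightarrow> complex" where
  "bumpc \<delta> y = of_real (bump \<delta> y)"

lemma smooth_on_bumpc: "smooth_on UNIV (bumpc \<delta>)"
  unfolding bumpc_def[abs_def]
  by (rule smooth_on_bounded_linear[OF open_UNIV bounded_linear_of_real smooth_on_bump])

lemma bumpc_eq_0: "\<delta> > 0 \<Longrightarrow> y \<notin> {-\<delta>..\<delta>} \<Longrightarrow> bumpc \<delta> y = 0"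
  using bump_eq_0[of \<delta> y] by (auto simp: bumpc_def)

lemma bumpc_measurable [measurable]: "bumpc \<delta> \<in> borel_measurable borel"
  by (intro borel_measurable_continuous_onI smooth_on_imp_continuous_on smooth_on_bumpc)

text \<open>Two powers of decay beyond N leave a multiple of 1/(1 + \<xi>^2), since 1 + \<xi>^2 is
  at most (1 + |\<xi>|)^2.\<close>

lemma fourier1_bump_integrable:
  assumes \<delta>: "\<delta> > 0"
  shows "integrable lborel (\<lambda>\<xi>. of_real (growth N \<xi>) * fourier1 (bumpc \<delta>) \<xi>)"
proof -
  have d: "\<exists>C. \<forall>\<xi>. \<bar>\<xi>\<bar> ^ M * norm (fourier1 (bumpc \<delta>) \<xi>) \<le> C" for M
  proof -
    obtain C where "\<And>t. \<bar>t\<bar> ^ M * norm (\<integral>y. bumpc \<delta> y * cis (y \<bullet> (t *\<^sub>R 1)) \<partial>lborel) \<le> C"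
      using oscillatory_decay[of "{-\<delta>..\<delta>}" "1::real" "bumpc \<delta>" M] bumpc_eq_0[OF \<delta>] smooth_on_bumpc by auto
    from this[of "- _"] have "\<bar>\<xi>\<bar> ^ M * norm (fourier1 (bumpc \<delta>) \<xi>) \<le> C" for \<xi>
      by (simp add: fourier1_def)
    then show ?thesis by blast
  qed
  obtain C0 where C0: "\<And>\<xi>. norm (fourier1 (bumpc \<delta>) \<xi>) \<le> C0" using d[of 0] by auto
  obtain C1 where C1: "\<And>\<xi>. \<bar>\<xi>\<bar> ^ (N + 2) * norm (fourier1 (bumpc \<delta>) \<xi>) \<le> C1" using d by blast
  have bd: "norm (of_real (growth N \<xi>) * fourier1 (bumpc \<delta>) \<xi>) \<le> 2 ^ (N + 2) * (C0 + C1) * inverse (1 + \<xi>\<^sup>2)" for \<xi>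
  proof -
    let ?f = "norm (fourier1 (bumpc \<delta>) \<xi>)"
    \<comment> \<open>\<open>oscillatory_decay\<close> controls powers of |\<xi>|, not of 1 +
      |\<xi>|; the two are compared separately for |\<xi>| up to 1 and beyond.\<close>
    have "growth (N + 2) \<xi> \<le> 2 ^ (N + 2) * (1 + \<bar>\<xi>\<bar> ^ (N + 2))"
    proof (cases "\<bar>\<xi>\<bar> \<le> 1")
      case True
      then have "growth (N + 2) \<xi> \<le> 2 ^ (N + 2)" unfolding growth_def by (intro power_mono) auto
      also have "\<dots> \<le> 2 ^ (N + 2) * (1 + \<bar>\<xi>\<bar> ^ (N + 2))" by simp
      finally show ?thesis .
    next
      case False
      then have "growth (N + 2) \<xi> \<le> (2 * \<bar>\<xi>\<bar>) ^ (N + 2)" unfolding growth_def by (intro power_mono) auto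
      also have "\<dots> \<le> 2 ^ (N + 2) * (1 + \<bar>\<xi>\<bar> ^ (N + 2))" by (simp add: power_mult_distrib)
      finally show ?thesis .
    qed
    then have "growth (N + 2) \<xi> * ?f \<le> 2 ^ (N + 2) * (1 + \<bar>\<xi>\<bar> ^ (N + 2)) * ?f"
      by (rule mult_right_mono) simp
    also have "\<dots> = 2 ^ (N + 2) * (?f + \<bar>\<xi>\<bar> ^ (N + 2) * ?f)" by (simp only: algebra_simps)
    also have "\<dots> \<le> 2 ^ (N + 2) * (C0 + C1)" using C0 C1 by (intro mult_left_mono add_mono) auto
    finally have a: "growth (N + 2) \<xi> * ?f \<le> 2 ^ (N + 2) * (C0 + C1)" .
    have "growth N \<xi> * ?f * (1 + \<xi>\<^sup>2) \<le> growth N \<xi> * ?f * (1 + \<bar>\<xi>\<bar>)\<^sup>2"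
      by (intro mult_left_mono) (auto simp: power2_sum growth_def)
    also have "\<dots> = growth (N + 2) \<xi> * ?f" by (simp add: growth_def power_add power2_eq_square)
    finally have "growth N \<xi> * ?f * (1 + \<xi>\<^sup>2) \<le> 2 ^ (N + 2) * (C0 + C1)" using a by linarith
    then have "growth N \<xi> * ?f \<le> 2 ^ (N + 2) * (C0 + C1) / (1 + \<xi>\<^sup>2)"
      by (subst pos_le_divide_eq) (auto simp: add_pos_nonneg)
    moreover have "\<bar>growth N \<xi>\<bar> = growth N \<xi>" using growth_ge_1[of N \<xi>] by simp
    ultimately show ?thesis by (simp add: norm_mult divide_inverse)
  qed
  have "integrable lborel (\<lambda>\<xi>::real. inverse (1 + \<xi>\<^sup>2))"
    using integrable_inverse_1_plus_square unfolding set_integrable_def by simp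
  then have i: "integrable lborel (\<lambda>\<xi>::real. 2 ^ (N + 2) * (C0 + C1) * inverse (1 + \<xi>\<^sup>2))"
    by (rule integrable_mult_right)
  have [measurable]: "(\<lambda>\<xi>::real. growth N \<xi>) \<in> borel_measurable borel"
    by (intro borel_measurable_continuous_onI continuous_intros)
  show ?thesis
  proof (rule Bochner_Integration.integrable_bound[OF i])
    show "(\<lambda>\<xi>. of_real (growth N \<xi>) * fourier1 (bumpc \<delta>) \<xi>) \<in> borel_measurable lborel" by measurable
    show "AE \<xi> in lborel. norm (of_real (growth N \<xi>) * fourier1 (bumpc \<delta>) \<xi>)
        \<le> norm (2 ^ (N + 2) * (C0 + C1) * inverse (1 + \<xi>\<^sup>2))"
      using bd by (intro AE_I2) (smt (verit) real_norm_def)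
  qed
qed

text \<open>The Fourier transform of the envelope of a packet centred at 0. The envelope is a
  product of bumps in the single coordinates, so that its transform factors.\<close>

definition packet_weight :: "real \<Rightarrow> real^4 \<Rightarrow> complex" where
  "packet_weight \<delta> \<zeta> = (\<Prod>j\<in>UNIV. fourier1 (bumpc \<delta>) (\<zeta> $ j))"

lemma weierstrass_prod_ge: "(\<And>i. i \<in> I \<Longrightarrow> a i \<ge> (0::real)) \<Longrightarrow> 1 + sum a I \<le> (\<Prod>i\<in>I. 1 + a i)"
proof (induction I rule: infinite_finite_induct)
  case (insert i I)
  have "1 + sum a (insert i I) = 1 + a i + sum a I" using insert by simp
  also have "\<dots> \<le> (1 + a i) * (1 + sum a I)"
    using insert by (simp add: algebra_simps sum_nonneg)
  also have "\<dots> \<le> (1 + a i) * (\<Prod>i\<in>I. 1 + a i)"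
    using insert by (intro mult_left_mono) auto
  finally show ?case using insert by simp
qed auto

lemma packet_weight_measurable [measurable]: "packet_weight \<delta> \<in> borel_measurable borel"
proof -
  have [measurable]: "(\<lambda>\<zeta>::real^4. \<zeta> $ j) \<in> borel_measurable borel" for j
    by (intro borel_measurable_continuous_onI continuous_intros)
  show ?thesis unfolding packet_weight_def[abs_def] by measurable
qed

text \<open>1 + |\<zeta>| is at most the product of 1 + |\<zeta>_j| over the four coordinates, which
  reduces the claim to one variable.\<close>

lemma packet_weight_integrable:
  assumes \<delta>: "\<delta> > 0"
  shows "integrable lborel (\<lambda>\<zeta>. growth N \<zeta> * norm (packet_weight \<delta> \<zeta>))"
proof -
  let ?f = "\<lambda>s. of_real (growth N s) * fourier1 (bumpc \<delta>) s"
  have "integrable lborel (\<lambda>\<zeta>::real^4. \<Prod>j\<in>UNIV. ?f (\<zeta> $ j))"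
    by (rule integrable_prod_vec[where f = "\<lambda>_. ?f"]) (rule fourier1_bump_integrable[OF \<delta>])
  then show ?thesis
  proof (rule Bochner_Integration.integrable_bound)
    have [measurable]: "(\<lambda>\<xi>::real^4. growth N \<xi>) \<in> borel_measurable borel"
      by (intro borel_measurable_continuous_onI continuous_intros)
    show "(\<lambda>\<zeta>. growth N \<zeta> * norm (packet_weight \<delta> \<zeta>)) \<in> borel_measurable lborel" by measurable
    show "AE \<zeta> in lborel. norm (growth N \<zeta> * norm (packet_weight \<delta> \<zeta>)) \<le> norm (\<Prod>j\<in>UNIV. ?f (\<zeta> $ j))"
    proof (intro AE_I2)
      fix \<zeta> :: "real^4"
      have "1 + norm \<zeta> \<le> 1 + (\<Sum>j\<in>UNIV. \<bar>\<zeta> $ j\<bar>)" using norm_le_l1_cart[of \<zeta>] by simp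
      also have "\<dots> \<le> (\<Prod>j\<in>UNIV. 1 + \<bar>\<zeta> $ j\<bar>)" by (rule weierstrass_prod_ge) simp
      finally have "growth N \<zeta> \<le> (\<Prod>j\<in>UNIV. 1 + \<bar>\<zeta> $ j\<bar>) ^ N"
        unfolding growth_def by (intro power_mono) auto
      also have "\<dots> = (\<Prod>j\<in>UNIV. growth N (\<zeta> $ j))" by (simp add: growth_def prod_power_distrib)
      finally have "growth N \<zeta> * norm (packet_weight \<delta> \<zeta>)
          \<le> (\<Prod>j\<in>UNIV. growth N (\<zeta> $ j)) * norm (packet_weight \<delta> \<zeta>)"
        by (intro mult_right_mono) auto
      also have "\<dots> = norm (\<Prod>j\<in>UNIV. ?f (\<zeta> $ j))"
      proof -
        have g: "\<bar>growth N s\<bar> = growth N s" for s :: real using growth_ge_1[of N s] by simp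
        show ?thesis by (simp add: packet_weight_def prod.distrib norm_mult prod_norm[symmetric] g)
      qed
      finally show "norm (growth N \<zeta> * norm (packet_weight \<delta> \<zeta>)) \<le> norm (\<Prod>j\<in>UNIV. ?f (\<zeta> $ j))"
        using growth_ge_1[of N \<zeta>] by simp
    qed
  qed
qed

lemma integral_packet_weight:
  assumes \<delta>: "\<delta> > 0"
  shows "(\<integral>\<zeta>. packet_weight \<delta> \<zeta> \<partial>lborel) = of_real ((2 * pi) ^ 4 * bump \<delta> 0 ^ 4)"
proof -
  have i: "integrable lborel (fourier1 (bumpc \<delta>))"
    using fourier1_bump_integrable[OF \<delta>, of 0] by (simp add: growth_def)
  have "(\<integral>\<zeta>. packet_weight \<delta> \<zeta> \<partial>lborel) = (\<Prod>j\<in>(UNIV :: 4 set). \<integral>s. fourier1 (bumpc \<delta>) s \<partial>lborel)"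
    unfolding packet_weight_def by (rule integral_prod_vec) (rule i)
  also have "\<dots> = (2 * of_real pi * bumpc \<delta> 0) ^ 4"
    using fourier1_inversion_at_0[of "{-\<delta>..\<delta>}" "bumpc \<delta>"] bumpc_eq_0[OF \<delta>] i
      smooth_on_imp_continuous_on[OF smooth_on_bumpc] by simp
  finally show ?thesis by (simp add: bumpc_def power_mult_distrib)
qed

text \<open>A wave packet: an envelope of sup-norm radius \<delta> about x, modulated at frequency
  \<eta>, with constant spinor direction u.\<close>

definition packet :: "real \<Rightarrow> real^4 \<Rightarrow> real^4 \<Rightarrow> complex^4 \<Rightarrow> real^4 \<Rightarrow> complex^4" where
  "packet \<delta> x \<eta> u y = ((\<Prod>j\<in>UNIV. bumpc \<delta> (y $ j - x $ j)) * cis (y \<bullet> \<eta>)) *s u"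

lemma smooth_on_packet_scalar: "smooth_on UNIV (\<lambda>y::real^4. \<Prod>j\<in>UNIV. bumpc \<delta> (y $ j - x $ j))"
proof (rule smooth_on_prod)
  fix j :: 4
  have "smooth_on UNIV (\<lambda>y::real^4. y $ j - x $ j)"
    by (intro smooth_on_diff smooth_on_const smooth_on_linear bounded_linear_vec_nth open_UNIV)
  from smooth_on_compose[OF open_UNIV smooth_on_bumpc this] show "smooth_on UNIV (\<lambda>y. bumpc \<delta> (y $ j - x $ j))"
    by simp
qed simp

lemma smooth_on_packet: "smooth_on UNIV (packet \<delta> x \<eta> u)"
  unfolding packet_def[abs_def]
  by (intro smooth_on_bilinear[OF open_UNIV bounded_bilinear_cvec] smooth_on_mult
      smooth_on_packet_scalar smooth_on_cis smooth_on_const open_UNIV)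

text \<open>The radius 4 \<delta> comes from bounding the Euclidean norm by the sum of four
  coordinates, each at most \<delta> where the envelope is nonzero.\<close>

lemma packet_support:
  assumes \<delta>: "\<delta> > 0" and y: "y \<notin> cball x (4 * \<delta>)"
  shows "(\<Prod>j\<in>UNIV. bumpc \<delta> (y $ j - x $ j)) = 0" and "packet \<delta> x \<eta> u y = 0"
proof -
  have "\<exists>j. \<bar>y $ j - x $ j\<bar> > \<delta>"
  proof (rule ccontr)
    assume "\<not> ?thesis"
    then have "(\<Sum>j\<in>(UNIV::4 set). \<bar>(x - y) $ j\<bar>) \<le> (\<Sum>j\<in>(UNIV::4 set). \<delta>)"
      by (intro sum_mono) (auto simp: abs_minus_commute not_less)
    then have "norm (x - y) \<le> 4 * \<delta>" using norm_le_l1_cart[of "x - y"] by simp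
    then show False using y by (simp add: dist_norm)
  qed
  then obtain j where "\<bar>y $ j - x $ j\<bar> > \<delta>" by blast
  then have "bumpc \<delta> (y $ j - x $ j) = 0" by (intro bumpc_eq_0[OF \<delta>]) auto
  then show "(\<Prod>j\<in>UNIV. bumpc \<delta> (y $ j - x $ j)) = 0" by (auto intro!: prod_zero)
  then show "packet \<delta> x \<eta> u y = 0" by (simp add: packet_def)
qed

text \<open>Modulation by \<eta> shifts the frequency and the centre x contributes a pure phase;
  what is left is one transform per coordinate.\<close>

lemma fourier_packet:
  assumes \<delta>: "\<delta> > 0"
  shows "fourier (packet \<delta> x \<eta> u) \<xi> = (cis (- (x \<bullet> (\<xi> - \<eta>))) * packet_weight \<delta> (\<xi> - \<eta>)) *s u"
proof -
  let ?\<chi> = "\<lambda>y::real^4. \<Prod>j\<in>UNIV. bumpc \<delta> (y $ j - x $ j)"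
  let ?\<zeta> = "\<xi> - \<eta>"
  have i1: "integrable lborel (\<lambda>s. bumpc \<delta> (s - x $ j) * cis (- (s * ?\<zeta> $ j)))" for j
  proof (rule integrable_compact_support[of "{x $ j - \<delta>..x $ j + \<delta>}"])
    show "continuous_on UNIV (\<lambda>s. bumpc \<delta> (s - x $ j) * cis (- (s * ?\<zeta> $ j)))"
      by (intro continuous_intros continuous_on_compose2[OF smooth_on_imp_continuous_on[OF smooth_on_bumpc]]) auto
    show "s \<notin> {x $ j - \<delta>..x $ j + \<delta>} \<Longrightarrow> bumpc \<delta> (s - x $ j) * cis (- (s * ?\<zeta> $ j)) = 0" for s
      using bumpc_eq_0[OF \<delta>, of "s - x $ j"] by auto
  qed simp
  have c4: "cis (- (y \<bullet> \<zeta>)) = (\<Prod>j\<in>UNIV. cis (- (y $ j * \<zeta> $ j)))" for y \<zeta> :: "real^4"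
    by (simp add: inner_vec_def cis_conv_exp exp_sum[symmetric] sum_negf[symmetric] sum_distrib_left)
  have e: "?\<chi> y * cis (- (y \<bullet> ?\<zeta>)) = (\<Prod>j\<in>UNIV. bumpc \<delta> (y $ j - x $ j) * cis (- (y $ j * ?\<zeta> $ j)))" for y
    unfolding c4 by (simp only: prod.distrib)
  have "fourier (packet \<delta> x \<eta> u) \<xi> = (LINT y|lborel. (?\<chi> y * cis (- (y \<bullet> ?\<zeta>))) *s u)"
    unfolding fourier_def packet_def
  proof (intro Bochner_Integration.integral_cong refl)
    fix y
    have "cis (- (y \<bullet> ?\<zeta>)) = cis (- (y \<bullet> \<xi>)) * cis (y \<bullet> \<eta>)"
      by (simp add: cis_mult inner_diff_right)
    then show "cis (- (y \<bullet> \<xi>)) *s ((?\<chi> y * cis (y \<bullet> \<eta>)) *s u) = (?\<chi> y * cis (- (y \<bullet> ?\<zeta>))) *s u"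
      by (simp add: vector_smult_assoc mult_ac)
  qed
  also have "\<dots> = (LINT y|lborel. ?\<chi> y * cis (- (y \<bullet> ?\<zeta>))) *s u"
    unfolding e by (rule integral_bounded_linear[OF bounded_bilinear.bounded_linear_left[OF bounded_bilinear_cvec]])
      (rule integrable_prod_vec[where f = "\<lambda>j s. bumpc \<delta> (s - x $ j) * cis (- (s * ?\<zeta> $ j))"], rule i1)
  also have "(LINT y|lborel. ?\<chi> y * cis (- (y \<bullet> ?\<zeta>)))
      = (\<Prod>j\<in>UNIV. \<integral>s. bumpc \<delta> (s - x $ j) * cis (- (s * ?\<zeta> $ j)) \<partial>lborel)"
    unfolding e by (rule integral_prod_vec[where f = "\<lambda>j s. bumpc \<delta> (s - x $ j) * cis (- (s * ?\<zeta> $ j))"], rule i1)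
  also have "\<dots> = (\<Prod>j\<in>UNIV. cis (- (x $ j * ?\<zeta> $ j)) * fourier1 (bumpc \<delta>) (?\<zeta> $ j))"
  proof (rule prod.cong[OF refl])
    fix j
    have [measurable]: "cis \<in> borel_measurable borel"
      by (intro borel_measurable_continuous_onI continuous_intros)
    have "(\<integral>s. bumpc \<delta> (s - x $ j) * cis (- (s * ?\<zeta> $ j)) \<partial>lborel)
        = (\<integral>s. bumpc \<delta> (x $ j + s - x $ j) * cis (- ((x $ j + s) * ?\<zeta> $ j)) \<partial>lborel)"
      by (rule integral_lborel_shift[symmetric]) measurable
    also have "\<dots> = (\<integral>s. cis (- (x $ j * ?\<zeta> $ j)) * (bumpc \<delta> s * cis (- (s * ?\<zeta> $ j))) \<partial>lborel)"
    proof (intro Bochner_Integration.integral_cong refl)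
      fix s
      have "cis (- ((x $ j + s) * ?\<zeta> $ j)) = cis (- (x $ j * ?\<zeta> $ j)) * cis (- (s * ?\<zeta> $ j))"
        by (simp add: cis_mult algebra_simps)
      then show "bumpc \<delta> (x $ j + s - x $ j) * cis (- ((x $ j + s) * ?\<zeta> $ j))
          = cis (- (x $ j * ?\<zeta> $ j)) * (bumpc \<delta> s * cis (- (s * ?\<zeta> $ j)))"
        by (simp add: mult_ac)
    qed
    finally show "(\<integral>s. bumpc \<delta> (s - x $ j) * cis (- (s * ?\<zeta> $ j)) \<partial>lborel)
        = cis (- (x $ j * ?\<zeta> $ j)) * fourier1 (bumpc \<delta>) (?\<zeta> $ j)"
      by (simp add: fourier1_def)
  qed
  also have "\<dots> = cis (- (x \<bullet> ?\<zeta>)) * packet_weight \<delta> ?\<zeta>"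
    unfolding c4 packet_weight_def by (simp only: prod.distrib)
  finally show ?thesis .
qed

section \<open>Symbols tested on wave packets\<close>

lemma powi_le_growth: "(1 + norm \<xi>) powi m \<le> growth (nat \<bar>m\<bar>) \<xi>"
proof (cases "m \<ge> 0")
  case True then show ?thesis by (simp add: growth_def power_int_def)
next
  case False
  then have "(1 + norm \<xi>) powi m \<le> 1"
    by (simp add: power_int_def power_inverse inverse_le_1_iff one_le_power)
  also have "1 \<le> growth (nat \<bar>m\<bar>) \<xi>" by (rule growth_ge_1)
  finally show ?thesis .
qed

lemma norm_mat_mult: "norm (mat c ** (B :: complex^'n::finite^'n)) = cmod c * norm B"
proof -
  have "mat c ** B = (\<chi> i. c *s (B $ i))"
    by (simp add: vec_eq_iff matrix_matrix_mult_def mat_def if_distrib if_distribR cong: if_cong)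
  then show ?thesis by (simp add: norm_vec_def[of "_ :: complex^'n^'n"] norm_cvec L2_set_right_distrib)
qed

text \<open>A class of symbols at a frozen base point for which the integral \<open>osc\<close>
  converges, because \<open>packet_weight\<close> decays faster than any power. It is closed under
  the operations that composition with a first order operator involves.\<close>

definition poly_bdd :: "(real^4 \<Rightarrow> complex^4^4) \<Rightarrow> bool" where
  "poly_bdd A \<longleftrightarrow> continuous_on UNIV A \<and> (\<exists>C N. \<forall>\<xi>. norm (A \<xi>) \<le> C * growth N \<xi>)"

lemma poly_bddI:
  assumes "continuous_on UNIV A" "\<And>\<xi>. norm (A \<xi>) \<le> C * growth N \<xi>"
  shows "poly_bdd A"
  using assms unfolding poly_bdd_def by blast

lemma poly_bdd_const: "poly_bdd (\<lambda>\<xi>. B)"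
  by (rule poly_bddI[of _ "norm B" 0]) (auto simp: growth_def)

lemma poly_bdd_add:
  assumes "poly_bdd A" "poly_bdd B"
  shows "poly_bdd (\<lambda>\<xi>. A \<xi> + B \<xi>)"
proof -
  obtain C M D N where C: "\<And>\<xi>. norm (A \<xi>) \<le> C * growth M \<xi>" and D: "\<And>\<xi>. norm (B \<xi>) \<le> D * growth N \<xi>"
    using assms unfolding poly_bdd_def by blast
  have "norm (A \<xi> + B \<xi>) \<le> (\<bar>C\<bar> + \<bar>D\<bar>) * growth (max M N) \<xi>" for \<xi>
  proof -
    have "norm (A \<xi>) \<le> \<bar>C\<bar> * growth (max M N) \<xi>"
      by (rule order_trans[OF C mult_mono]) (use growth_ge_1[of M \<xi>] in \<open>auto intro: growth_mono\<close>)
    moreover have "norm (B \<xi>) \<le> \<bar>D\<bar> * growth (max M N) \<xi>"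
      by (rule order_trans[OF D mult_mono]) (use growth_ge_1[of N \<xi>] in \<open>auto intro: growth_mono\<close>)
    ultimately show ?thesis using norm_triangle_ineq[of "A \<xi>" "B \<xi>"] by (simp add: algebra_simps)
  qed
  then show ?thesis using assms by (intro poly_bddI continuous_intros) (auto simp: poly_bdd_def)
qed

lemma poly_bdd_mult_left:
  assumes "poly_bdd A"
  shows "poly_bdd (\<lambda>\<xi>. B ** A \<xi>)"
proof -
  obtain C M where C: "\<And>\<xi>. norm (A \<xi>) \<le> C * growth M \<xi>"
    using assms unfolding poly_bdd_def by blast
  obtain K where K: "K \<ge> 0" "\<And>a b. norm (a ** b :: complex^4^4) \<le> norm (a :: complex^4^4) * norm (b :: complex^4^4) * K"
    using bounded_bilinear.nonneg_bounded[OF bounded_bilinear_cmm] by blast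
  have "norm (B ** A \<xi>) \<le> (norm B * C * K) * growth M \<xi>" for \<xi>
  proof -
    have "norm (B ** A \<xi>) \<le> norm B * norm (A \<xi>) * K" by (rule K)
    also have "\<dots> \<le> norm B * (C * growth M \<xi>) * K" by (intro mult_right_mono mult_left_mono C K) auto
    finally show ?thesis by (simp add: mult_ac)
  qed
  then show ?thesis using assms by (intro poly_bddI continuous_intros) (auto simp: poly_bdd_def)
qed

lemma poly_bdd_sum: "(\<And>i. i \<in> I \<Longrightarrow> poly_bdd (A i)) \<Longrightarrow> poly_bdd (\<lambda>\<xi>. \<Sum>i\<in>I. A i \<xi>)"
  by (induction I rule: infinite_finite_induct) (auto intro: poly_bdd_add poly_bdd_const)

lemma norm_fourier_packet:
  assumes "\<delta> > 0"
  shows "norm (fourier (packet \<delta> x \<eta> u) \<xi>) = norm (packet_weight \<delta> (\<xi> - \<eta>)) * norm u"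
  unfolding fourier_packet[OF assms] by (simp add: norm_cvec norm_mult)

lemma fourier_packet_measurable:
  assumes "\<delta> > 0"
  shows "fourier (packet \<delta> x \<eta> u) \<in> borel_measurable borel"
proof -
  have [measurable]: "(\<lambda>\<xi>. cis (- (x \<bullet> (\<xi> - \<eta>)))) \<in> borel_measurable borel"
    by (intro borel_measurable_continuous_onI continuous_intros)
  have [measurable]: "(\<lambda>c. c *s u) \<in> borel_measurable borel"
    by (intro borel_measurable_continuous_onI continuous_intros)
  show ?thesis unfolding fourier_packet[OF assms, abs_def] by measurable
qed

lemma fourier_packet_integrable:
  assumes \<delta>: "\<delta> > 0"
  shows "integrable lborel (\<lambda>\<xi>. growth N \<xi> * norm (fourier (packet \<delta> x \<eta> u) \<xi>))"
proof -
  have "integrable lborel (\<lambda>\<xi>. growth N (- \<eta> + \<xi>) * norm (packet_weight \<delta> (- \<eta> + \<xi>)))"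
    by (rule integrable_lborel_shift[OF packet_weight_integrable[OF \<delta>]])
  then have "integrable lborel (\<lambda>\<xi>. (growth N \<eta> * norm u) * (growth N (- \<eta> + \<xi>) * norm (packet_weight \<delta> (- \<eta> + \<xi>))))"
    by (rule integrable_mult_right)
  then show ?thesis
  proof (rule Bochner_Integration.integrable_bound)
    have [measurable]: "(\<lambda>\<xi>::real^4. growth N \<xi>) \<in> borel_measurable borel"
      by (intro borel_measurable_continuous_onI continuous_intros)
    note [measurable] = fourier_packet_measurable[OF \<delta>]
    show "(\<lambda>\<xi>. growth N \<xi> * norm (fourier (packet \<delta> x \<eta> u) \<xi>)) \<in> borel_measurable lborel" by measurable
    show "AE \<xi> in lborel. norm (growth N \<xi> * norm (fourier (packet \<delta> x \<eta> u) \<xi>))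
      \<le> norm (growth N \<eta> * norm u * (growth N (- \<eta> + \<xi>) * norm (packet_weight \<delta> (- \<eta> + \<xi>))))"
    proof (intro AE_I2)
      fix \<xi>
      have "growth N \<xi> \<le> growth N (- \<eta> + \<xi>) * growth N \<eta>" using growth_add[of N "- \<eta> + \<xi>" \<eta>] by simp
      then have "growth N \<xi> * (norm (packet_weight \<delta> (\<xi> - \<eta>)) * norm u)
          \<le> (growth N (- \<eta> + \<xi>) * growth N \<eta>) * (norm (packet_weight \<delta> (\<xi> - \<eta>)) * norm u)"
        by (intro mult_right_mono) auto
      then show "norm (growth N \<xi> * norm (fourier (packet \<delta> x \<eta> u) \<xi>))
        \<le> norm (growth N \<eta> * norm u * (growth N (- \<eta> + \<xi>) * norm (packet_weight \<delta> (- \<eta> + \<xi>))))"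
        using growth_ge_1[of N \<xi>] growth_ge_1[of N \<eta>] growth_ge_1[of N "- \<eta> + \<xi>"]
        by (simp add: norm_fourier_packet[OF \<delta>] abs_mult mult_ac)
    qed
  qed
qed

lemma cmv_norm_bound: "\<exists>K\<ge>0. \<forall>(a :: complex^4^4) (b :: complex^4). norm (a *v b) \<le> norm a * norm b * K"
  by (rule bounded_bilinear.nonneg_bounded[OF bounded_bilinear_cmv])

lemma osc_integrable:
  assumes \<delta>: "\<delta> > 0" and A: "poly_bdd A"
  shows "integrable lborel (\<lambda>\<xi>. cis (z \<bullet> \<xi>) *s (A \<xi> *v fourier (packet \<delta> x \<eta> u) \<xi>))"
proof -
  obtain C M where C: "\<And>\<xi>. norm (A \<xi>) \<le> C * growth M \<xi>" and cA: "continuous_on UNIV A"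
    using A unfolding poly_bdd_def by blast
  obtain K where K: "K \<ge> 0" "\<And>(a :: complex^4^4) b. norm (a *v b) \<le> norm a * norm b * K"
    using cmv_norm_bound by blast
  have "integrable lborel (\<lambda>\<xi>. (C * K) * (growth M \<xi> * norm (fourier (packet \<delta> x \<eta> u) \<xi>)))"
    by (intro integrable_mult_right fourier_packet_integrable \<delta>)
  then show ?thesis
  proof (rule Bochner_Integration.integrable_bound)
    note [measurable] = fourier_packet_measurable[OF \<delta>]
    have [measurable]: "A \<in> borel_measurable borel" by (rule borel_measurable_continuous_onI[OF cA])
    have [measurable]: "(\<lambda>\<xi>. cis (z \<bullet> \<xi>)) \<in> borel_measurable borel"
      by (intro borel_measurable_continuous_onI continuous_intros)
    have m1: "(\<lambda>(c, A, v). c *s (A *v v)) \<in> borel_measurable (borel :: (complex \<times> (complex^4^4) \<times> (complex^4)) measure)"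
      unfolding case_prod_beta by (intro borel_measurable_continuous_onI continuous_intros)
    have "(\<lambda>\<xi>. (cis (z \<bullet> \<xi>), A \<xi>, fourier (packet \<delta> x \<eta> u) \<xi>)) \<in> borel_measurable borel" by measurable
    from measurable_compose[OF this m1]
    show "(\<lambda>\<xi>. cis (z \<bullet> \<xi>) *s (A \<xi> *v fourier (packet \<delta> x \<eta> u) \<xi>)) \<in> borel_measurable lborel" by simp
    show "AE \<xi> in lborel. norm (cis (z \<bullet> \<xi>) *s (A \<xi> *v fourier (packet \<delta> x \<eta> u) \<xi>))
       \<le> norm (C * K * (growth M \<xi> * norm (fourier (packet \<delta> x \<eta> u) \<xi>)))"
    proof (intro AE_I2)
      fix \<xi>
      let ?f = "fourier (packet \<delta> x \<eta> u) \<xi>"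
      have "norm (A \<xi> *v ?f) \<le> norm (A \<xi>) * norm ?f * K" by (rule K)
      also have "\<dots> \<le> (C * growth M \<xi>) * norm ?f * K" by (intro mult_right_mono C K) auto
      also have "\<dots> = C * K * (growth M \<xi> * norm ?f)" by (simp add: mult_ac)
      also have "\<dots> \<le> norm \<dots>" by simp
      finally show "norm (cis (z \<bullet> \<xi>) *s (A \<xi> *v ?f)) \<le> norm (C * K * (growth M \<xi> * norm ?f))"
        by (simp add: norm_cvec)
    qed
  qed
qed

text \<open>Up to the factor (2 pi)^4, the value at the packet's centre x of the operator whose
  symbol at x is A, applied to that packet. Only values at x occur, so A depends on the covector
  alone.\<close>

definition osc :: "real \<Rightarrow> real^4 \<Rightarrow> real^4 \<Rightarrow> complex^4 \<Rightarrow> (real^4 \<Rightarrow> complex^4^4) \<Rightarrow> complex^4" where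
  "osc \<delta> x \<eta> u A = (LINT \<xi>|lborel. cis (x \<bullet> \<xi>) *s (A \<xi> *v fourier (packet \<delta> x \<eta> u) \<xi>))"

lemma osc_add:
  assumes "\<delta> > 0" "poly_bdd A" "poly_bdd B"
  shows "osc \<delta> x \<eta> u (\<lambda>\<xi>. A \<xi> + B \<xi>) = osc \<delta> x \<eta> u A + osc \<delta> x \<eta> u B"
  unfolding osc_def using osc_integrable[OF assms(1,2), of x] osc_integrable[OF assms(1,3), of x]
  by (simp add: matrix_vector_mult_add_rdistrib vector_add_ldistrib)

lemma osc_mult_left:
  assumes "\<delta> > 0" "poly_bdd A"
  shows "osc \<delta> x \<eta> u (\<lambda>\<xi>. B ** A \<xi>) = B *v osc \<delta> x \<eta> u A"
  unfolding osc_def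
  by (subst integral_bounded_linear[OF bounded_bilinear.bounded_linear_right[OF bounded_bilinear_cmv]
        osc_integrable[OF assms], symmetric])
    (simp add: vector_scalar_commute matrix_vector_mul_assoc)

lemma osc_sum:
  assumes "\<delta> > 0" "\<And>i. i \<in> I \<Longrightarrow> poly_bdd (A i)"
  shows "osc \<delta> x \<eta> u (\<lambda>\<xi>. \<Sum>i\<in>I. A i \<xi>) = (\<Sum>i\<in>I. osc \<delta> x \<eta> u (A i))"
  using assms(2)
proof (induction I rule: infinite_finite_induct)
  case (insert i I)
  then show ?case by (simp add: osc_add[OF assms(1)] poly_bdd_sum)
qed (auto simp: osc_def)

text \<open>Since the operator is evaluated at the centre of the packet, the phase exp(-i x.\<zeta>)
  of the transform cancels against that of the quantization. In the integral that remains, \<eta>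
  only translates the argument of A.\<close>

lemma osc_shift:
  assumes \<delta>: "\<delta> > 0" and A: "poly_bdd A"
  shows "osc \<delta> x \<eta> u A = cis (x \<bullet> \<eta>) *s (LINT \<zeta>|lborel. packet_weight \<delta> \<zeta> *s (A (\<zeta> + \<eta>) *v u))"
    and "integrable lborel (\<lambda>\<zeta>. packet_weight \<delta> \<zeta> *s (A (\<zeta> + \<eta>) *v u))"
proof -
  have e: "cis (x \<bullet> (\<eta> + \<zeta>)) *s (A (\<eta> + \<zeta>) *v fourier (packet \<delta> x \<eta> u) (\<eta> + \<zeta>))
      = cis (x \<bullet> \<eta>) *s (packet_weight \<delta> \<zeta> *s (A (\<zeta> + \<eta>) *v u))" for \<zeta>
  proof -
    have c: "cis (x \<bullet> (\<eta> + \<zeta>)) * (cis (- (x \<bullet> \<zeta>)) * w) = cis (x \<bullet> \<eta>) * w" for w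
      by (simp add: cis_mult inner_add_right mult.assoc[symmetric])
    have d: "\<eta> + \<zeta> - \<eta> = \<zeta>" by simp
    show ?thesis
      unfolding fourier_packet[OF \<delta>] d vector_scalar_commute vector_smult_assoc c by (simp only: add.commute)
  qed
  let ?g = "\<lambda>\<xi>. cis (x \<bullet> \<xi>) *s (A \<xi> *v fourier (packet \<delta> x \<eta> u) \<xi>)"
  have i: "integrable lborel ?g" by (rule osc_integrable[OF assms])
  then have "integrable lborel (\<lambda>\<zeta>. ?g (\<eta> + \<zeta>))" by (rule integrable_lborel_shift)
  then have i2: "integrable lborel (\<lambda>\<zeta>. cis (x \<bullet> \<eta>) *s (packet_weight \<delta> \<zeta> *s (A (\<zeta> + \<eta>) *v u)))"
    unfolding e .
  from integrable_bounded_linear[OF bounded_bilinear.bounded_linear_right[OF bounded_bilinear_cvec] this, of "cis (- (x \<bullet> \<eta>))"]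
  show i3: "integrable lborel (\<lambda>\<zeta>. packet_weight \<delta> \<zeta> *s (A (\<zeta> + \<eta>) *v u))"
    by (simp add: vector_smult_assoc cis_mult mult.assoc[symmetric])
  have "osc \<delta> x \<eta> u A = (LINT \<zeta>|lborel. ?g (\<eta> + \<zeta>))"
    unfolding osc_def by (rule integral_lborel_shift[symmetric]) (use borel_measurable_integrable[OF i] in simp)
  also have "\<dots> = cis (x \<bullet> \<eta>) *s (LINT \<zeta>|lborel. packet_weight \<delta> \<zeta> *s (A (\<zeta> + \<eta>) *v u))"
    unfolding e by (rule integral_bounded_linear[OF bounded_bilinear.bounded_linear_right[OF bounded_bilinear_cvec] i3])
  finally show "osc \<delta> x \<eta> u A = cis (x \<bullet> \<eta>) *s (LINT \<zeta>|lborel. packet_weight \<delta> \<zeta> *s (A (\<zeta> + \<eta>) *v u))" .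
qed

lemma scaleR_cvec: "r *\<^sub>R (v :: complex^'n::finite) = of_real r *s v"
  unfolding vec_eq_iff vector_scaleR_component vector_smult_component by (simp add: scaleR_conv_of_real)

text \<open>Fourier inversion for the packet at its centre.\<close>

lemma osc_one:
  assumes \<delta>: "\<delta> > 0"
  shows "osc \<delta> x \<eta> u (\<lambda>\<xi>. mat 1) = ((2 * pi) ^ 4) *\<^sub>R packet \<delta> x \<eta> u x"
proof -
  have i: "integrable lborel (packet_weight \<delta>)"
    using packet_weight_integrable[OF \<delta>, of 0]
    by (subst integrable_norm_iff[symmetric]) (auto simp: growth_def)
  have "osc \<delta> x \<eta> u (\<lambda>\<xi>. mat 1) = cis (x \<bullet> \<eta>) *s (LINT \<zeta>|lborel. packet_weight \<delta> \<zeta> *s u)"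
    by (subst osc_shift(1)[OF \<delta> poly_bdd_const]) simp
  also have "(LINT \<zeta>|lborel. packet_weight \<delta> \<zeta> *s u) = (LINT \<zeta>|lborel. packet_weight \<delta> \<zeta>) *s u"
    by (rule integral_bounded_linear[OF bounded_bilinear.bounded_linear_left[OF bounded_bilinear_cvec] i])
  finally show ?thesis
    by (simp add: integral_packet_weight[OF \<delta>] packet_def bumpc_def scaleR_cvec vector_smult_assoc mult_ac)
qed

text \<open>Descending induction on d. Against the packet of frequency \<open>t \<eta>\<close> the leading surviving term of e
  contributes \<open>t\<^sup>d \<epsilon>\<^sub>d(\<eta>)\<close> times the integral of the packet weight, which by Fourier inversion is
  a nonzero multiple of the bump function at 0; this contradicts the rapid decay unless
  \<open>\<epsilon>\<^sub>d(\<eta>) = 0\<close>.\<close>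

lemma symbol_vanish:
  fixes \<epsilon> :: "int \<Rightarrow> real^4 \<Rightarrow> complex^4^4"
  assumes \<delta>: "\<delta> > 0" and e: "poly_bdd e"
    and hom: "\<And>d \<xi> t. \<xi> \<noteq> 0 \<Longrightarrow> t > 0 \<Longrightarrow> \<epsilon> d (t *\<^sub>R \<xi>) = (t powi d) *\<^sub>R \<epsilon> d \<xi>"
    and cont: "\<And>d. continuous_on (- {0}) (\<epsilon> d)"
    and top: "\<And>d \<xi>. d > M \<Longrightarrow> \<xi> \<noteq> 0 \<Longrightarrow> \<epsilon> d \<xi> = 0"
    and exp: "\<And>L. \<exists>C. \<forall>\<xi>. norm \<xi> \<ge> 1 \<longrightarrow> norm (e \<xi> - (\<Sum>d\<in>{L..M}. \<epsilon> d \<xi>)) \<le> C * (1 + norm \<xi>) powi (L - 1)"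
    and decay: "\<And>N u \<eta>. \<eta> \<noteq> 0 \<Longrightarrow> \<exists>C. \<forall>t. \<bar>t\<bar> ^ N *
      norm (LINT \<zeta>|lborel. packet_weight \<delta> \<zeta> *s (e (\<zeta> + t *\<^sub>R \<eta>) *v u)) \<le> C"
    and "\<eta> \<noteq> 0"
  shows "\<epsilon> d \<eta> = 0"
  using \<open>\<eta> \<noteq> 0\<close>
proof (induction "nat (M - d + 1)" arbitrary: d \<eta> rule: less_induct)
  case less
  show ?case
  proof (cases "d > M")
    case True then show ?thesis using top less by blast
  next
    case False
    \<comment> \<open>The induction hypothesis at all higher degrees and all nonzero covectors
      leaves \<open>\<epsilon> d\<close> as the leading term of e.\<close>
    have zero: "\<epsilon> d' \<xi> = 0" if "d' > d" "\<xi> \<noteq> 0" for d' \<xi>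
      using less(1)[of d' \<xi>] that False by auto
    have s1: "(\<Sum>d'\<in>{d..M}. \<epsilon> d' \<xi>) = \<epsilon> d \<xi>" if "\<xi> \<noteq> 0" for \<xi>
    proof -
      have "{d..M} = insert d {d+1..M}" using False by auto
      then show ?thesis using zero that by (simp add: sum.neutral)
    qed
    have s2: "(\<Sum>d'\<in>{d+1..M}. \<epsilon> d' \<xi>) = 0" if "\<xi> \<noteq> 0" for \<xi>
      using zero that by (intro sum.neutral) auto
    obtain C1 where C1: "\<And>\<xi>. norm \<xi> \<ge> 1 \<Longrightarrow> norm (e \<xi> - \<epsilon> d \<xi>) \<le> C1 * (1 + norm \<xi>) powi (d - 1)"
    proof -
      obtain C where C: "\<forall>\<xi>. norm \<xi> \<ge> 1 \<longrightarrow> norm (e \<xi> - (\<Sum>d\<in>{d..M}. \<epsilon> d \<xi>)) \<le> C * (1 + norm \<xi>) powi (d - 1)"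
        using exp[of d] by blast
      have "norm (e \<xi> - \<epsilon> d \<xi>) \<le> C * (1 + norm \<xi>) powi (d - 1)" if n: "norm \<xi> \<ge> 1" for \<xi>
      proof -
        have "\<xi> \<noteq> 0" using n by auto
        then show ?thesis using C[rule_format, OF n] unfolding s1[OF \<open>\<xi> \<noteq> 0\<close>] by simp
      qed
      then show thesis using that by blast
    qed
    \<comment> \<open>Stopping the expansion one degree earlier bounds e itself by order d.\<close>
    obtain C2 where C2: "\<And>\<xi>. norm \<xi> \<ge> 1 \<Longrightarrow> norm (e \<xi>) \<le> C2 * (1 + norm \<xi>) powi d"
    proof -
      obtain C where C: "\<forall>\<xi>. norm \<xi> \<ge> 1 \<longrightarrow> norm (e \<xi> - (\<Sum>d\<in>{d+1..M}. \<epsilon> d \<xi>)) \<le> C * (1 + norm \<xi>) powi (d + 1 - 1)"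
        using exp[of "d + 1"] by blast
      have "norm (e \<xi>) \<le> C * (1 + norm \<xi>) powi d" if n: "norm \<xi> \<ge> 1" for \<xi>
      proof -
        have "\<xi> \<noteq> 0" using n by auto
        then show ?thesis using C[rule_format, OF n] by (simp add: s2)
      qed
      then show thesis using that by blast
    qed
    have ce: "continuous_on UNIV e" using e by (simp add: poly_bdd_def)
    \<comment> \<open>The expansion says nothing inside the unit ball, so compactness supplies the
      bound there.\<close>
    obtain C3 where C3: "C3 \<ge> 0" "\<And>\<xi>. norm (e \<xi>) \<le> C3 * (1 + norm \<xi>) powi d"
    proof -
      have "continuous_on (cball 0 1) (\<lambda>\<xi>. norm (e \<xi>) / (1 + norm \<xi>) powi d)"
        by (intro continuous_intros continuous_on_subset[OF ce]) (auto simp: add_nonneg_eq_0_iff power_int_eq_0_iff)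
      then have "bounded ((\<lambda>\<xi>. norm (e \<xi>) / (1 + norm \<xi>) powi d) ` cball 0 1)"
        by (intro compact_imp_bounded compact_continuous_image) auto
      then obtain B where B: "\<forall>\<xi>\<in>cball 0 1. norm (norm (e \<xi>) / (1 + norm \<xi>) powi d) \<le> B"
        unfolding bounded_iff by (auto simp del: norm_divide real_norm_def)
      have "norm (e \<xi>) \<le> (\<bar>B\<bar> + \<bar>C2\<bar>) * (1 + norm \<xi>) powi d" for \<xi>
      proof -
        have p: "(1 + norm \<xi>) powi d > 0" by (intro zero_less_power_int add_pos_nonneg) auto
        show ?thesis
        proof (cases "norm \<xi> \<le> 1")
          case True
          have "norm (e \<xi>) / (1 + norm \<xi>) powi d \<le> B" using bspec[OF B, of \<xi>] True by (simp add: abs_le_iff)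
          then have "norm (e \<xi>) \<le> B * (1 + norm \<xi>) powi d" using p by (simp add: pos_divide_le_eq)
          also have "\<dots> \<le> (\<bar>B\<bar> + \<bar>C2\<bar>) * (1 + norm \<xi>) powi d" using p by (intro mult_right_mono) auto
          finally show ?thesis .
        next
          case False
          then have "norm (e \<xi>) \<le> C2 * (1 + norm \<xi>) powi d" using C2 by simp
          also have "\<dots> \<le> (\<bar>B\<bar> + \<bar>C2\<bar>) * (1 + norm \<xi>) powi d" using p by (intro mult_right_mono) auto
          finally show ?thesis .
        qed
      qed
      then show thesis using that[of "\<bar>B\<bar> + \<bar>C2\<bar>"] by simp
    qed
    define \<kappa> where "\<kappa> = max (1 + norm \<eta>) (1 / norm \<eta>) ^ nat \<bar>d\<bar>"
    \<comment> \<open>A Peetre inequality uniform in t: both the quotient and its reciprocal are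
      bounded by a multiple of 1 + |\<zeta>|, so its power is controlled for either sign of
      d.\<close>
    have peetre: "((1 + norm (\<zeta> + t *\<^sub>R \<eta>)) / t) powi d \<le> \<kappa> * growth (nat \<bar>d\<bar>) \<zeta>" if t: "t \<ge> 1" for t \<zeta>
    proof -
      let ?m = "max (1 + norm \<eta>) (1 / norm \<eta>)"
      let ?q = "(1 + norm (\<zeta> + t *\<^sub>R \<eta>)) / t"
      have q: "?q > 0" using t by (intro divide_pos_pos add_pos_nonneg) auto
      have a: "?q \<le> ?m * (1 + norm \<zeta>)"
      proof -
        have "norm (\<zeta> + t *\<^sub>R \<eta>) \<le> norm \<zeta> + t * norm \<eta>" using norm_triangle_ineq[of \<zeta> "t *\<^sub>R \<eta>"] t by simp
        then have "1 + norm (\<zeta> + t *\<^sub>R \<eta>) \<le> t * (1 + norm \<zeta> + norm \<eta>)"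
          using t mult_right_mono[of 1 t "1 + norm \<zeta>"] by (simp add: algebra_simps)
        also have "\<dots> \<le> t * ((1 + norm \<eta>) * (1 + norm \<zeta>))"
          using t by (intro mult_left_mono) (auto simp: algebra_simps)
        finally have "?q \<le> (1 + norm \<eta>) * (1 + norm \<zeta>)" using t by (simp add: pos_divide_le_eq mult_ac)
        also have "\<dots> \<le> ?m * (1 + norm \<zeta>)" by (intro mult_right_mono) auto
        finally show ?thesis .
      qed
      have b: "1 / ?q \<le> ?m * (1 + norm \<zeta>)"
      proof -
        have "t * norm \<eta> \<le> norm (\<zeta> + t *\<^sub>R \<eta>) + norm \<zeta>"
          using norm_triangle_ineq4[of "\<zeta> + t *\<^sub>R \<eta>" \<zeta>] t by simp
        also have "\<dots> \<le> (1 + norm (\<zeta> + t *\<^sub>R \<eta>)) * (1 + norm \<zeta>)" by (simp add: algebra_simps)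
        finally have "t / (1 + norm (\<zeta> + t *\<^sub>R \<eta>)) \<le> (1 / norm \<eta>) * (1 + norm \<zeta>)"
          using less.prems by (simp add: pos_divide_le_eq pos_le_divide_eq add_pos_nonneg mult_ac)
        also have "\<dots> \<le> ?m * (1 + norm \<zeta>)" by (intro mult_right_mono) auto
        finally show ?thesis by simp
      qed
      have "?q powi d \<le> (?m * (1 + norm \<zeta>)) ^ nat \<bar>d\<bar>"
      proof (cases "d \<ge> 0")
        case True
        then show ?thesis using power_mono[OF a] q by (simp add: power_int_def)
      next
        case False
        then have "?q powi d = (1 / ?q) ^ nat \<bar>d\<bar>" by (simp add: power_int_def divide_inverse)
        also have "\<dots> \<le> (?m * (1 + norm \<zeta>)) ^ nat \<bar>d\<bar>" by (intro power_mono b divide_nonneg_pos q) simp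
        finally show ?thesis .
      qed
      then show ?thesis by (simp add: \<kappa>_def growth_def power_mult_distrib)
    qed
    have "\<epsilon> d \<eta> *v u = 0" for u
    proof -
      define T where "T n = real (Suc n)" for n
      have T1: "T n \<ge> 1" for n by (simp add: T_def)
      have Tinf: "filterlim T at_top sequentially"
        unfolding T_def by (rule filterlim_compose[OF filterlim_real_sequentially filterlim_Suc])
      \<comment> \<open>Rescaled by t^(-d), the integrand tends pointwise to the weight times
        \<open>\<epsilon> d \<eta> *v u\<close>, while \<open>peetre\<close> dominates it.\<close>
      define g where "g n \<zeta> = (T n powi (- d)) *\<^sub>R (packet_weight \<delta> \<zeta> *s (e (\<zeta> + T n *\<^sub>R \<eta>) *v u))" for n \<zeta>
      obtain K where K: "K \<ge> 0" "\<And>(a :: complex^4^4) b. norm (a *v b) \<le> norm a * norm b * K"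
        using cmv_norm_bound by blast
      have scale: "T n powi (- d) * (1 + norm (\<zeta> + T n *\<^sub>R \<eta>)) powi d = ((1 + norm (\<zeta> + T n *\<^sub>R \<eta>)) / T n) powi d" for n \<zeta>
        by (simp add: power_int_divide_distrib power_int_minus field_simps)
      have Tp: "T n powi k > 0" for n k using T1[of n] by (intro zero_less_power_int) simp
      have bnd: "norm (T n powi (- d) *\<^sub>R e (\<zeta> + T n *\<^sub>R \<eta>)) \<le> C3 * \<kappa> * growth (nat \<bar>d\<bar>) \<zeta>" for n \<zeta>
      proof -
        have "norm (T n powi (- d) *\<^sub>R e (\<zeta> + T n *\<^sub>R \<eta>)) \<le> T n powi (- d) * (C3 * (1 + norm (\<zeta> + T n *\<^sub>R \<eta>)) powi d)"
          using C3(2) Tp[of n "- d"] by simp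
        also have "\<dots> = C3 * ((1 + norm (\<zeta> + T n *\<^sub>R \<eta>)) / T n) powi d" unfolding scale[symmetric] by simp
        also have "\<dots> \<le> C3 * (\<kappa> * growth (nat \<bar>d\<bar>) \<zeta>)" by (intro mult_left_mono peetre T1 C3)
        finally show ?thesis by simp
      qed
      have lim: "(\<lambda>n. T n powi (- d) *\<^sub>R e (\<zeta> + T n *\<^sub>R \<eta>)) \<longlonglongrightarrow> \<epsilon> d \<eta>" for \<zeta>
      proof -
        have big: "filterlim (\<lambda>n. norm (\<zeta> + T n *\<^sub>R \<eta>)) at_top sequentially"
        proof (rule filterlim_at_top_mono)
          show "filterlim (\<lambda>n. - norm \<zeta> + norm \<eta> * T n) at_top sequentially"
            by (intro filterlim_tendsto_add_at_top[OF tendsto_const]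
                filterlim_tendsto_pos_mult_at_top[OF tendsto_const _ Tinf]) (use less.prems in auto)
          show "\<forall>\<^sub>F n in sequentially. - norm \<zeta> + norm \<eta> * T n \<le> norm (\<zeta> + T n *\<^sub>R \<eta>)"
          proof (intro always_eventually allI)
            fix n
            show "- norm \<zeta> + norm \<eta> * T n \<le> norm (\<zeta> + T n *\<^sub>R \<eta>)"
              using norm_triangle_ineq4[of "\<zeta> + T n *\<^sub>R \<eta>" \<zeta>] T1[of n] by (simp add: mult.commute)
          qed
        qed
        have ev1: "\<forall>\<^sub>F n in sequentially. norm (\<zeta> + T n *\<^sub>R \<eta>) \<ge> 1"
          using big by (simp add: filterlim_at_top)
        have z1: "(\<lambda>n. T n powi (- d) *\<^sub>R (e (\<zeta> + T n *\<^sub>R \<eta>) - \<epsilon> d (\<zeta> + T n *\<^sub>R \<eta>))) \<longlonglongrightarrow> 0"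
        proof (rule Lim_null_comparison)
          show "(\<lambda>n. \<bar>C1\<bar> * (\<kappa> * growth (nat \<bar>d\<bar>) \<zeta>) * inverse (norm (\<zeta> + T n *\<^sub>R \<eta>))) \<longlonglongrightarrow> 0"
            by (intro tendsto_mult_right_zero tendsto_inverse_0_at_top[OF big])
          show "\<forall>\<^sub>F n in sequentially. norm (T n powi (- d) *\<^sub>R (e (\<zeta> + T n *\<^sub>R \<eta>) - \<epsilon> d (\<zeta> + T n *\<^sub>R \<eta>)))
              \<le> \<bar>C1\<bar> * (\<kappa> * growth (nat \<bar>d\<bar>) \<zeta>) * inverse (norm (\<zeta> + T n *\<^sub>R \<eta>))"
            using ev1
          proof eventually_elim
            case (elim n)
            let ?w = "norm (\<zeta> + T n *\<^sub>R \<eta>)"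
            have w: "?w > 0" "1 + ?w > 0" using elim by linarith+
            have pw: "(1 + ?w) powi (d - 1) = (1 + ?w) powi d * inverse (1 + ?w)"
              using w by (simp add: power_int_diff divide_inverse)
            have "norm (T n powi (- d) *\<^sub>R (e (\<zeta> + T n *\<^sub>R \<eta>) - \<epsilon> d (\<zeta> + T n *\<^sub>R \<eta>)))
                \<le> T n powi (- d) * (C1 * (1 + ?w) powi (d - 1))"
              using C1[OF elim] Tp[of n "- d"] by simp
            also have "\<dots> = C1 * (((1 + ?w) / T n) powi d * inverse (1 + ?w))"
              unfolding scale[symmetric] pw by simp
            also have "\<dots> \<le> \<bar>C1\<bar> * ((\<kappa> * growth (nat \<bar>d\<bar>) \<zeta>) * inverse ?w)"
            proof (intro mult_mono peetre T1)
              show "inverse (1 + ?w) \<le> inverse ?w" using w by (intro le_imp_inverse_le) auto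
              show "0 \<le> ((1 + ?w) / T n) powi d * inverse (1 + ?w)"
                using w T1[of n] by (intro mult_nonneg_nonneg zero_le_power_int) auto
              show "0 \<le> \<kappa> * growth (nat \<bar>d\<bar>) \<zeta>"
                using growth_ge_1[of "nat \<bar>d\<bar>" \<zeta>] by (auto simp: \<kappa>_def le_max_iff_disj intro!: mult_nonneg_nonneg zero_le_power)
            qed (use w in auto)
            finally show ?case by (simp add: mult.assoc)
          qed
        qed
        have z2: "(\<lambda>n. T n powi (- d) *\<^sub>R \<epsilon> d (\<zeta> + T n *\<^sub>R \<eta>)) \<longlonglongrightarrow> \<epsilon> d \<eta>"
        proof (rule Lim_transform_eventually)
          have "(\<lambda>n. \<eta> + inverse (T n) *\<^sub>R \<zeta>) \<longlonglongrightarrow> \<eta> + 0 *\<^sub>R \<zeta>"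
            by (intro tendsto_intros tendsto_inverse_0_at_top[OF Tinf])
          then have l: "(\<lambda>n. \<eta> + inverse (T n) *\<^sub>R \<zeta>) \<longlonglongrightarrow> \<eta>" by simp
          have "isCont (\<epsilon> d) \<eta>"
            using cont[of d] less.prems by (simp add: continuous_on_eq_continuous_at open_Compl)
          then show "(\<lambda>n. \<epsilon> d (\<eta> + inverse (T n) *\<^sub>R \<zeta>)) \<longlonglongrightarrow> \<epsilon> d \<eta>"
            using isCont_tendsto_compose l by blast
          show "\<forall>\<^sub>F n in sequentially. \<epsilon> d (\<eta> + inverse (T n) *\<^sub>R \<zeta>) = T n powi (- d) *\<^sub>R \<epsilon> d (\<zeta> + T n *\<^sub>R \<eta>)"
            using ev1
          proof eventually_elim
            case (elim n)
            have t: "T n > 0" using T1[of n] by simp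
            have eq: "\<zeta> + T n *\<^sub>R \<eta> = T n *\<^sub>R (\<eta> + inverse (T n) *\<^sub>R \<zeta>)"
              using t by (simp add: scaleR_add_right)
            have nz: "\<eta> + inverse (T n) *\<^sub>R \<zeta> \<noteq> 0" using elim eq by auto
            have "T n powi (- d) * T n powi d = 1"
              unfolding power_int_minus by (rule left_inverse) (use Tp[of n d] in linarith)
            then show ?case unfolding eq hom[OF nz t] scaleR_scaleR by simp
          qed
        qed
        from tendsto_add[OF z1 z2] show ?thesis by (simp add: scaleR_diff_right)
      qed
      have iW: "integrable lborel (packet_weight \<delta>)"
        using packet_weight_integrable[OF \<delta>, of 0]
        by (subst integrable_norm_iff[symmetric]) (auto simp: growth_def)
      have "(\<lambda>n. LINT \<zeta>|lborel. g n \<zeta>) \<longlonglongrightarrow> (LINT \<zeta>|lborel. packet_weight \<delta> \<zeta> *s (\<epsilon> d \<eta> *v u))"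
      proof (rule integral_dominated_convergence[of _ _ _
            "\<lambda>\<zeta>. (C3 * \<kappa> * norm u * K) * (growth (nat \<bar>d\<bar>) \<zeta> * norm (packet_weight \<delta> \<zeta>))"])
        show "(\<lambda>\<zeta>. packet_weight \<delta> \<zeta> *s (\<epsilon> d \<eta> *v u)) \<in> borel_measurable lborel"
          using integrable_bounded_linear[OF bounded_bilinear.bounded_linear_left[OF bounded_bilinear_cvec] iW]
          by (rule borel_measurable_integrable)
        show "g n \<in> borel_measurable lborel" for n
          unfolding g_def[abs_def] using borel_measurable_integrable[OF osc_shift(2)[OF \<delta> e]]
          by (intro borel_measurable_scaleR borel_measurable_const)
        show "integrable lborel (\<lambda>\<zeta>. (C3 * \<kappa> * norm u * K) * (growth (nat \<bar>d\<bar>) \<zeta> * norm (packet_weight \<delta> \<zeta>)))"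
          by (intro integrable_mult_right packet_weight_integrable \<delta>)
        have geq: "g n \<zeta> = packet_weight \<delta> \<zeta> *s ((T n powi (- d) *\<^sub>R e (\<zeta> + T n *\<^sub>R \<eta>)) *v u)" for n \<zeta>
          unfolding g_def
          by (simp add: bounded_bilinear.scaleR_right[OF bounded_bilinear_cvec] bounded_bilinear.scaleR_left[OF bounded_bilinear_cmv])
        show "AE \<zeta> in lborel. (\<lambda>n. g n \<zeta>) \<longlonglongrightarrow> packet_weight \<delta> \<zeta> *s (\<epsilon> d \<eta> *v u)"
          unfolding geq
          by (intro AE_I2 bounded_bilinear.tendsto[OF bounded_bilinear_cvec] bounded_bilinear.tendsto[OF bounded_bilinear_cmv]
              tendsto_const lim)
        show "AE \<zeta> in lborel. norm (g n \<zeta>) \<le> (C3 * \<kappa> * norm u * K) * (growth (nat \<bar>d\<bar>) \<zeta> * norm (packet_weight \<delta> \<zeta>))" for n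
        proof (intro AE_I2)
          fix \<zeta>
          have "norm ((T n powi (- d) *\<^sub>R e (\<zeta> + T n *\<^sub>R \<eta>)) *v u) \<le> (C3 * \<kappa> * growth (nat \<bar>d\<bar>) \<zeta>) * norm u * K"
            by (rule order_trans[OF K(2)]) (intro mult_right_mono bnd K norm_ge_zero)
          then have "norm (g n \<zeta>) \<le> norm (packet_weight \<delta> \<zeta>) * ((C3 * \<kappa> * growth (nat \<bar>d\<bar>) \<zeta>) * norm u * K)"
            unfolding geq norm_cvec by (intro mult_left_mono) auto
          then show "norm (g n \<zeta>) \<le> (C3 * \<kappa> * norm u * K) * (growth (nat \<bar>d\<bar>) \<zeta> * norm (packet_weight \<delta> \<zeta>))"
            by (simp only: mult_ac)
        qed
      qed
      moreover have "(\<lambda>n. LINT \<zeta>|lborel. g n \<zeta>) \<longlonglongrightarrow> 0"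
      proof -
        \<comment> \<open>One power more than |d|: the factor t^(-d) is at most t^|d|, so the
          rescaled integral is O(1/t).\<close>
        obtain C where C: "\<And>t. \<bar>t\<bar> ^ (nat \<bar>d\<bar> + 1) *
            norm (LINT \<zeta>|lborel. packet_weight \<delta> \<zeta> *s (e (\<zeta> + t *\<^sub>R \<eta>) *v u)) \<le> C"
          using decay[OF less.prems] by blast
        show ?thesis
        proof (rule Lim_null_comparison)
          show "(\<lambda>n. C * inverse (T n)) \<longlonglongrightarrow> 0"
            by (intro tendsto_mult_right_zero tendsto_inverse_0_at_top[OF Tinf])
          show "\<forall>\<^sub>F n in sequentially. norm (LINT \<zeta>|lborel. g n \<zeta>) \<le> C * inverse (T n)"
          proof (intro always_eventually allI)
            fix n
            let ?I = "norm (LINT \<zeta>|lborel. packet_weight \<delta> \<zeta> *s (e (\<zeta> + T n *\<^sub>R \<eta>) *v u))"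
            have t: "T n > 0" using T1[of n] by simp
            have "T n powi (- d) \<le> T n ^ nat \<bar>d\<bar>"
            proof (cases "d \<ge> 0")
              case True
              then have "T n powi d \<ge> 1" using one_le_power[OF T1, of n "nat d"] by (simp add: power_int_def)
              then have "T n powi (- d) \<le> 1" by (simp add: power_int_minus inverse_le_1_iff)
              also have "1 \<le> T n ^ nat \<bar>d\<bar>" using T1[of n] by (rule one_le_power)
              finally show ?thesis .
            qed (simp add: power_int_def)
            then have "T n powi (- d) * ?I \<le> T n ^ nat \<bar>d\<bar> * ?I" by (rule mult_right_mono) simp
            also have "\<dots> = (\<bar>T n\<bar> ^ (nat \<bar>d\<bar> + 1) * ?I) * inverse (T n)" using t by simp
            also have "\<dots> \<le> C * inverse (T n)" using t by (intro mult_right_mono C) auto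
            finally show "norm (LINT \<zeta>|lborel. g n \<zeta>) \<le> C * inverse (T n)"
              unfolding g_def using Tp[of n "- d"] by simp
          qed
        qed
      qed
      ultimately have "(LINT \<zeta>|lborel. packet_weight \<delta> \<zeta> *s (\<epsilon> d \<eta> *v u)) = 0"
        using LIMSEQ_unique by blast
      moreover have "(LINT \<zeta>|lborel. packet_weight \<delta> \<zeta> *s (\<epsilon> d \<eta> *v u)) = of_real ((2 * pi) ^ 4 * bump \<delta> 0 ^ 4) *s (\<epsilon> d \<eta> *v u)"
        unfolding integral_packet_weight[OF \<delta>, symmetric]
        by (rule integral_bounded_linear[OF bounded_bilinear.bounded_linear_left[OF bounded_bilinear_cvec] iW])
      ultimately show ?thesis
        using bump_0[OF \<delta>] by (auto simp: vec_eq_iff)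
    qed
    then show ?thesis by (simp add: matrix_eq)
  qed
qed

section \<open>Derivatives of quantized symbols and smooth kernels along lines\<close>

lemma continuous_line_image_compact:
  fixes x :: "'a::real_normed_vector"
  shows "compact ((\<lambda>r. x + r *\<^sub>R w) ` {-\<delta>..\<delta>::real})"
  by (intro compact_continuous_image continuous_intros compact_Icc)

lemma line_in_open:
  fixes x :: "'a::real_normed_vector"
  assumes "open V" "x \<in> V"
  obtains \<delta> where "\<delta> > 0" "\<And>r. \<bar>r\<bar> \<le> \<delta> \<Longrightarrow> x + r *\<^sub>R w \<in> V"
proof -
  obtain \<epsilon> where \<epsilon>: "\<epsilon> > 0" "ball x \<epsilon> \<subseteq> V" using assms open_contains_ball by blast
  have "x + r *\<^sub>R w \<in> V" if "\<bar>r\<bar> \<le> \<epsilon> / (1 + norm w)" for r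
  proof -
    have "norm (r *\<^sub>R w) \<le> \<epsilon> / (1 + norm w) * norm w"  using mult_right_mono[OF that norm_ge_zero[of w]] by simp
    also have "\<dots> < \<epsilon>" using \<epsilon>(1) by (simp add: field_simps add_pos_nonneg)
    finally have "x + r *\<^sub>R w \<in> ball x \<epsilon>" by (simp add: dist_norm)
    then show ?thesis using \<epsilon>(2) by blast
  qed
  then show thesis using that[of "\<epsilon> / (1 + norm w)"] \<epsilon>(1) by (simp add: add_pos_nonneg)
qed

lemma dird_axis_expand:
  fixes q :: symbol
  assumes "q differentiable (at (x, \<xi>))"
  shows "dird (w, 0) q (x, \<xi>) = (\<Sum>j\<in>UNIV. (w $ j) *\<^sub>R dird (axis j 1, 0) q (x, \<xi>))"
proof -
  have "(w, 0) = (\<Sum>j\<in>UNIV. (w $ j) *\<^sub>R (axis j 1, 0 :: real^4))"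
    using basis_expansion[of w] by (auto simp: prod_eq_iff fst_sum snd_sum scalar_mult_eq_scaleR)
  then show ?thesis
    using linear_sum[OF dird_linear[OF assms], of "\<lambda>j. (w $ j) *\<^sub>R (axis j 1, 0)" UNIV]
    by (simp only: dird_scaleR[OF assms])
qed

text \<open>\<open>symbol_bound\<close> speaks of coordinate directions only; linearity of the
  derivative transfers the estimate to an arbitrary direction w.\<close>

lemma symbol_bound_dird:
  fixes q :: symbol
  assumes "symbol_bound m V R q" "compact K" "K \<subseteq> V"
    and d: "\<And>x \<xi>. x \<in> K \<Longrightarrow> norm \<xi> \<ge> R \<Longrightarrow> q differentiable (at (x, \<xi>))"
  shows "\<exists>C. \<forall>x\<in>K. \<forall>\<xi>. norm \<xi> \<ge> R \<longrightarrow> norm (dird (w, 0) q (x, \<xi>)) \<le> C * (1 + norm \<xi>) powi m"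
proof -
  have "\<exists>C. \<forall>x\<in>K. \<forall>\<xi>. norm \<xi> \<ge> R \<longrightarrow> norm (dird (axis j 1, 0) q (x, \<xi>)) \<le> C * (1 + norm \<xi>) powi m" for j
    using assms(1)[unfolded symbol_bound_def, rule_format, of K "[j]" "[]"] assms(2,3)
    by (simp add: dirds_Cons)
  then have "\<forall>j. \<exists>C. \<forall>x\<in>K. \<forall>\<xi>. norm \<xi> \<ge> R \<longrightarrow> norm (dird (axis j 1, 0) q (x, \<xi>)) \<le> C * (1 + norm \<xi>) powi m" by blast
  from choice[OF this] obtain C where C0: "\<forall>j. \<forall>x\<in>K. \<forall>\<xi>. norm \<xi> \<ge> R \<longrightarrow>
      norm (dird (axis j 1, 0) q (x, \<xi>)) \<le> C j * (1 + norm \<xi>) powi m" ..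
  note C = C0[rule_format]
  have "norm (dird (w, 0) q (x, \<xi>)) \<le> (\<Sum>j\<in>UNIV. \<bar>w $ j\<bar> * C j) * (1 + norm \<xi>) powi m"
    if "x \<in> K" "norm \<xi> \<ge> R" for x \<xi>
  proof -
    have "norm (dird (w, 0) q (x, \<xi>)) \<le> (\<Sum>j\<in>UNIV. norm ((w $ j) *\<^sub>R dird (axis j 1, 0) q (x, \<xi>)))"
      by (subst dird_axis_expand[OF d[OF that]]) (rule norm_sum)
    also have "\<dots> \<le> (\<Sum>j\<in>UNIV. \<bar>w $ j\<bar> * (C j * (1 + norm \<xi>) powi m))"
      using C[OF that] by (intro sum_mono) (simp add: mult_left_mono)
    finally show ?thesis by (simp add: sum_distrib_right mult.assoc)
  qed
  then show ?thesis by blast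
qed

lemma symbol_bound_plain:
  assumes "symbol_bound m V R q" "compact K" "K \<subseteq> V"
  shows "\<exists>C. \<forall>x\<in>K. \<forall>\<xi>. norm \<xi> \<ge> R \<longrightarrow> norm (q (x, \<xi>)) \<le> C * (1 + norm \<xi>) powi m"
  using assms(1)[unfolded symbol_bound_def, rule_format, of K "[]" "[]"] assms(2,3) by simp

lemma powi_bound_growth:
  assumes "a \<le> C * (1 + norm \<xi>) powi m"
  shows "a \<le> \<bar>C\<bar> * growth (nat \<bar>m\<bar>) \<xi>"
proof -
  have "C * (1 + norm \<xi>) powi m \<le> \<bar>C\<bar> * growth (nat \<bar>m\<bar>) \<xi>"
    by (intro mult_mono powi_le_growth zero_le_power_int) auto
  then show ?thesis using assms by linarith
qed

lemma continuous_on_snd_slice: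
  assumes "smooth_on (V \<times> T) f" "x \<in> V"
  shows "continuous_on T (\<lambda>\<xi>. f (x, \<xi>))"
  by (rule continuous_on_compose2[OF smooth_on_imp_continuous_on[OF assms(1)]])
    (use assms(2) in \<open>auto intro!: continuous_intros\<close>)

lemma symbol_poly_bdd:
  assumes q: "symbol_class m V q" and x: "x \<in> V"
  shows "poly_bdd (\<lambda>\<xi>. q (x, \<xi>))" "poly_bdd (\<lambda>\<xi>. dird (w, 0) q (x, \<xi>))"
proof -
  have s: "smooth_on (V \<times> UNIV) q" and b: "symbol_bound m V 0 q" using q by (auto simp: symbol_class_def)
  obtain C where C: "\<And>\<xi>. norm (q (x, \<xi>)) \<le> C * (1 + norm \<xi>) powi m"
    using symbol_bound_plain[OF b, of "{x}"] x by auto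
  obtain D where D: "\<And>\<xi>. norm (dird (w, 0) q (x, \<xi>)) \<le> D * (1 + norm \<xi>) powi m"
    using symbol_bound_dird[OF b, of "{x}" w] x smooth_onD_diff[OF s] by auto
  show "poly_bdd (\<lambda>\<xi>. q (x, \<xi>))"
    by (rule poly_bddI[OF continuous_on_snd_slice[OF s x] powi_bound_growth[OF C]])
  show "poly_bdd (\<lambda>\<xi>. dird (w, 0) q (x, \<xi>))"
    by (rule poly_bddI[OF continuous_on_snd_slice[OF smooth_on_dird[OF s] x] powi_bound_growth[OF D]])
qed

lemma poly_bdd_mat_mult:
  assumes "poly_bdd A"
  shows "poly_bdd (\<lambda>\<xi>. mat (\<i> * of_real (w \<bullet> \<xi>)) ** A \<xi>)"
proof -
  obtain C N where C: "\<And>\<xi>. norm (A \<xi>) \<le> C * growth N \<xi>" and c: "continuous_on UNIV A"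
    using assms unfolding poly_bdd_def by blast
  have "norm (mat (\<i> * of_real (w \<bullet> \<xi>)) ** A \<xi>) \<le> (norm w * C) * growth (Suc N) \<xi>" for \<xi>
  proof -
    have "norm (mat (\<i> * of_real (w \<bullet> \<xi>)) ** A \<xi>) = \<bar>w \<bullet> \<xi>\<bar> * norm (A \<xi>)"
      by (simp add: norm_mat_mult norm_mult)
    also have "\<dots> \<le> (norm w * (1 + norm \<xi>)) * (C * growth N \<xi>)"
    proof (intro mult_mono C)
      have "\<bar>w \<bullet> \<xi>\<bar> \<le> norm w * norm \<xi>" by (rule Cauchy_Schwarz_ineq2)
      also have "\<dots> \<le> norm w * (1 + norm \<xi>)" by (intro mult_left_mono) auto
      finally show "\<bar>w \<bullet> \<xi>\<bar> \<le> norm w * (1 + norm \<xi>)" .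
    qed auto
    finally show ?thesis by (simp add: growth_def mult_ac)
  qed
  then show ?thesis using c by (intro poly_bddI continuous_intros) auto
qed

lemma mat_mult_cvec: "mat c *v (v :: complex^'n::finite) = c *s v"
  by (simp add: vec_eq_iff matrix_vector_mult_def mat_def if_distrib if_distribR cong: if_cong)

text \<open>Under the integral the exponential contributes i(w.\<xi>) q and the base variable
  contributes the derivative of q; for a first order operator this is the whole composition formula.
  The base points run over a compact segment so that the symbol estimates are uniform.\<close>

lemma quantize_line:
  assumes V: "open V" "x \<in> V" and q: "symbol_class m V q" and \<delta>: "\<delta> > 0"
  shows "((\<lambda>r. quantize q (packet \<delta> x \<eta> u) (x + r *\<^sub>R w)) has_vector_derivative
    (1 / (2 * pi) ^ 4) *\<^sub>R osc \<delta> x \<eta> u (\<lambda>\<xi>. mat (\<i> * of_real (w \<bullet> \<xi>)) ** q (x, \<xi>) + dird (w, 0) q (x, \<xi>))) (at 0)"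
proof -
  have s: "smooth_on (V \<times> UNIV) q" and b: "symbol_bound m V 0 q" using q by (auto simp: symbol_class_def)
  obtain \<rho> where \<rho>: "\<rho> > 0" "\<And>r. \<bar>r\<bar> \<le> \<rho> \<Longrightarrow> x + r *\<^sub>R w \<in> V" using line_in_open[OF V] by blast
  let ?K = "(\<lambda>r. x + r *\<^sub>R w) ` {-\<rho>..\<rho>}"
  have K: "compact ?K" "?K \<subseteq> V" using continuous_line_image_compact \<rho>(2) by (auto simp: abs_le_iff)
  have xr: "x + r *\<^sub>R w \<in> ?K" if "\<bar>r\<bar> < \<rho>" for r using that by (auto simp: abs_le_iff intro!: imageI)
  obtain C where C: "\<And>z \<xi>. z \<in> ?K \<Longrightarrow> norm (q (z, \<xi>)) \<le> C * (1 + norm \<xi>) powi m"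
    using symbol_bound_plain[OF b K] by auto
  obtain D where D: "\<And>z \<xi>. z \<in> ?K \<Longrightarrow> norm (dird (w, 0) q (z, \<xi>)) \<le> D * (1 + norm \<xi>) powi m"
  proof -
    have "\<exists>C. \<forall>z\<in>?K. \<forall>\<xi>. norm \<xi> \<ge> 0 \<longrightarrow> norm (dird (w, 0) q (z, \<xi>)) \<le> C * (1 + norm \<xi>) powi m"
      by (rule symbol_bound_dird[OF b K]) (rule smooth_onD_diff[OF s], use K(2) in blast)
    then show thesis using that by fastforce
  qed
  let ?f = "fourier (packet \<delta> x \<eta> u)"
  let ?Q = "\<lambda>r \<xi>. mat (\<i> * of_real (w \<bullet> \<xi>)) ** q (x + r *\<^sub>R w, \<xi>) + dird (w, 0) q (x + r *\<^sub>R w, \<xi>)"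
  obtain L where L: "L \<ge> 0" "\<And>(a :: complex^4^4) b. norm (a *v b) \<le> norm a * norm b * L"
    using cmv_norm_bound by blast
  \<comment> \<open>One power more than |m|, for the factor w.\<xi>.\<close>
  define N where "N = Suc (nat \<bar>m\<bar>)"
  have bQ: "norm (?Q r \<xi>) \<le> (norm w * \<bar>C\<bar> + \<bar>D\<bar>) * growth N \<xi>" if r: "\<bar>r\<bar> < \<rho>" for r \<xi>
  proof -
    let ?g = "growth (nat \<bar>m\<bar>) \<xi>"
    have "norm (?Q r \<xi>) \<le> \<bar>w \<bullet> \<xi>\<bar> * norm (q (x + r *\<^sub>R w, \<xi>)) + norm (dird (w, 0) q (x + r *\<^sub>R w, \<xi>))"
      by (rule order_trans[OF norm_triangle_ineq]) (simp add: norm_mat_mult norm_mult)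
    also have "\<dots> \<le> (norm w * (1 + norm \<xi>)) * (\<bar>C\<bar> * ?g) + \<bar>D\<bar> * ?g"
    proof (intro add_mono mult_mono powi_bound_growth[OF C[OF xr[OF r]]] powi_bound_growth[OF D[OF xr[OF r]]])
      have "\<bar>w \<bullet> \<xi>\<bar> \<le> norm w * norm \<xi>" by (rule Cauchy_Schwarz_ineq2)
      also have "\<dots> \<le> norm w * (1 + norm \<xi>)" by (intro mult_left_mono) auto
      finally show "\<bar>w \<bullet> \<xi>\<bar> \<le> norm w * (1 + norm \<xi>)" .
    qed auto
    also have "\<dots> \<le> (norm w * \<bar>C\<bar>) * growth N \<xi> + \<bar>D\<bar> * growth N \<xi>"
    proof (intro add_mono)
      show "\<bar>D\<bar> * ?g \<le> \<bar>D\<bar> * growth N \<xi>" by (intro mult_left_mono growth_mono) (auto simp: N_def)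
    qed (simp add: N_def growth_def mult_ac)
    finally show ?thesis by (simp add: algebra_simps)
  qed
  have pbq: "poly_bdd (\<lambda>\<xi>. q (x + r *\<^sub>R w, \<xi>))" "poly_bdd (\<lambda>\<xi>. dird (w, 0) q (x + r *\<^sub>R w, \<xi>))" if "\<bar>r\<bar> < \<rho>" for r
    using symbol_poly_bdd[OF q] \<rho>(2)[of r] that by auto
  have "((\<lambda>r. LINT \<xi>|lborel. cis ((x + r *\<^sub>R w) \<bullet> \<xi>) *s (q (x + r *\<^sub>R w, \<xi>) *v ?f \<xi>)) has_vector_derivative
     (LINT \<xi>|lborel. cis ((x + 0 *\<^sub>R w) \<bullet> \<xi>) *s (?Q 0 \<xi> *v ?f \<xi>))) (at 0)"
  proof (rule has_vector_derivative_integral[OF \<rho>(1), of _ _ _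
        "\<lambda>\<xi>. ((norm w * \<bar>C\<bar> + \<bar>D\<bar>) * L) * (growth N \<xi> * norm (?f \<xi>))"])
    fix r :: real and \<xi> assume r: "\<bar>r\<bar> < \<rho>"
    have "q differentiable (at ((x, \<xi>) + r *\<^sub>R (w, 0)))"
      using \<rho>(2)[of r] r by (intro smooth_onD_diff[OF s]) auto
    from dird_line[OF this]
    have 1: "((\<lambda>s. q (x + s *\<^sub>R w, \<xi>)) has_vector_derivative dird (w, 0) q (x + r *\<^sub>R w, \<xi>)) (at r)" by simp
    have "((\<lambda>s. (x + s *\<^sub>R w) \<bullet> \<xi>) has_derivative (\<lambda>t. t * (w \<bullet> \<xi>))) (at r)"
      by (auto intro!: derivative_eq_intros simp: inner_add_left)
    from has_derivative_cis[OF this]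
    have 2: "((\<lambda>s. cis ((x + s *\<^sub>R w) \<bullet> \<xi>)) has_vector_derivative (w \<bullet> \<xi>) *\<^sub>R (\<i> * cis ((x + r *\<^sub>R w) \<bullet> \<xi>))) (at r)"
      by (simp add: has_vector_derivative_def)
    have 3: "((\<lambda>s. q (x + s *\<^sub>R w, \<xi>) *v ?f \<xi>) has_vector_derivative dird (w, 0) q (x + r *\<^sub>R w, \<xi>) *v ?f \<xi>) (at r)"
      by (rule bounded_linear.has_vector_derivative[OF bounded_bilinear.bounded_linear_left[OF bounded_bilinear_cmv] 1])
    from bounded_bilinear.has_vector_derivative[OF bounded_bilinear_cvec 2 3]
    have "((\<lambda>s. cis ((x + s *\<^sub>R w) \<bullet> \<xi>) *s (q (x + s *\<^sub>R w, \<xi>) *v ?f \<xi>)) has_vector_derivative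
        cis ((x + r *\<^sub>R w) \<bullet> \<xi>) *s (dird (w, 0) q (x + r *\<^sub>R w, \<xi>) *v ?f \<xi>) +
        ((w \<bullet> \<xi>) *\<^sub>R (\<i> * cis ((x + r *\<^sub>R w) \<bullet> \<xi>))) *s (q (x + r *\<^sub>R w, \<xi>) *v ?f \<xi>)) (at r)" .
    also have "cis ((x + r *\<^sub>R w) \<bullet> \<xi>) *s (dird (w, 0) q (x + r *\<^sub>R w, \<xi>) *v ?f \<xi>) +
        ((w \<bullet> \<xi>) *\<^sub>R (\<i> * cis ((x + r *\<^sub>R w) \<bullet> \<xi>))) *s (q (x + r *\<^sub>R w, \<xi>) *v ?f \<xi>)
        = cis ((x + r *\<^sub>R w) \<bullet> \<xi>) *s (?Q r \<xi> *v ?f \<xi>)"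
      by (simp add: matrix_vector_mult_add_rdistrib vector_add_ldistrib mat_mult_cvec vector_smult_assoc
          scaleR_conv_of_real mult_ac flip: matrix_vector_mul_assoc)
    finally show "((\<lambda>s. cis ((x + s *\<^sub>R w) \<bullet> \<xi>) *s (q (x + s *\<^sub>R w, \<xi>) *v ?f \<xi>)) has_vector_derivative
        cis ((x + r *\<^sub>R w) \<bullet> \<xi>) *s (?Q r \<xi> *v ?f \<xi>)) (at r)" .
    have "norm (?Q r \<xi> *v ?f \<xi>) \<le> ((norm w * \<bar>C\<bar> + \<bar>D\<bar>) * growth N \<xi>) * norm (?f \<xi>) * L"
      by (rule order_trans[OF L(2)]) (intro mult_right_mono bQ r L norm_ge_zero)
    then show "norm (cis ((x + r *\<^sub>R w) \<bullet> \<xi>) *s (?Q r \<xi> *v ?f \<xi>))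
        \<le> ((norm w * \<bar>C\<bar> + \<bar>D\<bar>) * L) * (growth N \<xi> * norm (?f \<xi>))"
      by (simp add: norm_cvec mult_ac)
  next
    fix r :: real assume r: "\<bar>r\<bar> < \<rho>"
    show "integrable lborel (\<lambda>\<xi>. cis ((x + r *\<^sub>R w) \<bullet> \<xi>) *s (q (x + r *\<^sub>R w, \<xi>) *v ?f \<xi>))"
      by (rule osc_integrable[OF \<delta> pbq(1)[OF r]])
  next
    show "(\<lambda>\<xi>. cis ((x + 0 *\<^sub>R w) \<bullet> \<xi>) *s (?Q 0 \<xi> *v ?f \<xi>)) \<in> borel_measurable lborel"
      by (rule borel_measurable_integrable[OF osc_integrable[OF \<delta>]])
        (intro poly_bdd_add poly_bdd_mat_mult pbq, use \<rho> in auto)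
    show "integrable lborel (\<lambda>\<xi>. ((norm w * \<bar>C\<bar> + \<bar>D\<bar>) * L) * (growth N \<xi> * norm (?f \<xi>)))"
      by (intro integrable_mult_right fourier_packet_integrable \<delta>)
  qed
  from bounded_linear.has_vector_derivative[OF bounded_linear_scaleR_right this, of "1 / (2 * pi) ^ 4"]
  show ?thesis
    unfolding quantize_def osc_def by simp
qed

lemma integrable_on_compact:
  fixes f :: "'a::euclidean_space \<Rightarrow> 'b::{banach, second_countable_topology}"
  assumes "compact K" "continuous_on K f" "\<And>y. y \<notin> K \<Longrightarrow> f y = 0"
  shows "integrable lborel f"
proof -
  have "integrable lborel (\<lambda>x. indicator K x *\<^sub>R f x)"
    by (rule borel_integrable_compact) (use assms in auto)
  moreover have "(\<lambda>x. indicator K x *\<^sub>R f x) = f"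
    using assms(3) by (auto simp: indicator_def fun_eq_iff)
  ultimately show ?thesis by simp
qed

text \<open>Counterpart of \<open>quantize_line\<close> for the smoothing part: continuity on the
  compact product of the segment with K gives a constant bound.\<close>

lemma kernel_line:
  fixes k :: symbol
  assumes V: "open V" "x \<in> V" and k: "smooth_on (V \<times> V) k" and K: "compact K" "K \<subseteq> V"
    and v: "continuous_on UNIV v" "\<And>y. y \<notin> K \<Longrightarrow> v y = 0"
  shows "((\<lambda>r. LINT y|lborel. k (x + r *\<^sub>R w, y) *v v y) has_vector_derivative
    (LINT y|lborel. dird (w, 0) k (x, y) *v v y)) (at 0)"
proof -
  obtain \<rho> where \<rho>: "\<rho> > 0" "\<And>r. \<bar>r\<bar> \<le> \<rho> \<Longrightarrow> x + r *\<^sub>R w \<in> V" using line_in_open[OF V] by blast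
  let ?L = "(\<lambda>r. x + r *\<^sub>R w) ` {-\<rho>..\<rho>}"
  have L: "compact ?L" "?L \<subseteq> V" using continuous_line_image_compact \<rho>(2) by (auto simp: abs_le_iff)
  have dk: "smooth_on (V \<times> V) (dird (w, 0) k)" by (rule smooth_on_dird[OF k])
  have cv: "continuous_on K v" using v(1) continuous_on_subset by blast
  have cont: "continuous_on K (\<lambda>y. f (z, y) *v v y)" if f: "smooth_on (V \<times> V) f" and z: "z \<in> V" for f :: symbol and z
    by (intro continuous_intros cv continuous_on_subset[OF continuous_on_snd_slice[OF f z] K(2)])
  have "compact ((\<lambda>(z, y). dird (w, 0) k (z, y) *v v y) ` (?L \<times> K))"
  proof (rule compact_continuous_image[OF _ compact_Times[OF L(1) K(1)]])
    have "continuous_on (?L \<times> K) (dird (w, 0) k)"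
      by (rule continuous_on_subset[OF smooth_on_imp_continuous_on[OF dk]]) (use L K in auto)
    then show "continuous_on (?L \<times> K) (\<lambda>(z, y). dird (w, 0) k (z, y) *v v y)"
      unfolding case_prod_beta
      by (intro continuous_intros) (auto intro!: continuous_intros continuous_on_compose2[OF v(1)])
  qed
  from compact_imp_bounded[OF this]
  obtain B where B: "\<And>z y. z \<in> ?L \<Longrightarrow> y \<in> K \<Longrightarrow> norm (dird (w, 0) k (z, y) *v v y) \<le> B"
    unfolding bounded_iff by fastforce
  have "((\<lambda>r. LINT y|lborel. k (x + r *\<^sub>R w, y) *v v y) has_vector_derivative
    (LINT y|lborel. dird (w, 0) k (x + 0 *\<^sub>R w, y) *v v y)) (at 0)"
  proof (rule has_vector_derivative_integral[OF \<rho>(1), of _ _ _ "\<lambda>y. indicator K y *\<^sub>R \<bar>B\<bar>"])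
    fix r :: real and y assume r: "\<bar>r\<bar> < \<rho>"
    show "((\<lambda>s. k (x + s *\<^sub>R w, y) *v v y) has_vector_derivative dird (w, 0) k (x + r *\<^sub>R w, y) *v v y) (at r)"
    proof (cases "y \<in> K")
      case True
      then have "k differentiable (at ((x, y) + r *\<^sub>R (w, 0)))"
        using \<rho>(2)[of r] r K by (intro smooth_onD_diff[OF k]) auto
      from dird_line[OF this]
      have "((\<lambda>s. k (x + s *\<^sub>R w, y)) has_vector_derivative dird (w, 0) k (x + r *\<^sub>R w, y)) (at r)" by simp
      then show ?thesis
        by (rule bounded_linear.has_vector_derivative[OF bounded_bilinear.bounded_linear_left[OF bounded_bilinear_cmv]])
    qed (simp add: v(2))
    show "norm (dird (w, 0) k (x + r *\<^sub>R w, y) *v v y) \<le> indicator K y *\<^sub>R \<bar>B\<bar>"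
    proof (cases "y \<in> K")
      case True
      have "norm (dird (w, 0) k (x + r *\<^sub>R w, y) *v v y) \<le> B"
        by (rule B[OF _ True]) (use r in \<open>auto intro!: imageI\<close>)
      then show ?thesis using True by simp
    qed (simp add: v(2))
  next
    fix r :: real assume r: "\<bar>r\<bar> < \<rho>"
    show "integrable lborel (\<lambda>y. k (x + r *\<^sub>R w, y) *v v y)"
      by (rule integrable_on_compact[OF K(1) cont[OF k]]) (use \<rho>(2)[of r] r v(2) in auto)
  next
    have "integrable lborel (\<lambda>y. dird (w, 0) k (x + 0 *\<^sub>R w, y) *v v y)"
      by (rule integrable_on_compact[OF K(1) cont[OF dk]]) (use V v(2) in auto)
    then show "(\<lambda>y. dird (w, 0) k (x + 0 *\<^sub>R w, y) *v v y) \<in> borel_measurable lborel"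
      by (rule borel_measurable_integrable)
    show "integrable lborel (\<lambda>y. indicator K y *\<^sub>R \<bar>B\<bar>)"
      by (rule borel_integrable_compact) (use K in auto)
  qed
  then show ?thesis by simp
qed

text \<open>k is smooth on V only. Multiplied by the envelope, which vanishes off a ball inside V,
  it extends by zero to a smooth function on the whole space, to which
  \<open>oscillatory_decay\<close> applies componentwise.\<close>

lemma packet_pairing_decay:
  assumes V: "open V" and k: "smooth_on V k" and \<delta>: "\<delta> > 0" and B: "cball x (4 * \<delta>) \<subseteq> V" and \<eta>: "\<eta> \<noteq> 0"
  shows "\<exists>C. \<forall>t. \<bar>t\<bar> ^ N * norm (LINT y|lborel. (k y :: complex^4^4) *v packet \<delta> x (t *\<^sub>R \<eta>) u y) \<le> C"
proof -
  let ?\<chi> = "\<lambda>y::real^4. \<Prod>j\<in>UNIV. bumpc \<delta> (y $ j - x $ j)"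
  let ?F = "\<lambda>y. k y *v (?\<chi> y *s u)"
  let ?K = "cball x (4 * \<delta>)"
  have z: "?F y = 0" if "y \<notin> ?K" for y
    unfolding packet_support(1)[OF \<delta> that] by simp
  have sF: "smooth_on UNIV ?F"
  proof -
    have "smooth_on V ?F"
      by (intro smooth_on_bilinear[OF V bounded_bilinear_cmv] k smooth_on_bilinear[OF V bounded_bilinear_cvec] smooth_on_const
          smooth_on_subset[OF smooth_on_packet_scalar]) auto
    moreover have "smooth_on (- ?K) ?F"
      by (rule smooth_on_cong[of _ "\<lambda>y. 0"]) (use z in auto)
    ultimately have "smooth_on (V \<union> - ?K) ?F" by (rule smooth_on_Un)
    then show ?thesis by (rule smooth_on_subset) (use B in auto)
  qed
  have e: "k y *v packet \<delta> x (t *\<^sub>R \<eta>) u y = cis (y \<bullet> (t *\<^sub>R \<eta>)) *s ?F y" for t y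
    unfolding packet_def vector_scalar_commute vector_smult_assoc by (simp only: mult.commute)
  have "\<exists>C. \<forall>t. \<bar>t\<bar> ^ N * norm (LINT y|lborel. ?F y $ i * cis (y \<bullet> (t *\<^sub>R \<eta>))) \<le> C" for i
    by (rule oscillatory_decay[OF _ \<eta>, of ?K]) (use z smooth_on_nth[OF open_UNIV sF] in auto)
  then have "\<forall>i. \<exists>C. \<forall>t. \<bar>t\<bar> ^ N * norm (LINT y|lborel. ?F y $ i * cis (y \<bullet> (t *\<^sub>R \<eta>))) \<le> C" by (rule allI)
  from choice[OF this] obtain C where C0: "\<forall>i. \<forall>t. \<bar>t\<bar> ^ N * norm (LINT y|lborel. ?F y $ i * cis (y \<bullet> (t *\<^sub>R \<eta>))) \<le> C i" ..
  note C = C0[rule_format]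
  have "\<bar>t\<bar> ^ N * norm (LINT y|lborel. k y *v packet \<delta> x (t *\<^sub>R \<eta>) u y) \<le> (\<Sum>i\<in>UNIV. C i)" for t
  proof -
    let ?I = "LINT y|lborel. k y *v packet \<delta> x (t *\<^sub>R \<eta>) u y"
    have i: "integrable lborel (\<lambda>y. k y *v packet \<delta> x (t *\<^sub>R \<eta>) u y)"
      unfolding e by (rule integrable_compact_support[of ?K])
        (auto intro!: continuous_intros smooth_on_imp_continuous_on[OF sF] simp del: inner_scaleR_right simp: z)
    have c: "?I $ j = (LINT y|lborel. ?F y $ j * cis (y \<bullet> (t *\<^sub>R \<eta>)))" for j
      using integral_bounded_linear[OF bounded_linear_vec_nth i, of j]
      unfolding e vector_smult_component by (simp only: mult.commute)
    have "norm ?I \<le> (\<Sum>j\<in>UNIV. norm (?I $ j))" unfolding norm_vec_def by (rule L2_set_le_sum) simp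
    then have "\<bar>t\<bar> ^ N * norm ?I \<le> (\<Sum>j\<in>UNIV. \<bar>t\<bar> ^ N * norm (?I $ j))"
      unfolding sum_distrib_left[symmetric] by (rule mult_left_mono) simp
    also have "\<dots> \<le> (\<Sum>j\<in>UNIV. C j)" unfolding c by (intro sum_mono C)
    finally show ?thesis .
  qed
  then show ?thesis by blast
qed

section \<open>Symbol equations for a parametrix\<close>

lemma dird_slice_line:
  fixes q :: symbol
  assumes "q differentiable (at (x, \<xi>))"
  shows "((\<lambda>r. q (x + r *\<^sub>R w, \<xi>)) has_vector_derivative dird (w, 0) q (x, \<xi>)) (at 0)"
  using dird_line[of q "(x, \<xi>)" 0 "(w, 0)"] assms by simp

lemma has_vector_derivative_line_cong:
  assumes V: "open V" "x \<in> V" and eq: "\<And>z. z \<in> V \<Longrightarrow> f z = g z"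
    and D: "((\<lambda>r. f (x + r *\<^sub>R w)) has_vector_derivative d) (at 0)"
  shows "((\<lambda>r. g (x + r *\<^sub>R (w :: 'a::real_normed_vector))) has_vector_derivative d) (at 0)"
proof -
  have o: "open ((\<lambda>r. x + r *\<^sub>R w) -` V)"
    by (intro open_vimage V continuous_intros)
  show ?thesis
    by (rule has_vector_derivative_transform_within_open[OF D o]) (use V eq in auto)
qed

text \<open>The expansion is restated with sums over a prescribed range of degrees, so that the
  remainders of the different arguments of \<open>compose_symbol\<close> can be combined; the terms
  above m that this adds are zero. The derivative along w obeys the same bounds because
  \<open>symbol_bound\<close> includes derivatives in the base point.\<close>

lemma classical_expansion_remainder:
  assumes V: "open V" "x \<in> V" and q: "symbol_class m V q" and \<sigma>: "classical_expansion m V q \<sigma>" and M: "M \<ge> m"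
  shows "\<exists>C. \<forall>\<xi>. norm \<xi> \<ge> 1 \<longrightarrow> norm (q (x, \<xi>) - (\<Sum>d\<in>{L..M}. \<sigma> d (x, \<xi>))) \<le> C * (1 + norm \<xi>) powi (L - 1)"
    and "\<exists>C. \<forall>\<xi>. norm \<xi> \<ge> 1 \<longrightarrow> norm (dird (w, 0) q (x, \<xi>) - (\<Sum>d\<in>{L..M}. dird (w, 0) (\<sigma> d) (x, \<xi>))) \<le> C * (1 + norm \<xi>) powi (L - 1)"
proof -
  \<comment> \<open>\<open>nat\<close> truncates to 0 when L > m + 1; then no term is subtracted and
    order m already suffices.\<close>
  define N where "N = nat (m - L + 1)"
  let ?R = "\<lambda>z. q z - (\<Sum>j<N. \<sigma> (m - int j) z)"
  have sq: "smooth_on (V \<times> UNIV) q" using q by (simp add: symbol_class_def)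
  have s\<sigma>: "smooth_on (V \<times> (- {0})) (\<sigma> d)" for d using \<sigma> by (simp add: classical_expansion_def)
  have b: "symbol_bound (m - int N) V 1 ?R" using \<sigma> unfolding classical_expansion_def by blast
  have z: "\<sigma> d (z, \<xi>) = 0" if "d > m" "z \<in> V" "\<xi> \<noteq> 0" for d z \<xi>
    using \<sigma> that unfolding classical_expansion_def by blast
  have dz: "dird (w, 0) (\<sigma> d) (x, \<xi>) = 0" if d: "d > m" and \<xi>: "\<xi> \<noteq> 0" for d \<xi>
  proof -
    have "dird (w, 0) (\<sigma> d) (x, \<xi>) = dird (w, 0) (\<lambda>z. 0) (x, \<xi>)"
      by (rule dird_cong_open[of "V \<times> (- {0})"]) (use V z[OF d] \<xi> in \<open>auto intro!: open_Times open_Compl\<close>)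
    then show ?thesis by (simp add: dird_eq[OF has_derivative_const])
  qed
  have re: "(\<Sum>j<N. f (m - int j)) = (\<Sum>d\<in>{L..M}. f d)" if "\<And>d. d > m \<Longrightarrow> f d = 0" for f :: "int \<Rightarrow> complex^4^4"
  proof -
    have "(\<Sum>j<N. f (m - int j)) = (\<Sum>d\<in>{L..m}. f d)"
      by (rule sum.reindex_bij_witness[of _ "\<lambda>d. nat (m - d)" "\<lambda>j. m - int j"]) (auto simp: N_def)
    also have "\<dots> = (\<Sum>d\<in>{L..M}. f d)"
      by (rule sum.mono_neutral_left) (use M that in auto)
    finally show ?thesis .
  qed
  have le: "C * (1 + norm \<xi>) powi (m - int N) \<le> \<bar>C\<bar> * (1 + norm \<xi>) powi (L - 1)" for C and \<xi> :: "real^4"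
  proof (intro mult_mono power_int_increasing zero_le_power_int)
    show "m - int N \<le> L - 1" by (simp add: N_def)
  qed auto
  have d: "?R differentiable (at (x, \<xi>))" and
    dR: "dird (w, 0) ?R (x, \<xi>) = dird (w, 0) q (x, \<xi>) - (\<Sum>j<N. dird (w, 0) (\<sigma> (m - int j)) (x, \<xi>))"
    if "norm \<xi> \<ge> 1" for \<xi>
  proof -
    have nz: "\<xi> \<noteq> 0" using that by auto
    have "(?R has_derivative (\<lambda>v. dird v q (x, \<xi>) - (\<Sum>j<N. dird v (\<sigma> (m - int j)) (x, \<xi>)))) (at (x, \<xi>))"
      by (intro has_derivative_diff has_derivative_sum has_derivative_dird smooth_onD_diff[OF sq] smooth_onD_diff[OF s\<sigma>])
        (use nz V in auto)
    then show "?R differentiable (at (x, \<xi>))"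
      "dird (w, 0) ?R (x, \<xi>) = dird (w, 0) q (x, \<xi>) - (\<Sum>j<N. dird (w, 0) (\<sigma> (m - int j)) (x, \<xi>))"
      using dird_eq by (blast intro: differentiableI)+
  qed
  obtain C where C: "\<And>\<xi>. norm \<xi> \<ge> 1 \<Longrightarrow> norm (?R (x, \<xi>)) \<le> C * (1 + norm \<xi>) powi (m - int N)"
    using symbol_bound_plain[OF b, of "{x}"] V by auto
  show "\<exists>C. \<forall>\<xi>. norm \<xi> \<ge> 1 \<longrightarrow> norm (q (x, \<xi>) - (\<Sum>d\<in>{L..M}. \<sigma> d (x, \<xi>))) \<le> C * (1 + norm \<xi>) powi (L - 1)"
  proof (intro exI[of _ "\<bar>C\<bar>"] allI impI)
    fix \<xi> :: "real^4" assume n: "1 \<le> norm \<xi>"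
    then have nz: "\<xi> \<noteq> 0" by auto
    have "(\<Sum>j<N. \<sigma> (m - int j) (x, \<xi>)) = (\<Sum>d\<in>{L..M}. \<sigma> d (x, \<xi>))" by (rule re) (use z V nz in auto)
    then show "norm (q (x, \<xi>) - (\<Sum>d\<in>{L..M}. \<sigma> d (x, \<xi>))) \<le> \<bar>C\<bar> * (1 + norm \<xi>) powi (L - 1)"
      using order_trans[OF C[OF n] le] by simp
  qed
  obtain D where D: "\<And>\<xi>. norm \<xi> \<ge> 1 \<Longrightarrow> norm (dird (w, 0) ?R (x, \<xi>)) \<le> D * (1 + norm \<xi>) powi (m - int N)"
    using symbol_bound_dird[OF b, of "{x}" w] V d by auto
  show "\<exists>C. \<forall>\<xi>. norm \<xi> \<ge> 1 \<longrightarrow> norm (dird (w, 0) q (x, \<xi>) - (\<Sum>d\<in>{L..M}. dird (w, 0) (\<sigma> d) (x, \<xi>))) \<le> C * (1 + norm \<xi>) powi (L - 1)"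
  proof (intro exI[of _ "\<bar>D\<bar>"] allI impI)
    fix \<xi> :: "real^4" assume n: "1 \<le> norm \<xi>"
    then have nz: "\<xi> \<noteq> 0" by auto
    have "(\<Sum>j<N. dird (w, 0) (\<sigma> (m - int j)) (x, \<xi>)) = (\<Sum>d\<in>{L..M}. dird (w, 0) (\<sigma> d) (x, \<xi>))"
      by (rule re) (use dz nz in auto)
    then show "norm (dird (w, 0) q (x, \<xi>) - (\<Sum>d\<in>{L..M}. dird (w, 0) (\<sigma> d) (x, \<xi>))) \<le> \<bar>D\<bar> * (1 + norm \<xi>) powi (L - 1)"
      using order_trans[OF D[OF n] le] dR[OF n] by simp
  qed
qed

text \<open>The symbol at \<open>\<xi>\<close> of the first order operator with coefficients a along the vectors w and zero order
  term b, applied to an operator with symbol Q whose derivatives along w are P'. In degree d the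
  argument P is the term of degree \<open>d - 1\<close>, while P' and Q are taken in degree d.\<close>

definition compose_symbol ::
  "(4 \<Rightarrow> complex^4^4) \<Rightarrow> (4 \<Rightarrow> real^4) \<Rightarrow> complex^4^4 \<Rightarrow> real^4 \<Rightarrow> complex^4^4 \<Rightarrow> (4 \<Rightarrow> complex^4^4) \<Rightarrow> complex^4^4 \<Rightarrow> complex^4^4" where
  "compose_symbol a w b \<xi> P P' Q =
     (\<Sum>i\<in>UNIV. a i ** (mat (\<i> * of_real (w i \<bullet> \<xi>)) ** P + P' i)) + b ** Q"

lemma compose_symbol_add:
  "compose_symbol a w b \<xi> (P1 + P2) (\<lambda>i. P1' i + P2' i) (Q1 + Q2)
    = compose_symbol a w b \<xi> P1 P1' Q1 + compose_symbol a w b \<xi> P2 P2' Q2"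
  by (simp add: compose_symbol_def matrix_add_ldistrib sum.distrib algebra_simps)

lemma compose_symbol_0: "compose_symbol a w b \<xi> 0 (\<lambda>i. 0) 0 = 0"
  by (simp add: compose_symbol_def)

lemma compose_symbol_sum:
  "(\<Sum>d\<in>D. compose_symbol a w b \<xi> (P d) (\<lambda>i. P' d i) (Q d))
    = compose_symbol a w b \<xi> (\<Sum>d\<in>D. P d) (\<lambda>i. \<Sum>d\<in>D. P' d i) (\<Sum>d\<in>D. Q d)"
  by (induction D rule: infinite_finite_induct) (simp_all add: compose_symbol_0 compose_symbol_add)

lemma compose_symbol_diff:
  "compose_symbol a w b \<xi> P1 P1' Q1 - compose_symbol a w b \<xi> P2 P2' Q2
    = compose_symbol a w b \<xi> (P1 - P2) (\<lambda>i. P1' i - P2' i) (Q1 - Q2)"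
  using compose_symbol_add[of a w b \<xi> "P1 - P2" P2 "\<lambda>i. P1' i - P2' i" P2' "Q1 - Q2" Q2]
  by (simp add: diff_eq_eq)

lemma mm_norm_bound: "\<exists>K\<ge>0. \<forall>(a :: complex^4^4) (b :: complex^4^4). norm (a ** b) \<le> norm a * norm b * K"
  by (rule bounded_bilinear.nonneg_bounded[OF bounded_bilinear_cmm])

text \<open>Only the argument P is multiplied by a covector and so carries the factor 1 + |\<xi>|.
  This matches the shift by one degree between P and the other arguments.\<close>

lemma norm_compose_symbol_le:
  "\<exists>K\<ge>0. \<forall>\<xi> P P' Q. norm (compose_symbol a w b \<xi> P P' Q)
     \<le> K * ((1 + norm \<xi>) * norm P + (\<Sum>i\<in>UNIV. norm (P' i)) + norm Q)"
proof -
  obtain K where K: "K \<ge> 0" "\<And>(a :: complex^4^4) (b :: complex^4^4). norm (a ** b) \<le> norm a * norm b * K"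
    using mm_norm_bound by blast
  define L where "L = (\<Sum>i\<in>UNIV. norm (a i) * K * (1 + norm (w i))) + norm b * K"
  have L1: "norm (a i) * K * (1 + norm (w i)) \<le> (\<Sum>i\<in>UNIV. norm (a i) * K * (1 + norm (w i)))" for i
    using member_le_sum[of i UNIV "\<lambda>i. norm (a i) * K * (1 + norm (w i))"] K by simp
  have L0: "L \<ge> 0" unfolding L_def using K by (intro add_nonneg_nonneg sum_nonneg mult_nonneg_nonneg) auto
  have "norm (compose_symbol a w b \<xi> P P' Q) \<le> (4 * L) * ((1 + norm \<xi>) * norm P + (\<Sum>i\<in>UNIV. norm (P' i)) + norm Q)"
    for \<xi> P P' Q
  proof -
    let ?T = "(1 + norm \<xi>) * norm P + (\<Sum>i\<in>UNIV. norm (P' i)) + norm Q"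
    have t: "norm (a i ** (mat (\<i> * of_real (w i \<bullet> \<xi>)) ** P + P' i))
        \<le> norm (a i) * K * (1 + norm (w i)) * ((1 + norm \<xi>) * norm P + (\<Sum>i\<in>UNIV. norm (P' i)))" for i
    proof -
      have "norm (mat (\<i> * of_real (w i \<bullet> \<xi>)) ** P + P' i) \<le> \<bar>w i \<bullet> \<xi>\<bar> * norm P + norm (P' i)"
        by (rule order_trans[OF norm_triangle_ineq]) (simp add: norm_mat_mult norm_mult)
      also have "\<dots> \<le> (1 + norm (w i)) * ((1 + norm \<xi>) * norm P) + (1 + norm (w i)) * (\<Sum>i\<in>UNIV. norm (P' i))"
      proof (intro add_mono)
        have "\<bar>w i \<bullet> \<xi>\<bar> \<le> norm (w i) * norm \<xi>" by (rule Cauchy_Schwarz_ineq2)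
        also have "\<dots> \<le> (1 + norm (w i)) * (1 + norm \<xi>)" by (intro mult_mono) auto
        finally show "\<bar>w i \<bullet> \<xi>\<bar> * norm P \<le> (1 + norm (w i)) * ((1 + norm \<xi>) * norm P)"
          unfolding mult.assoc[symmetric] by (rule mult_right_mono) simp
        have "norm (P' i) \<le> (\<Sum>i\<in>UNIV. norm (P' i))" using member_le_sum[of i UNIV "\<lambda>i. norm (P' i)"] by simp
        also have "\<dots> \<le> (1 + norm (w i)) * (\<Sum>i\<in>UNIV. norm (P' i))"
          using mult_right_mono[of 1 "1 + norm (w i)" "\<Sum>i\<in>UNIV. norm (P' i)"] by (simp add: sum_nonneg)
        finally show "norm (P' i) \<le> (1 + norm (w i)) * (\<Sum>i\<in>UNIV. norm (P' i))" .
      qed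
      also have "\<dots> = (1 + norm (w i)) * ((1 + norm \<xi>) * norm P + (\<Sum>i\<in>UNIV. norm (P' i)))" by (simp only: distrib_left)
      finally have "norm (a i) * norm (mat (\<i> * of_real (w i \<bullet> \<xi>)) ** P + P' i) * K
          \<le> norm (a i) * ((1 + norm (w i)) * ((1 + norm \<xi>) * norm P + (\<Sum>i\<in>UNIV. norm (P' i)))) * K"
        using K by (intro mult_right_mono mult_left_mono) auto
      with K(2)[of "a i" "mat (\<i> * of_real (w i \<bullet> \<xi>)) ** P + P' i"] show ?thesis by (simp only: mult_ac)
    qed
    have u: "norm (a i ** (mat (\<i> * of_real (w i \<bullet> \<xi>)) ** P + P' i)) \<le> norm (a i) * K * (1 + norm (w i)) * ?T" for i
      by (rule order_trans[OF t]) (use K in \<open>intro mult_left_mono mult_nonneg_nonneg; simp\<close>)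
    have T0: "?T \<ge> 0" by (intro add_nonneg_nonneg mult_nonneg_nonneg sum_nonneg) auto
    have "norm (b ** Q) \<le> norm b * norm Q * K" by (rule K)
    also have "\<dots> \<le> norm b * K * ?T"
    proof -
      have "norm Q \<le> ?T" by (simp add: sum_nonneg)
      then have "(norm b * K) * norm Q \<le> (norm b * K) * ?T" using K by (intro mult_left_mono) auto
      then show ?thesis by (simp only: mult_ac)
    qed
    finally have v: "norm (b ** Q) \<le> norm b * K * ?T" .
    have "norm (compose_symbol a w b \<xi> P P' Q)
        \<le> (\<Sum>i\<in>UNIV. norm (a i ** (mat (\<i> * of_real (w i \<bullet> \<xi>)) ** P + P' i))) + norm (b ** Q)"
      unfolding compose_symbol_def
      by (intro order_trans[OF norm_triangle_ineq] add_right_mono norm_sum)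
    also have "\<dots> \<le> (\<Sum>i\<in>UNIV. norm (a i) * K * (1 + norm (w i)) * ?T) + norm b * K * ?T"
      by (intro add_mono sum_mono u v)
    also have "\<dots> = L * ?T" unfolding L_def by (simp only: distrib_right sum_distrib_right)
    also have "\<dots> \<le> (4 * L) * ?T" using L0 T0 by (intro mult_right_mono) auto
    finally show ?thesis .
  qed
  then show ?thesis using L0 by (intro exI[of _ "4 * L"]) auto
qed

lemma poly_bdd_compose_symbol:
  assumes "poly_bdd P" "\<And>i. poly_bdd (P' i)" "poly_bdd Q"
  shows "poly_bdd (\<lambda>\<xi>. compose_symbol a w b \<xi> (P \<xi>) (\<lambda>i. P' i \<xi>) (Q \<xi>))"
  unfolding compose_symbol_def
  by (intro poly_bdd_add poly_bdd_sum poly_bdd_mult_left poly_bdd_mat_mult assms)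

lemma osc_compose_symbol:
  assumes \<delta>: "\<delta> > 0" and "poly_bdd P" "\<And>i. poly_bdd (P' i)" "poly_bdd Q"
  shows "osc \<delta> x \<eta> u (\<lambda>\<xi>. compose_symbol a w b \<xi> (P \<xi>) (\<lambda>i. P' i \<xi>) (Q \<xi>))
    = (\<Sum>i\<in>UNIV. a i *v osc \<delta> x \<eta> u (\<lambda>\<xi>. mat (\<i> * of_real (w i \<bullet> \<xi>)) ** P \<xi> + P' i \<xi>)) + b *v osc \<delta> x \<eta> u Q"
proof -
  have t: "poly_bdd (\<lambda>\<xi>. mat (\<i> * of_real (w i \<bullet> \<xi>)) ** P \<xi> + P' i \<xi>)" for i
    by (intro poly_bdd_add poly_bdd_mat_mult assms)
  show ?thesis
    unfolding compose_symbol_def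
    by (simp add: osc_add[OF \<delta>] osc_sum[OF \<delta>] osc_mult_left[OF \<delta>] poly_bdd_sum poly_bdd_mult_left t assms)
qed

text \<open>On the quantized part the first order operator gives \<open>osc\<close> of the composed
  symbol, and the packet itself is \<open>osc\<close> of the constant symbol 1, by Fourier
  inversion. The contributions of the smooth kernels are collected into one kernel on the
  right.\<close>

lemma packet_osc_identity:
  fixes q k k1 :: symbol
  assumes V: "open V" "x \<in> V" and q: "symbol_class m V q"
    and k: "smooth_on (V \<times> V) k" and k1: "smooth_on (V \<times> V) k1"
    and \<delta>: "\<delta> > 0" and B: "cball x (4 * \<delta>) \<subseteq> V"
    and f: "\<And>z. z \<in> V \<Longrightarrow> f z = quantize q (packet \<delta> x \<eta> u) z + (LINT y|lborel. k (z, y) *v packet \<delta> x \<eta> u y)"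
    and fd: "f differentiable (at x)"
    and eq: "(\<Sum>i\<in>UNIV. a i *v dird (w i) f x) + b *v f x - packet \<delta> x \<eta> u x = (LINT y|lborel. k1 (x, y) *v packet \<delta> x \<eta> u y)"
  shows "osc \<delta> x \<eta> u (\<lambda>\<xi>. compose_symbol a w b \<xi> (q (x, \<xi>)) (\<lambda>i. dird (w i, 0) q (x, \<xi>)) (q (x, \<xi>)) - mat 1)
    = ((2 * pi) ^ 4) *\<^sub>R (LINT y|lborel. (k1 (x, y) - ((\<Sum>i\<in>UNIV. a i ** dird (w i, 0) k (x, y)) + b ** k (x, y))) *v packet \<delta> x \<eta> u y)"
proof -
  let ?v = "packet \<delta> x \<eta> u" and ?c = "1 / (2 * pi) ^ 4 :: real" and ?K = "cball x (4 * \<delta>)"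
  let ?Q = "\<lambda>i \<xi>. mat (\<i> * of_real (w i \<bullet> \<xi>)) ** q (x, \<xi>) + dird (w i, 0) q (x, \<xi>)"
  have cv: "continuous_on UNIV ?v" by (rule smooth_on_imp_continuous_on[OF smooth_on_packet])
  have zv: "y \<notin> ?K \<Longrightarrow> ?v y = 0" for y by (rule packet_support(2)[OF \<delta>])
  note pb = symbol_poly_bdd[OF q V(2)]
  have int: "integrable lborel (\<lambda>y. g (x, y) *v ?v y)" if g: "smooth_on (V \<times> V) g" for g :: symbol
    by (rule integrable_on_compact[of ?K])
      (auto intro!: continuous_intros continuous_on_subset[OF continuous_on_snd_slice[OF g V(2)] B]
        continuous_on_subset[OF cv] simp: zv)
  have D: "dird (w i) f x = ?c *\<^sub>R osc \<delta> x \<eta> u (?Q i) + (LINT y|lborel. dird (w i, 0) k (x, y) *v ?v y)" for i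
  proof (rule dird_eq_line[OF fd])
    have "((\<lambda>r. quantize q ?v (x + r *\<^sub>R w i) + (LINT y|lborel. k (x + r *\<^sub>R w i, y) *v ?v y)) has_vector_derivative
        ?c *\<^sub>R osc \<delta> x \<eta> u (?Q i) + (LINT y|lborel. dird (w i, 0) k (x, y) *v ?v y)) (at 0)"
      by (intro has_vector_derivative_add quantize_line[OF V q \<delta>] kernel_line[OF V k _ B cv zv]) auto
    from has_vector_derivative_line_cong[OF V, of "\<lambda>z. quantize q ?v z + (LINT y|lborel. k (z, y) *v ?v y)" f, OF _ this]
    show "((\<lambda>s. f (x + s *\<^sub>R w i)) has_vector_derivative ?c *\<^sub>R osc \<delta> x \<eta> u (?Q i) + (LINT y|lborel. dird (w i, 0) k (x, y) *v ?v y)) (at 0)"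
      using f by simp
  qed
  have F: "f x = ?c *\<^sub>R osc \<delta> x \<eta> u (\<lambda>\<xi>. q (x, \<xi>)) + (LINT y|lborel. k (x, y) *v ?v y)"
    by (simp add: f[OF V(2)] quantize_def osc_def)
  have O: "?v x = ?c *\<^sub>R osc \<delta> x \<eta> u (\<lambda>\<xi>. mat 1)"
    by (simp add: osc_one[OF \<delta>])
  let ?J = "\<lambda>g. LINT y|lborel. g (x, y) *v ?v y"
  have lin: "A *v (?c *\<^sub>R s + t) = ?c *\<^sub>R (A *v s) + A *v t" for A :: "complex^4^4" and s t
    by (simp add: matrix_vector_right_distrib bounded_bilinear.scaleR_right[OF bounded_bilinear_cmv])
  let ?E = "\<lambda>\<xi>. compose_symbol a w b \<xi> (q (x, \<xi>)) (\<lambda>i. dird (w i, 0) q (x, \<xi>)) (q (x, \<xi>))"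
  have oE: "osc \<delta> x \<eta> u ?E = (\<Sum>i\<in>UNIV. a i *v osc \<delta> x \<eta> u (?Q i)) + b *v osc \<delta> x \<eta> u (\<lambda>\<xi>. q (x, \<xi>))"
    by (rule osc_compose_symbol[OF \<delta> pb(1) pb(2) pb(1)])
  \<comment> \<open>Subtracting 1 is phrased as adding a constant multiple of 1, the form in which
    linearity of \<open>osc\<close> has been established.\<close>
  have "osc \<delta> x \<eta> u (\<lambda>\<xi>. ?E \<xi> + mat (-1) ** mat 1) = osc \<delta> x \<eta> u ?E + mat (-1) *v osc \<delta> x \<eta> u (\<lambda>\<xi>. mat 1)"
    by (subst osc_add[OF \<delta> poly_bdd_compose_symbol[OF pb(1) pb(2) pb(1)] poly_bdd_mult_left[OF poly_bdd_const]])
      (simp only: osc_mult_left[OF \<delta> poly_bdd_const])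
  moreover have "A + mat (-1) ** mat 1 = A - mat 1" for A :: "complex^4^4"
    unfolding matrix_mul_rid by (simp add: vec_eq_iff mat_def)
  ultimately have oE1: "osc \<delta> x \<eta> u (\<lambda>\<xi>. ?E \<xi> - mat 1) = osc \<delta> x \<eta> u ?E - osc \<delta> x \<eta> u (\<lambda>\<xi>. mat 1)"
    by (simp only: mat_mult_cvec) simp
  have "?c *\<^sub>R osc \<delta> x \<eta> u (\<lambda>\<xi>. ?E \<xi> - mat 1)
      = ((\<Sum>i\<in>UNIV. a i *v dird (w i) f x) + b *v f x - ?v x)
        - ((\<Sum>i\<in>UNIV. a i *v ?J (dird (w i, 0) k)) + b *v ?J k)"
    unfolding D F O lin oE1 oE sum.distrib scaleR_diff_right scaleR_add_right scaleR_sum_right by simp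
  also have "\<dots> = ?J k1 - ((\<Sum>i\<in>UNIV. a i *v ?J (dird (w i, 0) k)) + b *v ?J k)"
    unfolding eq ..
  also have "\<dots> = (LINT y|lborel. (k1 (x, y) - ((\<Sum>i\<in>UNIV. a i ** dird (w i, 0) k (x, y)) + b ** k (x, y))) *v ?v y)"
  proof -
    have m: "A *v ?J g = (LINT y|lborel. A *v (g (x, y) *v ?v y))" "integrable lborel (\<lambda>y. A *v (g (x, y) *v ?v y))"
      if "smooth_on (V \<times> V) g" for A and g :: symbol
      using integral_bounded_linear[OF bounded_bilinear.bounded_linear_right[OF bounded_bilinear_cmv] int[OF that], of A]
        integrable_bounded_linear[OF bounded_bilinear.bounded_linear_right[OF bounded_bilinear_cmv] int[OF that], of A] by auto
    have dk: "smooth_on (V \<times> V) (dird (w i, 0) k)" for i by (rule smooth_on_dird[OF k])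
    have e: "(k1 (x, y) - ((\<Sum>i\<in>UNIV. a i ** dird (w i, 0) k (x, y)) + b ** k (x, y))) *v ?v y
       = k1 (x, y) *v ?v y - ((\<Sum>i\<in>UNIV. a i *v (dird (w i, 0) k (x, y) *v ?v y)) + b *v (k (x, y) *v ?v y))" for y
      by (simp add: matrix_vector_mult_diff_rdistrib matrix_vector_mult_add_rdistrib matrix_vector_mul_assoc
          bounded_bilinear.sum_left[OF bounded_bilinear_cmv])
    show ?thesis
      unfolding e m(1)[OF dk] m(1)[OF k]
      by (subst Bochner_Integration.integral_diff[OF int[OF k1]])
        (auto intro!: Bochner_Integration.integrable_add Bochner_Integration.integrable_sum m(2) dk k
          simp: Bochner_Integration.integral_add Bochner_Integration.integral_sum m(2) dk k)
  qed
  finally have "?c *\<^sub>R osc \<delta> x \<eta> u (\<lambda>\<xi>. ?E \<xi> - mat 1) = \<dots>" .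
  from arg_cong[OF this, of "scaleR ((2 * pi) ^ 4)"] show ?thesis by simp
qed

text \<open>The equation is tested at x on packets with frequency \<open>t \<xi>\<close>. The smooth kernels contribute
  rapidly decreasing terms, so every homogeneous term of the composed symbol minus 1 vanishes.\<close>

lemma local_symbol_equations:
  fixes q k k1 :: symbol
  assumes V: "open V" and x: "x \<in> V" and q: "symbol_class m V q" and \<sigma>: "classical_expansion m V q \<sigma>"
    and k: "smooth_on (V \<times> V) k" and k1: "smooth_on (V \<times> V) k1"
    and eq: "\<And>v K. smooth_on UNIV v \<Longrightarrow> compact K \<Longrightarrow> K \<subseteq> V \<Longrightarrow> (\<And>y. y \<notin> K \<Longrightarrow> v y = 0) \<Longrightarrow>
      \<exists>f. (\<forall>z\<in>V. f z = quantize q v z + (LINT y|lborel. k (z, y) *v v y)) \<and> f differentiable (at x) \<and>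
        (\<Sum>i\<in>UNIV. a i *v dird (w i) f x) + b *v f x - v x = (LINT y|lborel. k1 (x, y) *v v y)"
    and \<xi>: "\<xi> \<noteq> 0"
  shows "compose_symbol a w b \<xi> (\<sigma> (d - 1) (x, \<xi>)) (\<lambda>i. dird (w i, 0) (\<sigma> d) (x, \<xi>)) (\<sigma> d (x, \<xi>))
    = (if d = 0 then mat 1 else 0)"
proof -
  obtain \<rho> where \<rho>: "\<rho> > 0" "cball x \<rho> \<subseteq> V" using open_contains_cball V x by blast
  \<comment> \<open>With this choice the packet is supported in the ball of radius \<rho>, inside
    V.\<close>
  define \<delta> where "\<delta> = \<rho> / 4"
  have \<delta>: "\<delta> > 0" "cball x (4 * \<delta>) \<subseteq> V" using \<rho> by (auto simp: \<delta>_def)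
  define e where "e = (\<lambda>\<xi>. compose_symbol a w b \<xi> (q (x, \<xi>)) (\<lambda>i. dird (w i, 0) q (x, \<xi>)) (q (x, \<xi>)) - mat 1)"
  define c where "c = (\<lambda>d \<xi>. compose_symbol a w b \<xi> (\<sigma> (d - 1) (x, \<xi>)) (\<lambda>i. dird (w i, 0) (\<sigma> d) (x, \<xi>)) (\<sigma> d (x, \<xi>)))"
  define \<epsilon> where "\<epsilon> = (\<lambda>d \<xi>. c d \<xi> - (if d = 0 then mat 1 else 0))"
  \<comment> \<open>The composed symbol has order m + 1, and the identity to be subtracted has
    degree 0.\<close>
  define M where "M = max (m + 1) 0"
  note pb = symbol_poly_bdd[OF q x]
  have s\<sigma>: "smooth_on (V \<times> (- {0})) (\<sigma> d)" for d using \<sigma> by (simp add: classical_expansion_def)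
  have \<sigma>hom: "\<sigma> d (z, t *\<^sub>R \<xi>) = (t powi d) *\<^sub>R \<sigma> d (z, \<xi>)" if "z \<in> V" "\<xi> \<noteq> 0" "t > 0" for d z t \<xi>
    using \<sigma> that unfolding classical_expansion_def by blast
  have \<sigma>0: "\<sigma> d (z, \<xi>) = 0" if "d > m" "z \<in> V" "\<xi> \<noteq> 0" for d z \<xi>
    using \<sigma> that unfolding classical_expansion_def by blast
  have diff\<sigma>: "\<sigma> d differentiable (at (z, \<xi>))" if "z \<in> V" "\<xi> \<noteq> 0" for d z \<xi>
    using smooth_onD_diff[OF s\<sigma>] that by auto
  \<comment> \<open>Homogeneity in the covector passes to derivatives in the base point, as the
    scaling factor does not depend on the latter.\<close>
  have d\<sigma>hom: "dird (w', 0) (\<sigma> d) (x, t *\<^sub>R \<xi>) = (t powi d) *\<^sub>R dird (w', 0) (\<sigma> d) (x, \<xi>)" if "\<xi> \<noteq> 0" "t > 0" for d t \<xi> w'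
  proof -
    have 1: "((\<lambda>r. \<sigma> d (x + r *\<^sub>R w', t *\<^sub>R \<xi>)) has_vector_derivative dird (w', 0) (\<sigma> d) (x, t *\<^sub>R \<xi>)) (at 0)"
      by (rule dird_slice_line[OF diff\<sigma>]) (use x that in auto)
    have "((\<lambda>r. \<sigma> d (x + r *\<^sub>R w', \<xi>)) has_vector_derivative dird (w', 0) (\<sigma> d) (x, \<xi>)) (at 0)"
      by (rule dird_slice_line[OF diff\<sigma>]) (use x that in auto)
    from bounded_linear.has_vector_derivative[OF bounded_linear_scaleR_right this, of "t powi d"]
    have "((\<lambda>r. (t powi d) *\<^sub>R \<sigma> d (x + r *\<^sub>R w', \<xi>)) has_vector_derivative (t powi d) *\<^sub>R dird (w', 0) (\<sigma> d) (x, \<xi>)) (at 0)" .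
    from has_vector_derivative_line_cong[OF V x, of "\<lambda>z. (t powi d) *\<^sub>R \<sigma> d (z, \<xi>)" "\<lambda>z. \<sigma> d (z, t *\<^sub>R \<xi>)", OF _ this]
    have 2: "((\<lambda>r. \<sigma> d (x + r *\<^sub>R w', t *\<^sub>R \<xi>)) has_vector_derivative (t powi d) *\<^sub>R dird (w', 0) (\<sigma> d) (x, \<xi>)) (at 0)"
      using \<sigma>hom that by simp
    show ?thesis by (rule vector_derivative_unique_at[OF 1 2])
  qed
  have d\<sigma>0: "dird (w', 0) (\<sigma> d) (x, \<xi>) = 0" if "d > m" "\<xi> \<noteq> 0" for d \<xi> w'
  proof -
    have "dird (w', 0) (\<sigma> d) (x, \<xi>) = dird (w', 0) (\<lambda>z. 0) (x, \<xi>)"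
      by (rule dird_cong_open[of "V \<times> (- {0})"]) (use V x \<sigma>0 that in \<open>auto intro!: open_Times open_Compl\<close>)
    then show ?thesis by (simp add: dird_eq[OF has_derivative_const])
  qed
  have "\<epsilon> d \<xi> = 0"
  proof (rule symbol_vanish[OF \<delta>(1), of e \<epsilon> M])
    show "poly_bdd e"
      using poly_bdd_add[OF poly_bdd_compose_symbol[OF pb(1) pb(2) pb(1)] poly_bdd_const[of "- mat 1"]]
      unfolding e_def by simp
    show "\<epsilon> d (t *\<^sub>R \<xi>) = (t powi d) *\<^sub>R \<epsilon> d \<xi>" if "\<xi> \<noteq> 0" "t > 0" for d \<xi> t
    proof -
      have m1: "mat (\<i> * of_real (w i \<bullet> (t *\<^sub>R \<xi>))) ** \<sigma> (d - 1) (x, t *\<^sub>R \<xi>)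
          = (t powi d) *\<^sub>R (mat (\<i> * of_real (w i \<bullet> \<xi>)) ** \<sigma> (d - 1) (x, \<xi>))" for i
      proof -
        have "t powi d = t * t powi (d - 1)" using that(2) by (simp add: power_int_diff)
        moreover have "mat (\<i> * of_real (w i \<bullet> (t *\<^sub>R \<xi>))) = t *\<^sub>R (mat (\<i> * of_real (w i \<bullet> \<xi>)) :: complex^4^4)"
          by (simp add: vec_eq_iff mat_def scaleR_conv_of_real[where 'a=complex])
        ultimately show ?thesis
          using x that by (simp add: \<sigma>hom bounded_bilinear.scaleR_left[OF bounded_bilinear_cmm]
              bounded_bilinear.scaleR_right[OF bounded_bilinear_cmm])
      qed
      have "c d (t *\<^sub>R \<xi>) = (t powi d) *\<^sub>R c d \<xi>"
        unfolding c_def compose_symbol_def m1 unfolding d\<sigma>hom[OF that] \<sigma>hom[OF x that]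
        by (simp add: bounded_bilinear.scaleR_right[OF bounded_bilinear_cmm] scaleR_sum_right
            scaleR_add_right matrix_add_ldistrib)
      then show ?thesis by (simp add: \<epsilon>_def scaleR_diff_right)
    qed
    show "continuous_on (- {0}) (\<epsilon> d)" for d
      unfolding \<epsilon>_def c_def compose_symbol_def
      by (intro continuous_intros continuous_on_snd_slice[OF s\<sigma> x] continuous_on_snd_slice[OF smooth_on_dird[OF s\<sigma>] x])
    show "\<epsilon> d \<xi> = 0" if "d > M" "\<xi> \<noteq> 0" for d \<xi>
    proof -
      have "d > m" "d - 1 > m" "d \<noteq> 0" using that by (auto simp: M_def)
      then show ?thesis using that x by (simp add: \<epsilon>_def c_def \<sigma>0 d\<sigma>0 compose_symbol_0)
    qed
    show "\<exists>C. \<forall>\<xi>. norm \<xi> \<ge> 1 \<longrightarrow> norm (e \<xi> - (\<Sum>d\<in>{L..M}. \<epsilon> d \<xi>)) \<le> C * (1 + norm \<xi>) powi (L - 1)" for L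
    proof -
      have Mm: "M - 1 \<ge> m" "M \<ge> m" by (auto simp: M_def)
      obtain C1 where C1: "\<And>\<xi>. norm \<xi> \<ge> 1 \<Longrightarrow>
          norm (q (x, \<xi>) - (\<Sum>d\<in>{L-1..M-1}. \<sigma> d (x, \<xi>))) \<le> C1 * (1 + norm \<xi>) powi (L - 1 - 1)"
        using classical_expansion_remainder(1)[OF V x q \<sigma> Mm(1), of "L - 1"] by blast
      obtain C2 where C2: "\<And>\<xi>. norm \<xi> \<ge> 1 \<Longrightarrow>
          norm (q (x, \<xi>) - (\<Sum>d\<in>{L..M}. \<sigma> d (x, \<xi>))) \<le> C2 * (1 + norm \<xi>) powi (L - 1)"
        using classical_expansion_remainder(1)[OF V x q \<sigma> Mm(2), of L] by blast
      have "\<forall>i. \<exists>C. \<forall>\<xi>. norm \<xi> \<ge> 1 \<longrightarrow>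
          norm (dird (w i, 0) q (x, \<xi>) - (\<Sum>d\<in>{L..M}. dird (w i, 0) (\<sigma> d) (x, \<xi>))) \<le> C * (1 + norm \<xi>) powi (L - 1)"
        by (intro allI classical_expansion_remainder(2)[OF V x q \<sigma> Mm(2)])
      from choice[OF this] obtain C3 where C30: "\<forall>i. \<forall>\<xi>. norm \<xi> \<ge> 1 \<longrightarrow>
          norm (dird (w i, 0) q (x, \<xi>) - (\<Sum>d\<in>{L..M}. dird (w i, 0) (\<sigma> d) (x, \<xi>))) \<le> C3 i * (1 + norm \<xi>) powi (L - 1)" ..
      note C3 = C30[rule_format]
      obtain K where K: "K \<ge> 0" "\<And>\<xi> P P' Q. norm (compose_symbol a w b \<xi> P P' Q)
          \<le> K * ((1 + norm \<xi>) * norm P + (\<Sum>i\<in>UNIV. norm (P' i)) + norm Q)"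
        using norm_compose_symbol_le[of a w b] by blast
      have "norm (e \<xi> - (\<Sum>d\<in>{L..M}. \<epsilon> d \<xi>))
          \<le> (K * (C1 + (\<Sum>i\<in>UNIV. C3 i) + C2) + norm (mat 1 :: complex^4^4)) * (1 + norm \<xi>) powi (L - 1)"
        if n: "norm \<xi> \<ge> 1" for \<xi>
      proof -
        have sh: "(\<Sum>d\<in>{L..M}. \<sigma> (d - 1) (x, \<xi>)) = (\<Sum>d\<in>{L-1..M-1}. \<sigma> d (x, \<xi>))"
          by (rule sum.reindex_bij_witness[of _ "\<lambda>d. d + 1" "\<lambda>d. d - 1"]) auto
        \<comment> \<open>The identity terms sum to 1 or 0 according as the range reaches degree 0.
          When it does not, L - 1 is nonnegative and the missing 1 is absorbed into the
          remainder.\<close>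
        define I where "I = (\<Sum>d\<in>{L..M}. if d = 0 then mat 1 else (0 :: complex^4^4))"
        have I: "norm (I - mat 1) \<le> norm (mat 1 :: complex^4^4) * (1 + norm \<xi>) powi (L - 1)"
        proof (cases "L \<le> 0")
          case True
          then have "0 \<in> {L..M}" by (simp add: M_def)
          then have "I = mat 1" by (simp add: I_def)
          then show ?thesis by simp
        next
          case False
          then have "I = 0" unfolding I_def by (intro sum.neutral) auto
          moreover have "(1 + norm \<xi>) powi (L - 1) \<ge> 1"
            using False by (simp add: power_int_def one_le_power)
          ultimately show ?thesis using mult_left_mono[of 1 _ "norm (mat 1 :: complex^4^4)"] by simp
        qed
        define P where "P = q (x, \<xi>) - (\<Sum>d\<in>{L-1..M-1}. \<sigma> d (x, \<xi>))"
        define P' where "P' i = dird (w i, 0) q (x, \<xi>) - (\<Sum>d\<in>{L..M}. dird (w i, 0) (\<sigma> d) (x, \<xi>))" for i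
        define Q where "Q = q (x, \<xi>) - (\<Sum>d\<in>{L..M}. \<sigma> d (x, \<xi>))"
        define p where "p = (1 + norm \<xi>) powi (L - 1)"
        have bP: "norm P \<le> C1 * (1 + norm \<xi>) powi (L - 1 - 1)" unfolding P_def by (rule C1[OF n])
        have bP': "norm (P' i) \<le> C3 i * p" for i unfolding P'_def p_def by (rule C3[OF n])
        have bQ: "norm Q \<le> C2 * p" unfolding Q_def p_def by (rule C2[OF n])
        have "(\<Sum>d\<in>{L..M}. \<epsilon> d \<xi>) = compose_symbol a w b \<xi> (\<Sum>d\<in>{L-1..M-1}. \<sigma> d (x, \<xi>))
            (\<lambda>i. \<Sum>d\<in>{L..M}. dird (w i, 0) (\<sigma> d) (x, \<xi>)) (\<Sum>d\<in>{L..M}. \<sigma> d (x, \<xi>)) - I"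
          unfolding \<epsilon>_def c_def sum_subtractf compose_symbol_sum sh I_def ..
        moreover have "compose_symbol a w b \<xi> (q (x, \<xi>)) (\<lambda>i. dird (w i, 0) q (x, \<xi>)) (q (x, \<xi>))
            - compose_symbol a w b \<xi> (\<Sum>d\<in>{L-1..M-1}. \<sigma> d (x, \<xi>))
            (\<lambda>i. \<Sum>d\<in>{L..M}. dird (w i, 0) (\<sigma> d) (x, \<xi>)) (\<Sum>d\<in>{L..M}. \<sigma> d (x, \<xi>)) = compose_symbol a w b \<xi> P P' Q"
          unfolding P_def P'_def[abs_def] Q_def by (rule compose_symbol_diff)
        ultimately have "e \<xi> - (\<Sum>d\<in>{L..M}. \<epsilon> d \<xi>) = compose_symbol a w b \<xi> P P' Q + (I - mat 1)"
          by (simp only: e_def) (simp add: algebra_simps)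
        then have "norm (e \<xi> - (\<Sum>d\<in>{L..M}. \<epsilon> d \<xi>)) \<le> norm (compose_symbol a w b \<xi> P P' Q) + norm (I - mat 1)"
          by (simp only: norm_triangle_ineq)
        also have "\<dots> \<le> K * ((1 + norm \<xi>) * norm P + (\<Sum>i\<in>UNIV. norm (P' i)) + norm Q) + norm (mat 1 :: complex^4^4) * p"
          using K(2)[of \<xi> P P' Q] I unfolding p_def by linarith
        also have "K * ((1 + norm \<xi>) * norm P + (\<Sum>i\<in>UNIV. norm (P' i)) + norm Q)
            \<le> K * (C1 * p + (\<Sum>i\<in>UNIV. C3 i * p) + C2 * p)"
        proof (rule mult_left_mono[OF _ K(1)])
          have "(1 + norm \<xi>) * norm P \<le> (1 + norm \<xi>) * (C1 * (1 + norm \<xi>) powi (L - 1 - 1))"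
            by (rule mult_left_mono[OF bP]) simp
          also have "\<dots> = C1 * p"
          proof -
            have nz: "1 + norm \<xi> \<noteq> 0" using norm_ge_zero[of \<xi>] by linarith
            then have "(1 + norm \<xi>) powi (L - 1 - 1) = (1 + norm \<xi>) powi (L - 1) / (1 + norm \<xi>) powi 1"
              by (intro power_int_diff) simp
            then show ?thesis using nz by (simp only: p_def power_int_1_right) simp
          qed
          finally have "(1 + norm \<xi>) * norm P \<le> C1 * p" .
          moreover have "(\<Sum>i\<in>UNIV. norm (P' i)) \<le> (\<Sum>i\<in>UNIV. C3 i * p)" by (rule sum_mono[OF bP'])
          ultimately show "(1 + norm \<xi>) * norm P + (\<Sum>i\<in>UNIV. norm (P' i)) + norm Q
              \<le> C1 * p + (\<Sum>i\<in>UNIV. C3 i * p) + C2 * p" using bQ by linarith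
        qed
        finally show ?thesis
          unfolding p_def[symmetric] by (simp add: sum_distrib_right[symmetric] distrib_right mult.assoc)
      qed
      then show ?thesis by blast
    qed
    show "\<exists>C. \<forall>t. \<bar>t\<bar> ^ N * norm (LINT \<zeta>|lborel. packet_weight \<delta> \<zeta> *s (e (\<zeta> + t *\<^sub>R \<eta>) *v u)) \<le> C"
      if \<eta>: "\<eta> \<noteq> 0" for N u \<eta>
    proof -
      define k2 where "k2 y = k1 (x, y) - ((\<Sum>i\<in>UNIV. a i ** dird (w i, 0) k (x, y)) + b ** k (x, y))" for y
      have sl: "smooth_on V (\<lambda>y. g (x, y))" if "smooth_on (V \<times> V) g" for g :: symbol
        by (rule smooth_on_compose[OF V that]) (use x in \<open>auto intro!: smooth_on_Pair V\<close>)
      have sk2: "smooth_on V k2"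
        unfolding k2_def
        by (intro smooth_on_diff smooth_on_add smooth_on_sum V smooth_on_bilinear[OF V bounded_bilinear_cmm]
            smooth_on_const sl k k1 smooth_on_dird)
      obtain C where C: "\<And>t. \<bar>t\<bar> ^ N * norm (LINT y|lborel. k2 y *v packet \<delta> x (t *\<^sub>R \<eta>) u y) \<le> C"
        using packet_pairing_decay[OF V sk2 \<delta> \<eta>] by blast
      have pe: "poly_bdd e"
        using poly_bdd_add[OF poly_bdd_compose_symbol[OF pb(1) pb(2) pb(1)] poly_bdd_const[of "- mat 1"]]
        unfolding e_def by simp
      have "norm (LINT \<zeta>|lborel. packet_weight \<delta> \<zeta> *s (e (\<zeta> + t *\<^sub>R \<eta>) *v u))
          = (2 * pi) ^ 4 * norm (LINT y|lborel. k2 y *v packet \<delta> x (t *\<^sub>R \<eta>) u y)" for t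
      proof -
        let ?v = "packet \<delta> x (t *\<^sub>R \<eta>) u"
        have "\<exists>f. (\<forall>z\<in>V. f z = quantize q ?v z + (LINT y|lborel. k (z, y) *v ?v y)) \<and> f differentiable (at x) \<and>
            (\<Sum>i\<in>UNIV. a i *v dird (w i) f x) + b *v f x - ?v x = (LINT y|lborel. k1 (x, y) *v ?v y)"
          by (rule eq[OF smooth_on_packet compact_cball \<delta>(2) packet_support(2)[OF \<delta>(1)]])
        then obtain f where f: "\<forall>z\<in>V. f z = quantize q ?v z + (LINT y|lborel. k (z, y) *v ?v y)"
          "f differentiable (at x)"
          "(\<Sum>i\<in>UNIV. a i *v dird (w i) f x) + b *v f x - ?v x = (LINT y|lborel. k1 (x, y) *v ?v y)"
          by (elim exE conjE)
        have "osc \<delta> x (t *\<^sub>R \<eta>) u e = ((2 * pi) ^ 4) *\<^sub>R (LINT y|lborel. k2 y *v ?v y)"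
          unfolding e_def k2_def by (rule packet_osc_identity[OF V x q k k1 \<delta> f(1)[rule_format] f(2,3)])
        from arg_cong[OF this[unfolded osc_shift(1)[OF \<delta>(1) pe]], of norm] show ?thesis
          by (simp add: norm_cvec)
      qed
      then have "\<bar>t\<bar> ^ N * norm (LINT \<zeta>|lborel. packet_weight \<delta> \<zeta> *s (e (\<zeta> + t *\<^sub>R \<eta>) *v u)) \<le> (2 * pi) ^ 4 * C" for t
        using mult_left_mono[OF C[of t], of "(2 * pi) ^ 4"] by (simp only: mult.left_commute zero_le_power) simp
      then show ?thesis by blast
    qed
    show "\<xi> \<noteq> 0" by fact
  qed
  then show ?thesis by (simp add: \<epsilon>_def c_def)
qed

section \<open>Charts, the spin group and spinors\<close>

lemma matrix_inv_eqI:
  fixes A B :: "complex^4^4"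
  assumes "A ** B = mat 1" "B ** A = mat 1"
  shows "matrix_inv A = B"
proof -
  let ?C = "matrix_inv A"
  have "A ** ?C = mat 1 \<and> ?C ** A = mat 1"
    unfolding matrix_inv_def by (rule someI[of _ B]) (use assms in simp)
  then have "?C = ?C ** (A ** B)" using assms by simp
  also have "\<dots> = (?C ** A) ** B" by (simp only: matrix_mul_assoc)
  also have "\<dots> = B" using \<open>A ** ?C = mat 1 \<and> ?C ** A = mat 1\<close> by simp
  finally show ?thesis .
qed

lemma clifford_unit_square:
  assumes "clifford_relations \<gamma>" "norm v = 1"
  shows "clifford \<gamma> v ** clifford \<gamma> v = mat (-1)"
proof -
  let ?A = "clifford \<gamma> v ** clifford \<gamma> v"
  have "?A + ?A = mat (of_real (-2 * (v \<bullet> v)))" using assms(1) by (auto simp: clifford_relations_def)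
  moreover have "v \<bullet> v = 1" using assms(2) by (simp add: dot_square_norm)
  ultimately have "\<forall>i j. ?A $ i $ j + ?A $ i $ j = (mat (-2) :: complex^4^4) $ i $ j"
    by (simp add: vec_eq_iff)
  then have "2 * ?A $ i $ j = 2 * (mat (-1) :: complex^4^4) $ i $ j" for i j
    unfolding mult_2 by (simp add: mat_def)
  then show ?thesis by (simp add: vec_eq_iff)
qed

lemma mat_mm: "mat c ** (A :: complex^4^4) = (\<chi> i j. c * A $ i $ j)"
  by (simp add: vec_eq_iff matrix_matrix_mult_def mat_def if_distrib if_distribR cong: if_cong)

lemma mm_mat: "(A :: complex^4^4) ** mat c = (\<chi> i j. c * A $ i $ j)"
proof -
  have "(\<Sum>k\<in>UNIV. A $ i $ k * (if k = j then c else 0)) = c * A $ i $ j" for i j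
  proof -
    have "A $ i $ k * (if k = j then c else 0) = (if k = j then c * A $ i $ k else 0)" for k by simp
    then show ?thesis by (simp only: sum.delta finite) simp
  qed
  then show ?thesis by (simp add: vec_eq_iff matrix_matrix_mult_def mat_def)
qed

text \<open>Elements are products of Clifford matrices of unit vectors, and c(v)^2 = -1 makes -c(v)
  the inverse of such a factor.\<close>

lemma spin_group_invertible:
  assumes "clifford_relations \<gamma>" "S \<in> spin_group \<gamma>"
  shows "\<exists>T. S ** T = mat 1 \<and> T ** S = mat 1"
  using assms(2)
proof induction
  case one
  show ?case by (rule exI[of _ "mat 1"]) simp
next
  case (step S v w)
  then obtain T where T: "S ** T = mat 1" "T ** S = mat 1" by blast
  have n: "(clifford \<gamma> u ** (mat (-1) ** clifford \<gamma> u)) = mat 1" "((mat (-1) ** clifford \<gamma> u) ** clifford \<gamma> u) = mat 1"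
    if "norm u = 1" for u
  proof -
    have c: "mat (-1) ** A = A ** mat (-1)" for A :: "complex^4^4"
      by (simp only: mat_mm mm_mat)
    have m: "mat (-1) ** mat (-1) = (mat 1 :: complex^4^4)"
      unfolding mat_mm by (simp add: vec_eq_iff mat_def)
    show "clifford \<gamma> u ** (mat (-1) ** clifford \<gamma> u) = mat 1"
      by (simp only: c[of "clifford \<gamma> u"] matrix_mul_assoc clifford_unit_square[OF assms(1) that] m)
    show "(mat (-1) ** clifford \<gamma> u) ** clifford \<gamma> u = mat 1"
      by (simp only: matrix_mul_assoc[symmetric] clifford_unit_square[OF assms(1) that] m)
  qed
  let ?V = "clifford \<gamma> v" and ?W = "clifford \<gamma> w"
  let ?V' = "mat (-1) ** ?V" and ?W' = "mat (-1) ** ?W"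
  have "(S ** ?V ** ?W) ** (?W' ** ?V' ** T) = S ** (?V ** ((?W ** ?W') ** ?V')) ** T"
    by (simp only: matrix_mul_assoc)
  also have "\<dots> = mat 1" 
    by (simp only: n[OF step.hyps(3)] matrix_mul_lid n[OF step.hyps(2)] matrix_mul_rid T)
  finally have 1: "(S ** ?V ** ?W) ** (?W' ** ?V' ** T) = mat 1" .
  have "(?W' ** ?V' ** T) ** (S ** ?V ** ?W) = ?W' ** (?V' ** (T ** S) ** ?V) ** ?W"
    by (simp only: matrix_mul_assoc)
  also have "\<dots> = mat 1" 
    by (simp only: n[OF step.hyps(3)] matrix_mul_lid n[OF step.hyps(2)] matrix_mul_rid T)
  finally show ?case using 1 by blast
qed

lemma spin_group_mult:
  assumes "S \<in> spin_group \<gamma>" "T \<in> spin_group \<gamma>"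
  shows "S ** T \<in> spin_group \<gamma>"
  using assms(2)
proof induction
  case one then show ?case using assms by simp
next
  case (step T v w)
  have "S ** (T ** clifford \<gamma> v ** clifford \<gamma> w) = (S ** T) ** clifford \<gamma> v ** clifford \<gamma> w"
    by (simp only: matrix_mul_assoc)
  then show ?case using spin_group.step[OF step.IH step.hyps(2,3)] by simp
qed

lemma spin_group_matrix_inv:
  assumes "clifford_relations \<gamma>" "S \<in> spin_group \<gamma>"
  shows "S ** matrix_inv S = mat 1" "matrix_inv S ** S = mat 1"
proof -
  obtain T where T: "S ** T = mat 1" "T ** S = mat 1" using spin_group_invertible[OF assms] by blast
  have "matrix_inv S = T" by (rule matrix_inv_eqI[OF T])
  then show "S ** matrix_inv S = mat 1" "matrix_inv S ** S = mat 1" using T by auto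
qed

lemma spin_group_matrix_inv_mult:
  assumes "clifford_relations \<gamma>" "S \<in> spin_group \<gamma>" "T \<in> spin_group \<gamma>"
  shows "matrix_inv (S ** T) = matrix_inv T ** matrix_inv S"
proof (rule matrix_inv_eqI)
  note i = spin_group_matrix_inv[OF assms(1,2)] spin_group_matrix_inv[OF assms(1,3)]
  have "S ** T ** (matrix_inv T ** matrix_inv S) = S ** (T ** matrix_inv T) ** matrix_inv S"
    by (simp only: matrix_mul_assoc)
  then show "S ** T ** (matrix_inv T ** matrix_inv S) = mat 1" by (simp add: i)
  have "matrix_inv T ** matrix_inv S ** (S ** T) = matrix_inv T ** (matrix_inv S ** S) ** T"
    by (simp only: matrix_mul_assoc)
  then show "matrix_inv T ** matrix_inv S ** (S ** T) = mat 1" by (simp add: i)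
qed

section \<open>Charts and their overlaps\<close>

lemma
  assumes "is_chart X c"
  shows chart_openin: "openin (top_of_set X) (cdom c)"
    and chart_open_range: "open (crange c)"
    and chart_param_coord: "p \<in> cdom c \<Longrightarrow> param c (coord c p) = p"
    and chart_coord_param: "x \<in> crange c \<Longrightarrow> coord c (param c x) = x"
    and chart_param_in: "x \<in> crange c \<Longrightarrow> param c x \<in> cdom c"
    and chart_coord_in: "p \<in> cdom c \<Longrightarrow> coord c p \<in> crange c"
    and chart_cont_param: "continuous_on (crange c) (param c)"
    and chart_cont_coord: "continuous_on (cdom c) (coord c)"
    and chart_inj: "inj_on (coord c) (cdom c)"
proof -
  have h: "homeomorphism (cdom c) (crange c) (coord c) (param c)"
    and o: "openin (top_of_set X) (cdom c)" "open (crange c)"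
    using assms by (auto simp: is_chart_def)
  show "openin (top_of_set X) (cdom c)" "open (crange c)" by (fact o)+
  show "p \<in> cdom c \<Longrightarrow> param c (coord c p) = p" using homeomorphism_apply1[OF h] .
  show "x \<in> crange c \<Longrightarrow> coord c (param c x) = x" using homeomorphism_apply2[OF h] .
  show "x \<in> crange c \<Longrightarrow> param c x \<in> cdom c" using homeomorphism_image2[OF h] by blast
  show "p \<in> cdom c \<Longrightarrow> coord c p \<in> crange c" by (auto simp: crange_def)
  show "continuous_on (crange c) (param c)" "continuous_on (cdom c) (coord c)"
    using h by (auto simp: homeomorphism_def)
  show "inj_on (coord c) (cdom c)" by (rule inj_on_inverseI[of _ "param c"]) (rule homeomorphism_apply1[OF h])
qed

lemma overlap_eq:
  assumes "is_chart X c"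
  shows "overlap c c' = crange c \<inter> param c -` cdom c'"
proof (intro equalityI subsetI)
  fix x assume "x \<in> overlap c c'"
  then obtain p where "p \<in> cdom c" "p \<in> cdom c'" "x = coord c p" unfolding overlap_def by blast
  then show "x \<in> crange c \<inter> param c -` cdom c'"
    by (simp add: chart_param_coord[OF assms] chart_coord_in[OF assms])
next
  fix x assume x: "x \<in> crange c \<inter> param c -` cdom c'"
  then have "x = coord c (param c x)" "param c x \<in> cdom c \<inter> cdom c'"
    by (simp_all add: chart_coord_param[OF assms] chart_param_in[OF assms])
  then show "x \<in> overlap c c'" unfolding overlap_def by (rule image_eqI)
qed

text \<open>A chart domain is open only relative to X. Since \<open>param c\<close> maps into X, the
  preimage of the domain equals the preimage of an open set of the ambient space.\<close>

lemma overlap_open: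
  assumes "is_chart (X :: 'a::topological_space set) c" "is_chart X c'"
  shows "open (overlap c c')"
proof -
  obtain U where U: "open U" "cdom c' = X \<inter> U" using chart_openin[OF assms(2)] by (auto simp: openin_open)
  have s: "cdom c \<subseteq> X" using openin_imp_subset[OF chart_openin[OF assms(1)]] .
  have "overlap c c' = crange c \<inter> param c -` U"
    unfolding overlap_eq[OF assms(1)] U(2) using chart_param_in[OF assms(1)] s by blast
  then show ?thesis
    using continuous_open_preimage[OF chart_cont_param[OF assms(1)] chart_open_range[OF assms(1)] U(1)] by simp
qed

lemma spin_structure_dest:
  assumes "spin_structure X"
  shows spin_relations: "clifford_relations (gam X)"
    and spin_bproj_act: "S \<in> spin_group (gam X) \<Longrightarrow> bproj X (bact X u S) = bproj X u"
    and spin_act_one: "bact X u (mat 1) = u"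
    and spin_act_act: "S \<in> spin_group (gam X) \<Longrightarrow> T \<in> spin_group (gam X) \<Longrightarrow> bact X (bact X u S) T = bact X u (S ** T)"
    and spin_torsor: "bproj X u = bproj X v \<Longrightarrow> \<exists>!S. S \<in> spin_group (gam X) \<and> v = bact X u S"
    and spin_frame_change: "c \<in> atlas X \<Longrightarrow> c' \<in> atlas X \<Longrightarrow> bproj X u \<in> cdom c \<inter> cdom c' \<Longrightarrow>
        bframe X c' u = jac c c' (bproj X u) ** bframe X c u"
    and spin_covering: "c \<in> atlas X \<Longrightarrow> covering_space (bproj X -` cdom c) (\<lambda>u. (bproj X u, bframe X c u))
        {(p, F). p \<in> cdom c \<and> transpose F ** metr X c p ** F = mat 1 \<and> det F > 0}"
    and spin_transition_smooth: "spin_frame X c s \<Longrightarrow> spin_frame X c' s' \<Longrightarrow>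
        (\<forall>p\<in>cdom c \<inter> cdom c'. S' p \<in> spin_group (gam X) \<and> s' p = bact X (s p) (S' p)) \<Longrightarrow>
        smooth_on (overlap c c') (\<lambda>x. S' (param c x))"
proof -
  note A = assms[unfolded spin_structure_def]
  note A1 = A[THEN conjunct1]
  note A2 = A[THEN conjunct2, THEN conjunct1]
  note A3 = A[THEN conjunct2, THEN conjunct2, THEN conjunct1]
  note A4 = A[THEN conjunct2, THEN conjunct2, THEN conjunct2, THEN conjunct1]
  note A5 = A[THEN conjunct2, THEN conjunct2, THEN conjunct2, THEN conjunct2, THEN conjunct1]
  note A6 = A[THEN conjunct2, THEN conjunct2, THEN conjunct2, THEN conjunct2, THEN conjunct2, THEN conjunct1]
  note A7 = A[THEN conjunct2, THEN conjunct2, THEN conjunct2, THEN conjunct2, THEN conjunct2, THEN conjunct2, THEN conjunct1]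
  note A8 = A[THEN conjunct2, THEN conjunct2, THEN conjunct2, THEN conjunct2, THEN conjunct2, THEN conjunct2, THEN conjunct2, THEN conjunct1]
  note A9 = A[THEN conjunct2, THEN conjunct2, THEN conjunct2, THEN conjunct2, THEN conjunct2, THEN conjunct2, THEN conjunct2, THEN conjunct2, THEN conjunct1]
  note A10 = A[THEN conjunct2, THEN conjunct2, THEN conjunct2, THEN conjunct2, THEN conjunct2, THEN conjunct2, THEN conjunct2, THEN conjunct2, THEN conjunct2]
  show "clifford_relations (gam X)" by (rule A1)
  show "S \<in> spin_group (gam X) \<Longrightarrow> bproj X (bact X u S) = bproj X u" using A2 by blast
  show "bact X u (mat 1) = u" using A3 by blast
  show "S \<in> spin_group (gam X) \<Longrightarrow> T \<in> spin_group (gam X) \<Longrightarrow> bact X (bact X u S) T = bact X u (S ** T)"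
    using A4 by blast
  show "bproj X u = bproj X v \<Longrightarrow> \<exists>!S. S \<in> spin_group (gam X) \<and> v = bact X u S"
    by (rule A5[THEN spec, THEN spec, THEN mp])
  show "c \<in> atlas X \<Longrightarrow> c' \<in> atlas X \<Longrightarrow> bproj X u \<in> cdom c \<inter> cdom c' \<Longrightarrow>
      bframe X c' u = jac c c' (bproj X u) ** bframe X c u"
    using A7 by blast
  show "c \<in> atlas X \<Longrightarrow> covering_space (bproj X -` cdom c) (\<lambda>u. (bproj X u, bframe X c u))
      {(p, F). p \<in> cdom c \<and> transpose F ** metr X c p ** F = mat 1 \<and> det F > 0}"
    by (rule A9[THEN bspec])
  show "spin_frame X c s \<Longrightarrow> spin_frame X c' s' \<Longrightarrow>
      (\<forall>p\<in>cdom c \<inter> cdom c'. S' p \<in> spin_group (gam X) \<and> s' p = bact X (s p) (S' p)) \<Longrightarrow>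
      smooth_on (overlap c c') (\<lambda>x. S' (param c x))"
    by (rule A10[THEN spec, THEN spec, THEN spec, THEN spec, THEN spec, THEN mp, THEN mp, THEN mp])
qed

text \<open>Over the chart the spinor is determined by equivariance from its components in the frame s;
  the extension by 0 is smooth because the image of K is closed in the Hausdorff manifold.\<close>

lemma test_spinor_exists:
  fixes X :: "('m::{t2_space}, 'p::topological_space, 'z) spin_manifold_scheme"
    and v :: "real^4 \<Rightarrow> complex^4"
  assumes X: "spin_structure X" and M: "oriented_manifold UNIV (atlas X)" and s: "spin_frame X c s"
    and v: "smooth_on UNIV v" and K: "compact K" "K \<subseteq> crange c" "\<And>y. y \<notin> K \<Longrightarrow> v y = 0"
  shows "\<exists>\<Psi>. test_spinor X \<Psi> \<and> spinor_support X \<Psi> \<subseteq> cdom c \<and> local_rep c s \<Psi> = v"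
proof -
  let ?G = "spin_group (gam X)"
  note rel = spin_relations[OF X]
  have c: "c \<in> atlas X" and sp: "\<And>p. p \<in> cdom c \<Longrightarrow> bproj X (s p) = p" using s by (auto simp: spin_frame_def)
  have charts: "c' \<in> atlas X \<Longrightarrow> is_chart UNIV c'" and compat: "c' \<in> atlas X \<Longrightarrow> c'' \<in> atlas X \<Longrightarrow> oriented_compatible c' c''" for c' c''
    using M by (auto simp: oriented_manifold_def)
  note cc = charts[OF c]
  \<comment> \<open>\<open>T u\<close> is the group element that carries the point of s over the
    base point of u to u itself; equivariance forces the value at u to be its inverse applied to the
    components in s.\<close>
  define T where "T u = (THE S. S \<in> ?G \<and> u = bact X (s (bproj X u)) S)" for u
  have T: "T u \<in> ?G" "u = bact X (s (bproj X u)) (T u)" if "bproj X u \<in> cdom c" for u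
    using theI'[OF spin_torsor[OF X, of "s (bproj X u)" u]] sp[OF that] unfolding T_def by auto
  have Tuniq: "T u = S" if "bproj X u \<in> cdom c" "S \<in> ?G" "u = bact X (s (bproj X u)) S" for u S
    using spin_torsor[OF X, of "s (bproj X u)" u] T[OF that(1)] that sp[OF that(1)] by metis
  define \<Psi> where "\<Psi> u = (if bproj X u \<in> cdom c then matrix_inv (T u) *v v (coord c (bproj X u)) else 0)" for u
  have equiv: "\<Psi> (bact X u S) = matrix_inv S *v \<Psi> u" if S: "S \<in> ?G" for u S
  proof (cases "bproj X u \<in> cdom c")
    case True
    have "T (bact X u S) = T u ** S"
    proof (rule Tuniq)
      show "bproj X (bact X u S) \<in> cdom c" using True by (simp add: spin_bproj_act[OF X S])
      show "T u ** S \<in> ?G" by (rule spin_group_mult[OF T(1)[OF True] S])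
      show "bact X u S = bact X (s (bproj X (bact X u S))) (T u ** S)"
        using T[OF True] by (simp add: spin_bproj_act[OF X S] spin_act_act[OF X _ S, symmetric])
    qed
    then show ?thesis using True
      by (simp add: \<Psi>_def spin_bproj_act[OF X S] spin_group_matrix_inv_mult[OF rel T(1)[OF True] S] matrix_vector_mul_assoc)
  qed (simp add: \<Psi>_def spin_bproj_act[OF X S])
  have pK: "compact (param c ` K)" "param c ` K \<subseteq> cdom c"
    using K chart_param_in[OF cc] by (auto intro!: compact_continuous_image continuous_on_subset[OF chart_cont_param[OF cc]])
  have z: "\<Psi> u = 0" if "bproj X u \<notin> param c ` K" for u
  proof (cases "bproj X u \<in> cdom c")
    case True
    have "coord c (bproj X u) \<notin> K" using that chart_param_coord[OF cc True] by force
    then show ?thesis by (simp add: \<Psi>_def K(3))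
  qed (simp add: \<Psi>_def)
  have smooth: "smooth_on (crange c') (\<lambda>x. \<Psi> (s' (param c' x)))" if s': "spin_frame X c' s'" for c' s'
  proof -
    have c': "c' \<in> atlas X" and s'p: "\<And>p. p \<in> cdom c' \<Longrightarrow> bproj X (s' p) = p" using s' by (auto simp: spin_frame_def)
    note cc' = charts[OF c']
    \<comment> \<open>Two open sets cover the chart: on \<open>A\<close> the spinor is expressed
      through transition functions, and on \<open>B\<close>, away from the compact image of K, it is
      zero.\<close>
    define A where "A = overlap c' c"
    define B where "B = crange c' \<inter> param c' -` (- (param c ` K))"
    have oA: "open A" unfolding A_def by (rule overlap_open[OF cc' cc])
    have oB: "open B" unfolding B_def
      by (rule continuous_open_preimage[OF chart_cont_param[OF cc'] chart_open_range[OF cc']])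
        (use pK(1) compact_imp_closed in blast)
    have AB: "crange c' \<subseteq> A \<union> B" unfolding A_def B_def overlap_eq[OF cc'] using pK(2) by blast
    have "smooth_on B (\<lambda>x. \<Psi> (s' (param c' x)))"
      by (rule smooth_on_cong[OF oB, of "\<lambda>x. 0"])
        (use z s'p chart_param_in[OF cc'] in \<open>auto simp: B_def\<close>)
    moreover have "smooth_on A (\<lambda>x. \<Psi> (s' (param c' x)))"
    proof -
      \<comment> \<open>\<open>S\<close> goes from s' to s and is therefore the inverse of
        \<open>T\<close> along s'. In this direction smoothness of the transition functions applies
        without inverting a matrix.\<close>
      define S where "S p = (THE S. S \<in> ?G \<and> s p = bact X (s' p) S)" for p
      have S: "S p \<in> ?G" "s p = bact X (s' p) (S p)" if "p \<in> cdom c' \<inter> cdom c" for p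
        using theI'[OF spin_torsor[OF X, of "s' p" "s p"]] sp s'p that unfolding S_def by auto
      have sS: "smooth_on A (\<lambda>x. S (param c' x))"
        unfolding A_def by (rule spin_transition_smooth[OF X s' s]) (use S in blast)
      have tr: "smooth_on A (transition c' c)"
        using compat[OF c' c] by (simp add: A_def oriented_compatible_def)
      have "smooth_on A (\<lambda>x. S (param c' x) *v v (transition c' c x))"
        by (intro smooth_on_bilinear[OF oA bounded_bilinear_cmv] sS smooth_on_compose[OF oA v tr]) auto
      then show ?thesis
      proof (rule smooth_on_cong[OF oA, rotated])
        fix x assume "x \<in> A"
        define p where "p = param c' x"
        have p: "p \<in> cdom c' \<inter> cdom c" using \<open>x \<in> A\<close> chart_param_in[OF cc'] by (auto simp: p_def A_def overlap_eq[OF cc'])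
        have b: "bproj X (s' p) = p" using s'p p by blast
        have TG: "T (s' p) \<in> ?G" "s' p = bact X (s p) (T (s' p))" using T[of "s' p"] b p by auto
        have "s p = bact X (s p) (T (s' p) ** S p)"
          using S[OF p] TG by (metis spin_act_act[OF X])
        moreover have "s p = bact X (s p) (mat 1)" by (simp add: spin_act_one[OF X])
        moreover have "T (s' p) ** S p \<in> ?G" by (rule spin_group_mult[OF TG(1) S(1)[OF p]])
        ultimately have e: "T (s' p) ** S p = mat 1"
          using spin_torsor[OF X, of "s p" "s p"] spin_group.one by metis
        have "matrix_inv (T (s' p)) = matrix_inv (T (s' p)) ** (T (s' p) ** S p)" by (simp add: e)
        also have "\<dots> = S p" unfolding matrix_mul_assoc spin_group_matrix_inv[OF rel TG(1)] by simp
        finally show "S (param c' x) *v v (transition c' c x) = \<Psi> (s' (param c' x))"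
          using p b by (simp add: \<Psi>_def transition_def flip: p_def)
      qed
    qed
    ultimately have "smooth_on (A \<union> B) (\<lambda>x. \<Psi> (s' (param c' x)))" by (intro smooth_on_Un)
    then show ?thesis by (rule smooth_on_subset) (rule AB)
  qed
  have supp: "spinor_support X \<Psi> \<subseteq> param c ` K"
  proof -
    have "bproj X ` {u. \<Psi> u \<noteq> 0} \<subseteq> param c ` K" using z by blast
    then show ?thesis unfolding spinor_support_def by (rule closure_minimal) (rule compact_imp_closed[OF pK(1)])
  qed
  have "compact (spinor_support X \<Psi>)"
    using compact_Int_closed[OF pK(1), of "spinor_support X \<Psi>"] supp
    by (simp add: spinor_support_def Int_absorb1)
  then have "test_spinor X \<Psi>" unfolding test_spinor_def smooth_spinor_def using equiv smooth by blast
  moreover have "local_rep c s \<Psi> = v"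
  proof
    fix x
    show "local_rep c s \<Psi> x = v x"
    proof (cases "x \<in> crange c")
      case True
      have p: "param c x \<in> cdom c" by (rule chart_param_in[OF cc True])
      have b: "bproj X (s (param c x)) = param c x" by (rule sp[OF p])
      have "T (s (param c x)) = mat 1" by (rule Tuniq) (use p b spin_act_one[OF X] spin_group.one in auto)
      moreover have "matrix_inv (mat 1 :: complex^4^4) = mat 1" by (rule matrix_inv_eqI) auto
      ultimately show ?thesis using True p b chart_coord_param[OF cc True] by (simp add: local_rep_def \<Psi>_def)
    next
      case False
      then show ?thesis using K by (auto simp: local_rep_def)
    qed
  qed
  ultimately show ?thesis using supp pK(2) by blast
qed

definition dirac_order_zero :: "(4 \<Rightarrow> complex^4^4) \<Rightarrow> (real^4 \<Rightarrow> real^4^4) \<Rightarrow> (real^4 \<Rightarrow> real^4^4) \<Rightarrow> real^4 \<Rightarrow> complex^4^4" where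
  "dirac_order_zero \<gamma> G E x = (\<Sum>i\<in>UNIV. \<gamma> i ** ((1/4) *\<^sub>R (\<Sum>s\<in>UNIV. \<Sum>t\<in>UNIV. frame_connection G E x i s t *\<^sub>R (\<gamma> s ** \<gamma> t))))"

lemma local_dirac_eq:
  "local_dirac \<gamma> G E \<psi> x = (\<Sum>i\<in>UNIV. \<gamma> i *v dird (column i (E x)) \<psi> x) + dirac_order_zero \<gamma> G E x *v \<psi> x"
  unfolding local_dirac_def dirac_order_zero_def
  by (simp add: matrix_vector_right_distrib sum.distrib bounded_bilinear.sum_left[OF bounded_bilinear_cmv]
      bounded_bilinear.scaleR_left[OF bounded_bilinear_cmv] flip: matrix_vector_mul_assoc)

text \<open>The components of \<open>Q \<Psi>\<close> over the chart serve as the function f of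
  \<open>local_symbol_equations\<close>: they are smooth, they are given there by the symbol and a
  smooth kernel, and the local formula for \<open>D\<close> applies to them. Every admissible v
  occurs as the components of some test spinor, by \<open>test_spinor_exists\<close>.\<close>

lemma parametrix_symbol_equations:
  fixes X :: "('m::{t2_space}, 'p::topological_space, 'z) spin_manifold_scheme"
  assumes X: "spin_structure X" and M: "oriented_manifold UNIV (atlas X)" and s: "spin_frame X c s"
    and D: "dirac_operator X D" and Q: "parametrix X D Q" and \<sigma>: "full_symbol X Q c s \<sigma>"
    and x: "x \<in> crange c" and \<xi>: "\<xi> \<noteq> 0"
  defines "G \<equiv> \<lambda>z. metr X c (param c z)" and "E \<equiv> \<lambda>z. bframe X c (s (param c z))"
  shows "compose_symbol (gam X) (\<lambda>i. column i (E x)) (dirac_order_zero (gam X) G E x) \<xi>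
      (\<sigma> (d - 1) (x, \<xi>)) (\<lambda>i. dird (column i (E x), 0) (\<sigma> d) (x, \<xi>)) (\<sigma> d (x, \<xi>)) = (if d = 0 then mat 1 else 0)"
proof -
  have c: "c \<in> atlas X" using s by (simp add: spin_frame_def)
  have cc: "is_chart UNIV c" using M c by (auto simp: oriented_manifold_def)
  obtain m q k where q: "symbol_class m (crange c) q" and e: "classical_expansion m (crange c) q \<sigma>"
    and k: "smooth_on (crange c \<times> crange c) k"
    and Qk: "\<And>\<Psi> z. test_spinor X \<Psi> \<Longrightarrow> spinor_support X \<Psi> \<subseteq> cdom c \<Longrightarrow> z \<in> crange c \<Longrightarrow>
        Q \<Psi> (s (param c z)) = quantize q (local_rep c s \<Psi>) z + (LINT y|lborel. k (z, y) *v local_rep c s \<Psi> y)"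
    using \<sigma> unfolding full_symbol_def full_symbol_of_order_def smooth_kernel_def by blast
  have Qs: "\<And>\<Psi>. test_spinor X \<Psi> \<Longrightarrow> smooth_spinor X (Q \<Psi>)"
    and sm: "smoothing_operator X (\<lambda>\<Psi> u. D (Q \<Psi>) u - \<Psi> u)"
    using Q unfolding parametrix_def pseudodifferential_def by blast+
  obtain k1 where k1: "smooth_on (crange c \<times> crange c) k1"
    and DQ: "\<And>\<Psi> z. test_spinor X \<Psi> \<Longrightarrow> spinor_support X \<Psi> \<subseteq> cdom c \<Longrightarrow> z \<in> crange c \<Longrightarrow>
        D (Q \<Psi>) (s (param c z)) - \<Psi> (s (param c z)) = (LINT y|lborel. k1 (z, y) *v local_rep c s \<Psi> y)"
    using sm s unfolding smoothing_operator_def smooth_kernel_def by blast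
  show ?thesis
  proof (rule local_symbol_equations[OF chart_open_range[OF cc] x q e k k1 _ \<xi>])
 fix v :: "real^4 \<Rightarrow> complex^4" and K
    assume v: "smooth_on UNIV v" "compact K" "K \<subseteq> crange c" "\<And>y. y \<notin> K \<Longrightarrow> v y = 0"
    obtain \<Psi> where \<Psi>: "test_spinor X \<Psi>" "spinor_support X \<Psi> \<subseteq> cdom c" "local_rep c s \<Psi> = v"
      using test_spinor_exists[OF X M s v] by blast
    let ?f = "local_rep c s (Q \<Psi>)"
    have "smooth_on (crange c) (\<lambda>x. Q \<Psi> (s (param c x)))"
      using Qs[OF \<Psi>(1)] s unfolding smooth_spinor_def by blast
    then have "smooth_on (crange c) ?f"
      by (rule smooth_on_cong[OF chart_open_range[OF cc], rotated]) (simp add: local_rep_def)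
    then have fd: "?f differentiable (at x)" using x smooth_onD_diff by blast
    have f: "\<forall>z\<in>crange c. ?f z = quantize q v z + (LINT y|lborel. k (z, y) *v v y)"
      using Qk[OF \<Psi>(1,2)] by (simp add: local_rep_def[of c s "Q \<Psi>"] \<Psi>(3))
    have "D (Q \<Psi>) (s (param c x)) = local_dirac (gam X) G E ?f x"
      using D Qs[OF \<Psi>(1)] s x unfolding dirac_operator_def G_def E_def by blast
    moreover have "\<Psi> (s (param c x)) = v x" using x by (simp add: \<Psi>(3)[symmetric] local_rep_def)
    ultimately have "(\<Sum>i\<in>UNIV. gam X i *v dird (column i (E x)) ?f x) + dirac_order_zero (gam X) G E x *v ?f x - v x
        = (LINT y|lborel. k1 (x, y) *v v y)"
      using DQ[OF \<Psi>(1,2) x] by (simp add: local_dirac_eq \<Psi>(3))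
    then show "\<exists>f. (\<forall>z\<in>crange c. f z = quantize q v z + (LINT y|lborel. k (z, y) *v v y)) \<and> f differentiable (at x) \<and>
        (\<Sum>i\<in>UNIV. gam X i *v dird (column i (E x)) f x) + dirac_order_zero (gam X) G E x *v f x - v x
        = (LINT y|lborel. k1 (x, y) *v v y)"
      using f fd by blast
  qed
qed

section \<open>Charts adapted to the collar\<close>

text \<open>Charts are cut down because the orthonormal frame is lifted to the spin bundle only over
  an evenly covered neighbourhood.\<close>

definition restrict_chart :: "('a, 'n::finite) chart \<Rightarrow> 'a set \<Rightarrow> ('a, 'n) chart" where
  "restrict_chart c U = (cdom c \<inter> U, coord c)"

lemma restrict_chart_simps [simp]:
  "cdom (restrict_chart c U) = cdom c \<inter> U" "coord (restrict_chart c U) = coord c"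
  by (simp_all add: restrict_chart_def)

lemma crange_restrict_chart: "crange (restrict_chart c U) = coord c ` (cdom c \<inter> U)"
  by (simp add: crange_def)

lemma param_subchart:
  assumes c: "is_chart X c" and sub: "cdom r \<subseteq> cdom c" and eq: "\<And>p. p \<in> cdom r \<Longrightarrow> coord r p = coord c p"
    and x: "x \<in> crange r"
  shows "param r x = param c x" "param r x \<in> cdom r" "x \<in> crange c"
proof -
  obtain p where p: "p \<in> cdom r" "x = coord r p" using x by (auto simp: crange_def)
  have "inj_on (coord r) (cdom r)"
    using inj_on_subset[OF chart_inj[OF c] sub] eq by (simp add: inj_on_def)
  then have "param r x = p" unfolding param_def p(2) by (rule inv_into_f_f) (rule p(1))
  moreover have "param c x = p"
    using p sub eq chart_param_coord[OF c, of p] by auto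
  ultimately show "param r x = param c x" "param r x \<in> cdom r" using p by auto
  show "x \<in> crange c" using p sub eq chart_coord_in[OF c, of p] by auto
qed

lemma jacobian_cong_open:
  assumes "open S" "x \<in> S" "\<And>y. y \<in> S \<Longrightarrow> f y = g y"
  shows "jacobian f (at x) = jacobian g (at x)"
proof -
  have "frechet_derivative f (at x) = frechet_derivative g (at x)"
    using dird_cong_open[OF assms] by (auto simp: dird_def fun_eq_iff)
  then show ?thesis by (simp add: jacobian_def)
qed

lemma jacobian_id: "jacobian (\<lambda>x. x) (at x) = mat 1"
proof -
  have "frechet_derivative (\<lambda>x. x) (at x) = (\<lambda>h. h)"
    using frechet_derivative_at[OF has_derivative_ident, of x] by simp
  then show ?thesis by (simp add: jacobian_def matrix_def mat_def axis_def vec_eq_iff)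
qed

lemma restrict_chart_is_chart:
  assumes c: "is_chart (UNIV :: 'a::topological_space set) c" and U: "open U"
  shows "is_chart UNIV (restrict_chart c U)"
proof -
  let ?r = "restrict_chart c U"
  have sub: "cdom ?r \<subseteq> cdom c" by simp
  note ps = param_subchart[OF c sub]
  have oc: "open (cdom c)" using chart_openin[OF c] by simp
  have cr: "crange ?r = crange c \<inter> param c -` U"
    using overlap_eq[OF c, of "(U, coord c)"] by (simp add: crange_restrict_chart overlap_def)
  show ?thesis
    unfolding is_chart_def
  proof (intro conjI)
    show "openin (top_of_set UNIV) (cdom ?r)" using oc U by auto
    show "open (crange ?r)" unfolding cr
      by (rule continuous_open_preimage[OF chart_cont_param[OF c] chart_open_range[OF c] U])
    show "homeomorphism (cdom ?r) (crange ?r) (coord ?r) (param ?r)"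
    proof (rule homeomorphismI)
      show "continuous_on (cdom ?r) (coord ?r)"
        using continuous_on_subset[OF chart_cont_coord[OF c] sub] by simp
      show "continuous_on (crange ?r) (param ?r)"
        by (rule continuous_on_eq[OF continuous_on_subset[OF chart_cont_param[OF c], of "crange ?r"]])
          (auto simp: cr ps(1)[symmetric] intro: ps(1)[symmetric])
      show "coord ?r ` cdom ?r \<subseteq> crange ?r" by (simp add: crange_def)
      show "param ?r ` crange ?r \<subseteq> cdom ?r" using ps(2) by auto
      show "param ?r (coord ?r p) = p" if "p \<in> cdom ?r" for p
      proof -
        have "coord ?r p \<in> crange ?r" using that by (auto simp: crange_def)
        from ps(1)[OF _ this] show ?thesis using chart_param_coord[OF c, of p] that by simp
      qed
      show "coord ?r (param ?r x) = x" if "x \<in> crange ?r" for x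
        using ps[OF _ that] chart_coord_param[OF c, of x] by simp
    qed
  qed
qed

text \<open>Membership follows from maximality of the atlas: transition maps of the restriction are
  restrictions of transition maps, with the same Jacobians on the smaller domain.\<close>

lemma restrict_chart_in_atlas:
  assumes M: "oriented_manifold (UNIV :: 'a::topological_space set) A" and c: "c \<in> A" and U: "open U"
  shows "restrict_chart c U \<in> A"
proof -
  let ?r = "restrict_chart c U"
  note MA = M[unfolded oriented_manifold_def]
  have charts: "c' \<in> A \<Longrightarrow> is_chart UNIV c'" for c' by (rule MA[THEN conjunct1, THEN bspec])
  have compat: "c' \<in> A \<Longrightarrow> c'' \<in> A \<Longrightarrow> oriented_compatible c' c''" for c' c''
    by (rule MA[THEN conjunct2, THEN conjunct2, THEN conjunct1, THEN bspec, THEN bspec])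
  have max: "c \<in> A" if "is_chart UNIV c" "\<And>c'. c' \<in> A \<Longrightarrow> oriented_compatible c c' \<and> oriented_compatible c' c" for c
    by (rule MA[THEN conjunct2, THEN conjunct2, THEN conjunct2, THEN spec, THEN mp]) (use that in blast)
  note cc = charts[OF c]
  have r: "is_chart UNIV ?r" by (rule restrict_chart_is_chart[OF cc U])
  note ps = param_subchart[OF cc, of ?r]
  show ?thesis
  proof (rule max[OF r], intro conjI)
    fix c' assume c': "c' \<in> A"
    note cc' = charts[OF c']
    have t: "transition ?r c' x = transition c c' x" if "x \<in> crange ?r" for x
      using ps(1)[OF _ _ that] by (simp add: transition_def)
    show "oriented_compatible ?r c'"
      unfolding oriented_compatible_def
    proof (intro conjI ballI)
      have "smooth_on (overlap c c') (transition c c')" using compat[OF c c'] by (simp add: oriented_compatible_def)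
      then have "smooth_on (overlap ?r c') (transition c c')"
        by (rule smooth_on_subset) (auto simp: overlap_def)
      then show "smooth_on (overlap ?r c') (transition ?r c')"
        by (rule smooth_on_cong[OF overlap_open[OF r cc'], rotated]) (rule t[symmetric], auto simp: overlap_eq[OF r])
      fix p assume p: "p \<in> cdom ?r \<inter> cdom c'"
      have "jac ?r c' p = jac c c' p"
        unfolding jac_def restrict_chart_simps
        by (rule jacobian_cong_open[OF chart_open_range[OF r]]) (use p t in \<open>auto simp: crange_restrict_chart\<close>)
      then show "det (jac ?r c' p) > 0" using compat[OF c c'] p by (simp add: oriented_compatible_def)
    qed
    have tr: "transition c' ?r = transition c' c" by (simp add: transition_def fun_eq_iff)
    show "oriented_compatible c' ?r"
      unfolding oriented_compatible_def
    proof (intro conjI ballI)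
      have "smooth_on (overlap c' c) (transition c' c)" using compat[OF c' c] by (simp add: oriented_compatible_def)
      then show "smooth_on (overlap c' ?r) (transition c' ?r)"
        unfolding tr by (rule smooth_on_subset) (auto simp: overlap_def)
      fix p assume "p \<in> cdom c' \<inter> cdom ?r"
      then show "det (jac c' ?r p) > 0" using compat[OF c' c] by (simp add: oriented_compatible_def jac_def tr)
    qed
  qed
qed

text \<open>An adapted chart is only known to agree with the collar chart on a smaller domain, not
  to be a \<open>restrict_chart\<close> of it; hence the general form.\<close>

lemma jac_subchart:
  assumes c: "is_chart (UNIV :: 'a::topological_space set) c" and r: "is_chart UNIV r"
    and sub: "cdom r \<subseteq> cdom c" and eq: "\<And>p. p \<in> cdom r \<Longrightarrow> coord r p = coord c p" and p: "p \<in> cdom r"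
  shows "jac r c p = mat 1" "jac c r p = mat 1"
proof -
  have ps: "param r y = param c y" "y \<in> crange c" if "y \<in> crange r" for y
    by (rule param_subchart[OF c sub _ that], rule eq, assumption)+
  have x: "coord r p \<in> crange r" by (rule chart_coord_in[OF r p])
  have "jac r c p = jacobian (\<lambda>x. x) (at (coord r p))"
    unfolding jac_def
  proof (rule jacobian_cong_open[OF chart_open_range[OF r] x])
    fix y assume y: "y \<in> crange r"
    show "transition r c y = y"
      using chart_coord_param[OF c ps(2)[OF y]] ps(1)[OF y] by (simp add: transition_def)
  qed
  then show "jac r c p = mat 1" by (simp add: jacobian_id)
  have "jac c r p = jacobian (\<lambda>x. x) (at (coord r p))"
    unfolding jac_def eq[OF p, symmetric]
  proof (rule jacobian_cong_open[OF chart_open_range[OF r] x])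
    fix y assume y: "y \<in> crange r"
    show "transition c r y = y"
      using chart_coord_param[OF r y] ps(1)[OF y] by (simp add: transition_def)
  qed
  then show "jac c r p = mat 1" by (simp add: jacobian_id)
qed

section \<open>Block matrices over the collar\<close>

lemma down_simps [simp]: "down 1 = 1" "down 2 = 2" "down 3 = 3"
  by (simp_all add: down_def)

lemma up_simps [simp]: "up 1 = 1" "up 2 = 2" "up 3 = 3"
  by (simp_all add: up_def)

lemma down_up [simp]: "down (up i) = i"
  using exhaust_3[of i] by auto

lemma up_neq_4 [simp]: "up i \<noteq> 4" "4 \<noteq> up i"
  using exhaust_3[of i] by auto

lemma join_4 [simp]: "Defs.join x t $ 4 = t"
  by (simp add: Defs.join_def)

lemma join_up [simp]: "Defs.join x t $ up i = x $ i"
  by (simp add: Defs.join_def)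

lemma up_down: "j \<noteq> 4 \<Longrightarrow> up (down j) = j"
  using exhaust_4[of j] by auto

text \<open>Over a flat boundary chart both the collar metric and the adapted frame have this
  shape.\<close>

definition diag_block :: "real \<Rightarrow> real \<Rightarrow> real^4^4" where
  "diag_block r a = (\<chi> i j. if i = j then (if i = 4 then a else r) else 0)"

lemma block_scale_mat: "block (r *\<^sub>R mat 1) a = diag_block r a"
proof -
  have "down i = down j \<longleftrightarrow> i = j" if "i \<noteq> 4" "j \<noteq> 4" for i j
    using up_down that by metis
  then show ?thesis by (auto simp: block_def diag_block_def vec_eq_iff mat_def)
qed

lemma block_mat: "block (mat r) a = diag_block r a"
proof -
  have "mat r = r *\<^sub>R (mat 1 :: real^3^3)" by (simp add: mat_def vec_eq_iff)
  then show ?thesis by (simp add: block_scale_mat)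
qed

text \<open>The affine form through which the frame inherits continuity and smoothness from the
  warping function.\<close>

lemma diag_block_affine: "diag_block r a = r *\<^sub>R diag_block 1 0 + a *\<^sub>R diag_block 0 1"
  by (simp add: diag_block_def vec_eq_iff)

lemma diag_block_mult: "diag_block r a ** diag_block s b = diag_block (r * s) (a * b)"
proof -
  let ?d = "\<lambda>i. if i = 4 then a else r" and ?e = "\<lambda>i. if i = 4 then b else s"
  have "(\<Sum>k\<in>UNIV. diag_block r a $ i $ k * diag_block s b $ k $ j) = (\<Sum>k\<in>UNIV. if k = i then ?d i * diag_block s b $ i $ j else 0)" for i j
    by (rule sum.cong[OF refl]) (simp add: diag_block_def)
  then show ?thesis
    by (simp add: vec_eq_iff matrix_matrix_mult_def) (simp add: diag_block_def)
qed

lemma diag_block_1: "diag_block 1 1 = mat 1"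
  by (simp add: diag_block_def mat_def vec_eq_iff)

lemma transpose_diag_block: "transpose (diag_block r a) = diag_block r a"
  by (auto simp: diag_block_def transpose_def vec_eq_iff)

lemma det_diag_block: "det (diag_block r a) = r ^ 3 * a"
proof -
  have "det (diag_block r a) = (\<Prod>i\<in>UNIV. diag_block r a $ i $ i)"
    by (rule det_diagonal) (simp add: diag_block_def)
  also have "\<dots> = (\<Prod>i\<in>(UNIV::4 set). if i = 4 then a else r)"
    by (rule prod.cong[OF refl]) (simp add: diag_block_def)
  also have "\<dots> = r ^ 3 * a"
    unfolding UNIV_4 by (simp add: power3_eq_cube)
  finally show ?thesis .
qed

lemma column_diag_block: "column i (diag_block r a) = (if i = 4 then a else r) *\<^sub>R axis i 1"
  by (auto simp: column_def diag_block_def vec_eq_iff axis_def)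

section \<open>The collar and its adapted frames\<close>

locale collar_spin =
  fixes X :: "('m::{t2_space, second_countable_topology}, 'p::topological_space, 'z) collar_manifold_scheme"
  assumes X: "spin_manifold_with_collar X"
begin

lemma
  shows manifold: "oriented_manifold UNIV (atlas X)"
    and metric: "riemannian_metric (atlas X) (metr X)"
    and spin: "spin_structure (X :: ('m, 'p, 'z) collar_manifold_scheme)"
    and boundary_manifold: "oriented_manifold (bdry X) (batlas X)"
    and boundary_metric: "riemannian_metric (batlas X) (bmetr X)"
    and ceps_pos: "ceps X > 0"
    and warp_smooth: "smooth_on {- ceps X<..<1} (warp X)"
    and warp_pos: "\<And>t. t \<in> {- ceps X<..<1} \<Longrightarrow> warp X t > 0"
    and collar_homeo: "\<exists>r. homeomorphism (collar_dom X (bdry X)) (collar X ` collar_dom X (bdry X)) (collar X) r"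
    and collar_0: "\<And>y. y \<in> bdry X \<Longrightarrow> collar X (y, 0) = y"
    and collar_chart_atlas: "\<And>b. b \<in> batlas X \<Longrightarrow> collar_chart X b \<in> atlas X"
    and collar_metric: "\<And>b y t. b \<in> batlas X \<Longrightarrow> y \<in> cdom b \<Longrightarrow> t \<in> {- ceps X<..<1} \<Longrightarrow>
        metr X (collar_chart X b) (collar X (y, t)) = block ((1 / warp X t) *\<^sub>R bmetr X b y) 1"
proof -
  note A = X[unfolded spin_manifold_with_collar_def]
  note A1 = A[THEN conjunct1]
  note A2 = A[THEN conjunct2, THEN conjunct1]
  note A3 = A[THEN conjunct2, THEN conjunct2, THEN conjunct1]
  note A4 = A[THEN conjunct2, THEN conjunct2, THEN conjunct2, THEN conjunct1]
  note A5 = A[THEN conjunct2, THEN conjunct2, THEN conjunct2, THEN conjunct2, THEN conjunct1]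
  note A6 = A[THEN conjunct2, THEN conjunct2, THEN conjunct2, THEN conjunct2, THEN conjunct2, THEN conjunct1]
  note A7 = A[THEN conjunct2, THEN conjunct2, THEN conjunct2, THEN conjunct2, THEN conjunct2, THEN conjunct2, THEN conjunct1]
  note A8 = A[THEN conjunct2, THEN conjunct2, THEN conjunct2, THEN conjunct2, THEN conjunct2, THEN conjunct2, THEN conjunct2, THEN conjunct1]
  note A9 = A[THEN conjunct2, THEN conjunct2, THEN conjunct2, THEN conjunct2, THEN conjunct2, THEN conjunct2, THEN conjunct2, THEN conjunct2, THEN conjunct1]
  note A10 = A[THEN conjunct2, THEN conjunct2, THEN conjunct2, THEN conjunct2, THEN conjunct2, THEN conjunct2, THEN conjunct2, THEN conjunct2, THEN conjunct2, THEN conjunct1]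
  note A11 = A[THEN conjunct2, THEN conjunct2, THEN conjunct2, THEN conjunct2, THEN conjunct2, THEN conjunct2, THEN conjunct2, THEN conjunct2, THEN conjunct2, THEN conjunct2, THEN conjunct1]
  note A12 = A[THEN conjunct2, THEN conjunct2, THEN conjunct2, THEN conjunct2, THEN conjunct2, THEN conjunct2, THEN conjunct2, THEN conjunct2, THEN conjunct2, THEN conjunct2, THEN conjunct2, THEN conjunct1]
  note A13 = A[THEN conjunct2, THEN conjunct2, THEN conjunct2, THEN conjunct2, THEN conjunct2, THEN conjunct2, THEN conjunct2, THEN conjunct2, THEN conjunct2, THEN conjunct2, THEN conjunct2, THEN conjunct2, THEN conjunct1]
  note A14 = A[THEN conjunct2, THEN conjunct2, THEN conjunct2, THEN conjunct2, THEN conjunct2, THEN conjunct2, THEN conjunct2, THEN conjunct2, THEN conjunct2, THEN conjunct2, THEN conjunct2, THEN conjunct2, THEN conjunct2, THEN conjunct1]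
  note A15 = A[THEN conjunct2, THEN conjunct2, THEN conjunct2, THEN conjunct2, THEN conjunct2, THEN conjunct2, THEN conjunct2, THEN conjunct2, THEN conjunct2, THEN conjunct2, THEN conjunct2, THEN conjunct2, THEN conjunct2, THEN conjunct2, THEN conjunct1]
  note A16 = A[THEN conjunct2, THEN conjunct2, THEN conjunct2, THEN conjunct2, THEN conjunct2, THEN conjunct2, THEN conjunct2, THEN conjunct2, THEN conjunct2, THEN conjunct2, THEN conjunct2, THEN conjunct2, THEN conjunct2, THEN conjunct2, THEN conjunct2, THEN conjunct1]
  note A17 = A[THEN conjunct2, THEN conjunct2, THEN conjunct2, THEN conjunct2, THEN conjunct2, THEN conjunct2, THEN conjunct2, THEN conjunct2, THEN conjunct2, THEN conjunct2, THEN conjunct2, THEN conjunct2, THEN conjunct2, THEN conjunct2, THEN conjunct2, THEN conjunct2]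
  show "oriented_manifold UNIV (atlas X)" "riemannian_metric (atlas X) (metr X)"
    "spin_structure (X :: ('m, 'p, 'z) collar_manifold_scheme)"
    "oriented_manifold (bdry X) (batlas X)" "riemannian_metric (batlas X) (bmetr X)"
    "ceps X > 0" "smooth_on {- ceps X<..<1} (warp X)"
    "\<exists>r. homeomorphism (collar_dom X (bdry X)) (collar X ` collar_dom X (bdry X)) (collar X) r"
    by (rule A1 A2 A3 A6 A7 A8 A9 A12)+
  show "\<And>t. t \<in> {- ceps X<..<1} \<Longrightarrow> warp X t > 0" by (rule A10[THEN bspec])
  show "\<And>y. y \<in> bdry X \<Longrightarrow> collar X (y, 0) = y" by (rule A13[THEN bspec])
  show "\<And>b. b \<in> batlas X \<Longrightarrow> collar_chart X b \<in> atlas X" by (rule A16[THEN bspec])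
  show "\<And>b y t. b \<in> batlas X \<Longrightarrow> y \<in> cdom b \<Longrightarrow> t \<in> {- ceps X<..<1} \<Longrightarrow>
      metr X (collar_chart X b) (collar X (y, t)) = block ((1 / warp X t) *\<^sub>R bmetr X b y) 1"
    by (rule A17[THEN bspec, THEN bspec, THEN bspec])
qed

lemma atlas_chart: "c \<in> atlas X \<Longrightarrow> is_chart UNIV c"
  using manifold by (auto simp: oriented_manifold_def)

lemma batlas_dom: "b \<in> batlas X \<Longrightarrow> cdom b \<subseteq> bdry X"
  using boundary_manifold by (auto simp: oriented_manifold_def)

lemma collar_inj: "inj_on (collar X) (collar_dom X (bdry X))"
proof -
  obtain r where "homeomorphism (collar_dom X (bdry X)) (collar X ` collar_dom X (bdry X)) (collar X) r"
    using collar_homeo by blast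
  then show ?thesis by (intro inj_on_inverseI[of _ r]) (rule homeomorphism_apply1)
qed

lemma collar_inv: "y \<in> bdry X \<Longrightarrow> t \<in> {- ceps X<..<1} \<Longrightarrow>
    inv_into (collar_dom X (bdry X)) (collar X) (collar X (y, t)) = (y, t)"
  by (rule inv_into_f_f[OF collar_inj]) (simp add: collar_dom_def)

lemma normal_coord_collar: "y \<in> bdry X \<Longrightarrow> t \<in> {- ceps X<..<1} \<Longrightarrow> normal_coord X (collar X (y, t)) = t"
  by (simp add: normal_coord_def collar_inv)

lemma collar_chart_coord:
  assumes "b \<in> batlas X" "y \<in> cdom b" "t \<in> {- ceps X<..<1}"
  shows "collar X (y, t) \<in> cdom (collar_chart X b)" "coord (collar_chart X b) (collar X (y, t)) = Defs.join (coord b y) t"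
proof -
  show "collar X (y, t) \<in> cdom (collar_chart X b)" using assms by (auto simp: collar_chart_def collar_dom_def)
  have "y \<in> bdry X" using batlas_dom assms by blast
  then show "coord (collar_chart X b) (collar X (y, t)) = Defs.join (coord b y) t"
    using assms(3) by (simp add: collar_chart_def collar_inv)
qed

lemma collar_chart_cases:
  assumes "p \<in> cdom (collar_chart X b)"
  obtains y t where "y \<in> cdom b" "t \<in> {- ceps X<..<1}" "p = collar X (y, t)"
  using assms by (auto simp: collar_chart_def collar_dom_def)

lemma adapted_collar:
  assumes "adapted X b c s y" "x \<in> crange c"
  obtains y' where "y' \<in> cdom b" "x $ 4 \<in> {- ceps X<..<1}" "param c x = collar X (y', x $ 4)"
    "metr X (collar_chart X b) (param c x) = diag_block (1 / warp X (x $ 4)) 1"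
    "normal_coord X (param c x) = x $ 4"
proof -
  have b: "b \<in> batlas X" and fl: "flat_chart (bmetr X) b" and sub: "cdom c \<subseteq> cdom (collar_chart X b)"
    and eq: "\<And>p. p \<in> cdom c \<Longrightarrow> coord c p = coord (collar_chart X b) p" and c: "c \<in> atlas X"
    using assms(1) by (auto simp: adapted_def spin_frame_def)
  have p: "param c x \<in> cdom c" by (rule chart_param_in[OF atlas_chart[OF c] assms(2)])
  then obtain y' t where y': "y' \<in> cdom b" "t \<in> {- ceps X<..<1}" "param c x = collar X (y', t)"
    using sub collar_chart_cases by blast
  have "x = coord c (param c x)" by (rule chart_coord_param[OF atlas_chart[OF c] assms(2), symmetric])
  also have "\<dots> = Defs.join (coord b y') t" using eq[OF p] y' collar_chart_coord(2)[OF b y'(1,2)] by simp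
  finally have x: "x $ 4 = t" by simp
  have "bmetr X b y' = mat 1" using fl y' by (simp add: flat_chart_def)
  then have "metr X (collar_chart X b) (param c x) = diag_block (1 / warp X (x $ 4)) 1"
    using collar_metric[OF b y'(1,2)] by (simp add: y'(3) x block_scale_mat)
  moreover have "normal_coord X (param c x) = x $ 4"
    using normal_coord_collar batlas_dom[OF b] y' x by auto
  ultimately show thesis using that y' x by blast
qed

text \<open>c agrees with the collar chart on its domain, so the Jacobian between them is 1 and the
  collar metric can be read in c directly. Flatness of the boundary chart makes the tangential block
  scalar.\<close>

lemma adapted_metr:
  assumes a: "adapted X b c s y" and x: "x \<in> crange c"
  shows "metr X c (param c x) = diag_block (1 / warp X (x $ 4)) 1"
    and "bframe X c (s (param c x)) = diag_block (sqrt (warp X (x $ 4))) 1"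
    and "x $ 4 \<in> {- ceps X<..<1}"
proof -
  have b: "b \<in> batlas X" and sub: "cdom c \<subseteq> cdom (collar_chart X b)"
    and eq: "\<And>p. p \<in> cdom c \<Longrightarrow> coord c p = coord (collar_chart X b) p" and c: "c \<in> atlas X"
    and fr: "\<And>p. p \<in> cdom c \<Longrightarrow> bframe X c (s p) = block (mat (sqrt (warp X (normal_coord X p)))) 1"
    using a by (auto simp: adapted_def spin_frame_def)
  have p: "param c x \<in> cdom c" by (rule chart_param_in[OF atlas_chart[OF c] x])
  obtain y' where y': "x $ 4 \<in> {- ceps X<..<1}" "metr X (collar_chart X b) (param c x) = diag_block (1 / warp X (x $ 4)) 1"
    "normal_coord X (param c x) = x $ 4"
    using adapted_collar[OF a x] by metis
  have cb: "collar_chart X b \<in> atlas X" by (rule collar_chart_atlas[OF b])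
  have j: "jac c (collar_chart X b) (param c x) = mat 1"
    by (rule jac_subchart(1)[OF atlas_chart[OF cb] atlas_chart[OF c] sub eq p])
  have "metr X c (param c x) = transpose (jac c (collar_chart X b) (param c x)) ** metr X (collar_chart X b) (param c x)
      ** jac c (collar_chart X b) (param c x)"
    using metric c cb p sub unfolding riemannian_metric_def by blast
  then show "metr X c (param c x) = diag_block (1 / warp X (x $ 4)) 1"
    by (simp add: j y' transpose_mat)
  show "bframe X c (s (param c x)) = diag_block (sqrt (warp X (x $ 4))) 1"
    using fr[OF p] by (simp add: y' block_mat)
  show "x $ 4 \<in> {- ceps X<..<1}" by (rule y')
qed

lemma adapted_point:
  assumes a: "adapted X b c s y"
  shows "Defs.join (coord b y) 0 \<in> crange c"
proof -
  have b: "b \<in> batlas X" and eq: "\<And>p. p \<in> cdom c \<Longrightarrow> coord c p = coord (collar_chart X b) p" and c: "c \<in> atlas X"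
    and y: "y \<in> cdom b" "y \<in> cdom c"
    using a by (auto simp: adapted_def spin_frame_def)
  have "coord c y = coord (collar_chart X b) (collar X (y, 0))" using eq[OF y(2)] collar_0 batlas_dom[OF b] y by auto
  also have "\<dots> = Defs.join (coord b y) 0" by (rule collar_chart_coord(2)[OF b y(1)]) (use ceps_pos in simp)
  finally show ?thesis using chart_coord_in[OF atlas_chart[OF c] y(2)] by simp
qed

lemma sqrt_warp_smooth: "smooth_on {- ceps X<..<1} (\<lambda>t. sqrt (warp X t))"
  by (rule smooth_on_compose[OF _ smooth_on_sqrt warp_smooth]) (use warp_pos in auto)

text \<open>The wanted frames form a continuous section of the oriented orthonormal frame bundle
  over the collar chart. Near y this section stays in one evenly covered set, and composing it with
  the inverse of a sheet lifts it to the spin bundle.\<close>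

lemma adapted_exists:
  assumes fl: "flat_metric (bdry X) (batlas X) (bmetr X)" and y: "y \<in> bdry X"
  shows "\<exists>b c s. adapted X b c s y"
proof -
  obtain b where b: "b \<in> batlas X" "y \<in> cdom b" "flat_chart (bmetr X) b"
    using fl y by (auto simp: flat_metric_def)
  define cb where "cb = collar_chart X b"
  have cb: "cb \<in> atlas X" unfolding cb_def by (rule collar_chart_atlas[OF b(1)])
  note ccb = atlas_chart[OF cb]
  define F where "F p = diag_block (sqrt (warp X (normal_coord X p))) 1" for p
  let ?T = "{(p, F). p \<in> cdom cb \<and> transpose F ** metr X cb p ** F = mat 1 \<and> det F > 0}"
  have nc: "normal_coord X p = coord cb p $ 4" "normal_coord X p \<in> {- ceps X<..<1}"
    and FT: "(p, F p) \<in> ?T" if "p \<in> cdom cb" for p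
  proof -
    have "p \<in> cdom (collar_chart X b)" using that by (simp add: cb_def)
    then obtain y' t where y': "y' \<in> cdom b" "t \<in> {- ceps X<..<1}" "p = collar X (y', t)"
      by (rule collar_chart_cases)
    have n: "normal_coord X p = t" using normal_coord_collar batlas_dom[OF b(1)] y' by auto
    show "normal_coord X p = coord cb p $ 4"
      using collar_chart_coord(2)[OF b(1) y'(1,2)] n by (simp add: cb_def y'(3))
    show "normal_coord X p \<in> {- ceps X<..<1}" using n y' by simp
    have w: "warp X t > 0" by (rule warp_pos[OF y'(2)])
    have "bmetr X b y' = mat 1" using b(3) y' by (simp add: flat_chart_def)
    then have m: "metr X cb p = diag_block (1 / warp X t) 1"
      using collar_metric[OF b(1) y'(1,2)] by (simp add: y'(3) block_scale_mat cb_def)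
    have "sqrt (warp X t) * (1 / warp X t) * sqrt (warp X t) = 1" using w by simp
    then show "(p, F p) \<in> ?T"
      using that w by (simp add: F_def m n transpose_diag_block diag_block_mult det_diag_block diag_block_1)
  qed
  have cov: "covering_space (bproj X -` cdom cb) (\<lambda>u. (bproj X u, bframe X cb u)) ?T"
    by (rule spin_covering[OF spin cb])
  let ?\<pi> = "\<lambda>u. (bproj X u, bframe X cb u)"
  have ycb: "y \<in> cdom cb"
  proof -
    have "collar X (y, 0) \<in> cdom cb" unfolding cb_def by (rule collar_chart_coord(1)[OF b(1,2)]) (use ceps_pos in simp)
    then show ?thesis using collar_0[OF y] by simp
  qed
  obtain T v where T: "(y, F y) \<in> T" "openin (top_of_set ?T) T"
    "\<Union>v = (bproj X -` cdom cb) \<inter> ?\<pi> -` T" "\<And>u. u \<in> v \<Longrightarrow> \<exists>q. homeomorphism u T ?\<pi> q"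
    using cov FT[OF ycb] unfolding covering_space_def by meson
  have "(y, F y) \<in> ?\<pi> ` (bproj X -` cdom cb)"
    using cov FT[OF ycb] unfolding covering_space_def by blast
  then have "\<Union>v \<noteq> {}" unfolding T(3) using T(1) by force
  then obtain u where u: "u \<in> v" by blast
  obtain q where q: "homeomorphism u T ?\<pi> q" using T(4)[OF u] by blast
  \<comment> \<open>The chart is cut down to the part where the section stays in the evenly covered
    neighbourhood of its value at y.\<close>
  define U where "U = {p \<in> cdom cb. (p, F p) \<in> T}"
  have cF: "continuous_on (cdom cb) F"
  proof -
    have "continuous_on (cdom cb) (\<lambda>p. sqrt (warp X (coord cb p $ 4)))"
      by (rule continuous_on_compose2[OF smooth_on_imp_continuous_on[OF sqrt_warp_smooth]])
        (use nc in \<open>auto intro!: continuous_intros chart_cont_coord[OF ccb]\<close>)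
    then have c1: "continuous_on (cdom cb) (\<lambda>p. sqrt (warp X (normal_coord X p)))"
      by (rule continuous_on_eq) (simp add: nc)
    show ?thesis
      unfolding F_def[abs_def] diag_block_affine[of "sqrt _"]
      by (intro continuous_on_add continuous_on_scaleR continuous_on_const c1)
  qed
  have oU: "open U"
  proof -
    have c2: "continuous_on (cdom cb) (\<lambda>p. (p, F p))" by (intro continuous_intros cF)
    have "openin (top_of_set (cdom cb)) (cdom cb \<inter> (\<lambda>p. (p, F p)) -` T)"
      by (rule continuous_openin_preimage[OF c2 _ T(2)]) (use FT in blast)
    moreover have "open (cdom cb)" using chart_openin[OF ccb] by simp
    moreover have "cdom cb \<inter> (\<lambda>p. (p, F p)) -` T = U" by (auto simp: U_def)
    ultimately show ?thesis using openin_open_trans by metis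
  qed
  define c where "c = restrict_chart cb U"
  have cU: "cdom c = U" "coord c = coord cb" by (auto simp: c_def U_def)
  have c: "c \<in> atlas X" unfolding c_def by (rule restrict_chart_in_atlas[OF manifold cb oU])
  note cc = atlas_chart[OF c]
  define s where "s p = q (p, F p)" for p
  have sp: "?\<pi> (s p) = (p, F p)" if "p \<in> U" for p
    using homeomorphism_apply2[OF q, of "(p, F p)"] that by (simp add: s_def U_def)
  have fr: "bframe X c (s p) = F p" if "p \<in> U" for p
  proof -
    have "p \<in> cdom cb" "p \<in> cdom c" using that by (auto simp: U_def cU)
    then have "bframe X c (s p) = jac cb c p ** bframe X cb (s p)"
      using spin_frame_change[OF spin cb c, of "s p"] sp[OF that] by simp
    moreover have "jac cb c p = mat 1"
      by (rule jac_subchart(2)[OF ccb cc]) (use that in \<open>auto simp: cU U_def\<close>)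
    ultimately show ?thesis using sp[OF that] by simp
  qed
  have "spin_frame X c s"
    unfolding spin_frame_def
  proof (intro conjI ballI c)
    show "continuous_on (cdom c) s"
      unfolding s_def cU
    proof (rule continuous_on_compose2[of T q])
      show "continuous_on T q" using q by (simp add: homeomorphism_def)
      show "continuous_on U (\<lambda>p. (p, F p))"
        by (intro continuous_intros continuous_on_subset[OF cF]) (auto simp: U_def)
    qed (auto simp: U_def)
    show "bproj X (s p) = p" if "p \<in> cdom c" for p using sp that by (simp add: cU)
    have *: "bframe X c (s (param c x)) = diag_block (sqrt (warp X (x $ 4))) 1" and x4: "x $ 4 \<in> {- ceps X<..<1}"
      if "x \<in> crange c" for x
    proof -
      have p: "param c x \<in> U" using chart_param_in[OF cc that] by (simp add: cU)
      then have pc: "param c x \<in> cdom cb" by (simp add: U_def)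
      have "coord cb (param c x) = x" using chart_coord_param[OF cc that] by (simp add: cU)
      then show "bframe X c (s (param c x)) = diag_block (sqrt (warp X (x $ 4))) 1" "x $ 4 \<in> {- ceps X<..<1}"
        using fr[OF p] nc[OF pc] by (auto simp: F_def)
    qed
    have "smooth_on (crange c) (\<lambda>x. sqrt (warp X (x $ 4)))"
      by (rule smooth_on_compose[OF chart_open_range[OF cc] sqrt_warp_smooth])
        (use x4 in \<open>auto intro!: smooth_on_linear bounded_linear_vec_nth\<close>)
    then have "smooth_on (crange c) (\<lambda>x. diag_block (sqrt (warp X (x $ 4))) 1)"
      unfolding diag_block_affine[of "sqrt _"]
      by (intro smooth_on_add smooth_on_scaleR smooth_on_const chart_open_range[OF cc])
    then show "smooth_on (crange c) (\<lambda>x. bframe X c (s (param c x)))"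
      by (rule smooth_on_cong[OF chart_open_range[OF cc], rotated]) (simp add: *)
  qed
  moreover have "y \<in> U" using ycb T(1) by (simp add: U_def)
  ultimately have "adapted X b c s y"
    unfolding adapted_def using b fr by (auto simp: cU F_def block_mat U_def cb_def)
  then show ?thesis by blast
qed

end

section \<open>Extrinsic curvature and the Dirac operator on the collar\<close>

lemma christoffel_cong:
  assumes S: "open S" "x \<in> S" and eq: "\<And>z. z \<in> S \<Longrightarrow> G z = H z"
  shows "christoffel G x k i j = christoffel H x k i j"
proof -
  have "dird v (\<lambda>z. G z $ a $ b) x = dird v (\<lambda>z. H z $ a $ b) x" for v a b
    by (rule dird_cong_open[OF S]) (simp add: eq)
  then show ?thesis using eq[OF S(2)] by (simp add: christoffel_def)
qed

lemma frame_connection_cong: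
  assumes S: "open S" "x \<in> S" and G: "\<And>z. z \<in> S \<Longrightarrow> G z = G' z" and E: "\<And>z. z \<in> S \<Longrightarrow> E z = E' z"
  shows "frame_connection G E x i s t = frame_connection G' E' x i s t"
proof -
  have "dird v (\<lambda>z. E z $ a $ b) x = dird v (\<lambda>z. E' z $ a $ b) x" for v a b
    by (rule dird_cong_open[OF S]) (simp add: E)
  then show ?thesis using G[OF S(2)] E[OF S(2)] christoffel_cong[OF S G] by (simp add: frame_connection_def)
qed

lemma dirac_order_zero_cong:
  assumes "open S" "x \<in> S" "\<And>z. z \<in> S \<Longrightarrow> G z = G' z" "\<And>z. z \<in> S \<Longrightarrow> E z = E' z"
  shows "dirac_order_zero \<gamma> G E x = dirac_order_zero \<gamma> G' E' x"
  unfolding dirac_order_zero_def using frame_connection_cong[OF assms] by simp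

lemma clifford_axis: "clifford \<gamma> (axis i 1) = \<gamma> i"
  by (simp add: clifford_def axis_def if_distrib if_distribR cong: if_cong)

lemma gamma_anticommute:
  assumes "clifford_relations \<gamma>"
  shows "\<gamma> i ** \<gamma> j + \<gamma> j ** \<gamma> i = (if i = j then mat (-2) else 0)"
  using assms[unfolded clifford_relations_def, rule_format, of "axis i 1" "axis j 1"]
  by (simp add: clifford_axis inner_axis_axis)

lemma gamma_square:
  assumes "clifford_relations \<gamma>"
  shows "\<gamma> i ** \<gamma> i = - mat 1"
proof -
  have "clifford \<gamma> (axis i 1) ** clifford \<gamma> (axis i 1) = mat (-1)"
    by (rule clifford_unit_square[OF assms]) simp
  moreover have "mat (-1) = - (mat 1 :: complex^4^4)" by (simp add: mat_def vec_eq_iff)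
  ultimately show ?thesis by (simp add: clifford_axis)
qed

lemma gamma_swap:
  assumes "clifford_relations \<gamma>" "i \<noteq> j"
  shows "\<gamma> i ** \<gamma> j = - (\<gamma> j ** \<gamma> i)"
  using gamma_anticommute[OF assms(1), of i j] assms(2) by (simp add: eq_neg_iff_add_eq_0)

lemma matrix_inv_mat_1: "matrix_inv (mat 1 :: real^'n::finite^'n) = mat 1"
proof -
  have "(mat 1 :: real^'n^'n) ** matrix_inv (mat 1) = mat 1 \<and> matrix_inv (mat 1) ** (mat 1 :: real^'n^'n) = mat 1"
    unfolding matrix_inv_def by (rule someI[of _ "mat 1"]) simp
  then show ?thesis by simp
qed

lemma dird_normal_function:
  fixes f :: "real \<Rightarrow> real"
  assumes "(f has_real_derivative d) (at ((x :: real^4) $ 4))"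
  shows "dird (axis k 1) (\<lambda>z. f (z $ 4)) x = (if k = 4 then d else 0)"
proof -
  have "((\<lambda>z :: real^4. z $ 4) has_derivative (\<lambda>v. v $ 4)) (at x)"
    by (rule bounded_linear_imp_has_derivative[OF bounded_linear_vec_nth])
  from has_derivative_compose[OF this, of f "(*) d"] assms
  have "((\<lambda>z. f (z $ 4)) has_derivative (\<lambda>v. d * v $ 4)) (at x)"
    by (simp add: has_field_derivative_def)
  from dird_eq[OF this] show ?thesis by (simp add: axis_def)
qed

lemma matrix_scaleR_right: "(A :: complex^4^4) ** (r *\<^sub>R B) = r *\<^sub>R (A ** B)"
  by (rule bounded_bilinear.scaleR_right[OF bounded_bilinear_cmm])

lemma matrix_minus_left: "(- A :: complex^4^4) ** B = - (A ** B)"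
  by (rule bounded_bilinear.minus_left[OF bounded_bilinear_cmm])

text \<open>At the boundary metric and frame are the identity, so only the normal derivatives of 1/h
  and sqrt h enter. The nonzero connection coefficients pair a tangential direction with the normal
  one, and since the gamma matrices square to -1, each of the three tangential directions
  contributes -h'/4 times \<open>\<gamma> 4\<close>.\<close>

lemma dirac_order_zero_warped:
  fixes h :: "real \<Rightarrow> real" and x :: "real^4"
  assumes rel: "clifford_relations \<gamma>" and x4: "x $ 4 = 0" and h0: "h 0 = 1" and h: "(h has_real_derivative h') (at 0)"
  shows "dirac_order_zero \<gamma> (\<lambda>z. diag_block (1 / h (z $ 4)) 1) (\<lambda>z. diag_block (sqrt (h (z $ 4))) 1) x = (- 3/4 * h') *\<^sub>R \<gamma> 4"
proof -
  let ?G = "\<lambda>z::real^4. diag_block (1 / h (z $ 4)) 1" and ?E = "\<lambda>z::real^4. diag_block (sqrt (h (z $ 4))) 1"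
  have G1: "?G x = mat 1" and E1: "?E x = mat 1" by (simp_all add: x4 h0 diag_block_1)
  have dG: "dird (axis k 1) (\<lambda>z. ?G z $ i $ j) x = (if k = 4 \<and> i = j \<and> i \<noteq> 4 then - h' else 0)" for k i j
  proof (cases "i = j \<and> i \<noteq> 4")
    case True
    have "((\<lambda>t. 1 / h t) has_real_derivative - h') (at (x $ 4))"
      using h h0 by (auto intro!: derivative_eq_intros simp: x4)
    moreover have "(\<lambda>z. ?G z $ i $ j) = (\<lambda>z. 1 / h (z $ 4))" using True by (auto simp: diag_block_def)
    ultimately show ?thesis using True dird_normal_function[of "\<lambda>t. 1 / h t" "- h'" x k] by auto
  next
    case False
    then have "(\<lambda>z. ?G z $ i $ j) = (\<lambda>z. if i = j then 1 else 0)" by (auto simp: diag_block_def fun_eq_iff)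
    then show ?thesis using False by (simp only: dird_eq[OF has_derivative_const]) auto
  qed
  have dE: "dird (axis k 1) (\<lambda>z. ?E z $ i $ j) x = (if k = 4 \<and> i = j \<and> i \<noteq> 4 then h' / 2 else 0)" for k i j
  proof (cases "i = j \<and> i \<noteq> 4")
    case True
    have "((\<lambda>t. sqrt (h t)) has_real_derivative h' / 2) (at (x $ 4))"
      using h h0 by (auto intro!: derivative_eq_intros simp: x4)
    moreover have "(\<lambda>z. ?E z $ i $ j) = (\<lambda>z. sqrt (h (z $ 4)))" using True by (auto simp: diag_block_def)
    ultimately show ?thesis using True dird_normal_function[of "\<lambda>t. sqrt (h t)" "h' / 2" x k] by auto
  next
    case False
    then have "(\<lambda>z. ?E z $ i $ j) = (\<lambda>z. if i = j then 1 else 0)" by (auto simp: diag_block_def fun_eq_iff)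
    then show ?thesis using False by (simp only: dird_eq[OF has_derivative_const]) auto
  qed
  have d1: "(\<Sum>k\<in>UNIV. (mat 1 :: real^4^4) $ i $ k * f k) = f i" "(\<Sum>k\<in>UNIV. (mat 1 :: real^4^4) $ k $ i * f k) = f i"
    "(\<Sum>k\<in>UNIV. f k * (mat 1 :: real^4^4) $ k $ i) = f i" for i and f :: "4 \<Rightarrow> real"
  proof -
    have "(mat 1 :: real^4^4) $ i $ k * f k = (if k = i then f k else 0)" "(mat 1 :: real^4^4) $ k $ i * f k = (if k = i then f k else 0)"
      "f k * (mat 1 :: real^4^4) $ k $ i = (if k = i then f k else 0)" for k
      by (auto simp: mat_def)
    then show "(\<Sum>k\<in>UNIV. (mat 1 :: real^4^4) $ i $ k * f k) = f i" "(\<Sum>k\<in>UNIV. (mat 1 :: real^4^4) $ k $ i * f k) = f i"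
      "(\<Sum>k\<in>UNIV. f k * (mat 1 :: real^4^4) $ k $ i) = f i" by simp_all
  qed
  have \<Gamma>: "christoffel ?G x k i j = (1/2) * ((if i = 4 \<and> j = k \<and> j \<noteq> 4 then - h' else 0)
      + (if j = 4 \<and> i = k \<and> i \<noteq> 4 then - h' else 0) - (if k = 4 \<and> i = j \<and> i \<noteq> 4 then - h' else 0))" for k i j
    unfolding christoffel_def G1 matrix_inv_mat_1 d1 dG ..
  have \<omega>: "frame_connection ?G ?E x i s t = (if s = i \<and> t = 4 \<and> i \<noteq> 4 then h' / 2 else 0) - (if s = 4 \<and> t = i \<and> i \<noteq> 4 then h' / 2 else 0)" for i s t
  proof -
    have "frame_connection ?G ?E x i s t = (\<Sum>k\<in>UNIV. \<Sum>l\<in>UNIV. (mat 1 :: real^4^4) $ k $ l * (mat 1 :: real^4^4) $ l $ t *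
        (dird (axis i 1) (\<lambda>z. ?E z $ k $ s) x + christoffel ?G x k i s))"
      unfolding frame_connection_def G1 E1 d1 ..
    also have "\<dots> = dird (axis i 1) (\<lambda>z. ?E z $ t $ s) x + christoffel ?G x t i s"
      unfolding mult.assoc d1 ..
    finally show ?thesis unfolding dE \<Gamma>
      by (cases "i = 4"; cases "s = 4"; cases "t = 4"; cases "t = i"; cases "s = i"; cases "s = t"; simp)
  qed
  have summand: "\<gamma> i ** ((1/4) *\<^sub>R (\<Sum>s\<in>UNIV. \<Sum>t\<in>UNIV. frame_connection ?G ?E x i s t *\<^sub>R (\<gamma> s ** \<gamma> t)))
      = (if i = 4 then 0 else (- h' / 4) *\<^sub>R \<gamma> 4)" for i
  proof -
    \<comment> \<open>For tangential i only (s, t) = (i, 4) and (4, i) survive, with opposite signs;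
      anticommutation makes the two contributions equal.\<close>
    have e: "frame_connection ?G ?E x i s t *\<^sub>R (\<gamma> s ** \<gamma> t)
        = (if t = 4 then if s = i then if i \<noteq> 4 then (h' / 2) *\<^sub>R (\<gamma> i ** \<gamma> 4) else 0 else 0 else 0)
        - (if t = i then if s = 4 then if i \<noteq> 4 then (h' / 2) *\<^sub>R (\<gamma> 4 ** \<gamma> i) else 0 else 0 else 0)" for s t
      unfolding \<omega> by (cases "i = 4"; cases "s = 4"; cases "t = 4"; cases "t = i"; cases "s = i"; simp)
    have S: "(\<Sum>s\<in>UNIV. \<Sum>t\<in>UNIV. frame_connection ?G ?E x i s t *\<^sub>R (\<gamma> s ** \<gamma> t))
        = (if i \<noteq> 4 then (h' / 2) *\<^sub>R (\<gamma> i ** \<gamma> 4) - (h' / 2) *\<^sub>R (\<gamma> 4 ** \<gamma> i) else 0)"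
      unfolding e sum_subtractf by simp
    show ?thesis
    proof (cases "i = 4")
      case False
      have "\<gamma> 4 ** \<gamma> i = - (\<gamma> i ** \<gamma> 4)" by (rule gamma_swap[OF rel]) (use False in simp)
      then have S': "(\<Sum>s\<in>UNIV. \<Sum>t\<in>UNIV. frame_connection ?G ?E x i s t *\<^sub>R (\<gamma> s ** \<gamma> t)) = h' *\<^sub>R (\<gamma> i ** \<gamma> 4)"
        unfolding S using False scaleR_add_left[of "h'/2" "h'/2" "\<gamma> i ** \<gamma> 4"] by simp
      have "\<gamma> i ** (\<gamma> i ** \<gamma> 4) = - \<gamma> 4"
        unfolding matrix_mul_assoc gamma_square[OF rel] matrix_minus_left by simp
      then show ?thesis unfolding S' matrix_scaleR_right using False by simp
    next
      case True
      then show ?thesis unfolding S by simp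
    qed
  qed
  have "dirac_order_zero \<gamma> ?G ?E x = (\<Sum>i\<in>(UNIV::4 set). if i = 4 then 0 else (- h' / 4) *\<^sub>R \<gamma> 4)"
    unfolding dirac_order_zero_def summand ..
  also have "\<dots> = (- h' / 4) *\<^sub>R \<gamma> 4 + (- h' / 4) *\<^sub>R \<gamma> 4 + (- h' / 4) *\<^sub>R \<gamma> 4"
    unfolding sum_4 by simp
  also have "\<dots> = (- 3/4 * h') *\<^sub>R \<gamma> 4"
    unfolding scaleR_add_left[symmetric] by simp
  finally show ?thesis .
qed

lemma pos_def_invertible:
  fixes A :: "real^'n::finite^'n"
  assumes "\<And>v. v \<noteq> 0 \<Longrightarrow> v \<bullet> (A *v v) > 0"
  shows "A ** matrix_inv A = mat 1" "matrix_inv A ** A = mat 1"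
proof -
  have "\<forall>v. A *v v = 0 \<longrightarrow> v = 0" using assms by (metis inner_zero_right less_irrefl)
  then obtain B where "B ** A = mat 1" using matrix_left_invertible_ker by blast
  then have "A ** B = mat 1 \<and> B ** A = mat 1" using matrix_left_right_inverse by blast
  then have "A ** matrix_inv A = mat 1 \<and> matrix_inv A ** A = mat 1"
    unfolding matrix_inv_def by (rule someI)
  then show "A ** matrix_inv A = mat 1" "matrix_inv A ** A = mat 1" by auto
qed

lemma Defs_join_add: "Defs.join x t + s *\<^sub>R axis 4 1 = Defs.join x (t + s)"
  by (auto simp: Defs.join_def vec_eq_iff axis_def)

context collar_spin
begin

definition warp' :: real where "warp' = deriv (warp X) 0"

lemma warp_deriv: "(warp X has_real_derivative warp') (at 0)"
proof -
  have "warp X differentiable (at 0)" by (rule smooth_onD_diff[OF warp_smooth]) (use ceps_pos in simp)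
  then show ?thesis
    unfolding warp'_def by (simp add: DERIV_deriv_iff_real_differentiable)
qed

lemma collar_chart_param:
  assumes "b \<in> batlas X" "y \<in> cdom b" "t \<in> {- ceps X<..<1}"
  shows "Defs.join (coord b y) t \<in> crange (collar_chart X b)" "param (collar_chart X b) (Defs.join (coord b y) t) = collar X (y, t)"
  using collar_chart_coord[OF assms] atlas_chart[OF collar_chart_atlas[OF assms(1)]]
  by (metis chart_coord_in, metis chart_param_coord)

text \<open>The block form makes row 4 of the inverse metric trivial and the mixed entries of the
  metric zero. So the Christoffel symbol with upper index 4 is minus half the normal derivative of
  the tangential block, and that derivative is -h'(0) times the boundary metric because h(0) =
  1.\<close>

lemma extrinsic_curvature_eq:
  assumes w0: "warp X 0 = 1" and b: "b \<in> batlas X" and y: "y \<in> cdom b"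
  shows "extrinsic_curvature X b y i j = - (warp' / 2) * bmetr X b y $ i $ j"
proof -
  define cb where "cb = collar_chart X b"
  have cb: "cb \<in> atlas X" unfolding cb_def by (rule collar_chart_atlas[OF b])
  note cc = atlas_chart[OF cb]
  define G where "G z = metr X cb (param cb z)" for z
  define x where "x = Defs.join (coord b y) 0"
  have t0: "0 \<in> {- ceps X<..<1}" using ceps_pos by simp
  have x: "x \<in> crange cb" "param cb x = collar X (y, 0)"
    unfolding x_def cb_def by (rule collar_chart_param[OF b y t0])+
  have sG: "smooth_on (crange cb) G" using metric cb unfolding riemannian_metric_def G_def[abs_def] by blast
  have pd: "v \<noteq> 0 \<Longrightarrow> v \<bullet> (G x *v v) > 0" for v
    using metric cb chart_param_in[OF cc x(1)] unfolding riemannian_metric_def G_def by blast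
  have G4: "G z $ 4 $ k = (if k = 4 then 1 else 0)" "G z $ k $ 4 = (if k = 4 then 1 else 0)" if z: "z \<in> crange cb" for z k
  proof -
    have "param cb z \<in> cdom (collar_chart X b)" using chart_param_in[OF cc z] by (simp add: cb_def)
    then obtain y' t where "y' \<in> cdom b" "t \<in> {- ceps X<..<1}" "param cb z = collar X (y', t)"
      by (rule collar_chart_cases)
    then have "G z = block ((1 / warp X t) *\<^sub>R bmetr X b y') 1" using collar_metric[OF b] by (simp add: G_def cb_def)
    then show "G z $ 4 $ k = (if k = 4 then 1 else 0)" "G z $ k $ 4 = (if k = 4 then 1 else 0)"
      by (auto simp: block_def)
  qed
  have inv4: "matrix_inv (G x) $ 4 $ l = (if l = 4 then 1 else 0)" for l
  proof -
    have "(G x ** matrix_inv (G x)) $ 4 $ l = (\<Sum>k\<in>UNIV. if k = 4 then matrix_inv (G x) $ k $ l else 0)"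
      unfolding matrix_matrix_mult_def by (simp add: G4[OF x(1)] if_distrib if_distribR cong: if_cong)
    moreover have "G x ** matrix_inv (G x) = mat 1" by (rule pos_def_invertible(1)) (rule pd)
    ultimately have "matrix_inv (G x) $ 4 $ l = (mat 1 :: real^4^4) $ 4 $ l" by simp
    then show ?thesis by (simp add: mat_def)
  qed
  have z: "dird v (\<lambda>z. G z $ up a $ 4) x = 0" for v a
  proof -
    have "dird v (\<lambda>z. G z $ up a $ 4) x = dird v (\<lambda>z. 0) x"
      by (rule dird_cong_open[OF chart_open_range[OF cc] x(1)]) (simp add: G4)
    then show ?thesis by (simp add: dird_eq[OF has_derivative_const])
  qed
  have d4: "dird (axis 4 1) (\<lambda>z. G z $ up i $ up j) x = - warp' * bmetr X b y $ i $ j"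
  proof (rule dird_eq_line)
    show "(\<lambda>z. G z $ up i $ up j) differentiable at x"
      by (rule smooth_onD_diff[OF _ x(1)]) (intro smooth_on_nth chart_open_range[OF cc] sG)
    have "((\<lambda>t. 1 / warp X t * bmetr X b y $ i $ j) has_real_derivative - warp' * bmetr X b y $ i $ j) (at 0)"
      using warp_deriv w0 by (auto intro!: derivative_eq_intros)
    then have "((\<lambda>t. 1 / warp X t * bmetr X b y $ i $ j) has_vector_derivative - warp' * bmetr X b y $ i $ j) (at 0)"
      by (simp add: has_real_derivative_iff_has_vector_derivative)
    then show "((\<lambda>s. G (x + s *\<^sub>R axis 4 1) $ up i $ up j) has_vector_derivative - warp' * bmetr X b y $ i $ j) (at 0)"
    proof (rule has_vector_derivative_transform_within_open[of _ _ _ "{- ceps X<..<1}"])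
      fix s assume s: "s \<in> {- ceps X<..<1}"
      show "1 / warp X s * bmetr X b y $ i $ j = G (x + s *\<^sub>R axis 4 1) $ up i $ up j"
        unfolding x_def Defs_join_add G_def cb_def
        using collar_chart_param(2)[OF b y s] collar_metric[OF b y s] by (simp add: block_def)
    qed (use t0 in auto)
  qed
  have "christoffel G x 4 (up i) (up j) = (1/2) * (\<Sum>l\<in>UNIV. if l = 4 then
     (dird (axis (up i) 1) (\<lambda>z. G z $ up j $ l) x + dird (axis (up j) 1) (\<lambda>z. G z $ up i $ l) x
      - dird (axis l 1) (\<lambda>z. G z $ up i $ up j) x) else 0)"
    unfolding christoffel_def inv4 by (intro arg_cong[where f = "(*) (1/2)"] sum.cong refl) simp
  also have "\<dots> = (1/2) * (warp' * bmetr X b y $ i $ j)" by (simp add: z d4)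
  finally show ?thesis
    unfolding extrinsic_curvature_def cb_def[symmetric] G_def[symmetric, abs_def] x_def[symmetric] by simp
qed

text \<open>Contracting the metric with its inverse gives the dimension 3 in every chart, so all
  charts agree and the description in \<open>extrinsic_trace\<close> has a single witness.\<close>

lemma extrinsic_trace_eq:
  assumes w0: "warp X 0 = 1" and y: "y \<in> bdry X"
  shows "extrinsic_trace X y = - (3/2) * warp'"
proof -
  have K: "(\<Sum>i\<in>UNIV. \<Sum>j\<in>UNIV. extrinsic_curvature X b y i j * matrix_inv (bmetr X b y) $ i $ j) = - (3/2) * warp'"
    if b: "b \<in> batlas X" "y \<in> cdom b" for b
  proof -
    let ?N = "bmetr X b y"
    have s: "transpose ?N = ?N" and pd: "\<And>v. v \<noteq> 0 \<Longrightarrow> v \<bullet> (?N *v v) > 0"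
      using boundary_metric b unfolding riemannian_metric_def by blast+
    have sym: "?N $ i $ j = ?N $ j $ i" for i j
      using arg_cong[OF s, of "\<lambda>A. A $ i $ j"] by (simp add: transpose_def)
    have "(\<Sum>i\<in>UNIV. \<Sum>j\<in>UNIV. ?N $ i $ j * matrix_inv ?N $ i $ j) = (\<Sum>i\<in>UNIV. \<Sum>j\<in>UNIV. ?N $ j $ i * matrix_inv ?N $ i $ j)"
      by (intro sum.cong refl arg_cong2[where f = "(*)"] sym)
    also have "\<dots> = (\<Sum>j\<in>UNIV. (?N ** matrix_inv ?N) $ j $ j)"
      unfolding matrix_matrix_mult_def by (subst sum.swap) simp
    also have "?N ** matrix_inv ?N = mat 1" by (rule pos_def_invertible(1)) (rule pd)
    also have "(\<Sum>j\<in>UNIV. (mat 1 :: real^3^3) $ j $ j) = 3" by (simp add: mat_def)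
    finally have t: "(\<Sum>i\<in>UNIV. \<Sum>j\<in>UNIV. ?N $ i $ j * matrix_inv ?N $ i $ j) = 3" .
    have "(\<Sum>i\<in>UNIV. \<Sum>j\<in>UNIV. extrinsic_curvature X b y i j * matrix_inv ?N $ i $ j)
        = - (warp' / 2) * (\<Sum>i\<in>UNIV. \<Sum>j\<in>UNIV. ?N $ i $ j * matrix_inv ?N $ i $ j)"
      unfolding extrinsic_curvature_eq[OF w0 b] sum_distrib_left by (simp only: mult.assoc)
    then show ?thesis unfolding t by simp
  qed
  have "(\<Union>b\<in>batlas X. cdom b) = bdry X" using boundary_manifold by (simp add: oriented_manifold_def)
  then obtain b where b: "b \<in> batlas X" "y \<in> cdom b" using y by blast
  show ?thesis unfolding extrinsic_trace_def
  proof (rule the_equality)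
    show "\<exists>b\<in>batlas X. y \<in> cdom b \<and> - (3/2) * warp' =
        (\<Sum>i\<in>UNIV. \<Sum>j\<in>UNIV. extrinsic_curvature X b y i j * matrix_inv (bmetr X b y) $ i $ j)"
      by (rule bexI[OF _ b(1)]) (simp only: K[OF b] b(2) simp_thms)
  next
    fix k
    assume "\<exists>b\<in>batlas X. y \<in> cdom b \<and> k =
        (\<Sum>i\<in>UNIV. \<Sum>j\<in>UNIV. extrinsic_curvature X b y i j * matrix_inv (bmetr X b y) $ i $ j)"
    then show "k = - (3/2) * warp'" by (elim bexE conjE) (simp only: K)
  qed
qed

end

section \<open>The symbol of the parametrix\<close>

text \<open>Multiplication of a matrix by a complex scalar, kept as a function of its own so that
  rewriting can gather scalars in front of matrix products.\<close>

definition cm :: "complex \<Rightarrow> complex^4^4 \<Rightarrow> complex^4^4" where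
  "cm z M = mat z ** M"

lemma cm_nth [simp]: "cm z M $ i $ j = z * M $ i $ j"
  by (simp add: cm_def mat_mm)

lemma bounded_bilinear_cm: "bounded_bilinear cm"
  unfolding bilinear_conv_bounded_bilinear[symmetric] bilinear_def
  by (auto intro!: linearI simp: vec_eq_iff algebra_simps)

lemma cm_cm [simp]: "cm z (cm w M) = cm (z * w) M"
  by (simp add: vec_eq_iff)

lemma cm_1 [simp]: "cm 1 M = M"
  by (simp add: vec_eq_iff)

lemma cm_0 [simp]: "cm 0 M = 0"
  by (simp add: vec_eq_iff)

lemma cm_mult_left [simp]: "cm z M ** N = cm z (M ** N)"
  by (simp add: cm_def matrix_mul_assoc)

lemma cm_mult_right [simp]: "M ** cm z N = cm z (M ** N)"
proof -
  have "M ** mat z = mat z ** M" by (simp only: mat_mm mm_mat)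
  then show ?thesis by (simp add: cm_def matrix_mul_assoc)
qed

lemma cm_add_right: "cm z (M + N) = cm z M + cm z N"
  by (simp add: vec_eq_iff algebra_simps)

lemma cm_minus: "- M = cm (-1) M"
  by (simp add: vec_eq_iff)

lemma cm_sum: "cm z (\<Sum>i\<in>I. M i) = (\<Sum>i\<in>I. cm z (M i))"
  by (rule bounded_bilinear.sum_right[OF bounded_bilinear_cm])

lemma scaleR_cm: "r *\<^sub>R M = cm (of_real r) M"
  unfolding vec_eq_iff vector_scaleR_component cm_nth by (simp add: scaleR_conv_of_real)

lemma matrix_sum_left: "(\<Sum>i\<in>I. A i) ** (B :: complex^4^4) = (\<Sum>i\<in>I. A i ** B)"
  by (rule bounded_bilinear.sum_left[OF bounded_bilinear_cmm])

section \<open>Clifford algebra and the inversion of the principal symbol\<close>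

lemma clifford_square:
  assumes "clifford_relations \<gamma>"
  shows "clifford \<gamma> v ** clifford \<gamma> v = cm (- of_real (v \<bullet> v)) (mat 1)"
proof -
  let ?A = "clifford \<gamma> v ** clifford \<gamma> v"
  have "?A + ?A = mat (of_real (-2 * (v \<bullet> v)))" using assms(1) by (auto simp: clifford_relations_def)
  then have "2 * ?A $ i $ j = 2 * (cm (- of_real (v \<bullet> v)) (mat 1)) $ i $ j" for i j
    unfolding mult_2 by (simp add: vec_eq_iff mat_def)
  then show ?thesis by (simp add: vec_eq_iff)
qed

lemma clifford_anticommute:
  assumes "clifford_relations \<gamma>" "v \<bullet> w = 0"
  shows "clifford \<gamma> v ** clifford \<gamma> w = cm (-1) (clifford \<gamma> w ** clifford \<gamma> v)"
proof -
  have "clifford \<gamma> v ** clifford \<gamma> w + clifford \<gamma> w ** clifford \<gamma> v = 0"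
    using assms by (simp add: clifford_relations_def)
  then show ?thesis unfolding cm_minus[symmetric] by (simp add: eq_neg_iff_add_eq_0)
qed

lemma compose_symbol_clifford:
  "compose_symbol \<gamma> w b \<xi> P P' Q
    = cm \<i> (clifford \<gamma> (\<chi> i. w i \<bullet> \<xi>) ** P) + (\<Sum>i\<in>UNIV. \<gamma> i ** P' i) + b ** Q"
proof -
  have "(\<Sum>i\<in>UNIV. \<gamma> i ** (mat (\<i> * of_real (w i \<bullet> \<xi>)) ** P)) = cm \<i> (clifford \<gamma> (\<chi> i. w i \<bullet> \<xi>) ** P)"
    unfolding clifford_def cm_def[symmetric] matrix_sum_left cm_sum
    by (simp add: scaleR_cm)
  then show ?thesis
    by (simp add: compose_symbol_def matrix_add_ldistrib sum.distrib)
qed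

text \<open>A Clifford matrix squares to the scalar -|v|^2, so multiplying by it once more inverts
  it up to a scalar.\<close>

lemma principal_solve:
  assumes rel: "clifford_relations \<gamma>" and v: "v \<noteq> 0" and eq: "cm \<i> (clifford \<gamma> v ** P) = R"
  shows "P = cm (\<i> / of_real (v \<bullet> v)) (clifford \<gamma> v ** R)"
proof -
  have "clifford \<gamma> v ** R = cm \<i> ((clifford \<gamma> v ** clifford \<gamma> v) ** P)"
    unfolding eq[symmetric] by (simp add: matrix_mul_assoc)
  also have "\<dots> = cm (- \<i> * of_real (v \<bullet> v)) P"
    unfolding clifford_square[OF rel] by simp
  finally have "clifford \<gamma> v ** R = cm (- \<i> * of_real (v \<bullet> v)) P" .
  then show ?thesis using v by simp
qed

text \<open>Components of a covector in the orthonormal frame, with r = sqrt h for the tangential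
  directions.\<close>

definition cotangent_frame :: "real \<Rightarrow> real^4 \<Rightarrow> real^4" where
  "cotangent_frame r \<xi> = (\<chi> i. (if i = 4 then 1 else r) * \<xi> $ i)"

lemma cotangent_frame_nonzero:
  assumes "r > 0" "\<xi> \<noteq> 0" shows "cotangent_frame r \<xi> \<noteq> 0"
proof -
  obtain i where "\<xi> $ i \<noteq> 0" using assms(2) by (auto simp: vec_eq_iff)
  then have "cotangent_frame r \<xi> $ i \<noteq> 0" using assms(1) by (simp add: cotangent_frame_def)
  then show ?thesis by auto
qed

lemma join_nonzero: "norm \<omega> = 1 \<Longrightarrow> Defs.join \<omega> \<tau> \<noteq> 0"
proof
  assume n: "norm \<omega> = 1" and "Defs.join \<omega> \<tau> = 0"
  then have "\<omega> $ i = 0" for i using join_up[of \<omega> \<tau> i] by simp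
  then have "\<omega> = 0" by (simp add: vec_eq_iff)
  then show False using n by simp
qed

lemma inner_join: "Defs.join x s \<bullet> Defs.join y t = x \<bullet> y + s * t"
  unfolding inner_vec_def sum_4 sum_3 by (simp add: Defs.join_def)

lemma cotangent_frame_join: "cotangent_frame r (Defs.join \<omega> \<tau>) = Defs.join (r *\<^sub>R \<omega>) \<tau>"
  by (auto simp: cotangent_frame_def Defs.join_def vec_eq_iff)

lemma clifford_join:
  "clifford \<gamma> (Defs.join (r *\<^sub>R \<omega>) \<tau>) = cm (of_real r) (clifford \<gamma> (Defs.join \<omega> 0)) + cm (of_real \<tau>) (\<gamma> 4)"
  unfolding clifford_def sum_4
  by (simp add: Defs.join_def scaleR_cm cm_add_right algebra_simps)

lemma has_vector_derivative_cm:
  fixes f :: "real \<Rightarrow> real"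
  assumes "(f has_real_derivative d) (at t)"
  shows "((\<lambda>r. cm (z * of_real (f r)) M) has_vector_derivative cm (z * of_real d) M) (at t)"
proof -
  have "(f has_vector_derivative d) (at t)" using assms by (simp add: has_real_derivative_iff_has_vector_derivative)
  then have "((\<lambda>r. of_real (f r) :: complex) has_vector_derivative of_real d) (at t)"
    by (rule bounded_linear.has_vector_derivative[OF bounded_linear_of_real])
  from bounded_linear.has_vector_derivative[OF bounded_linear_mult_right this, of z]
  have "((\<lambda>r. z * of_real (f r)) has_vector_derivative z * of_real d) (at t)" .
  then show ?thesis
    by (rule bounded_linear.has_vector_derivative[OF bounded_bilinear.bounded_linear_left[OF bounded_bilinear_cm]])
qed

lemma full_symbol_basic:
  fixes X :: "('m::topological_space, 'p::topological_space, 'z) spin_manifold_scheme"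
  assumes "full_symbol X T c s \<sigma>"
  obtains m where "\<And>d x \<xi>. d > m \<Longrightarrow> x \<in> crange c \<Longrightarrow> \<xi> \<noteq> 0 \<Longrightarrow> \<sigma> d (x, \<xi>) = 0"
    "\<And>d. smooth_on (crange c \<times> (- {0})) (\<sigma> d)"
proof -
  obtain m q where "classical_expansion m (crange c) q \<sigma>"
    using assms unfolding full_symbol_def full_symbol_of_order_def by blast
  note C = this[unfolded classical_expansion_def]
  show thesis
  proof (rule that[of m])
    show "\<sigma> d (x, \<xi>) = 0" if "d > m" "x \<in> crange c" "\<xi> \<noteq> 0" for d x \<xi>
      using C[THEN conjunct2, THEN conjunct1, THEN spec, THEN bspec, THEN spec, THEN mp, THEN conjunct1, THEN mp] that by blast
    show "smooth_on (crange c \<times> (- {0})) (\<sigma> d)" for d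
      by (rule C[THEN conjunct1, THEN spec])
  qed
qed

text \<open>One choice of adapted chart, frame and symbol, of the kind over which the residue
  densities are described.\<close>

locale adapted_symbol = collar_spin X
  for X :: "('m::{t2_space, second_countable_topology}, 'p::topological_space, 'z) collar_manifold_scheme" +
  fixes D Q :: "'p spinor_op" and b c s y \<sigma>
  assumes w0: "warp X 0 = 1"
    and D: "dirac_operator (X :: ('m, 'p, 'z) collar_manifold_scheme) D" and Q: "parametrix X D Q"
    and a: "adapted X b c s y" and \<sigma>: "full_symbol X Q c s \<sigma>"
begin

lemma spin_rel: "clifford_relations (gam X)"
  by (rule spin_relations[OF spin])

lemma s: "spin_frame X c s"
  using a by (simp add: adapted_def)

lemma c_chart: "is_chart UNIV c"
  using s atlas_chart by (simp add: spin_frame_def)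

abbreviation "V \<equiv> crange c"

lemma V_open: "open V"
  by (rule chart_open_range[OF c_chart])

definition ordzero :: "real^4 \<Rightarrow> complex^4^4" where
  "ordzero x = dirac_order_zero (gam X) (\<lambda>z. metr X c (param c z)) (\<lambda>z. bframe X c (s (param c z))) x"

definition frame_vector :: "real^4 \<Rightarrow> 4 \<Rightarrow> real^4" where
  "frame_vector x i = (if i = 4 then 1 else sqrt (warp X (x $ 4))) *\<^sub>R axis i 1"

definition cov :: "real^4 \<Rightarrow> real^4 \<Rightarrow> real^4" where
  "cov x \<xi> = cotangent_frame (sqrt (warp X (x $ 4))) \<xi>"

lemma cov_nonzero: "x \<in> V \<Longrightarrow> \<xi> \<noteq> 0 \<Longrightarrow> cov x \<xi> \<noteq> 0"
  unfolding cov_def using adapted_metr(3)[OF a] warp_pos by (intro cotangent_frame_nonzero) auto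

lemma symbol_equation:
  assumes x: "x \<in> V" and \<xi>: "\<xi> \<noteq> 0"
  shows "cm \<i> (clifford (gam X) (cov x \<xi>) ** \<sigma> (d - 1) (x, \<xi>))
      + (\<Sum>i\<in>UNIV. gam X i ** dird (frame_vector x i, 0) (\<sigma> d) (x, \<xi>)) + ordzero x ** \<sigma> d (x, \<xi>)
      = (if d = 0 then mat 1 else 0)"
proof -
  have col: "column i (bframe X c (s (param c x))) = frame_vector x i" for i
    unfolding adapted_metr(2)[OF a x] column_diag_block frame_vector_def ..
  have v: "(\<chi> i. frame_vector x i \<bullet> \<xi>) = cov x \<xi>"
    by (simp add: vec_eq_iff frame_vector_def cov_def cotangent_frame_def inner_axis_axis inner_axis' )
  show ?thesis
    using parametrix_symbol_equations[OF spin manifold s D Q \<sigma> x \<xi>, of d]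
    unfolding col compose_symbol_clifford v ordzero_def .
qed

lemma symbol_smooth: "smooth_on (V \<times> (- {0})) (\<sigma> d)"
  using full_symbol_basic[OF \<sigma>] by metis

lemma symbol_differentiable: "x \<in> V \<Longrightarrow> \<xi> \<noteq> 0 \<Longrightarrow> \<sigma> d differentiable (at (x, \<xi>))"
  using smooth_onD_diff[OF symbol_smooth] by auto

text \<open>\<open>full_symbol\<close> leaves the order open, so terms of nonnegative degree are not
  excluded beforehand. Descending from the unknown order, the equation of degree d + 1 reduces to
  its principal part, which is invertible.\<close>

lemma symbol_nonneg_0:
  assumes "d \<ge> 0" "x \<in> V" "\<xi> \<noteq> 0"
  shows "\<sigma> d (x, \<xi>) = 0"
proof -
  obtain m where m: "\<And>d x \<xi>. d > m \<Longrightarrow> x \<in> V \<Longrightarrow> \<xi> \<noteq> 0 \<Longrightarrow> \<sigma> d (x, \<xi>) = 0"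
    using full_symbol_basic[OF \<sigma>] by metis
  show ?thesis
    using assms
  proof (induction "nat (m + 1 - d)" arbitrary: d x \<xi> rule: less_induct)
    case less
    show ?case
    proof (cases "d > m")
      case True then show ?thesis using m less.prems by blast
    next
      case False
      have z: "\<sigma> (d + 1) (x', \<xi>') = 0" if "x' \<in> V" "\<xi>' \<noteq> 0" for x' \<xi>'
        using less.hyps[of "d + 1" x' \<xi>'] less.prems that False by auto
      have dz: "dird v (\<sigma> (d + 1)) (x, \<xi>) = 0" for v
      proof -
        have "dird v (\<sigma> (d + 1)) (x, \<xi>) = dird v (\<lambda>z. 0) (x, \<xi>)"
          by (rule dird_cong_open[of "V \<times> (- {0})"])
            (use V_open z less.prems in \<open>auto intro!: open_Times open_Compl\<close>)
        then show ?thesis by (simp add: dird_eq[OF has_derivative_const])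
      qed
      have "cm \<i> (clifford (gam X) (cov x \<xi>) ** \<sigma> d (x, \<xi>)) = 0"
        using symbol_equation[OF less.prems(2,3), of "d + 1"] less.prems by (simp add: dz z)
      from principal_solve[OF spin_rel cov_nonzero[OF less.prems(2,3)] this]
      show ?thesis by (simp add: vec_eq_iff)
    qed
  qed
qed

lemma symbol_minus_1:
  assumes x: "x \<in> V" and \<xi>: "\<xi> \<noteq> 0"
  shows "\<sigma> (-1) (x, \<xi>) = cm (\<i> / of_real (cov x \<xi> \<bullet> cov x \<xi>)) (clifford (gam X) (cov x \<xi>))"
proof -
  have dz: "dird v (\<sigma> 0) (x, \<xi>) = 0" for v
  proof -
    have "dird v (\<sigma> 0) (x, \<xi>) = dird v (\<lambda>z. 0) (x, \<xi>)"
      by (rule dird_cong_open[of "V \<times> (- {0})"])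
        (use V_open symbol_nonneg_0[of 0] x \<xi> in \<open>auto intro!: open_Times open_Compl\<close>)
    then show ?thesis by (simp add: dird_eq[OF has_derivative_const])
  qed
  have "cm \<i> (clifford (gam X) (cov x \<xi>) ** \<sigma> (-1) (x, \<xi>)) = mat 1"
    using symbol_equation[OF x \<xi>, of 0] by (simp add: dz symbol_nonneg_0[OF _ x \<xi>])
  from principal_solve[OF spin_rel cov_nonzero[OF x \<xi>] this] show ?thesis by simp
qed

text \<open>The equation of degree -1 has right-hand side 0, and inverting its principal part
  amounts to multiplying by the term of degree -1.\<close>

lemma symbol_minus_2:
  assumes x: "x \<in> V" and \<xi>: "\<xi> \<noteq> 0"
  shows "\<sigma> (-2) (x, \<xi>) = cm (-1) (\<sigma> (-1) (x, \<xi>) **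
    ((\<Sum>i\<in>UNIV. gam X i ** dird (frame_vector x i, 0) (\<sigma> (-1)) (x, \<xi>)) + ordzero x ** \<sigma> (-1) (x, \<xi>)))"
proof -
  let ?R = "(\<Sum>i\<in>UNIV. gam X i ** dird (frame_vector x i, 0) (\<sigma> (-1)) (x, \<xi>)) + ordzero x ** \<sigma> (-1) (x, \<xi>)"
  have "cm \<i> (clifford (gam X) (cov x \<xi>) ** \<sigma> (-2) (x, \<xi>)) + ?R = 0"
    using symbol_equation[OF x \<xi>, of "-1"] by (simp add: add.assoc)
  then have "cm \<i> (clifford (gam X) (cov x \<xi>) ** \<sigma> (-2) (x, \<xi>)) = cm (-1) ?R"
    unfolding cm_minus[symmetric] by (simp only: eq_neg_iff_add_eq_0)
  from principal_solve[OF spin_rel cov_nonzero[OF x \<xi>] this]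
  show ?thesis unfolding symbol_minus_1[OF x \<xi>] by simp
qed

abbreviation "x0 \<equiv> coord b y"

definition tangential :: "real^3 \<Rightarrow> complex^4^4" where
  "tangential \<omega> = clifford (gam X) (Defs.join \<omega> 0)"

lemma point: "Defs.join x0 0 \<in> V"
  by (rule adapted_point[OF a])

lemma near_boundary:
  obtains \<epsilon> where "\<epsilon> > 0" "\<And>r. \<bar>r\<bar> < \<epsilon> \<Longrightarrow> Defs.join x0 r \<in> V"
proof -
  obtain \<epsilon> where \<epsilon>: "\<epsilon> > 0" "\<And>r. \<bar>r\<bar> \<le> \<epsilon> \<Longrightarrow> Defs.join x0 0 + r *\<^sub>R axis 4 1 \<in> V"
    using line_in_open[OF V_open point] by blast
  show thesis by (rule that[OF \<epsilon>(1)]) (use \<epsilon>(2) in \<open>simp add: Defs_join_add\<close>)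
qed

text \<open>Valid at all points of the chart, not only on the boundary, because the normal
  derivative of this formula is needed. The covector has squared length h(x_n) + \<tau>^2 in the
  dual metric.\<close>

lemma symbol_minus_1_collar:
  assumes \<omega>: "norm \<omega> = 1" and x: "x \<in> V"
  shows "\<sigma> (-1) (x, Defs.join \<omega> \<tau>)
    = cm (\<i> * of_real (sqrt (warp X (x $ 4)) / (warp X (x $ 4) + \<tau>\<^sup>2))) (tangential \<omega>)
      + cm (\<i> * of_real (\<tau> / (warp X (x $ 4) + \<tau>\<^sup>2))) (gam X 4)"
proof -
  have h: "warp X (x $ 4) > 0" using adapted_metr(3)[OF a x] warp_pos by blast
  have "\<omega> \<bullet> \<omega> = 1" using \<omega> by (simp add: dot_square_norm)
  then have n: "cov x (Defs.join \<omega> \<tau>) \<bullet> cov x (Defs.join \<omega> \<tau>) = warp X (x $ 4) + \<tau>\<^sup>2"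
    using h by (simp add: cov_def cotangent_frame_join inner_join power2_eq_square)
  show ?thesis
    unfolding symbol_minus_1[OF x join_nonzero[OF \<omega>]] n
    unfolding cov_def cotangent_frame_join clifford_join tangential_def
    by (simp add: cm_add_right)
qed

lemma ordzero_point: "ordzero (Defs.join x0 0) = cm (of_real (- 3/4 * warp')) (gam X 4)"
proof -
  have "ordzero (Defs.join x0 0) = dirac_order_zero (gam X) (\<lambda>z. diag_block (1 / warp X (z $ 4)) 1)
      (\<lambda>z. diag_block (sqrt (warp X (z $ 4))) 1) (Defs.join x0 0)"
    unfolding ordzero_def
    by (rule dirac_order_zero_cong[OF V_open point]) (use adapted_metr[OF a] in auto)
  also have "\<dots> = (- 3/4 * warp') *\<^sub>R gam X 4"
    by (rule dirac_order_zero_warped[OF spin_rel _ w0 warp_deriv]) simp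
  finally show ?thesis by (simp only: scaleR_cm)
qed

lemma symbol_minus_1_normal_derivative:
  assumes \<omega>: "norm \<omega> = 1"
  shows "dird (axis 4 1, 0) (\<sigma> (-1)) (Defs.join x0 0, Defs.join \<omega> \<tau>)
     = cm (\<i> * of_real (warp' / 2 / (1 + \<tau>\<^sup>2) - warp' / (1 + \<tau>\<^sup>2)\<^sup>2)) (tangential \<omega>)
       + cm (\<i> * of_real (- \<tau> * warp' / (1 + \<tau>\<^sup>2)\<^sup>2)) (gam X 4)" (is "_ = ?d")
proof (rule vector_derivative_unique_at)
  show "((\<lambda>r. \<sigma> (-1) (Defs.join x0 0 + r *\<^sub>R axis 4 1, Defs.join \<omega> \<tau>)) has_vector_derivative
      dird (axis 4 1, 0) (\<sigma> (-1)) (Defs.join x0 0, Defs.join \<omega> \<tau>)) (at 0)"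
    by (rule dird_slice_line[OF symbol_differentiable[OF point join_nonzero[OF \<omega>]]])
  have p: "1 + \<tau>\<^sup>2 > 0" by (simp add: add_pos_nonneg)
  have s: "((\<lambda>r. sqrt (warp X r)) has_real_derivative warp' / 2) (at 0)"
    using warp_deriv w0 by (auto intro!: derivative_eq_intros)
  have w: "((\<lambda>r. warp X r + \<tau>\<^sup>2) has_real_derivative warp') (at 0)"
    using warp_deriv by (auto intro!: derivative_eq_intros)
  have 1: "((\<lambda>r. sqrt (warp X r) / (warp X r + \<tau>\<^sup>2)) has_real_derivative
      warp' / 2 / (1 + \<tau>\<^sup>2) - warp' / (1 + \<tau>\<^sup>2)\<^sup>2) (at 0)"
  proof (rule DERIV_cong[OF DERIV_divide[OF s w]])
    have "(k / 2 * d - 1 * k) / (d * d) = k / 2 / d - k / d\<^sup>2" if "d \<noteq> 0" for k d :: real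
      using that by (simp add: diff_divide_distrib power2_eq_square)
    from this[of "1 + \<tau>\<^sup>2" warp'] p
    show "(warp' / 2 * (warp X 0 + \<tau>\<^sup>2) - sqrt (warp X 0) * warp') / ((warp X 0 + \<tau>\<^sup>2) * (warp X 0 + \<tau>\<^sup>2))
        = warp' / 2 / (1 + \<tau>\<^sup>2) - warp' / (1 + \<tau>\<^sup>2)\<^sup>2"
      by (simp add: w0)
  qed (use p w0 in simp)
  have 2: "((\<lambda>r. \<tau> / (warp X r + \<tau>\<^sup>2)) has_real_derivative - \<tau> * warp' / (1 + \<tau>\<^sup>2)\<^sup>2) (at 0)"
    by (rule DERIV_cong[OF DERIV_divide[OF DERIV_const w]]) (use p w0 in \<open>simp_all add: power2_eq_square\<close>)
  have D0: "((\<lambda>r. cm (\<i> * of_real (sqrt (warp X r) / (warp X r + \<tau>\<^sup>2))) (tangential \<omega>)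
      + cm (\<i> * of_real (\<tau> / (warp X r + \<tau>\<^sup>2))) (gam X 4)) has_vector_derivative ?d) (at 0)"
    by (intro has_vector_derivative_add has_vector_derivative_cm 1 2)
  obtain \<epsilon> where \<epsilon>: "\<epsilon> > 0" "\<And>r. \<bar>r\<bar> < \<epsilon> \<Longrightarrow> Defs.join x0 r \<in> V" by (rule near_boundary) blast
  show "((\<lambda>r. \<sigma> (-1) (Defs.join x0 0 + r *\<^sub>R axis 4 1, Defs.join \<omega> \<tau>)) has_vector_derivative ?d) (at 0)"
    by (rule has_vector_derivative_transform_within_open[OF D0, where S = "{-\<epsilon><..<\<epsilon>}"])
      (use \<epsilon> symbol_minus_1_collar[OF \<omega>] in \<open>auto simp: Defs_join_add\<close>)
qed

text \<open>The formula for the principal term depends on the point through x_n alone, an effect of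
  the flat boundary chart.\<close>

lemma symbol_minus_1_tangential_derivative:
  assumes \<omega>: "norm \<omega> = 1" and i: "i \<noteq> 4"
  shows "dird (axis i 1, 0) (\<sigma> (-1)) (Defs.join x0 0, Defs.join \<omega> \<tau>) = 0"
proof (rule vector_derivative_unique_at)
  show "((\<lambda>r. \<sigma> (-1) (Defs.join x0 0 + r *\<^sub>R axis i 1, Defs.join \<omega> \<tau>)) has_vector_derivative
      dird (axis i 1, 0) (\<sigma> (-1)) (Defs.join x0 0, Defs.join \<omega> \<tau>)) (at 0)"
    by (rule dird_slice_line[OF symbol_differentiable[OF point join_nonzero[OF \<omega>]]])
  obtain \<epsilon> where \<epsilon>: "\<epsilon> > 0" "\<And>r. \<bar>r\<bar> \<le> \<epsilon> \<Longrightarrow> Defs.join x0 0 + r *\<^sub>R axis i 1 \<in> V"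
    using line_in_open[OF V_open point] by blast
  have x4: "(Defs.join x0 0 + r *\<^sub>R axis i 1) $ 4 = 0" for r using i by (simp add: axis_def)
  have e: "\<sigma> (-1) (Defs.join x0 0 + r *\<^sub>R axis i 1, Defs.join \<omega> \<tau>) = \<sigma> (-1) (Defs.join x0 0, Defs.join \<omega> \<tau>)"
    if "\<bar>r\<bar> \<le> \<epsilon>" for r
    unfolding symbol_minus_1_collar[OF \<omega> \<epsilon>(2)[OF that]] symbol_minus_1_collar[OF \<omega> point] x4 by simp
  show "((\<lambda>r. \<sigma> (-1) (Defs.join x0 0 + r *\<^sub>R axis i 1, Defs.join \<omega> \<tau>)) has_vector_derivative 0) (at 0)"
    by (rule has_vector_derivative_transform_within_open[OF has_vector_derivative_const, where S = "{-\<epsilon><..<\<epsilon>}"])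
      (use \<epsilon>(1) e in auto)
qed

lemma tangential_relations:
  assumes \<omega>: "norm \<omega> = 1"
  shows "tangential \<omega> ** tangential \<omega> = cm (-1) (mat 1)" "gam X 4 ** gam X 4 = cm (-1) (mat 1)"
    "tangential \<omega> ** gam X 4 = cm (-1) (gam X 4 ** tangential \<omega>)"
proof -
  have "Defs.join \<omega> 0 \<bullet> Defs.join \<omega> 0 = 1" unfolding inner_join using \<omega> by (simp add: dot_square_norm)
  then show "tangential \<omega> ** tangential \<omega> = cm (-1) (mat 1)"
    unfolding tangential_def clifford_square[OF spin_rel] by simp
  have g: "clifford (gam X) (axis 4 1) = gam X 4" by (rule clifford_axis)
  show "gam X 4 ** gam X 4 = cm (-1) (mat 1)"
    unfolding g[symmetric] clifford_square[OF spin_rel] by (simp add: inner_axis_axis)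
  have "Defs.join \<omega> 0 \<bullet> axis 4 1 = 0" by (simp add: inner_axis Defs.join_def)
  from clifford_anticommute[OF spin_rel this] show "tangential \<omega> ** gam X 4 = cm (-1) (gam X 4 ** tangential \<omega>)"
    unfolding g tangential_def .
qed

text \<open>With C = \<open>tangential \<omega>\<close> and G = \<open>gam X 4\<close>, the
  threefold products reduce to C and G by C^2 = G^2 = -1 and CG = -GC. The coefficients become
  rational in \<tau>, and replacing \<tau>^2 by d - 1 for d = 1 + \<tau>^2 brings them to the stated
  form.\<close>

lemma symbol_minus_2_point:
  assumes \<omega>: "norm \<omega> = 1"
  shows "\<sigma> (-2) (Defs.join x0 0, Defs.join \<omega> \<tau>)
    = cm (of_real (warp' * (\<tau> / (1 + \<tau>\<^sup>2)^2 + 2 * \<tau> / (1 + \<tau>\<^sup>2)^3))) (tangential \<omega>)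
      + cm (of_real (warp' * (3/4 / (1 + \<tau>\<^sup>2) - 2 / (1 + \<tau>\<^sup>2)^3))) (gam X 4)"
proof -
  let ?x = "Defs.join x0 0" and ?C = "tangential \<omega>" and ?g = "gam X 4"
  have p: "1 + \<tau>\<^sup>2 > 0" by (simp add: add_pos_nonneg)
  \<comment> \<open>The a's are the coefficients of the principal term, the b's those of its normal
    derivative, and e that of the order zero term of the Dirac operator.\<close>
  define a1 :: complex where "a1 = \<i> * of_real (1 / (1 + \<tau>\<^sup>2))"
  define a2 :: complex where "a2 = \<i> * of_real (\<tau> / (1 + \<tau>\<^sup>2))"
  define b1 :: complex where "b1 = \<i> * of_real (warp' / 2 / (1 + \<tau>\<^sup>2) - warp' / (1 + \<tau>\<^sup>2)\<^sup>2)"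
  define b2 :: complex where "b2 = \<i> * of_real (- \<tau> * warp' / (1 + \<tau>\<^sup>2)\<^sup>2)"
  define e :: complex where "e = of_real (- 3/4 * warp')"
  have s1: "\<sigma> (-1) (?x, Defs.join \<omega> \<tau>) = cm a1 ?C + cm a2 ?g"
    using symbol_minus_1_collar[OF \<omega> point, of \<tau>] by (simp add: w0 a1_def a2_def)
  have fv: "frame_vector ?x i = axis i 1" for i by (simp add: frame_vector_def w0)
  have dsum: "(\<Sum>i\<in>UNIV. gam X i ** dird (frame_vector ?x i, 0) (\<sigma> (-1)) (?x, Defs.join \<omega> \<tau>))
      = ?g ** (cm b1 ?C + cm b2 ?g)"
  proof -
    have "gam X i ** dird (frame_vector ?x i, 0) (\<sigma> (-1)) (?x, Defs.join \<omega> \<tau>)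
        = (if i = 4 then ?g ** (cm b1 ?C + cm b2 ?g) else 0)" for i
    proof (cases "i = 4")
      case True
      then show ?thesis unfolding fv b1_def b2_def by (simp only: symbol_minus_1_normal_derivative[OF \<omega>] if_True simp_thms)
    next
      case False
      then show ?thesis unfolding fv
        by (simp only: symbol_minus_1_tangential_derivative[OF \<omega> False] if_False bounded_bilinear.zero_right[OF bounded_bilinear_cmm])
    qed
    then show ?thesis by simp
  qed
  note CC = tangential_relations(1)[OF \<omega>] and gg = tangential_relations(2)[OF \<omega>] and Cg = tangential_relations(3)[OF \<omega>]
  have CgC: "?C ** (?g ** ?C) = ?g"
    unfolding matrix_mul_assoc Cg by (simp add: matrix_mul_assoc[symmetric] CC)
  have ggC: "?g ** (?g ** ?C) = cm (-1) ?C" unfolding matrix_mul_assoc gg by simp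
  have "\<sigma> (-2) (?x, Defs.join \<omega> \<tau>) = cm (-1) ((cm a1 ?C + cm a2 ?g) **
      (?g ** (cm b1 ?C + cm b2 ?g) + cm e ?g ** (cm a1 ?C + cm a2 ?g)))"
    unfolding symbol_minus_2[OF point join_nonzero[OF \<omega>]] dsum s1 ordzero_point e_def ..
  also have "\<dots> = cm (a1 * (b2 + e * a2) + a2 * (b1 + e * a1)) ?C + cm (- a1 * (b1 + e * a1) + a2 * (b2 + e * a2)) ?g"
    by (simp add: matrix_add_ldistrib bounded_bilinear.add_left[OF bounded_bilinear_cmm] cm_add_right CgC ggC gg)
      (simp add: vec_eq_iff algebra_simps)
  also have "a1 * (b2 + e * a2) + a2 * (b1 + e * a1) = of_real (warp' * (\<tau> / (1 + \<tau>\<^sup>2)^2 + 2 * \<tau> / (1 + \<tau>\<^sup>2)^3))"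
  proof -
    have g: "\<i> * of_real A1 * (\<i> * of_real B2 + of_real E * (\<i> * of_real A2)) + \<i> * of_real A2 * (\<i> * of_real B1 + of_real E * (\<i> * of_real A1))
       = of_real (- (A1 * (B2 + E * A2)) - A2 * (B1 + E * A1))" for A1 A2 B1 B2 E :: real
      by (simp add: complex_eq_iff algebra_simps)
    have r: "- (1 / d * (- \<tau> * k / d\<^sup>2 + (- 3/4 * k) * (\<tau> / d))) - \<tau> / d * (k / 2 / d - k / d\<^sup>2 + (- 3/4 * k) * (1 / d))
       = k * (\<tau> / d^2 + 2 * \<tau> / d^3)" if "d > 0" for d k :: real
      using that by (simp add: divide_simps power2_eq_square power3_eq_cube) algebra
    show ?thesis unfolding a1_def a2_def b1_def b2_def e_def g r[OF p] ..
  qed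
  also have "- a1 * (b1 + e * a1) + a2 * (b2 + e * a2) = of_real (warp' * (3/4 / (1 + \<tau>\<^sup>2) - 2 / (1 + \<tau>\<^sup>2)^3))"
  proof -
    have g: "- (\<i> * of_real A1) * (\<i> * of_real B1 + of_real E * (\<i> * of_real A1)) + \<i> * of_real A2 * (\<i> * of_real B2 + of_real E * (\<i> * of_real A2))
       = of_real (A1 * (B1 + E * A1) - A2 * (B2 + E * A2))" for A1 A2 B1 B2 E :: real
      by (simp add: complex_eq_iff algebra_simps)
    have r: "1 / d * (k / 2 / d - k / d\<^sup>2 + (- 3/4 * k) * (1 / d)) - \<tau> / d * (- \<tau> * k / d\<^sup>2 + (- 3/4 * k) * (\<tau> / d))
       = k * (3/4 / d - 2 / d^3)" if "d > 0" "\<tau> * \<tau> = d - 1" for d k :: real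
    proof -
      have "1 / d * (k / 2 / d - k / d\<^sup>2 + (- 3/4 * k) * (1 / d)) - \<tau> / d * (- \<tau> * k / d\<^sup>2 + (- 3/4 * k) * (\<tau> / d))
          = 1 / d * (k / 2 / d - k / d\<^sup>2 + (- 3/4 * k) * (1 / d)) + (\<tau> * \<tau>) * (k / d^3 + 3/4 * k / d\<^sup>2)"
        using that(1) by (simp add: field_simps power2_eq_square power3_eq_cube)
      also have "\<dots> = k * (3/4 / d - 2 / d^3)"
        unfolding that(2) using that(1) by (simp add: divide_simps power2_eq_square power3_eq_cube) algebra
      finally show ?thesis .
    qed
    have t: "\<tau> * \<tau> = 1 + \<tau>\<^sup>2 - 1" by (simp add: power2_eq_square)
    show ?thesis unfolding a1_def a2_def b1_def b2_def e_def g r[OF p t] ..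
  qed
  finally show ?thesis .
qed

end

section \<open>Partial fractions\<close>

text \<open>The relation under \<open>THE\<close> in \<open>pi_plus\<close>, named so that
  decompositions can be added and scaled before the description is evaluated.\<close>

definition is_pi_plus :: "(real \<Rightarrow> complex) \<Rightarrow> (real \<Rightarrow> complex) \<Rightarrow> bool" where
  "is_pi_plus f g \<longleftrightarrow> (\<exists>p1 q1 p2 q2 :: complex poly.
     q1 \<noteq> 0 \<and> q2 \<noteq> 0 \<and> (p1 = 0 \<or> degree p1 < degree q1) \<and> (p2 = 0 \<or> degree p2 < degree q2) \<and>
     (\<forall>z. poly q1 z = 0 \<longrightarrow> Im z > 0) \<and> (\<forall>z. poly q2 z = 0 \<longrightarrow> Im z < 0) \<and>
     (\<forall>t. g t = poly p1 (of_real t) / poly q1 (of_real t)) \<and>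
     (\<forall>t. f t = g t + poly p2 (of_real t) / poly q2 (of_real t)))"

text \<open>Induction on the degree of B: by the fundamental theorem of algebra B has a root, E does
  not share it, so it is a root of A and can be cancelled.\<close>

lemma poly_dvd_of_disjoint_roots:
  fixes A B C E :: "complex poly"
  assumes eq: "A * E = C * B" and B: "B \<noteq> 0" and disj: "\<And>z. poly B z = 0 \<Longrightarrow> poly E z \<noteq> 0"
  shows "B dvd A"
  using assms
proof (induction "degree B" arbitrary: A B rule: less_induct)
  case less
  show ?case
  proof (cases "degree B = 0")
    case True
    then have "is_unit B" using less.prems(2) by (simp add: is_unit_iff_degree)
    then show ?thesis by (rule unit_imp_dvd)
  next
    case False
    then obtain z where z: "poly B z = 0"
      using fundamental_theorem_of_algebra[of B] by (auto simp: constant_degree)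
    have "poly A z * poly E z = 0" using arg_cong[OF less.prems(1), of "\<lambda>p. poly p z"] z by simp
    then have "poly A z = 0" using less.prems(3)[OF z] by simp
    then obtain A' where A': "A = [:-z, 1:] * A'" by (auto simp: poly_eq_0_iff_dvd)
    obtain B' where B': "B = [:-z, 1:] * B'" using z by (auto simp: poly_eq_0_iff_dvd)
    have nz: "B' \<noteq> 0" using less.prems(2) B' by auto
    have "[:-z, 1:] * (A' * E) = [:-z, 1:] * (C * B')"
      using less.prems(1) unfolding A' B' by (simp only: mult_ac)
    then have e: "A' * E = C * B'" by (subst (asm) mult_cancel_left) auto
    have d: "degree B' < degree B" unfolding B' by (subst degree_mult_eq) (use nz in auto)
    have "B' dvd A'"
      by (rule less.hyps[OF d e nz]) (use less.prems(3) B' in auto)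
    then show ?thesis unfolding A' B' by (rule mult_dvd_mono[OF dvd_refl])
  qed
qed

text \<open>The difference of two candidates is a proper fraction A/B with the roots of B above the
  axis, and on the reals it equals C/E with the roots of E below. Agreement at infinitely many
  points makes A E = C B a polynomial identity; B and E share no root, so B divides A, which is of
  smaller degree or zero, and hence vanishes.\<close>

lemma is_pi_plus_unique:
  assumes "is_pi_plus f g" "is_pi_plus f g'"
  shows "g = g'"
proof -
  obtain p1 q1 p2 q2 where "q1 \<noteq> 0" "q2 \<noteq> 0" "p1 = 0 \<or> degree p1 < degree q1" "p2 = 0 \<or> degree p2 < degree q2"
    "\<forall>z. poly q1 z = 0 \<longrightarrow> Im z > 0" "\<forall>z. poly q2 z = 0 \<longrightarrow> Im z < 0"
    "\<forall>t. g t = poly p1 (of_real t) / poly q1 (of_real t)" "\<forall>t. f t = g t + poly p2 (of_real t) / poly q2 (of_real t)"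
    using assms(1)[unfolded is_pi_plus_def] by (elim exE conjE)
  note 1 = this[rule_format]
  obtain r1 s1 r2 s2 where "s1 \<noteq> 0" "s2 \<noteq> 0" "r1 = 0 \<or> degree r1 < degree s1" "r2 = 0 \<or> degree r2 < degree s2"
    "\<forall>z. poly s1 z = 0 \<longrightarrow> Im z > 0" "\<forall>z. poly s2 z = 0 \<longrightarrow> Im z < 0"
    "\<forall>t. g' t = poly r1 (of_real t) / poly s1 (of_real t)" "\<forall>t. f t = g' t + poly r2 (of_real t) / poly s2 (of_real t)"
    using assms(2)[unfolded is_pi_plus_def] by (elim exE conjE)
  note 2 = this[rule_format]
  define A where "A = p1 * s1 - r1 * q1"
  define B where "B = q1 * s1"
  define C where "C = r2 * q2 - p2 * s2"
  define E where "E = q2 * s2"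
  have real_nz: "poly q1 (of_real t) \<noteq> 0" "poly q2 (of_real t) \<noteq> 0" "poly s1 (of_real t) \<noteq> 0" "poly s2 (of_real t) \<noteq> 0" for t :: real
    using 1(5,6)[of "of_real t"] 2(5,6)[of "of_real t"] by auto
  have gg: "g t - g' t = poly A (of_real t) / poly B (of_real t)" for t
    unfolding 1(7) 2(7) A_def B_def using real_nz[of t] by (simp add: field_simps)
  have cc: "poly A (of_real t) / poly B (of_real t) = poly C (of_real t) / poly E (of_real t)" for t
  proof -
    have "g t - g' t = poly r2 (of_real t) / poly s2 (of_real t) - poly p2 (of_real t) / poly q2 (of_real t)"
      using 1(8)[of t] 2(8)[of t] by (simp add: algebra_simps)
    also have "\<dots> = poly C (of_real t) / poly E (of_real t)"
      unfolding C_def E_def using real_nz[of t] by (simp add: field_simps)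
    finally show ?thesis by (simp add: gg)
  qed
  have "poly (A * E - C * B) (of_real t) = 0" for t
    using cc[of t] real_nz[of t] by (simp add: B_def E_def frac_eq_eq)
  then have "range (of_real :: real \<Rightarrow> complex) \<subseteq> {z. poly (A * E - C * B) z = 0}" by auto
  moreover have "infinite (range (of_real :: real \<Rightarrow> complex))"
  proof -
    have "inj (of_real :: real \<Rightarrow> complex)" by (simp add: inj_on_def)
    then show ?thesis using finite_image_iff infinite_UNIV_char_0 by blast
  qed
  ultimately have "\<not> finite {z. poly (A * E - C * B) z = 0}" using finite_subset by blast
  then have "A * E - C * B = 0" using poly_roots_finite by blast
  then have eq: "A * E = C * B" by simp
  have Bnz: "B \<noteq> 0" using 1 2 by (simp add: B_def)
  have "B dvd A"
  proof (rule poly_dvd_of_disjoint_roots[OF eq Bnz])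
    fix z assume "poly B z = 0"
    then have "Im z > 0" using 1(5) 2(5) by (auto simp: B_def)
    then show "poly E z \<noteq> 0" using 1(6)[of z] 2(6)[of z] by (auto simp: E_def)
  qed
  moreover have "A = 0 \<or> degree A < degree B"
  proof -
    have dB: "degree B = degree q1 + degree s1" unfolding B_def by (rule degree_mult_eq) (use 1 2 in auto)
    have a: "p1 * s1 = 0 \<or> degree (p1 * s1) < degree B"
      using 1(3) degree_mult_le[of p1 s1] unfolding dB by auto
    have b: "r1 * q1 = 0 \<or> degree (r1 * q1) < degree B"
      using 2(3) degree_mult_le[of r1 q1] unfolding dB by auto
    show ?thesis
    proof (cases "p1 * s1 = 0 \<or> r1 * q1 = 0")
      case True then show ?thesis using a b unfolding A_def by auto
    next
      case False
      then show ?thesis using a b unfolding A_def by (auto intro: degree_diff_less)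
    qed
  qed
  ultimately have "A = 0" using dvd_imp_degree_le[of B A] by force
  then show ?thesis using gg by (simp add: fun_eq_iff)
qed

lemma pi_plus_eq: "is_pi_plus f g \<Longrightarrow> pi_plus f = g"
  unfolding pi_plus_def is_pi_plus_def[symmetric] using is_pi_plus_unique by blast

lemma proper_fraction_add:
  fixes p q p' q' :: "complex poly"
  assumes "q \<noteq> 0" "q' \<noteq> 0" "p = 0 \<or> degree p < degree q" "p' = 0 \<or> degree p' < degree q'"
  shows "p * q' + p' * q = 0 \<or> degree (p * q' + p' * q) < degree (q * q')"
proof -
  have d: "degree (q * q') = degree q + degree q'" by (rule degree_mult_eq) (use assms in auto)
  have a: "p * q' = 0 \<or> degree (p * q') < degree (q * q')"
    using assms(3) degree_mult_le[of p q'] unfolding d by auto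
  have b: "p' * q = 0 \<or> degree (p' * q) < degree (q * q')"
    using assms(4) degree_mult_le[of p' q] unfolding d by auto
  show ?thesis
  proof (cases "p * q' = 0 \<or> p' * q = 0")
    case True then show ?thesis using a b by auto
  next
    case False
    then show ?thesis using a b by (auto intro: degree_add_less)
  qed
qed

lemma is_pi_plus_add:
  assumes "is_pi_plus f g" "is_pi_plus f' g'"
  shows "is_pi_plus (\<lambda>t. f t + f' t) (\<lambda>t. g t + g' t)"
proof -
  obtain p1 q1 p2 q2 where "q1 \<noteq> 0" "q2 \<noteq> 0" "p1 = 0 \<or> degree p1 < degree q1" "p2 = 0 \<or> degree p2 < degree q2"
    "\<forall>z. poly q1 z = 0 \<longrightarrow> Im z > 0" "\<forall>z. poly q2 z = 0 \<longrightarrow> Im z < 0"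
    "\<forall>t. g t = poly p1 (of_real t) / poly q1 (of_real t)" "\<forall>t. f t = g t + poly p2 (of_real t) / poly q2 (of_real t)"
    using assms(1)[unfolded is_pi_plus_def] by (elim exE conjE)
  note 1 = this[rule_format]
  obtain r1 s1 r2 s2 where "s1 \<noteq> 0" "s2 \<noteq> 0" "r1 = 0 \<or> degree r1 < degree s1" "r2 = 0 \<or> degree r2 < degree s2"
    "\<forall>z. poly s1 z = 0 \<longrightarrow> Im z > 0" "\<forall>z. poly s2 z = 0 \<longrightarrow> Im z < 0"
    "\<forall>t. g' t = poly r1 (of_real t) / poly s1 (of_real t)" "\<forall>t. f' t = g' t + poly r2 (of_real t) / poly s2 (of_real t)"
    using assms(2)[unfolded is_pi_plus_def] by (elim exE conjE)
  note 2 = this[rule_format]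
  have nz: "poly q1 (of_real t) \<noteq> 0" "poly q2 (of_real t) \<noteq> 0" "poly s1 (of_real t) \<noteq> 0" "poly s2 (of_real t) \<noteq> 0" for t :: real
    using 1(5,6)[of "of_real t"] 2(5,6)[of "of_real t"] by auto
  show ?thesis
    unfolding is_pi_plus_def
  proof (intro exI conjI)
    show "q1 * s1 \<noteq> 0" "q2 * s2 \<noteq> 0" using 1 2 by auto
    show "p1 * s1 + r1 * q1 = 0 \<or> degree (p1 * s1 + r1 * q1) < degree (q1 * s1)"
      by (rule proper_fraction_add) (use 1 2 in auto)
    show "p2 * s2 + r2 * q2 = 0 \<or> degree (p2 * s2 + r2 * q2) < degree (q2 * s2)"
      by (rule proper_fraction_add) (use 1 2 in auto)
    show "\<forall>z. poly (q1 * s1) z = 0 \<longrightarrow> Im z > 0" using 1(5) 2(5) by auto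
    show "\<forall>z. poly (q2 * s2) z = 0 \<longrightarrow> Im z < 0" using 1(6) 2(6) by auto
    show "\<forall>t. g t + g' t = poly (p1 * s1 + r1 * q1) (of_real t) / poly (q1 * s1) (of_real t)"
      unfolding 1(7) 2(7) using nz by (simp add: add_frac_eq)
    show "\<forall>t. f t + f' t = g t + g' t + poly (p2 * s2 + r2 * q2) (of_real t) / poly (q2 * s2) (of_real t)"
      unfolding 1(8) 2(8) using nz by (simp add: add_frac_eq)
  qed
qed

lemma is_pi_plus_cmult:
  assumes "is_pi_plus f g"
  shows "is_pi_plus (\<lambda>t. c * f t) (\<lambda>t. c * g t)"
proof -
  obtain p1 q1 p2 q2 where "q1 \<noteq> 0" "q2 \<noteq> 0" "p1 = 0 \<or> degree p1 < degree q1" "p2 = 0 \<or> degree p2 < degree q2"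
    "\<forall>z. poly q1 z = 0 \<longrightarrow> Im z > 0" "\<forall>z. poly q2 z = 0 \<longrightarrow> Im z < 0"
    "\<forall>t. g t = poly p1 (of_real t) / poly q1 (of_real t)" "\<forall>t. f t = g t + poly p2 (of_real t) / poly q2 (of_real t)"
    using assms(1)[unfolded is_pi_plus_def] by (elim exE conjE)
  note 1 = this[rule_format]
  show ?thesis
    unfolding is_pi_plus_def
    by (rule exI[of _ "smult c p1"], rule exI[of _ q1], rule exI[of _ "smult c p2"], rule exI[of _ q2])
      (use 1 in \<open>auto simp: algebra_simps\<close>)
qed

lemma is_pi_plus_upper:
  assumes "Im a > 0" "k > 0"
  shows "is_pi_plus (\<lambda>t. 1 / (of_real t - a) ^ k) (\<lambda>t. 1 / (of_real t - a) ^ k)"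
  unfolding is_pi_plus_def
  by (rule exI[of _ 1], rule exI[of _ "[:-a, 1:] ^ k"], rule exI[of _ 0], rule exI[of _ 1])
    (use assms in \<open>auto simp: degree_power_eq\<close>)

lemma is_pi_plus_lower:
  assumes "Im a < 0" "k > 0"
  shows "is_pi_plus (\<lambda>t. 1 / (of_real t - a) ^ k) (\<lambda>t. 0)"
  unfolding is_pi_plus_def
  by (rule exI[of _ 0], rule exI[of _ 1], rule exI[of _ 1], rule exI[of _ "[:-a, 1:] ^ k"])
    (use assms in \<open>auto simp: degree_power_eq\<close>)

text \<open>\<open>pi_plus_mat\<close> acts entry by entry, so two scalar decompositions settle all
  entries at once.\<close>

lemma pi_plus_mat_eq:
  assumes "is_pi_plus \<alpha> \<alpha>'" "is_pi_plus \<beta> \<beta>'"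
  shows "pi_plus_mat (\<lambda>\<tau>. cm (\<alpha> \<tau>) M + cm (\<beta> \<tau>) N) t = cm (\<alpha>' t) M + cm (\<beta>' t) N"
proof -
  have "pi_plus (\<lambda>\<tau>. (cm (\<alpha> \<tau>) M + cm (\<beta> \<tau>) N) $ i $ j) = (\<lambda>t. \<alpha>' t * M $ i $ j + \<beta>' t * N $ i $ j)" for i j
  proof (rule pi_plus_eq)
    have "is_pi_plus (\<lambda>\<tau>. M $ i $ j * \<alpha> \<tau> + N $ i $ j * \<beta> \<tau>) (\<lambda>t. M $ i $ j * \<alpha>' t + N $ i $ j * \<beta>' t)"
      by (intro is_pi_plus_add is_pi_plus_cmult assms)
    then show "is_pi_plus (\<lambda>\<tau>. (cm (\<alpha> \<tau>) M + cm (\<beta> \<tau>) N) $ i $ j) (\<lambda>t. \<alpha>' t * M $ i $ j + \<beta>' t * N $ i $ j)"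
      by (simp add: mult.commute)
  qed
  then show ?thesis by (simp add: pi_plus_mat_def vec_eq_iff)
qed

section \<open>The local residues\<close>

lemma trace_cm [simp]: "trace (cm z M) = z * trace M"
  by (simp add: trace_def sum_distrib_left)

text \<open>CG and GC have trace zero by anticommutation and cyclicity, while C^2 and G^2 have trace
  -4. The left factor has the form p(C + iG) common to the projected symbols below, so of the right
  factor only A + iB counts.\<close>

lemma trace_clifford_pair:
  fixes C G :: "complex^4^4"
  assumes "C ** C = cm (-1) (mat 1)" "G ** G = cm (-1) (mat 1)" "C ** G = cm (-1) (G ** C)"
  shows "trace ((cm p C + cm (\<i> * p) G) ** (cm A C + cm B G)) = - 4 * p * (A + \<i> * B)"
proof -
  have "trace (C ** G) = - trace (G ** C)" unfolding assms(3) by simp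
  then have z: "trace (G ** C) = 0" "trace (C ** G) = 0" using trace_mul_sym[of C G] by auto
  have m: "trace (mat 1 :: complex^4^4) = 4" by (simp add: trace_def mat_def)
  show ?thesis
    by (simp add: matrix_add_ldistrib bounded_bilinear.add_left[OF bounded_bilinear_cmm] cm_add_right
        trace_add assms(1,2) m z algebra_simps)
qed

section \<open>Rational integrals over the line and the integral over the sphere\<close>

lemma integral_LBINT_UNIV:
  fixes f F :: "real \<Rightarrow> real"
  assumes D: "\<And>x. DERIV F x :> f x" and c: "continuous_on UNIV f" and p: "\<And>x. 0 \<le> f x"
    and A: "(F \<longlongrightarrow> A) at_bot" and B: "(F \<longlongrightarrow> B) at_top"
  shows "integrable lborel f" "(LINT x|lborel. f x) = B - A"
proof -
  have e: "einterval (-\<infinity>) \<infinity> = UNIV" by (auto simp: einterval_def)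
  have 1: "((F \<circ> real_of_ereal) \<longlongrightarrow> A) (at_right (-\<infinity>))" "((F \<circ> real_of_ereal) \<longlongrightarrow> B) (at_left \<infinity>)"
    using A B by (simp_all add: ereal_tendsto_simps)
  have "isCont f x" for x using c by (simp add: continuous_on_eq_continuous_at)
  note r = interval_integral_FTC_nonneg[of "-\<infinity>" \<infinity> F f, OF _ D this _ 1]
  show "integrable lborel f" using r(1) p by (simp add: e set_integrable_def)
  show "(LINT x|lborel. f x) = B - A" using r(2) p
    by (simp add: interval_lebesgue_integral_def e set_lebesgue_integral_def)
qed

lemma lorentz_tendsto:
  "((\<lambda>t::real. t / (1 + t\<^sup>2)) \<longlongrightarrow> 0) at_top" "((\<lambda>t::real. t / (1 + t\<^sup>2)) \<longlongrightarrow> 0) at_bot"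
  "((\<lambda>t::real. t / (1 + t\<^sup>2)^2) \<longlongrightarrow> 0) at_top" "((\<lambda>t::real. t / (1 + t\<^sup>2)^2) \<longlongrightarrow> 0) at_bot"
  by real_asymp+

text \<open>With d = 1/(1 + t^2) as an atom subject to d(1 + t^2) = 1, identities between the
  quotients below become polynomial.\<close>

lemma lorentz_power:
  fixes t :: real
  shows "a / (1 + t\<^sup>2) ^ k = a * (1 / (1 + t\<^sup>2)) ^ k" "a / ((1 + t\<^sup>2)^2 * (1 + t\<^sup>2)^2) = a * (1 / (1 + t\<^sup>2)) ^ 4"
    "(1 / (1 + t\<^sup>2)) * (1 + t\<^sup>2) = 1"
proof -
  have "1 + t\<^sup>2 > 0" by (simp add: add_pos_nonneg)
  then show "(1 / (1 + t\<^sup>2)) * (1 + t\<^sup>2) = 1" by simp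
  show "a / ((1 + t\<^sup>2)^2 * (1 + t\<^sup>2)^2) = a * (1 / (1 + t\<^sup>2)) ^ 4" by (simp add: power_divide power_add[symmetric])
qed (simp add: power_divide)

lemma DERIV_lorentz:
  "DERIV (\<lambda>t. t / (1 + t\<^sup>2)) t :> ((1 + t\<^sup>2) - t * (2 * t)) / (1 + t\<^sup>2)^2"
  "DERIV (\<lambda>t. t / (1 + t\<^sup>2)^2) t :> ((1 + t\<^sup>2)^2 - t * (2 * (1 + t\<^sup>2) * (2 * t))) / ((1 + t\<^sup>2)^2 * (1 + t\<^sup>2)^2)"
  "DERIV arctan t :> 1 / (1 + t\<^sup>2)"
  "DERIV (\<lambda>t. -2 * t / (1 + t\<^sup>2)^2) t :> (-2 * (1 + t\<^sup>2)^2 - -2 * t * (2 * (1 + t\<^sup>2) * (2 * t))) / ((1 + t\<^sup>2)^2 * (1 + t\<^sup>2)^2)"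
  "DERIV (\<lambda>t. (1 - t\<^sup>2) / (1 + t\<^sup>2)^2) t :> (- (2 * t) * (1 + t\<^sup>2)^2 - (1 - t\<^sup>2) * (2 * (1 + t\<^sup>2) * (2 * t))) / ((1 + t\<^sup>2)^2 * (1 + t\<^sup>2)^2)"
proof -
  have nz: "1 + t\<^sup>2 \<noteq> 0" "(1 + t\<^sup>2)^2 \<noteq> 0" using lorentz_power(3)[of t] by auto
  have D: "DERIV (\<lambda>t. 1 + t\<^sup>2) t :> 2 * t" by (auto intro!: derivative_eq_intros)
  have D2: "DERIV (\<lambda>t. (1 + t\<^sup>2)^2) t :> 2 * (1 + t\<^sup>2) * (2 * t)" by (auto intro!: derivative_eq_intros)
  have E: "DERIV (\<lambda>t. -2 * t) t :> -2" "DERIV (\<lambda>t. 1 - t\<^sup>2) t :> - (2 * t)" by (auto intro!: derivative_eq_intros)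
  show "DERIV (\<lambda>t. t / (1 + t\<^sup>2)) t :> ((1 + t\<^sup>2) - t * (2 * t)) / (1 + t\<^sup>2)^2"
    using DERIV_divide[OF DERIV_ident D nz(1)] by (simp add: power2_eq_square)
  show "DERIV (\<lambda>t. t / (1 + t\<^sup>2)^2) t :> ((1 + t\<^sup>2)^2 - t * (2 * (1 + t\<^sup>2) * (2 * t))) / ((1 + t\<^sup>2)^2 * (1 + t\<^sup>2)^2)"
    using DERIV_divide[OF DERIV_ident D2 nz(2)] by (simp only: mult_1_left)
  show "DERIV arctan t :> 1 / (1 + t\<^sup>2)" using DERIV_arctan[of t] by (simp add: inverse_eq_divide)
  show "DERIV (\<lambda>t. -2 * t / (1 + t\<^sup>2)^2) t :> (-2 * (1 + t\<^sup>2)^2 - -2 * t * (2 * (1 + t\<^sup>2) * (2 * t))) / ((1 + t\<^sup>2)^2 * (1 + t\<^sup>2)^2)"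
    by (rule DERIV_divide[OF E(1) D2 nz(2)])
  show "DERIV (\<lambda>t. (1 - t\<^sup>2) / (1 + t\<^sup>2)^2) t :> (- (2 * t) * (1 + t\<^sup>2)^2 - (1 - t\<^sup>2) * (2 * (1 + t\<^sup>2) * (2 * t))) / ((1 + t\<^sup>2)^2 * (1 + t\<^sup>2)^2)"
    by (rule DERIV_divide[OF E(2) D2 nz(2)])
qed

lemma has_integral_lorentz_2:
  "integrable lborel (\<lambda>t::real. 1 / (1 + t\<^sup>2)^2)" "(LINT t|lborel. 1 / (1 + t\<^sup>2)^2) = pi / 2"
proof -
  let ?F = "\<lambda>t::real. (1/2) * (t / (1 + t\<^sup>2) + arctan t)"
  have p: "1 + t\<^sup>2 > 0" for t :: real by (simp add: add_pos_nonneg)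
  have D: "DERIV ?F t :> 1 / (1 + t\<^sup>2)^2" for t
  proof -
    have e: "(1/2) * (((1 + t\<^sup>2) - t * (2 * t)) / (1 + t\<^sup>2)^2 + 1 / (1 + t\<^sup>2)) = 1 / (1 + t\<^sup>2)^2"
      unfolding lorentz_power(1)[of _ _ 2] using lorentz_power(3)[of t] by algebra
    show ?thesis unfolding e[symmetric] using DERIV_cmult[OF DERIV_add[OF DERIV_lorentz(1) DERIV_lorentz(3)], of "1/2" t]
      by simp
  qed
  have c: "continuous_on UNIV (\<lambda>t::real. 1 / (1 + t\<^sup>2)^2)"
    using p by (auto intro!: continuous_intros simp: less_imp_neq[THEN not_sym])
  have l: "(?F \<longlongrightarrow> (1/2) * (0 + pi/2)) at_top" "(?F \<longlongrightarrow> (1/2) * (0 + - (pi/2))) at_bot"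
    by (intro tendsto_intros lorentz_tendsto tendsto_arctan_at_top tendsto_arctan_at_bot)+
  show "integrable lborel (\<lambda>t::real. 1 / (1 + t\<^sup>2)^2)" "(LINT t|lborel. 1 / (1 + t\<^sup>2)^2) = pi / 2"
    using integral_LBINT_UNIV[OF D c _ l(2,1)] by simp_all
qed

text \<open>The antiderivative comes from the reduction formula for powers of 1/(1 + t^2): 1/4 is
  the new term, and 3/8 is 3/4 of the factor 1/2 for the square.\<close>

lemma has_integral_lorentz_3:
  "integrable lborel (\<lambda>t::real. 1 / (1 + t\<^sup>2)^3)" "(LINT t|lborel. 1 / (1 + t\<^sup>2)^3) = 3 * pi / 8"
proof -
  let ?F = "\<lambda>t::real. (1/4) * (t / (1 + t\<^sup>2)^2) + (3/8) * (t / (1 + t\<^sup>2) + arctan t)"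
  have p: "1 + t\<^sup>2 > 0" for t :: real by (simp add: add_pos_nonneg)
  have D: "DERIV ?F t :> 1 / (1 + t\<^sup>2)^3" for t
  proof -
    have e: "(1/4) * (((1 + t\<^sup>2)^2 - t * (2 * (1 + t\<^sup>2) * (2 * t))) / ((1 + t\<^sup>2)^2 * (1 + t\<^sup>2)^2))
       + (3/8) * (((1 + t\<^sup>2) - t * (2 * t)) / (1 + t\<^sup>2)^2 + 1 / (1 + t\<^sup>2)) = 1 / (1 + t\<^sup>2)^3"
    proof -
      define d where "d = 1 / (1 + t\<^sup>2)"
      have d: "d * (1 + t\<^sup>2) = 1" unfolding d_def by (rule lorentz_power(3))
      have "((1 + t\<^sup>2)^2 - t * (2 * (1 + t\<^sup>2) * (2 * t))) * d ^ 4 = 4 * (d * (1 + t\<^sup>2)) * d ^ 3 - 3 * (d * (1 + t\<^sup>2))^2 * d ^ 2"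
        by algebra
      moreover have "((1 + t\<^sup>2) - t * (2 * t)) * d ^ 2 = 2 * d ^ 2 - (d * (1 + t\<^sup>2)) * d" by algebra
      ultimately show ?thesis
        unfolding lorentz_power(2) lorentz_power(1)[of _ _ 2] lorentz_power(1)[of _ _ 3] d_def[symmetric] by (simp add: d diff_divide_distrib)
    qed
    show ?thesis unfolding e[symmetric] using DERIV_add[OF DERIV_cmult[OF DERIV_lorentz(2), of "1/4" t]
        DERIV_cmult[OF DERIV_add[OF DERIV_lorentz(1) DERIV_lorentz(3)], of "3/8" t]]
      by simp
  qed
  have c: "continuous_on UNIV (\<lambda>t::real. 1 / (1 + t\<^sup>2)^3)"
    using p by (auto intro!: continuous_intros simp: less_imp_neq[THEN not_sym])
  have l: "(?F \<longlongrightarrow> (1/4) * 0 + (3/8) * (0 + pi/2)) at_top" "(?F \<longlongrightarrow> (1/4) * 0 + (3/8) * (0 + - (pi/2))) at_bot"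
    by (intro tendsto_intros lorentz_tendsto tendsto_arctan_at_top tendsto_arctan_at_bot)+
  show "integrable lborel (\<lambda>t::real. 1 / (1 + t\<^sup>2)^3)" "(LINT t|lborel. 1 / (1 + t\<^sup>2)^3) = 3 * pi / 8"
    using integral_LBINT_UNIV[OF D c _ l(2,1)] by (simp_all add: add_pos_nonneg)
qed

text \<open>An odd integrand, killed by the substitution of -t for t; integrability follows by
  comparison with the square, as |t| is at most 1 + t^2.\<close>

lemma has_integral_lorentz_odd:
  "integrable lborel (\<lambda>t::real. t / (1 + t\<^sup>2)^3)" "(LINT t|lborel. t / (1 + t\<^sup>2)^3) = (0::real)"
proof -
  have p: "1 + t\<^sup>2 > 0" for t :: real by (simp add: add_pos_nonneg)
  have I: "integrable lborel (\<lambda>t::real. t / (1 + t\<^sup>2)^3)"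
  proof (rule Bochner_Integration.integrable_bound[OF has_integral_lorentz_2(1)])
    show "AE t::real in lborel. norm (t / (1 + t\<^sup>2)^3) \<le> norm (1 / (1 + t\<^sup>2)^2)"
    proof (rule AE_I2)
      fix t :: real
      have "\<bar>t\<bar> \<le> 1 + t\<^sup>2"
        using sum_squares_bound[of "\<bar>t\<bar>" 1] by simp
      then have "\<bar>t\<bar> / (1 + t\<^sup>2)^3 \<le> (1 + t\<^sup>2) / (1 + t\<^sup>2)^3" by (rule divide_right_mono) (use p[of t] in simp)
      also have "\<dots> = 1 / (1 + t\<^sup>2)^2" using p[of t] by (simp add: power3_eq_cube power2_eq_square divide_simps)
      finally show "norm (t / (1 + t\<^sup>2)^3) \<le> norm (1 / (1 + t\<^sup>2)^2)" using p[of t] by simp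
    qed
  qed measurable
  show "integrable lborel (\<lambda>t::real. t / (1 + t\<^sup>2)^3)" by (rule I)
  show "(LINT t|lborel. t / (1 + t\<^sup>2)^3) = (0::real)"
    using lborel_integral_real_affine[of "-1" "\<lambda>t. t / (1 + t\<^sup>2)^3" 0] by simp
qed

lemma integral_of_real_I:
  fixes f g :: "real \<Rightarrow> real"
  assumes "integrable lborel f" "integrable lborel g"
  shows "(LINT t|lborel. complex_of_real (f t) + \<i> * complex_of_real (g t))
    = complex_of_real (LINT t|lborel. f t) + \<i> * complex_of_real (LINT t|lborel. g t)"
  using assms by (subst Bochner_Integration.integral_add) auto

text \<open>The factor is the total area of the unit sphere in spherical coordinates; it has the
  same value 4 pi as \<open>Omega3\<close>.\<close>

lemma sphere_integral_const:
  assumes "\<And>\<omega>. norm \<omega> = 1 \<Longrightarrow> f \<omega> = c"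
  shows "sphere_integral f = 4 * complex_of_real pi * c"
proof -
  have n: "norm (vector [sin \<theta> * cos \<phi>, sin \<theta> * sin \<phi>, cos \<theta>] :: real^3) = 1" for \<theta> \<phi>
  proof -
    have "(vector [sin \<theta> * cos \<phi>, sin \<theta> * sin \<phi>, cos \<theta>] :: real^3) \<bullet> vector [sin \<theta> * cos \<phi>, sin \<theta> * sin \<phi>, cos \<theta>]
      = (sin \<theta> * cos \<phi>) * (sin \<theta> * cos \<phi>) + (sin \<theta> * sin \<phi>) * (sin \<theta> * sin \<phi>) + cos \<theta> * cos \<theta>"
      by (simp add: inner_vec_def sum_3 vector_3)
    also have "\<dots> = 1" using sin_cos_squared_add[of \<phi>] sin_cos_squared_add[of \<theta>] by algebra
    finally show ?thesis by (simp add: norm_eq_sqrt_inner)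
  qed
  have "sphere_integral f = (LINT \<theta>:{0..pi}|lborel. LINT \<phi>:{0..2*pi}|lborel. sin \<theta> *\<^sub>R c)"
    unfolding sphere_integral_def by (simp add: assms n)
  also have "\<dots> = (LINT \<theta>:{0..pi}|lborel. (2 * pi * sin \<theta>) *\<^sub>R c)"
    by (subst set_integral_const) (auto simp: mult.assoc)
  also have "\<dots> = (LINT \<theta>|lborel. (indicator {0..pi} \<theta> * (2 * pi * sin \<theta>)) *\<^sub>R c)"
    by (simp add: set_lebesgue_integral_def)
  also have "\<dots> = (LINT \<theta>|lborel. 2 * pi * sin \<theta> * indicator {0..pi} \<theta>) *\<^sub>R c"
  proof -
    have "integrable lborel (\<lambda>\<theta>. indicator {0..pi} \<theta> *\<^sub>R (2 * pi * sin \<theta>))"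
      by (rule borel_integrable_compact) (auto intro!: continuous_intros)
    then have "integrable lborel (\<lambda>\<theta>. indicator {0..pi} \<theta> * (2 * pi * sin \<theta>))" by simp
    from integral_scaleR_left[OF this] show ?thesis by (simp add: mult.commute)
  qed
  also have "(LINT \<theta>|lborel. 2 * pi * sin \<theta> * indicator {0..pi} \<theta>) = - 2 * pi * cos pi - (- 2 * pi * cos 0)"
    by (rule integral_FTC_Icc_real) (auto intro!: derivative_eq_intros)
  finally show ?thesis by (simp add: scaleR_conv_of_real)
qed

lemma is_pi_plus_cong:
  assumes "is_pi_plus f g" "\<And>t. f t = f' t" "\<And>t. g t = g' t"
  shows "is_pi_plus f' g'"
  using assms by (simp add: is_pi_plus_def)

lemma is_pi_plus_split:
  assumes "is_pi_plus p q" "is_pi_plus m (\<lambda>t. 0)" "\<And>t. f t = p t + m t"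
  shows "is_pi_plus f q"
  using is_pi_plus_cong[OF is_pi_plus_add[OF assms(1,2)], of f q] assms(3) by simp

lemma of_real_plus_minus_i_neq:
  assumes "s \<noteq> 0"
  shows "complex_of_real t - \<i> * of_real s \<noteq> 0" "complex_of_real t - - (\<i> * of_real s) \<noteq> 0"
  using assms by (auto simp: complex_eq_iff)

text \<open>The poles are plus and minus i s. The two upper parts differ by the factor i, which is
  what produces multiples of C + iG after projection.\<close>

lemma is_pi_plus_inverse_quadratic:
  assumes s: "s > 0"
  shows "is_pi_plus (\<lambda>\<tau>. \<i> * of_real (s / (s\<^sup>2 + \<tau>\<^sup>2))) (\<lambda>t. (1/2) * (1 / (of_real t - \<i> * of_real s)))" (is ?A)
    and "is_pi_plus (\<lambda>\<tau>. \<i> * of_real (\<tau> / (s\<^sup>2 + \<tau>\<^sup>2))) (\<lambda>t. (\<i>/2) * (1 / (of_real t - \<i> * of_real s)))" (is ?B)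
proof -
  have u: "is_pi_plus (\<lambda>t. k * (1 / (of_real t - \<i> * of_real s))) (\<lambda>t. k * (1 / (of_real t - \<i> * of_real s)))"
    for k using is_pi_plus_cmult[OF is_pi_plus_upper[of "\<i> * of_real s" 1], of k] s by simp
  have l: "is_pi_plus (\<lambda>t. k * (1 / (of_real t - - (\<i> * of_real s)))) (\<lambda>t. 0)"
    for k using is_pi_plus_cmult[OF is_pi_plus_lower[of "- (\<i> * of_real s)" 1], of k] s by simp
  have uw: "a / (s\<^sup>2 + z\<^sup>2) = a * ((1 / (z - \<i> * s)) * (1 / (z - - (\<i> * s))))" for a z s :: complex
  proof -
    have "s\<^sup>2 + z\<^sup>2 = (z - \<i> * s) * (z - - (\<i> * s))"
      by (simp add: power2_eq_square algebra_simps)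
    then show ?thesis by simp
  qed
  have nz: "(complex_of_real t - \<i> * of_real s) * (1 / (of_real t - \<i> * of_real s)) = 1"
    "(complex_of_real t - - (\<i> * of_real s)) * (1 / (of_real t - - (\<i> * of_real s))) = 1" for t
    using of_real_plus_minus_i_neq[of s t] s by simp_all
  have i: "\<i>^2 = -1" by simp
  have "\<i> * complex_of_real (s / (s\<^sup>2 + t\<^sup>2)) = (1/2) * (1 / (of_real t - \<i> * of_real s)) + (-1/2) * (1 / (of_real t - - (\<i> * of_real s)))" for t
    unfolding of_real_divide of_real_add of_real_power uw using nz[of t] i by algebra
  then show ?A by (rule is_pi_plus_split[OF u l])
  have "\<i> * complex_of_real (t / (s\<^sup>2 + t\<^sup>2)) = (\<i>/2) * (1 / (of_real t - \<i> * of_real s)) + (\<i>/2) * (1 / (of_real t - - (\<i> * of_real s)))" for t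
    unfolding of_real_divide of_real_add of_real_power uw using nz[of t] i by algebra
  then show ?B by (rule is_pi_plus_split[OF u l])
qed

text \<open>Principal parts at the triple poles j and -j, where j stands for the imaginary unit. The
  upper part of the second function is j times that of the first, the same ratio as for the
  principal term.\<close>

lemma partial_fractions_minus_2:
  fixes z j :: complex
  assumes "z - j \<noteq> 0" "z - - j \<noteq> 0" and j: "j^2 = -1"
  shows "z / (1 + z\<^sup>2)^2 + 2 * z / (1 + z\<^sup>2)^3 =
      (-1/4 * (1 / (z - j)^3) + (-3*j/8) * (1 / (z - j)^2))
    + (-1/4 * (1 / (z - - j)^3) + (3*j/8) * (1 / (z - - j)^2))" (is ?A)
    and "3/4 / (1 + z\<^sup>2) - 2 / (1 + z\<^sup>2)^3 =
      (-j/4 * (1 / (z - j)^3) + (3/8) * (1 / (z - j)^2))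
    + (j/4 * (1 / (z - - j)^3) + (3/8) * (1 / (z - - j)^2))" (is ?B)
proof -
  define u w where "u = 1 / (z - j)" and "w = 1 / (z - - j)"
  have 1: "u * (z - j) = 1" "w * (z + j) = 1" using assms by (auto simp: u_def w_def)
  have "1 + z\<^sup>2 = (z - j) * (z - - j)" using j by algebra
  then have D: "1 / (1 + z\<^sup>2) = u * w" by (simp add: u_def w_def)
  have 2: "1 / (z - j)^k = u ^ k" "1 / (z - - j)^k = w ^ k" for k by (simp_all add: u_def w_def power_divide)
  have 3: "a / (1 + z\<^sup>2)^k = a * (u * w)^k" for a k unfolding D[symmetric] by (simp add: power_divide)
  have 4: "a / (1 + z\<^sup>2) = a * (u * w)" for a unfolding D[symmetric] by simp
  \<comment> \<open>The resolvent identity for the two poles, by which products of u and w are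
    separated.\<close>
  have d: "w - u + 2 * j * u * w = 0" using 1 by algebra
  show ?A unfolding 2 3
    using 1 j d by algebra
  show ?B unfolding 2 3 4
    using 1 j d by algebra
qed

context adapted_symbol begin

lemma pi_plus_symbol_minus_2:
  assumes \<omega>: "norm \<omega> = 1"
  defines "\<alpha> \<equiv> \<lambda>t. of_real warp' * (-1/4 * (1 / (of_real t - \<i>)^3) + (-3*\<i>/8) * (1 / (of_real t - \<i>)^2))"
  shows "pi_plus_mat (\<lambda>\<tau>. \<sigma> (-2) (Defs.join x0 0, Defs.join \<omega> \<tau>)) t = cm (\<alpha> t) (tangential \<omega>) + cm (\<i> * \<alpha> t) (gam X 4)"
proof -
  have u: "is_pi_plus (\<lambda>t. k * (a * (1 / (of_real t - \<i>)^3) + b * (1 / (of_real t - \<i>)^2)))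
      (\<lambda>t. k * (a * (1 / (of_real t - \<i>)^3) + b * (1 / (of_real t - \<i>)^2)))" for k a b
    by (intro is_pi_plus_cmult is_pi_plus_add is_pi_plus_upper) auto
  have l: "is_pi_plus (\<lambda>t. k * (a * (1 / (of_real t - - \<i>)^3) + b * (1 / (of_real t - - \<i>)^2))) (\<lambda>t. 0)" for k a b
    using is_pi_plus_cmult[OF is_pi_plus_add[OF is_pi_plus_cmult[OF is_pi_plus_lower[of "- \<i>" 3], of a]
      is_pi_plus_cmult[OF is_pi_plus_lower[of "- \<i>" 2], of b]], of k] by simp
  have nz: "complex_of_real t - \<i> \<noteq> 0" "complex_of_real t - - \<i> \<noteq> 0" for t by (auto simp: complex_eq_iff)
  have v1: "complex_of_real (warp' * (t / (1 + t\<^sup>2)^2 + 2 * t / (1 + t\<^sup>2)^3))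
      = of_real warp' * (of_real t / (1 + (of_real t)\<^sup>2)^2 + 2 * of_real t / (1 + (of_real t)\<^sup>2)^3)" for t by simp
  note pf = partial_fractions_minus_2[OF nz]
  have "is_pi_plus (\<lambda>\<tau>. of_real (warp' * (\<tau> / (1 + \<tau>\<^sup>2)^2 + 2 * \<tau> / (1 + \<tau>\<^sup>2)^3))) \<alpha>"
    unfolding \<alpha>_def
    by (rule is_pi_plus_split[OF u l[of "of_real warp'" "-1/4" "3*\<i>/8"]], unfold v1 pf(1)[OF power2_i]) (rule distrib_left)
  moreover have "is_pi_plus (\<lambda>\<tau>. of_real (warp' * (3/4 / (1 + \<tau>\<^sup>2) - 2 / (1 + \<tau>\<^sup>2)^3))) (\<lambda>t. \<i> * \<alpha> t)"
  proof -
    have e: "(\<lambda>t. \<i> * \<alpha> t) = (\<lambda>t. of_real warp' * (-\<i>/4 * (1 / (of_real t - \<i>)^3) + (3/8) * (1 / (of_real t - \<i>)^2)))"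
      by (simp add: \<alpha>_def fun_eq_iff algebra_simps)
    have v: "complex_of_real (warp' * (3/4 / (1 + t\<^sup>2) - 2 / (1 + t\<^sup>2)^3))
      = of_real warp' * (3/4 / (1 + (of_real t)\<^sup>2) - 2 / (1 + (of_real t)\<^sup>2)^3)" for t by simp
    show ?thesis unfolding e
      by (rule is_pi_plus_split[OF u l[of "of_real warp'" "\<i>/4" "3/8"]], unfold v pf(2)[OF power2_i]) (rule distrib_left)
  qed
  ultimately show ?thesis
    unfolding symbol_minus_2_point[OF \<omega>] by (rule pi_plus_mat_eq)
qed

text \<open>The projection is taken at each nearby x_n, where the pole sits at i sqrt(h(x_n)), and
  only then differentiated. The derivative of 1/(2(t - i s)) in s is (i/2)/(t - i s)^2, and s = sqrt
  h has derivative h'(0)/2 at 0.\<close>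

lemma pi_plus_symbol_minus_1_normal_derivative:
  assumes \<omega>: "norm \<omega> = 1"
  defines "p \<equiv> \<lambda>t. \<i> * of_real warp' / 4 * (1 / (of_real t - \<i>)^2)"
  shows "vector_derivative (\<lambda>r. pi_plus_mat (\<lambda>\<tau>. \<sigma> (-1) (Defs.join x0 r, Defs.join \<omega> \<tau>)) t) (at 0)
    = cm (p t) (tangential \<omega>) + cm (\<i> * p t) (gam X 4)"
proof -
  obtain \<epsilon> where \<epsilon>: "\<epsilon> > 0" "\<And>r. \<bar>r\<bar> < \<epsilon> \<Longrightarrow> Defs.join x0 r \<in> V" by (rule near_boundary) blast
  define q where "q r = (1/2) * (1 / (complex_of_real t - \<i> * of_real (sqrt (warp X r))))" for r
  have eq: "pi_plus_mat (\<lambda>\<tau>. \<sigma> (-1) (Defs.join x0 r, Defs.join \<omega> \<tau>)) t = cm (q r) (tangential \<omega>) + cm (\<i> * q r) (gam X 4)"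
    if r: "\<bar>r\<bar> < \<epsilon>" for r
  proof -
    have j: "Defs.join x0 r $ 4 = r" by (simp add: Defs.join_def)
    have h: "warp X r > 0" using adapted_metr(3)[OF a \<epsilon>(2)[OF r]] warp_pos j by metis
    then have s: "sqrt (warp X r) > 0" "(sqrt (warp X r))\<^sup>2 = warp X r" by simp_all
    have 1: "is_pi_plus (\<lambda>\<tau>. \<i> * of_real (sqrt (warp X r) / (warp X r + \<tau>\<^sup>2)))
        (\<lambda>t. (1/2) * (1 / (of_real t - \<i> * of_real (sqrt (warp X r)))))"
      "is_pi_plus (\<lambda>\<tau>. \<i> * of_real (\<tau> / (warp X r + \<tau>\<^sup>2)))
        (\<lambda>t. (\<i>/2) * (1 / (of_real t - \<i> * of_real (sqrt (warp X r)))))"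
      using is_pi_plus_inverse_quadratic[OF s(1)] unfolding s(2) .
    show ?thesis
      unfolding symbol_minus_1_collar[OF \<omega> \<epsilon>(2)[OF r]] j pi_plus_mat_eq[OF 1] q_def by simp
  qed
  have ds: "((\<lambda>r. sqrt (warp X r)) has_real_derivative warp' / 2) (at 0)"
    using warp_deriv w0 by (auto intro!: derivative_eq_intros)
  have nz: "complex_of_real t - \<i> \<noteq> 0" by (auto simp: complex_eq_iff)
  have dq: "(q has_vector_derivative p t) (at 0)"
  proof -
    have "((\<lambda>r. complex_of_real (sqrt (warp X r))) has_vector_derivative of_real (warp' / 2)) (at 0)"
      by (rule bounded_linear.has_vector_derivative[OF bounded_linear_of_real])
        (use ds in \<open>simp add: has_real_derivative_iff_has_vector_derivative\<close>)
    moreover have "((\<lambda>z. (1/2) * (1 / (complex_of_real t - \<i> * z))) has_field_derivative \<i> / 2 * (1 / (of_real t - \<i>)^2))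
        (at (complex_of_real (sqrt (warp X 0))))"
      using nz w0 by (auto intro!: derivative_eq_intros simp: power2_eq_square simp del: right_diff_distrib_numeral)
    ultimately have "(((\<lambda>z. (1/2) * (1 / (complex_of_real t - \<i> * z))) \<circ> (\<lambda>r. complex_of_real (sqrt (warp X r))))
       has_vector_derivative of_real (warp' / 2) * (\<i> / 2 * (1 / (of_real t - \<i>)^2))) (at 0)"
      by (rule field_vector_diff_chain_at)
    then show ?thesis unfolding q_def p_def comp_def by (simp add: mult.commute)
  qed
  have cmd: "((\<lambda>r. cm (f r) M) has_vector_derivative cm d M) (at 0)" if "(f has_vector_derivative d) (at 0)" for f d M
    using that by (rule bounded_linear.has_vector_derivative[OF bounded_bilinear.bounded_linear_left[OF bounded_bilinear_cm]])
  have "((\<lambda>r. cm (q r) (tangential \<omega>) + cm (\<i> * q r) (gam X 4)) has_vector_derivative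
      cm (p t) (tangential \<omega>) + cm (\<i> * p t) (gam X 4)) (at 0)"
    by (intro has_vector_derivative_add cmd dq has_vector_derivative_mult_right)
  then have "((\<lambda>r. pi_plus_mat (\<lambda>\<tau>. \<sigma> (-1) (Defs.join x0 r, Defs.join \<omega> \<tau>)) t) has_vector_derivative
      cm (p t) (tangential \<omega>) + cm (\<i> * p t) (gam X 4)) (at 0)"
    by (rule has_vector_derivative_transform_within_open[where S = "{-\<epsilon><..<\<epsilon>}"]) (use \<epsilon>(1) eq in auto)
  then show ?thesis by (rule vector_derivative_at)
qed

lemma symbol_minus_1_xi_derivative:
  assumes \<omega>: "norm \<omega> = 1"
  defines "A1 \<equiv> \<lambda>t. -2 * t / (1 + t\<^sup>2)^2" and "B1 \<equiv> \<lambda>t. (1 - t\<^sup>2) / (1 + t\<^sup>2)^2"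
    and "A2 \<equiv> \<lambda>t. (6 * t\<^sup>2 - 2) / (1 + t\<^sup>2)^3" and "B2 \<equiv> \<lambda>t. (2 * t^3 - 6 * t) / (1 + t\<^sup>2)^3"
  shows "vector_derivative (\<lambda>\<tau>. \<sigma> (-1) (Defs.join x0 0, Defs.join \<omega> \<tau>)) (at t)
      = cm (\<i> * of_real (A1 t)) (tangential \<omega>) + cm (\<i> * of_real (B1 t)) (gam X 4)" (is "?L1 t = ?R1 t")
    and "vector_derivative (\<lambda>\<tau>. vector_derivative (\<lambda>\<rho>. \<sigma> (-1) (Defs.join x0 0, Defs.join \<omega> \<rho>)) (at \<tau>)) (at t)
      = cm (\<i> * of_real (A2 t)) (tangential \<omega>) + cm (\<i> * of_real (B2 t)) (gam X 4)"
proof -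
  have p: "1 + t\<^sup>2 \<noteq> 0" for t :: real by (metis add_pos_nonneg less_irrefl zero_le_power2 zero_less_one)
  have j: "Defs.join x0 0 $ 4 = 0" by (simp add: Defs.join_def)
  have 0: "\<sigma> (-1) (Defs.join x0 0, Defs.join \<omega> \<tau>)
    = cm (\<i> * of_real (1 / (1 + \<tau>\<^sup>2))) (tangential \<omega>) + cm (\<i> * of_real (\<tau> / (1 + \<tau>\<^sup>2))) (gam X 4)" for \<tau>
    using symbol_minus_1_collar[OF \<omega> point] by (simp add: j w0)
  have d: "((\<lambda>t. 1 / (1 + t\<^sup>2)) has_real_derivative A1 t) (at t)"
    "((\<lambda>t. t / (1 + t\<^sup>2)) has_real_derivative B1 t) (at t)" for t
    unfolding A1_def B1_def using p[of t] by (auto intro!: derivative_eq_intros simp: power2_eq_square)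
  have E: "(-2 * (1 + t\<^sup>2)^2 - -2 * t * (2 * (1 + t\<^sup>2) * (2 * t))) / ((1 + t\<^sup>2)^2 * (1 + t\<^sup>2)^2) = A2 t"
    "(- (2 * t) * (1 + t\<^sup>2)^2 - (1 - t\<^sup>2) * (2 * (1 + t\<^sup>2) * (2 * t))) / ((1 + t\<^sup>2)^2 * (1 + t\<^sup>2)^2) = B2 t" for t
    proof -
    define d where "d = 1 / (1 + t\<^sup>2)"
    have d: "d * (1 + t\<^sup>2) = 1" unfolding d_def by (rule lorentz_power(3))
    have "(-2 * (1 + t\<^sup>2)^2 - -2 * t * (2 * (1 + t\<^sup>2) * (2 * t))) * d ^ 4 = (d * (1 + t\<^sup>2)) * (6 * t\<^sup>2 - 2) * d ^ 3"
      "(- (2 * t) * (1 + t\<^sup>2)^2 - (1 - t\<^sup>2) * (2 * (1 + t\<^sup>2) * (2 * t))) * d ^ 4 = (d * (1 + t\<^sup>2)) * (2 * t^3 - 6 * t) * d ^ 3"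
      by algebra+
    then show "(-2 * (1 + t\<^sup>2)^2 - -2 * t * (2 * (1 + t\<^sup>2) * (2 * t))) / ((1 + t\<^sup>2)^2 * (1 + t\<^sup>2)^2) = A2 t"
      "(- (2 * t) * (1 + t\<^sup>2)^2 - (1 - t\<^sup>2) * (2 * (1 + t\<^sup>2) * (2 * t))) / ((1 + t\<^sup>2)^2 * (1 + t\<^sup>2)^2) = B2 t"
      unfolding A2_def B2_def lorentz_power(2) lorentz_power(1)[of _ _ 3] d_def[symmetric] d by simp_all
  qed
  have 1: "?L1 = ?R1"
    unfolding 0 by (intro ext vector_derivative_at has_vector_derivative_add has_vector_derivative_cm d)
  then show "?L1 t = ?R1 t" by (rule fun_cong)
  show "vector_derivative ?L1 (at t) = cm (\<i> * of_real (A2 t)) (tangential \<omega>) + cm (\<i> * of_real (B2 t)) (gam X 4)"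
    unfolding 1 A1_def B1_def E[symmetric] by (intro vector_derivative_at has_vector_derivative_add has_vector_derivative_cm DERIV_lorentz)
qed

text \<open>For the principal term the combination A + iB equals -1/(t + i); the right-hand sides
  are its first two derivatives.\<close>

lemma xi_derivative_combinations:
  fixes t :: real
  shows "\<i> * complex_of_real (-2 * t / (1 + t\<^sup>2)^2) + \<i> * (\<i> * of_real ((1 - t\<^sup>2) / (1 + t\<^sup>2)^2)) = (1 / (of_real t - - \<i>))^2"
    and "\<i> * complex_of_real ((6 * t\<^sup>2 - 2) / (1 + t\<^sup>2)^3) + \<i> * (\<i> * of_real ((2 * t^3 - 6 * t) / (1 + t\<^sup>2)^3)) = -2 * (1 / (of_real t - - \<i>))^3"
proof -
  define z u w where "z = complex_of_real t" and "u = 1 / (z - \<i>)" and "w = 1 / (z - - \<i>)"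
  have nz: "z - \<i> \<noteq> 0" "z - - \<i> \<noteq> 0" by (auto simp: complex_eq_iff z_def)
  then have 1: "u * (z - \<i>) = 1" "w * (z + \<i>) = 1" by (auto simp: u_def w_def)
  have i: "\<i>^2 = -1" by simp
  have "1 + z\<^sup>2 = (z - \<i>) * (z - - \<i>)" using i by algebra
  then have 3: "a / (1 + z\<^sup>2)^k = a * (u * w)^k" for a k by (simp add: u_def w_def power_divide power_mult_distrib)
  have "\<i> * (-2 * z / (1 + z\<^sup>2)^2) + \<i> * (\<i> * ((1 - z\<^sup>2) / (1 + z\<^sup>2)^2)) = w^2"
    unfolding 3 using 1 i by algebra
  then show "\<i> * complex_of_real (-2 * t / (1 + t\<^sup>2)^2) + \<i> * (\<i> * of_real ((1 - t\<^sup>2) / (1 + t\<^sup>2)^2)) = (1 / (of_real t - - \<i>))^2"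
    by (simp add: z_def w_def)
  have "\<i> * ((6 * z\<^sup>2 - 2) / (1 + z\<^sup>2)^3) + \<i> * (\<i> * ((2 * z^3 - 6 * z) / (1 + z\<^sup>2)^3)) = -2 * w^3"
    unfolding 3 using 1 i by algebra
  then show "\<i> * complex_of_real ((6 * t\<^sup>2 - 2) / (1 + t\<^sup>2)^3) + \<i> * (\<i> * of_real ((2 * t^3 - 6 * t) / (1 + t\<^sup>2)^3)) = -2 * (1 / (of_real t - - \<i>))^3"
    by (simp add: z_def w_def)
qed

end

text \<open>Since u w = 1/(1 + t^2), unequal powers leave one factor u = (t + i)/(1 + t^2) or w = (t
  - i)/(1 + t^2), so the integrands split into real and imaginary parts whose integrals are
  known.\<close>

lemma residue_integrands:
  fixes t :: real and h :: real
  defines "u \<equiv> 1 / (complex_of_real t - \<i>)" and "w \<equiv> 1 / (complex_of_real t - - \<i>)"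
  shows "- 4 * (\<i> * of_real h / 4 * u^2) * (-2 * w^3)
      = of_real (2 * h * (1 / (1 + t\<^sup>2)^3)) + \<i> * of_real (2 * h * (t / (1 + t\<^sup>2)^3))"
    and "- 4 * (of_real h * (-1/4 * u^3 + (-3*\<i>/8) * u^2)) * w^2
      = of_real (h * (t / (1 + t\<^sup>2)^3)) + \<i> * of_real (h * (1 / (1 + t\<^sup>2)^3) + 3/2 * h * (1 / (1 + t\<^sup>2)^2))"
proof -
  define z where "z = complex_of_real t"
  have nz: "z - \<i> \<noteq> 0" "z - - \<i> \<noteq> 0" by (auto simp: complex_eq_iff z_def)
  then have 1: "u * (z - \<i>) = 1" "w * (z + \<i>) = 1" by (auto simp: u_def w_def z_def)
  have i: "\<i>^2 = -1" by simp
  have "1 + z\<^sup>2 = (z - \<i>) * (z - - \<i>)" using i by algebra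
  then have 3: "a / (1 + z\<^sup>2)^k = a * (u * w)^k" for a k by (simp add: u_def w_def z_def power_divide power_mult_distrib)
  have "- 4 * (\<i> * H / 4 * u^2) * (-2 * w^3) = 2 * H * (1 / (1 + z\<^sup>2)^3) + \<i> * (2 * H * (z / (1 + z\<^sup>2)^3))" for H
    unfolding 3 using 1 i by algebra
  from this[of "of_real h"] show "- 4 * (\<i> * of_real h / 4 * u^2) * (-2 * w^3)
      = of_real (2 * h * (1 / (1 + t\<^sup>2)^3)) + \<i> * of_real (2 * h * (t / (1 + t\<^sup>2)^3))" by (simp add: z_def)
  have "- 4 * (H * (-1/4 * u^3 + (-3*\<i>/8) * u^2)) * w^2
      = H * (z / (1 + z\<^sup>2)^3) + \<i> * (H * (1 / (1 + z\<^sup>2)^3) + 3/2 * H * (1 / (1 + z\<^sup>2)^2))" for H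
    unfolding 3 using 1 i by algebra
  from this[of "of_real h"] show "- 4 * (of_real h * (-1/4 * u^3 + (-3*\<i>/8) * u^2)) * w^2
      = of_real (h * (t / (1 + t\<^sup>2)^3)) + \<i> * of_real (h * (1 / (1 + t\<^sup>2)^3) + 3/2 * h * (1 / (1 + t\<^sup>2)^2))"
    by (simp add: z_def)
qed

text \<open>The line integrals are 3 pi h'(0)/4 and 9 pi i h'(0)/8, independent of the point of the
  sphere, whence the factor 4 pi. Two symbols occur because the densities allow independent choices
  for the two operators.\<close>

lemma local_residues:
  fixes X :: "('m::{t2_space, second_countable_topology}, 'p::topological_space, 'z) collar_manifold_scheme"
  assumes P: "adapted_symbol X D Q b c s y \<sigma>" and P': "adapted_symbol X D Q b c s y \<sigma>'"
  shows "local_res11 \<sigma> \<sigma>' (coord b y) = of_real (- (3 * pi\<^sup>2 / 2) * deriv (warp X) 0)"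
    and "local_res21 \<sigma> \<sigma>' (coord b y) = of_real (9 * pi\<^sup>2 / 2 * deriv (warp X) 0)"
proof -
  interpret S: adapted_symbol X D Q b c s y \<sigma> by (rule P)
  interpret S': adapted_symbol X D Q b c s y \<sigma>' by (rule P')
  let ?h = "S.warp'" and ?y = "coord b y"
  note tr = trace_clifford_pair[OF S.tangential_relations]
  have 11: "(LINT t|lborel. trace (
     vector_derivative (\<lambda>r. pi_plus_mat (\<lambda>\<tau>. \<sigma> (-1) (Defs.join ?y r, Defs.join \<omega> \<tau>)) t) (at 0) **
     vector_derivative (\<lambda>\<tau>. vector_derivative (\<lambda>\<rho>. \<sigma>' (-1) (Defs.join ?y 0, Defs.join \<omega> \<rho>)) (at \<tau>)) (at t)))
     = of_real (2 * ?h * (3 * pi / 8))" if \<omega>: "norm \<omega> = 1" for \<omega>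
    unfolding S.pi_plus_symbol_minus_1_normal_derivative[OF \<omega>] S'.symbol_minus_1_xi_derivative(2)[OF \<omega>] tr[OF \<omega> \<omega> \<omega>]
      S.xi_derivative_combinations power_one_over[symmetric]
    unfolding residue_integrands integral_of_real_I[OF Bochner_Integration.integrable_mult_right[OF has_integral_lorentz_3(1)] Bochner_Integration.integrable_mult_right[OF has_integral_lorentz_odd(1)]]
      integral_mult_right_zero has_integral_lorentz_3 has_integral_lorentz_odd by simp
  have 21: "(LINT t|lborel. trace (
     pi_plus_mat (\<lambda>\<tau>. \<sigma> (-2) (Defs.join ?y 0, Defs.join \<omega> \<tau>)) t **
     vector_derivative (\<lambda>\<tau>. \<sigma>' (-1) (Defs.join ?y 0, Defs.join \<omega> \<tau>)) (at t)))
     = \<i> * of_real (9 * pi / 8 * ?h)" if \<omega>: "norm \<omega> = 1" for \<omega>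
    unfolding S.pi_plus_symbol_minus_2[OF \<omega>] S'.symbol_minus_1_xi_derivative(1)[OF \<omega>] tr[OF \<omega> \<omega> \<omega>]
      S.xi_derivative_combinations power_one_over[symmetric]
    unfolding residue_integrands integral_of_real_I[OF Bochner_Integration.integrable_mult_right[OF has_integral_lorentz_odd(1)]
        Bochner_Integration.integrable_add[OF Bochner_Integration.integrable_mult_right[OF has_integral_lorentz_3(1)] Bochner_Integration.integrable_mult_right[OF has_integral_lorentz_2(1)]]]
      Bochner_Integration.integral_add[OF Bochner_Integration.integrable_mult_right[OF has_integral_lorentz_3(1)] Bochner_Integration.integrable_mult_right[OF has_integral_lorentz_2(1)]]
      integral_mult_right_zero has_integral_lorentz_2 has_integral_lorentz_3 has_integral_lorentz_odd by (simp add: algebra_simps)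
  have "local_res11 \<sigma> \<sigma>' ?y = - (1/2) * (4 * complex_of_real pi * of_real (2 * ?h * (3 * pi / 8)))"
    unfolding local_res11_def by (intro arg_cong2[where f = "(*)"] refl sphere_integral_const 11)
  then show "local_res11 \<sigma> \<sigma>' ?y = of_real (- (3 * pi\<^sup>2 / 2) * deriv (warp X) 0)"
    by (simp add: S.warp'_def power2_eq_square)
  have "local_res21 \<sigma> \<sigma>' ?y = - \<i> * (4 * complex_of_real pi * (\<i> * of_real (9 * pi / 8 * ?h)))"
    unfolding local_res21_def by (intro arg_cong2[where f = "(*)"] refl sphere_integral_const 21)
  then show "local_res21 \<sigma> \<sigma>' ?y = of_real (9 * pi\<^sup>2 / 2 * deriv (warp X) 0)"
    by (simp add: S.warp'_def power2_eq_square)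
qed

section \<open>The Riemannian volume measure\<close>

lemma nn_integral_absolutely_integrable:
  fixes k :: "'a::euclidean_space \<Rightarrow> real"
  assumes m: "(\<lambda>x. indicator A x * k x) \<in> borel_measurable borel" and k: "\<And>x. x \<in> A \<Longrightarrow> 0 \<le> k x"
  shows "k absolutely_integrable_on A \<longleftrightarrow> (\<integral>\<^sup>+x. indicator A x * ennreal (k x) \<partial>lborel) < \<infinity>"
    and "k absolutely_integrable_on A \<Longrightarrow> (\<integral>\<^sup>+x. indicator A x * ennreal (k x) \<partial>lborel) = ennreal (integral A k)"
proof -
  have p: "0 \<le> indicator A x * k x" for x using k[of x] by (auto simp: indicator_def)
  have e: "indicator A x * ennreal (k x) = ennreal (indicator A x * k x)" for x by (auto simp: indicator_def)
  have i: "k absolutely_integrable_on A \<longleftrightarrow> integrable lborel (\<lambda>x. indicator A x * k x)"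
    unfolding set_integrable_def using integrable_completion[of "\<lambda>x. indicator A x * k x" lborel] m by simp
  show "k absolutely_integrable_on A \<longleftrightarrow> (\<integral>\<^sup>+x. indicator A x * ennreal (k x) \<partial>lborel) < \<infinity>"
    unfolding i e integrable_iff_bounded using m p by (simp add: abs_of_nonneg)
  assume a: "k absolutely_integrable_on A"
  have "(\<integral>\<^sup>+x. indicator A x * ennreal (k x) \<partial>lborel) = ennreal (LINT x|lborel. indicator A x * k x)"
    unfolding e by (rule nn_integral_eq_integral) (use a i p in auto)
  also have "(LINT x|lborel. indicator A x * k x) = (LINT x:A|lborel. k x)"
    by (simp add: set_lebesgue_integral_def)
  also have "\<dots> = integral A k"
    by (rule set_borel_integral_eq_integral(2)) (use a i in \<open>simp add: set_integrable_def\<close>)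
  finally show "(\<integral>\<^sup>+x. indicator A x * ennreal (k x) \<partial>lborel) = ennreal (integral A k)" .
qed

text \<open>The underlying theorem concerns absolutely integrable functions. Where integrability
  fails, it fails on both sides, and both nonnegative integrals are infinite. The separate h allows
  measurability to be checked on a function that agrees with the Jacobian expression on P.\<close>

lemma nn_integral_change_of_variables:
  fixes f h :: "real^'n::{finite,wellorder} \<Rightarrow> real" and T :: "real^'n::_ \<Rightarrow> real^'n::_"
  assumes P: "P \<in> sets borel"
    and D: "\<And>x. x \<in> P \<Longrightarrow> (T has_derivative T' x) (at x within P)" and inj: "inj_on T P"
    and f: "(\<lambda>x. indicator (T ` P) x * f x) \<in> borel_measurable borel"
    and h: "(\<lambda>x. indicator P x * h x) \<in> borel_measurable borel"
    and f0: "\<And>x. x \<in> T ` P \<Longrightarrow> 0 \<le> f x"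
    and hf: "\<And>x. x \<in> P \<Longrightarrow> h x = \<bar>det (matrix (T' x))\<bar> * f (T x)"
  shows "(\<integral>\<^sup>+x. indicator (T ` P) x * ennreal (f x) \<partial>lborel) = (\<integral>\<^sup>+x. indicator P x * ennreal (h x) \<partial>lborel)"
proof -
  let ?F = "\<integral>\<^sup>+x. indicator (T ` P) x * ennreal (f x) \<partial>lborel" and ?H = "\<integral>\<^sup>+x. indicator P x * ennreal (h x) \<partial>lborel"
  let ?h = "\<lambda>x. \<bar>det (matrix (T' x))\<bar> * f (T x)"
  have Pl: "P \<in> sets lebesgue" using P by (simp add: sets_completionI_sets)
  have "(\<lambda>x. \<bar>det (matrix (T' x))\<bar> *\<^sub>R (vec (f (T x)) :: real^1)) absolutely_integrable_on P \<and>
      integral P (\<lambda>x. \<bar>det (matrix (T' x))\<bar> *\<^sub>R (vec (f (T x)) :: real^1)) = vec r \<longleftrightarrow>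
    (\<lambda>x. vec (f x) :: real^1) absolutely_integrable_on (T ` P) \<and> integral (T ` P) (\<lambda>x. vec (f x) :: real^1) = vec r" for r
    by (rule has_absolute_integral_change_of_variables[OF Pl D inj])
  then have cv: "?h absolutely_integrable_on P \<and> integral P ?h = r \<longleftrightarrow> f absolutely_integrable_on (T ` P) \<and> integral (T ` P) f = r" for r
    by (simp add: absolutely_integrable_on_1_iff integral_on_1_eq)
  have hc: "?h absolutely_integrable_on P \<longleftrightarrow> h absolutely_integrable_on P" "integral P ?h = integral P h"
    unfolding set_integrable_def using hf by (auto intro!: integrable_cong arg_cong[where f="integrable lebesgue"] integral_cong ext simp: indicator_def)
  have h0: "0 \<le> h x" if "x \<in> P" for x using hf[OF that] f0 that by simp
  have F: "f absolutely_integrable_on T ` P \<longleftrightarrow> ?F < \<infinity>" "f absolutely_integrable_on T ` P \<Longrightarrow> ?F = ennreal (integral (T ` P) f)"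
    by (rule nn_integral_absolutely_integrable[OF f], rule f0, assumption)+
  have H: "h absolutely_integrable_on P \<longleftrightarrow> ?H < \<infinity>" "h absolutely_integrable_on P \<Longrightarrow> ?H = ennreal (integral P h)"
    by (rule nn_integral_absolutely_integrable[OF h], rule h0, assumption)+
  show ?thesis
  proof (cases "f absolutely_integrable_on (T ` P)")
    case True
    then have "?h absolutely_integrable_on P" "integral P ?h = integral (T ` P) f" using cv by blast+
    then show ?thesis using F(2)[OF True] H(2) hc by simp
  next
    case False
    then have "\<not> h absolutely_integrable_on P" using cv hc by blast
    then have "?H = \<infinity>" "?F = \<infinity>" using F(1) H(1) False by (simp_all add: not_less top_unique)
    then show ?thesis by simp
  qed
qed

section \<open>Gluing the chart measures to one volume\<close>

locale riemannian_manifold =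
  fixes X :: "'a::second_countable_topology set" and A :: "('a, 'n::{finite,wellorder}) chart set" and g :: "('a, 'n) metric"
  assumes manifold: "oriented_manifold X A" and metric: "riemannian_metric A g"
begin

abbreviation M :: "'a measure" where "M \<equiv> restrict_space borel X"

text \<open>The truncation at 0 leaves the volume unchanged, as \<open>ennreal\<close> maps negative numbers to 0; it makes
  the sign of the determinant irrelevant in the change of variables.\<close>

definition dens :: "('a, 'n) chart \<Rightarrow> real^'n::_ \<Rightarrow> real" where
  "dens c x = max 0 (sqrt (det (g c (param c x))))"

definition chart_measure :: "('a, 'n) chart \<Rightarrow> 'a measure" where
  "chart_measure c = distr (density (restrict_space lborel (crange c)) (\<lambda>x. ennreal (dens c x))) M (param c)"

lemma chart: "c \<in> A \<Longrightarrow> is_chart X c"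
  using manifold by (simp add: oriented_manifold_def)

lemma dom_sub: "c \<in> A \<Longrightarrow> cdom c \<subseteq> X"
  using openin_imp_subset[OF chart_openin[OF chart]] .

lemma dom_sets: assumes c: "c \<in> A" shows "cdom c \<in> sets M"
proof -
  obtain U where "open U" "cdom c = X \<inter> U" using chart_openin[OF chart[OF c]] by (auto simp: openin_open)
  then show ?thesis by (auto simp: sets_restrict_space)
qed

lemma param_measurable:
  assumes c: "c \<in> A"
  shows "param c \<in> measurable (restrict_space lborel (crange c)) M"
proof (rule measurable_restrict_space2)
  show "param c \<in> space (restrict_space lborel (crange c)) \<rightarrow> X"
    using chart_param_in[OF chart[OF c]] dom_sub[OF c] by (auto simp: space_restrict_space)
  have "param c \<in> borel_measurable (restrict_space borel (crange c))"
    by (rule borel_measurable_continuous_on_restrict[OF chart_cont_param[OF chart[OF c]]])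
  then show "param c \<in> borel_measurable (restrict_space lborel (crange c))"
    by (subst measurable_cong_sets[OF _ refl, of _ "restrict_space borel (crange c)"]) (simp_all add: sets_restrict_space)
qed

lemma range_sets: "c \<in> A \<Longrightarrow> crange c \<in> sets borel"
  using chart_open_range[OF chart] by simp

lemma coord_image: assumes c: "c \<in> A" and S: "S \<subseteq> cdom c"
  shows "coord c ` S = param c -` S \<inter> crange c"
proof (intro equalityI subsetI)
  fix x assume "x \<in> coord c ` S"
  then show "x \<in> param c -` S \<inter> crange c"
    using chart_param_coord[OF chart[OF c]] chart_coord_in[OF chart[OF c]] S by auto
next
  fix x assume "x \<in> param c -` S \<inter> crange c"
  then show "x \<in> coord c ` S" using chart_coord_param[OF chart[OF c], of x] by (metis IntD1 IntD2 image_eqI vimageD)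
qed

lemma preimage_sets:
  assumes c: "c \<in> A" and S: "S \<in> sets M"
  shows "param c -` S \<inter> crange c \<in> sets borel"
proof -
  have "param c -` S \<inter> space (restrict_space lborel (crange c)) \<in> sets (restrict_space lborel (crange c))"
    by (rule measurable_sets[OF param_measurable[OF c] S])
  then show ?thesis using range_sets[OF c] by (auto simp: space_restrict_space sets_restrict_space)
qed

lemma dens_continuous: assumes c: "c \<in> A" shows "continuous_on (crange c) (dens c)"
proof -
  have "smooth_on (crange c) (\<lambda>x. g c (param c x))" using metric c by (simp add: riemannian_metric_def)
  then have "continuous_on (crange c) (\<lambda>x. g c (param c x))" by (rule smooth_on_imp_continuous_on)
  then show ?thesis unfolding dens_def det_def by (intro continuous_intros)
qed

lemma dens_measurable:
  assumes c: "c \<in> A" and P: "P \<in> sets borel" "P \<subseteq> crange c"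
  shows "(\<lambda>x. indicator P x * dens c x) \<in> borel_measurable borel"
proof -
  have "dens c \<in> borel_measurable (restrict_space borel P)"
    by (rule borel_measurable_continuous_on_restrict[OF continuous_on_subset[OF dens_continuous[OF c] P(2)]])
  then show ?thesis using P(1) by (simp add: borel_measurable_restrict_space_iff mult.commute)
qed

lemma emeasure_chart_measure:
  assumes c: "c \<in> A" and S: "S \<in> sets M"
  shows "emeasure (chart_measure c) S = (\<integral>\<^sup>+x. indicator (param c -` S \<inter> crange c) x * ennreal (dens c x) \<partial>lborel)"
proof -
  have d: "(\<lambda>x. ennreal (dens c x)) \<in> borel_measurable (restrict_space lborel (crange c))"
  proof -
    have "dens c \<in> borel_measurable (restrict_space borel (crange c))"
      by (rule borel_measurable_continuous_on_restrict[OF dens_continuous[OF c]])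
    then have "dens c \<in> borel_measurable (restrict_space lborel (crange c))"
      by (subst measurable_cong_sets[OF _ refl, of _ "restrict_space borel (crange c)"]) (simp_all add: sets_restrict_space)
    then show ?thesis by simp
  qed
  let ?R = "restrict_space lborel (crange c)"
  have s: "param c -` S \<inter> crange c \<in> sets ?R"
    using measurable_sets[OF param_measurable[OF c] S] by (simp add: space_restrict_space)
  have "emeasure (chart_measure c) S = emeasure (density ?R (\<lambda>x. ennreal (dens c x))) (param c -` S \<inter> crange c)"
    unfolding chart_measure_def by (subst emeasure_distr) (use S param_measurable[OF c] in \<open>auto simp: space_restrict_space\<close>)
  also have "\<dots> = (\<integral>\<^sup>+x. ennreal (dens c x) * indicator (param c -` S \<inter> crange c) x \<partial>?R)"
    by (rule emeasure_density[OF d s])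
  also have "\<dots> = (\<integral>\<^sup>+x. ennreal (dens c x) * indicator (param c -` S \<inter> crange c) x * indicator (crange c) x \<partial>lborel)"
    by (rule nn_integral_restrict_space) (use range_sets[OF c] in simp)
  also have "\<dots> = (\<integral>\<^sup>+x. indicator (param c -` S \<inter> crange c) x * ennreal (dens c x) \<partial>lborel)"
    by (rule nn_integral_cong) (auto simp: indicator_def)
  finally show ?thesis .
qed

text \<open>The Gram determinants in the two charts differ by the square of the Jacobian
  determinant, so the densities differ by its absolute value, exactly the factor in the change of
  variables.\<close>

lemma chart_measure_eq:
  assumes c: "c \<in> A" "c' \<in> A" and S: "S \<in> sets M" "S \<subseteq> cdom c" "S \<subseteq> cdom c'"
  shows "emeasure (chart_measure c) S = emeasure (chart_measure c') S"
proof -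
  let ?T = "transition c c'" and ?P = "coord c ` S"
  note C = chart[OF c(1)] and C' = chart[OF c(2)]
  have Teq: "?T (coord c p) = coord c' p" if "p \<in> S" for p
    using chart_param_coord[OF C, of p] S(2) that by (auto simp: transition_def)
  then have TP: "?T ` ?P = coord c' ` S" by (force simp: image_image)
  have Ps: "?P \<in> sets borel" "coord c' ` S \<in> sets borel"
    using preimage_sets[OF _ S(1)] c coord_image[OF c(1) S(2)] coord_image[OF c(2) S(3)] by auto
  have Pr: "?P \<subseteq> crange c" "coord c' ` S \<subseteq> crange c'" using S by (auto simp: crange_def)
  have sm: "smooth_on (overlap c c') ?T"
    using manifold c by (auto simp: oriented_manifold_def oriented_compatible_def)
  have eq: "(\<integral>\<^sup>+x. indicator (?T ` ?P) x * ennreal (dens c' x) \<partial>lborel) = (\<integral>\<^sup>+x. indicator ?P x * ennreal (dens c x) \<partial>lborel)"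
  proof (rule nn_integral_change_of_variables[OF Ps(1), where T' = "\<lambda>x. frechet_derivative ?T (at x)"])
    fix x assume x: "x \<in> ?P"
    then obtain p where p: "p \<in> S" "x = coord c p" by blast
    have "x \<in> overlap c c'" using p S by (auto simp: overlap_def)
    then have "?T differentiable (at x)" by (rule smooth_onD_diff[OF sm])
    then have "(?T has_derivative frechet_derivative ?T (at x)) (at x)" by (simp add: frechet_derivative_works)
    then show "(?T has_derivative frechet_derivative ?T (at x)) (at x within ?P)" by (rule has_derivative_at_withinI)
    have J: "matrix (frechet_derivative ?T (at x)) = jac c c' p" by (simp add: jac_def jacobian_def p(2))
    have pp: "p \<in> cdom c \<inter> cdom c'" using p S by blast
    have "g c p = transpose (jac c c' p) ** g c' p ** jac c c' p"
      by (rule metric[unfolded riemannian_metric_def, THEN conjunct2, rule_format, OF c pp])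
    then have "det (g c p) = det (transpose (jac c c' p) ** g c' p ** jac c c' p)" by (rule arg_cong)
    also have "\<dots> = (det (jac c c' p))\<^sup>2 * det (g c' p)"
      by (simp add: det_mul det_transpose power2_eq_square)
    finally have "det (g c p) = (det (jac c c' p))\<^sup>2 * det (g c' p)" .
    then have d: "sqrt (det (g c p)) = \<bar>det (jac c c' p)\<bar> * sqrt (det (g c' p))" by (simp add: real_sqrt_mult)
    have e: "param c x = p" "param c' (?T x) = p"
      using chart_param_coord[OF C, of p] chart_param_coord[OF C', of p] S p Teq by auto
    have mx: "max 0 (r * s) = r * max 0 s" if "r \<ge> 0" for r s :: real
      using that by (subst max_mult_distrib_left) simp
    show "dens c x = \<bar>det (matrix (frechet_derivative ?T (at x)))\<bar> * dens c' (?T x)"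
      unfolding dens_def e d J by (rule mx) simp
  next
    show "inj_on ?T ?P"
    proof (rule inj_onI)
      fix x x' assume "x \<in> ?P" "x' \<in> ?P" and e: "?T x = ?T x'"
      then obtain p p' where p: "p \<in> S" "p' \<in> S" "x = coord c p" "x' = coord c p'" by blast
      then have "coord c' p = coord c' p'" using Teq e by simp
      then have "p = p'" using inj_onD[OF chart_inj[OF C']] S p by blast
      then show "x = x'" using p by simp
    qed
  next
    show "(\<lambda>x. indicator (?T ` ?P) x * dens c' x) \<in> borel_measurable borel"
      unfolding TP by (rule dens_measurable[OF c(2) Ps(2) Pr(2)])
    show "(\<lambda>x. indicator ?P x * dens c x) \<in> borel_measurable borel"
      by (rule dens_measurable[OF c(1) Ps(1) Pr(1)])
  next
    fix x assume "x \<in> ?T ` ?P"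
    show "0 \<le> dens c' x" by (simp add: dens_def)
  qed
  show ?thesis
    unfolding emeasure_chart_measure[OF c(1) S(1)] emeasure_chart_measure[OF c(2) S(1)]
      coord_image[OF c(1) S(2), symmetric] coord_image[OF c(2) S(3), symmetric] TP[symmetric]
    using eq by simp
qed

text \<open>The Lindelof property of a second countable space leaves countably many chart
  domains.\<close>

lemma atlas_sequence:
  obtains C :: "nat \<Rightarrow> ('a, 'n) chart" where "\<And>n. C n \<in> A" "(\<Union>n. cdom (C n)) = X"
proof -
  have "openin (top_of_set X) S" if "S \<in> cdom ` A" for S using that chart_openin[OF chart] by blast
  then obtain F where F: "F \<subseteq> cdom ` A" "countable F" "\<Union>F = \<Union>(cdom ` A)" using Lindelof_openin[of "cdom ` A" X] by blast
  have U: "\<Union>(cdom ` A) = X" using manifold by (simp add: oriented_manifold_def)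
  \<comment> \<open>The empty chart belongs to the maximal atlas. Adding its domain keeps the family
    nonempty, so that it can be enumerated by all natural numbers even if X is empty.\<close>
  have "({}, \<lambda>_. 0) \<in> A"
  proof -
    have "is_chart X ({}, \<lambda>_. 0 :: real^'n::_)" by (simp add: is_chart_def crange_def homeomorphism_def)
    moreover have "oriented_compatible ({}, \<lambda>_. 0) c \<and> oriented_compatible c ({}, \<lambda>_. 0)" for c :: "('a, 'n) chart"
      by (simp add: oriented_compatible_def overlap_def smooth_on_def)
    ultimately show ?thesis using manifold unfolding oriented_manifold_def by blast
  qed
  then have E: "{} \<in> cdom ` A" by force
  define G where "G = insert {} F"
  have G: "G \<subseteq> cdom ` A" "countable G" "\<Union>G = X" "G \<noteq> {}" using F E U by (auto simp: G_def)
  have ex: "\<exists>c. c \<in> A \<and> cdom c = from_nat_into G n" for n using from_nat_into[OF G(4)] G(1) by force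
  define C where "C n = (SOME c. c \<in> A \<and> cdom c = from_nat_into G n)" for n
  have C: "C n \<in> A \<and> cdom (C n) = from_nat_into G n" for n unfolding C_def by (rule someI_ex[OF ex])
  then have "(\<Union>n. cdom (C n)) = \<Union>(range (from_nat_into G))" by auto
  also have "\<dots> = X" using range_from_nat_into[OF G(4,2)] G(3) by simp
  finally have U: "(\<Union>n. cdom (C n)) = X" .
  have "C n \<in> A" for n using C[of n] ..
  then show thesis using U by (rule that)
qed

text \<open>The relation under \<open>THE\<close> in \<open>riemannian_volume\<close>, so that its
  unique solvability can be stated.\<close>

definition is_volume :: "'a measure \<Rightarrow> bool" where
  "is_volume \<nu> \<longleftrightarrow> space \<nu> = X \<and> sets \<nu> = sets M \<and>
     (\<forall>c\<in>A. \<forall>S\<in>sets \<nu>. S \<subseteq> cdom c \<longrightarrow>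
        emeasure \<nu> S = (\<integral>\<^sup>+x. indicator (coord c ` S) x * ennreal (sqrt (det (g c (param c x)))) \<partial>lborel))"

lemma is_volume_iff:
  "is_volume \<nu> \<longleftrightarrow> space \<nu> = X \<and> sets \<nu> = sets M \<and>
     (\<forall>c\<in>A. \<forall>S\<in>sets M. S \<subseteq> cdom c \<longrightarrow> emeasure \<nu> S = emeasure (chart_measure c) S)"
proof -
  have e: "emeasure (chart_measure c) S = (\<integral>\<^sup>+x. indicator (coord c ` S) x * ennreal (sqrt (det (g c (param c x)))) \<partial>lborel)"
    if "c \<in> A" "S \<in> sets M" "S \<subseteq> cdom c" for c S
    unfolding emeasure_chart_measure[OF that(1,2)] coord_image[OF that(1,3)] dens_def by (simp add: ennreal_max_0)
  have "(emeasure \<nu> S = (\<integral>\<^sup>+x. indicator (coord c ` S) x * ennreal (sqrt (det (g c (param c x)))) \<partial>lborel))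
      \<longleftrightarrow> emeasure \<nu> S = emeasure (chart_measure c) S" if "c \<in> A" "S \<in> sets M" "S \<subseteq> cdom c" for c S
    by (subst e[OF that]) (rule refl)
  then have "(\<forall>c\<in>A. \<forall>S\<in>sets M. S \<subseteq> cdom c \<longrightarrow>
        emeasure \<nu> S = (\<integral>\<^sup>+x. indicator (coord c ` S) x * ennreal (sqrt (det (g c (param c x)))) \<partial>lborel))
    \<longleftrightarrow> (\<forall>c\<in>A. \<forall>S\<in>sets M. S \<subseteq> cdom c \<longrightarrow> emeasure \<nu> S = emeasure (chart_measure c) S)"
    by (intro ball_cong imp_cong refl)
  then show ?thesis
    unfolding is_volume_def by (cases "sets \<nu> = sets M") (simp_all only: simp_thms)
qed

text \<open>A countable cover by chart domains is made disjoint and each piece is measured in its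
  own chart; \<open>chart_measure_eq\<close> makes the result agree with every chart. Uniqueness
  holds because a candidate is determined on the pieces.\<close>

lemma volume_ex1: "\<exists>!\<nu>. is_volume \<nu>"
proof -
  obtain C :: "nat \<Rightarrow> ('a, 'n) chart" where C: "\<And>n. C n \<in> A" "(\<Union>n. cdom (C n)) = X" by (rule atlas_sequence) blast
  define B where "B = disjointed (\<lambda>n. cdom (C n))"
  have Bsub: "B n \<subseteq> cdom (C n)" for n unfolding B_def by (rule disjointed_subset)
  have Bs: "B n \<in> sets M" for n
    using sets.range_disjointed_sets[of "\<lambda>n. cdom (C n)" M] dom_sets[OF C(1)] by (auto simp: B_def)
  have BU: "(\<Union>n. B n) = X" by (simp add: B_def UN_disjointed_eq C)
  have Bd: "disjoint_family B" by (simp add: B_def disjoint_family_disjointed)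
  have split: "emeasure N S = (\<Sum>n. emeasure N (S \<inter> B n))" if N: "sets N = sets M" and S: "S \<in> sets M" for N S
  proof -
    have "S \<subseteq> X" using sets.sets_into_space[OF S] by (simp add: space_restrict_space)
    then have "S = (\<Union>n. S \<inter> B n)" using BU by blast
    moreover have "disjoint_family (\<lambda>n. S \<inter> B n)" using Bd by (auto simp: disjoint_family_on_def)
    moreover have "range (\<lambda>n. S \<inter> B n) \<subseteq> sets N" using S Bs N by auto
    ultimately show ?thesis using suminf_emeasure by metis
  qed
  define F where "F S = (\<Sum>n. emeasure (chart_measure (C n)) (S \<inter> B n))" for S
  define \<nu> where "\<nu> = measure_of X (sets M) F"
  have cs: "sets (chart_measure c) = sets M" for c by (simp add: chart_measure_def)
  have sM: "space M = X" by (simp add: space_restrict_space)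
  have sp: "sets \<nu> = sets M" "space \<nu> = X"
    using sets.space_closed[of M] sets.sigma_sets_eq[of M] unfolding sM \<nu>_def by simp_all
  have em: "emeasure \<nu> S = F S" if S: "S \<in> sets M" for S
    unfolding \<nu>_def
  proof (rule emeasure_measure_of_sigma[OF _ _ _ S])
    show "sigma_algebra X (sets M)" using sets.sigma_algebra_axioms[of M] unfolding sM .
    show "positive (sets M) F" by (simp add: positive_def F_def)
    show "countably_additive (sets M) F"
    proof (rule countably_additiveI)
      fix S :: "nat \<Rightarrow> 'a set" assume S: "range S \<subseteq> sets M" "disjoint_family S"
      \<comment> \<open>Written as integrals over the counting measure, the two infinite sums can be
        interchanged.\<close>
      have "(\<Sum>i. F (S i)) = (\<Sum>i. \<integral>\<^sup>+n. emeasure (chart_measure (C n)) (S i \<inter> B n) \<partial>count_space UNIV)"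
        by (simp add: F_def nn_integral_count_space_nat)
      also have "\<dots> = (\<integral>\<^sup>+n. (\<Sum>i. emeasure (chart_measure (C n)) (S i \<inter> B n)) \<partial>count_space UNIV)"
        by (rule nn_integral_suminf[symmetric]) simp
      also have "(\<lambda>n. \<Sum>i. emeasure (chart_measure (C n)) (S i \<inter> B n)) = (\<lambda>n. emeasure (chart_measure (C n)) ((\<Union>i. S i) \<inter> B n))"
      proof
        fix n
        have "range (\<lambda>i. S i \<inter> B n) \<subseteq> sets (chart_measure (C n))" using S Bs by (auto simp: cs)
        moreover have "disjoint_family (\<lambda>i. S i \<inter> B n)" using S(2) by (auto simp: disjoint_family_on_def)
        ultimately show "(\<Sum>i. emeasure (chart_measure (C n)) (S i \<inter> B n)) = emeasure (chart_measure (C n)) ((\<Union>i. S i) \<inter> B n)"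
          by (simp add: suminf_emeasure)
      qed
      finally show "(\<Sum>i. F (S i)) = F (\<Union>(range S))" by (simp add: F_def nn_integral_count_space_nat)
    qed
  qed
  have "is_volume \<nu>"
    unfolding is_volume_iff
  proof (intro conjI ballI impI sp)
    fix c S assume c: "c \<in> A" and S: "S \<in> sets M" "S \<subseteq> cdom c"
    have "emeasure (chart_measure (C n)) (S \<inter> B n) = emeasure (chart_measure c) (S \<inter> B n)" for n
      by (rule chart_measure_eq[OF C(1) c]) (use S Bs Bsub in auto)
    then show "emeasure \<nu> S = emeasure (chart_measure c) S"
      unfolding em[OF S(1)] F_def split[OF cs S(1)] by simp
  qed
  moreover have "\<nu>' = \<nu>''" if "is_volume \<nu>'" "is_volume \<nu>''" for \<nu>' \<nu>''
  proof (rule measure_eqI)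
    have s: "sets \<nu>' = sets M" "sets \<nu>'' = sets M" using that by (auto simp: is_volume_iff)
    then show "sets \<nu>' = sets \<nu>''" by simp
    fix S assume "S \<in> sets \<nu>'"
    then have S: "S \<in> sets M" using s by simp
    have "emeasure \<nu>' (S \<inter> B n) = emeasure \<nu>'' (S \<inter> B n)" for n
    proof -
      have "S \<inter> B n \<in> sets M" "S \<inter> B n \<subseteq> cdom (C n)" using S Bs Bsub by auto
      then show ?thesis using that C(1)[of n] by (simp add: is_volume_iff)
    qed
    then show "emeasure \<nu>' S = emeasure \<nu>'' S" using split[OF s(1) S] split[OF s(2) S] by simp
  qed
  ultimately show ?thesis by blast
qed

lemma space_riemannian_volume: "space (riemannian_volume X A g) = X"
proof -
  have "is_volume (THE \<nu>. is_volume \<nu>)" by (rule theI'[OF volume_ex1])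
  then have "is_volume (riemannian_volume X A g)" unfolding riemannian_volume_def is_volume_def[symmetric] .
  then show ?thesis by (simp add: is_volume_def)
qed

end

section \<open>The residue densities and the gravitational action\<close>

context collar_spin begin

text \<open>Every admissible choice gives the same value, and \<open>adapted_exists\<close> together
  with the symbol that a pseudodifferential operator has in every spin frame provides one choice; so
  each description denotes this value.\<close>

lemma residue_densities:
  assumes w0: "warp X 0 = 1" and fl: "flat_metric (bdry X) (batlas X) (bmetr X)"
    and D: "dirac_operator X D" and Q: "parametrix X D Q" and y: "y \<in> bdry X"
  shows "res11 X Q Q y = of_real (- (3 * pi\<^sup>2 / 2) * warp')"
    and "res21 X Q Q y = of_real (9 * pi\<^sup>2 / 2 * warp')"
proof -
  have L: "local_res11 \<sigma> \<sigma>' (coord b y) = of_real (- (3 * pi\<^sup>2 / 2) * warp')"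
    "local_res21 \<sigma> \<sigma>' (coord b y) = of_real (9 * pi\<^sup>2 / 2 * warp')"
    if "adapted X b c s y" "full_symbol X Q c s \<sigma>" "full_symbol X Q c s \<sigma>'" for b c s \<sigma> \<sigma>'
  proof -
    have "adapted_symbol X D Q b c s y \<sigma>" "adapted_symbol X D Q b c s y \<sigma>'"
      using w0 D Q that by unfold_locales
    from local_residues[OF this] show "local_res11 \<sigma> \<sigma>' (coord b y) = of_real (- (3 * pi\<^sup>2 / 2) * warp')"
      "local_res21 \<sigma> \<sigma>' (coord b y) = of_real (9 * pi\<^sup>2 / 2 * warp')"
      by (simp_all add: warp'_def)
  qed
  obtain b c s where a: "adapted X b c s y" using adapted_exists[OF fl y] by (elim exE)
  have "spin_frame X c s" using a by (simp add: adapted_def)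
  then obtain \<sigma> where \<sigma>: "full_symbol X Q c s \<sigma>"
    using Q unfolding parametrix_def pseudodifferential_def full_symbol_def by blast
  show "res11 X Q Q y = of_real (- (3 * pi\<^sup>2 / 2) * warp')"
    unfolding res11_def
  proof (rule the_equality)
    show "\<exists>b c s \<sigma> \<sigma>'. adapted X b c s y \<and> full_symbol X Q c s \<sigma> \<and> full_symbol X Q c s \<sigma>' \<and>
        complex_of_real (- (3 * pi\<^sup>2 / 2) * warp') = local_res11 \<sigma> \<sigma>' (coord b y)"
      by (intro exI conjI, rule a, rule \<sigma>, rule \<sigma>, rule L(1)[OF a \<sigma> \<sigma>, symmetric])
  qed (elim exE conjE, simp only: L(1))
  show "res21 X Q Q y = of_real (9 * pi\<^sup>2 / 2 * warp')"
    unfolding res21_def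
  proof (rule the_equality)
    show "\<exists>b c s \<sigma> \<sigma>'. adapted X b c s y \<and> full_symbol X Q c s \<sigma> \<and> full_symbol X Q c s \<sigma>' \<and>
        complex_of_real (9 * pi\<^sup>2 / 2 * warp') = local_res21 \<sigma> \<sigma>' (coord b y)"
      by (intro exI conjI, rule a, rule \<sigma>, rule \<sigma>, rule L(2)[OF a \<sigma> \<sigma>, symmetric])
  qed (elim exE conjE, simp only: L(2))
qed

lemma space_boundary_volume: "space (boundary_volume X) = bdry X"
proof -
  interpret B: riemannian_manifold "bdry X" "batlas X" "bmetr X"
    by unfold_locales (rule boundary_manifold, rule boundary_metric)
  show ?thesis unfolding boundary_volume_def by (rule B.space_riemannian_volume)
qed

end

theorem theorem4p1:
  fixes X :: "('m::{t2_space, second_countable_topology}, 'p::topological_space) collar_manifold"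
    and D Dinv :: "'p spinor_op"
  assumes "spin_manifold_with_collar X"
    and "warp X 0 = 1"
    and "flat_metric (bdry X) (batlas X) (bmetr X)"
    and "dirac_operator X D"
    and "parametrix X D Dinv"
  shows "(LINT y|boundary_volume X. res11 X Dinv Dinv y)
           = complex_of_real (pi / 8 * Omega3 * I_Gr_b X)
       \<and> (LINT y|boundary_volume X. res21 X Dinv Dinv y)
           = complex_of_real (- (3 * pi / 8) * Omega3 * I_Gr_b X)"
proof -
  interpret collar_spin X by (rule collar_spin.intro[OF assms(1)])
  let ?m = "measure (boundary_volume X) (bdry X)"
  have c: "(LINT y|boundary_volume X. f y) = ?m *\<^sub>R k" if "\<And>y. y \<in> bdry X \<Longrightarrow> f y = k"
    for f and k :: "'b::{banach, second_countable_topology}"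
  proof -
    have "(LINT y|boundary_volume X. f y) = (LINT y|boundary_volume X. k)"
      by (rule Bochner_Integration.integral_cong) (simp_all add: space_boundary_volume that)
    then show ?thesis by (simp add: space_boundary_volume)
  qed
  have I: "I_Gr_b X = - 3 * warp' * ?m"
  proof -
    have "(LINT y|boundary_volume X. extrinsic_trace X y) = ?m *\<^sub>R (- (3/2) * warp')"
      by (rule c) (rule extrinsic_trace_eq[OF assms(2)])
    then show ?thesis by (simp add: I_Gr_b_def)
  qed
  have "(LINT y|boundary_volume X. res11 X Dinv Dinv y) = ?m *\<^sub>R of_real (- (3 * pi\<^sup>2 / 2) * warp')"
    by (rule c) (rule residue_densities(1)[OF assms(2-5)])
  moreover have "(LINT y|boundary_volume X. res21 X Dinv Dinv y) = ?m *\<^sub>R of_real (9 * pi\<^sup>2 / 2 * warp')"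
    by (rule c) (rule residue_densities(2)[OF assms(2-5)])
  \<comment> \<open>The constants match: (pi/8)(4 pi)(-3) = -(3/2) pi^2 and -(3 pi/8)(4 pi)(-3) =
    (9/2) pi^2.\<close>
  ultimately show ?thesis
    unfolding I Omega3_eq by (simp add: scaleR_conv_of_real power2_eq_square)
qed

end
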